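(* Let $p\neq2$ be a prime, let $X$ be a connected CW-complex, and let $\nu\colon\pi_1(X)\twoheadrightarrow\mathbb{Z}_p$ be an epimorphism. If the chain complex $(H_*(X,\mathbb{F}_p),\varrho_* )$ is acyclic in degree $*=q$ (that is, $\ker\varrho_q=\operatorname{im}\varrho_{q+1}$), then $J^2\cdot H_q(X,(\mathbb{F}_p\mathbb{Z}_p)_\nu)=0$.
   Context: $\mathbb{Z}_p$ is the cyclic group of order $p$. $(\mathbb{F}_p\mathbb{Z}_p)_\nu$ is the group ring $\mathbb{F}_p\mathbb{Z}_p=\mathbb{F}_p[t]/(t^p-1)$ viewed as a right $\mathbb{F}_p\pi$-module, $\pi=\pi_1(X)$, via $h\cdot g=h\nu(g)$; $J=(t-1)$ is its augmentation ideal. $H_*(X,(\mathbb{F}_p\mathbb{Z}_p)_\nu)$ is the homology of $(\mathbb{F}_p\mathbb{Z}_p)_\nu\otimes_{\mathbb{F}_p\pi}C_\bullet(\widetilde X,\mathbb{F}_p)$ ($\widetilde X$ the universal cover), a left $\mathbb{F}_p\mathbb{Z}_p$-module. The map $\varrho_q\colon H_q(X,\mathbb{F}_p)\to H_{q-1}(X,\mathbb{F}_p)$ is the composite $H_q(X,\mathbb{F}_p)\xrightarrow{\nabla_X}H_1(X,\mathbb{F}_p)\otimes H_{q-1}(X,\mathbb{F}_p)\xrightarrow{\nu_*\otimes\mathrm{id}}\mathbb{F}_p\otimes H_{q-1}(X,\mathbb{F}_p)$, where $\nu_*\colon H_1(X,\mathbb{F}_p)\to H_1(\mathbb{Z}_p,\mathbb{F}_p)=\mathbb{F}_p$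 is induced by $\nu$, and $\nabla_X$ is the composite of the diagonal-induced map $H_q(X,\mathbb{F}_p)\to H_q(X\times X,\mathbb{F}_p)$, the Künneth isomorphism with $\bigoplus_iH_i(X,\mathbb{F}_p)\otimes H_{q-i}(X,\mathbb{F}_p)$, and projection onto the $i=1$ summand. For $p\ne2$ one has $\varrho_{q}\circ\varrho_{q+1}=0$, so $(H_*(X,\mathbb{F}_p),\varrho_* )$ is a chain complex. *)

theory Defs
  imports
    "HOL-Homology.Homology"
    "HOL-Algebra.Ideal_Product"
    "Berlekamp_Zassenhaus.Finite_Field"
begin

text \<open>
  The field with p elements is the type \<open>'p mod_ring\<close> with \<open>'p :: prime_card\<close>, so that
  \<open>p = CARD('p)\<close>.  Its additive group is the cyclic group of order p, and the group ring of that
  group over the field is \<open>'p mod_ring \<Rightarrow>\<^sub>0 'p mod_ring\<close> with the convolution product, in which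
  \<open>t\<close> is \<open>Poly_Mapping.single 1 1\<close>.
\<close>


section \<open>Modules, quotients and tensor products\<close>

text \<open>
  Modules are records of HOL-Algebra; the ring fields \<open>mult\<close> and \<open>one\<close> carry no
  meaning.  For a right module, \<open>r \<odot> m\<close> stands for m acted on by r from the right.
\<close>

definition scalar_module :: "('k::comm_ring_1, 'k) module" where
  "scalar_module =
     \<lparr>carrier = UNIV, monoid.mult = undefined, one = undefined, zero = 0, add = (+), module.smult = (*)\<rparr>"

definition module_maps :: "('r, 'm) module \<Rightarrow> ('r, 'n) module \<Rightarrow> ('m \<Rightarrow> 'n) set" where
  "module_maps M N =
     {f \<in> carrier M \<rightarrow>\<^sub>E carrier N.
        (\<forall>x\<in>carrier M. \<forall>y\<in>carrier M. f (x \<oplus>\<^bsub>M\<^esub> y) = f x \<oplus>\<^bsub>N\<^esub> f y) \<and>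
        (\<forall>r. \<forall>x\<in>carrier M. f (r \<odot>\<^bsub>M\<^esub> x) = r \<odot>\<^bsub>N\<^esub> f x)}"

definition quotient_module :: "('r, 'm) module \<Rightarrow> 'm set \<Rightarrow> ('r, 'm set) module" where
  "quotient_module M B =
     \<lparr>carrier = a_rcosets\<^bsub>M\<^esub> B, monoid.mult = undefined, one = undefined,
      zero = B, add = (<+>\<^bsub>M\<^esub>), module.smult = (\<lambda>r U. \<Union>u\<in>U. B +>\<^bsub>M\<^esub> (r \<odot>\<^bsub>M\<^esub> u))\<rparr>"

definition direct_sum :: "'i set \<Rightarrow> ('i \<Rightarrow> ('r, 'm) module) \<Rightarrow> ('r, 'i \<Rightarrow> 'm) module" where
  "direct_sum I M =
     \<lparr>carrier = (\<Pi>\<^sub>E i\<in>I. carrier (M i)), monoid.mult = undefined, one = undefined,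
      zero = (\<lambda>i\<in>I. \<zero>\<^bsub>M i\<^esub>), add = (\<lambda>f g. \<lambda>i\<in>I. f i \<oplus>\<^bsub>M i\<^esub> g i),
      module.smult = (\<lambda>r f. \<lambda>i\<in>I. r \<odot>\<^bsub>M i\<^esub> f i)\<rparr>"
  \<comment> \<open>only used for finite \<open>I\<close>\<close>

text \<open>
  The tensor product of a right module M and a left module N over a (possibly noncommutative) ring
  with carrier R is the free abelian group on pairs modulo the biadditivity and balancing relations.
\<close>

definition tensor_relations ::
    "'r set \<Rightarrow> ('r, 'm) module \<Rightarrow> ('r, 'n) module \<Rightarrow> ('m \<times> 'n \<Rightarrow>\<^sub>0 int) set" where
  "tensor_relations R M N =
     {frag_of (m \<oplus>\<^bsub>M\<^esub> m', n) - frag_of (m, n) - frag_of (m', n) | m m' n.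
        m \<in> carrier M \<and> m' \<in> carrier M \<and> n \<in> carrier N} \<union>
     {frag_of (m, n \<oplus>\<^bsub>N\<^esub> n') - frag_of (m, n) - frag_of (m, n') | m n n'.
        m \<in> carrier M \<and> n \<in> carrier N \<and> n' \<in> carrier N} \<union>
     {frag_of (r \<odot>\<^bsub>M\<^esub> m, n) - frag_of (m, r \<odot>\<^bsub>N\<^esub> n) | r m n.
        r \<in> R \<and> m \<in> carrier M \<and> n \<in> carrier N}"

definition tensor_kernel ::
    "'r set \<Rightarrow> ('r, 'm) module \<Rightarrow> ('r, 'n) module \<Rightarrow> ('m \<times> 'n \<Rightarrow>\<^sub>0 int) set" where
  "tensor_kernel R M N =
     generate (free_Abelian_group (carrier M \<times> carrier N)) (tensor_relations R M N)"

definition tensor_group ::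
    "'r set \<Rightarrow> ('r, 'm) module \<Rightarrow> ('r, 'n) module \<Rightarrow> ('m \<times> 'n \<Rightarrow>\<^sub>0 int) set monoid" where
  "tensor_group R M N =
     free_Abelian_group (carrier M \<times> carrier N) Mod tensor_kernel R M N"

definition tensor_class ::
    "'r set \<Rightarrow> ('r, 'm) module \<Rightarrow> ('r, 'n) module \<Rightarrow> ('m \<times> 'n \<Rightarrow>\<^sub>0 int) \<Rightarrow>
     ('m \<times> 'n \<Rightarrow>\<^sub>0 int) set" where
  "tensor_class R M N u =
     tensor_kernel R M N #>\<^bsub>free_Abelian_group (carrier M \<times> carrier N)\<^esub> u"

definition tensor_pure ::
    "'r set \<Rightarrow> ('r, 'm) module \<Rightarrow> ('r, 'n) module \<Rightarrow> 'm \<Rightarrow> 'n \<Rightarrow> ('m \<times> 'n \<Rightarrow>\<^sub>0 int) set" where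
  "tensor_pure R M N m n = tensor_class R M N (frag_of (m, n))"

definition tensor_map ::
    "'r set \<Rightarrow> ('r, 'm) module \<Rightarrow> ('r, 'n) module \<Rightarrow> ('a \<Rightarrow> 'm) \<Rightarrow> ('b \<Rightarrow> 'n) \<Rightarrow>
     ('a \<times> 'b \<Rightarrow>\<^sub>0 int) set \<Rightarrow> ('m \<times> 'n \<Rightarrow>\<^sub>0 int) set" where
  "tensor_map R M N f g U =
     (\<Union>u\<in>U. tensor_class R M N (frag_extend (\<lambda>(a, b). frag_of (f a, g b)) u))"
  \<comment> \<open>\<open>R\<close>, \<open>M\<close>, \<open>N\<close> describe the target; all members of the union coincide\<close>

definition tensor_module ::
    "('s \<Rightarrow> 'm \<Rightarrow> 'm) \<Rightarrow> 'r set \<Rightarrow> ('r, 'm) module \<Rightarrow> ('r, 'n) module \<Rightarrow>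
     ('s, ('m \<times> 'n \<Rightarrow>\<^sub>0 int) set) module" where
  "tensor_module act R M N =
     \<lparr>carrier = carrier (tensor_group R M N), monoid.mult = undefined, one = undefined,
      zero = \<one>\<^bsub>tensor_group R M N\<^esub>, add = monoid.mult (tensor_group R M N),
      module.smult = (\<lambda>s. tensor_map R M N (act s) id)\<rparr>"
  \<comment> \<open>\<open>act\<close> is an additional left action on \<open>M\<close>, commuting with the right action of \<open>R\<close>\<close>

text \<open>The homomorphism out of a tensor product given by a balanced biadditive map.\<close>

definition tensor_lift ::
    "('s, 'p) module \<Rightarrow> ('m \<Rightarrow> 'n \<Rightarrow> 'p) \<Rightarrow> ('m \<times> 'n \<Rightarrow>\<^sub>0 int) set \<Rightarrow> 'p" where
  "tensor_lift P b U =
     the_elem ((\<lambda>u. \<Oplus>\<^bsub>P\<^esub>k\<in>Poly_Mapping.keys u.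
        [Poly_Mapping.lookup u k] \<cdot>\<^bsub>P\<^esub> b (fst k) (snd k)) ` U)"

text \<open>Over a commutative ring of scalars (a type), left and right modules are identified.\<close>

abbreviation ctensor ::
    "('k::comm_ring_1, 'm) module \<Rightarrow> ('k, 'n) module \<Rightarrow> ('k, ('m \<times> 'n \<Rightarrow>\<^sub>0 int) set) module" where
  "ctensor M N \<equiv> tensor_module (module.smult M) UNIV M N"


section \<open>Chain complexes\<close>

text \<open>
  A complex \<open>C\<close> with differentials \<open>d n : C n \<rightarrow> C (n - 1)\<close> is indexed by the natural numbers and
  extended by zero, so every element of \<open>C 0\<close> is a cycle.
\<close>

definition complex_cycles ::
    "(nat \<Rightarrow> ('r, 'm) module) \<Rightarrow> (nat \<Rightarrow> 'm \<Rightarrow> 'm) \<Rightarrow> nat \<Rightarrow> 'm set" where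
  "complex_cycles C d n = {x \<in> carrier (C n). n = 0 \<or> d n x = \<zero>\<^bsub>C (n - 1)\<^esub>}"

definition complex_boundaries ::
    "(nat \<Rightarrow> ('r, 'm) module) \<Rightarrow> (nat \<Rightarrow> 'm \<Rightarrow> 'm) \<Rightarrow> nat \<Rightarrow> 'm set" where
  "complex_boundaries C d n = d (Suc n) ` carrier (C (Suc n))"

definition complex_homology ::
    "(nat \<Rightarrow> ('r, 'm) module) \<Rightarrow> (nat \<Rightarrow> 'm \<Rightarrow> 'm) \<Rightarrow> nat \<Rightarrow> ('r, 'm set) module" where
  "complex_homology C d n =
     quotient_module (C n\<lparr>carrier := complex_cycles C d n\<rparr>) (complex_boundaries C d n)"

definition complex_class ::
    "(nat \<Rightarrow> ('r, 'm) module) \<Rightarrow> (nat \<Rightarrow> 'm \<Rightarrow> 'm) \<Rightarrow> nat \<Rightarrow> 'm \<Rightarrow> 'm set" where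
  "complex_class C d n z = complex_boundaries C d n +>\<^bsub>C n\<^esub> z"

definition homology_map ::
    "(nat \<Rightarrow> ('r, 'm) module) \<Rightarrow> (nat \<Rightarrow> 'm \<Rightarrow> 'm) \<Rightarrow> nat \<Rightarrow> ('a \<Rightarrow> 'm) \<Rightarrow> 'a set \<Rightarrow> 'm set" where
  "homology_map C d n f U = (\<Union>u\<in>U. complex_class C d n (f u))"
  \<comment> \<open>\<open>C\<close>, \<open>d\<close> describe the target\<close>

definition tensor_complex ::
    "(nat \<Rightarrow> ('k::comm_ring_1, 'm) module) \<Rightarrow> (nat \<Rightarrow> ('k, 'n) module) \<Rightarrow>
     nat \<Rightarrow> ('k, nat \<Rightarrow> ('m \<times> 'n \<Rightarrow>\<^sub>0 int) set) module" where
  "tensor_complex C C' n = direct_sum {..n} (\<lambda>i. ctensor (C i) (C' (n - i)))"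

text \<open>The differential of \<open>a \<otimes> b\<close> with a of degree i is \<open>da \<otimes> b + (-1)^i a \<otimes> db\<close>.\<close>

definition tensor_diff ::
    "(nat \<Rightarrow> ('k::comm_ring_1, 'm) module) \<Rightarrow> (nat \<Rightarrow> 'm \<Rightarrow> 'm) \<Rightarrow>
     (nat \<Rightarrow> ('k, 'n) module) \<Rightarrow> (nat \<Rightarrow> 'n \<Rightarrow> 'n) \<Rightarrow>
     nat \<Rightarrow> (nat \<Rightarrow> ('m \<times> 'n \<Rightarrow>\<^sub>0 int) set) \<Rightarrow> nat \<Rightarrow> ('m \<times> 'n \<Rightarrow>\<^sub>0 int) set" where
  "tensor_diff C d C' d' n T =
     (\<lambda>i\<in>{..n - 1}. let P = ctensor (C i) (C' (n - 1 - i)) in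
        tensor_map UNIV (C i) (C' (n - 1 - i)) (d (Suc i)) id (T (Suc i)) \<oplus>\<^bsub>P\<^esub>
        (((-1) ^ i) \<odot>\<^bsub>P\<^esub> tensor_map UNIV (C i) (C' (n - 1 - i)) id (d' (n - i)) (T i)))"

text \<open>
  The cross product: on the i-th summand it sends \<open>[a] \<otimes> [b]\<close> to the class of \<open>a \<otimes> b\<close>.  Over a field
  it is an isomorphism (algebraic Kuenneth theorem).
\<close>

definition homology_cross ::
    "(nat \<Rightarrow> ('k::comm_ring_1, 'm) module) \<Rightarrow> (nat \<Rightarrow> 'm \<Rightarrow> 'm) \<Rightarrow>
     (nat \<Rightarrow> ('k, 'n) module) \<Rightarrow> (nat \<Rightarrow> 'n \<Rightarrow> 'n) \<Rightarrow>
     nat \<Rightarrow> (nat \<Rightarrow> ('m set \<times> 'n set \<Rightarrow>\<^sub>0 int) set) \<Rightarrow> (nat \<Rightarrow> ('m \<times> 'n \<Rightarrow>\<^sub>0 int) set) set" where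
  "homology_cross C d C' d' n x =
     (let T = tensor_complex C C'; D = tensor_diff C d C' d'; H = complex_homology T D n in
       \<Oplus>\<^bsub>H\<^esub>i\<in>{..n}. tensor_lift H
         (\<lambda>U V. \<Union>a\<in>U. \<Union>b\<in>V. complex_class T D n
            (\<lambda>j\<in>{..n}. if j = i then tensor_pure UNIV (C i) (C' (n - i)) a b
                       else \<zero>\<^bsub>ctensor (C j) (C' (n - j))\<^esub>))
         (x i))"


section \<open>Singular homology with coefficients\<close>

type_synonym 'a simplex = "(nat \<Rightarrow> real) \<Rightarrow> 'a"

definition lin_extend :: "('a \<Rightarrow> 'b \<Rightarrow>\<^sub>0 'k) \<Rightarrow> ('a \<Rightarrow>\<^sub>0 'k) \<Rightarrow> 'b \<Rightarrow>\<^sub>0 'k::comm_ring_1" where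
  "lin_extend f c =
     (\<Sum>x\<in>Poly_Mapping.keys c. Poly_Mapping.map ((*) (Poly_Mapping.lookup c x)) (f x))"

definition chain_module :: "'a topology \<Rightarrow> nat \<Rightarrow> ('k::comm_ring_1, 'a simplex \<Rightarrow>\<^sub>0 'k) module" where
  "chain_module X n =
     \<lparr>carrier = {c. Poly_Mapping.keys c \<subseteq> singular_simplex_set n X},
      monoid.mult = undefined, one = undefined, zero = 0, add = (+),
      module.smult = (\<lambda>a. Poly_Mapping.map ((*) a))\<rparr>"

definition chain_diff :: "nat \<Rightarrow> ('a simplex \<Rightarrow>\<^sub>0 'k) \<Rightarrow> 'a simplex \<Rightarrow>\<^sub>0 'k::comm_ring_1" where
  "chain_diff n = lin_extend (\<lambda>\<sigma>. Poly_Mapping.map of_int (chain_boundary n (frag_of \<sigma>)))"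

definition chain_push ::
    "nat \<Rightarrow> ('a \<Rightarrow> 'b) \<Rightarrow> ('a simplex \<Rightarrow>\<^sub>0 'k) \<Rightarrow> 'b simplex \<Rightarrow>\<^sub>0 'k::comm_ring_1" where
  "chain_push n f = lin_extend (\<lambda>\<sigma>. Poly_Mapping.single (simplex_map n f \<sigma>) 1)"

abbreviation sing_homology :: "'a topology \<Rightarrow> nat \<Rightarrow> ('k::comm_ring_1, ('a simplex \<Rightarrow>\<^sub>0 'k) set) module" where
  "sing_homology X \<equiv> complex_homology (chain_module X) chain_diff"


section \<open>The Kuenneth isomorphism\<close>

definition front_face :: "nat \<Rightarrow> 'a simplex \<Rightarrow> 'a simplex" where
  "front_face i \<sigma> = restrict \<sigma> (standard_simplex i)"

definition back_face :: "nat \<Rightarrow> nat \<Rightarrow> 'a simplex \<Rightarrow> 'a simplex" where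
  "back_face i m \<sigma> = restrict (\<sigma> \<circ> (\<lambda>x j. if j < i then 0 else x (j - i))) (standard_simplex m)"
  \<comment> \<open>the face on the vertices \<open>i, \<dots>, i + m\<close>\<close>

text \<open>
  The Alexander-Whitney map, which is the Eilenberg-Zilber chain equivalence from the chains of the
  product to the tensor product of the chain complexes.
\<close>

definition alexander_whitney ::
    "'a topology \<Rightarrow> 'b topology \<Rightarrow> nat \<Rightarrow> (('a \<times> 'b) simplex \<Rightarrow>\<^sub>0 'k) \<Rightarrow>
     nat \<Rightarrow> (('a simplex \<Rightarrow>\<^sub>0 'k) \<times> ('b simplex \<Rightarrow>\<^sub>0 'k::comm_ring_1) \<Rightarrow>\<^sub>0 int) set" where
  "alexander_whitney X Y n c =
     (let P = tensor_complex (chain_module X) (chain_module Y) n in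
       \<Oplus>\<^bsub>P\<^esub>\<omega>\<in>Poly_Mapping.keys c. Poly_Mapping.lookup c \<omega> \<odot>\<^bsub>P\<^esub>
         (\<lambda>i\<in>{..n}. tensor_pure UNIV (chain_module X i) (chain_module Y (n - i))
            (Poly_Mapping.single (front_face i (simplex_map n fst \<omega>)) 1)
            (Poly_Mapping.single (back_face i (n - i) (simplex_map n snd \<omega>)) 1)))"

definition kunneth_iso ::
    "'a topology \<Rightarrow> 'b topology \<Rightarrow> nat \<Rightarrow> (('a \<times> 'b) simplex \<Rightarrow>\<^sub>0 'k) set \<Rightarrow>
     nat \<Rightarrow> (('a simplex \<Rightarrow>\<^sub>0 'k) set \<times> ('b simplex \<Rightarrow>\<^sub>0 'k::field) set \<Rightarrow>\<^sub>0 int) set" where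
  "kunneth_iso X Y n U =
     inv_into (carrier (direct_sum {..n} (\<lambda>i. ctensor (sing_homology X i) (sing_homology Y (n - i)))))
       (homology_cross (chain_module X) chain_diff (chain_module Y) chain_diff n)
       (homology_map
          (tensor_complex (chain_module X) (chain_module Y))
          (tensor_diff (chain_module X) chain_diff (chain_module Y) chain_diff)
          n (alexander_whitney X Y n) U)"

definition nabla ::
    "'a topology \<Rightarrow> nat \<Rightarrow> ('a simplex \<Rightarrow>\<^sub>0 'k) set \<Rightarrow>
     (('a simplex \<Rightarrow>\<^sub>0 'k) set \<times> ('a simplex \<Rightarrow>\<^sub>0 'k::field) set \<Rightarrow>\<^sub>0 int) set" where
  "nabla X q U =
     kunneth_iso X X q
       (homology_map (chain_module (prod_topology X X)) chain_diff q (chain_push q (\<lambda>x. (x, x))) U) 1"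
  \<comment> \<open>meaningful for \<open>q \<ge> 1\<close>\<close>


section \<open>CW complexes\<close>

definition closed_disc :: "nat \<Rightarrow> (nat \<Rightarrow> real) topology" where
  "closed_disc n = subtopology (Euclidean_space n) {x. (\<Sum>i<n. (x i)\<^sup>2) \<le> 1}"

definition disc_interior :: "nat \<Rightarrow> (nat \<Rightarrow> real) set" where
  "disc_interior n = {x \<in> topspace (Euclidean_space n). (\<Sum>i<n. (x i)\<^sup>2) < 1}"

definition disc_sphere :: "nat \<Rightarrow> (nat \<Rightarrow> real) set" where
  "disc_sphere n = {x \<in> topspace (Euclidean_space n). (\<Sum>i<n. (x i)\<^sup>2) = 1}"

text \<open>A cell is given by its dimension and characteristic map.\<close>

definition cw_structure ::
    "'a::topological_space set \<Rightarrow> (nat \<times> ((nat \<Rightarrow> real) \<Rightarrow> 'a)) set \<Rightarrow> bool" where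
  "cw_structure X E \<longleftrightarrow>
     Hausdorff_space (top_of_set X) \<and>
     (\<forall>(n, \<Phi>)\<in>E. continuous_map (closed_disc n) (top_of_set X) \<Phi> \<and> inj_on \<Phi> (disc_interior n)) \<and>
     X = (\<Union>(n, \<Phi>)\<in>E. \<Phi> ` disc_interior n) \<and>
     pairwise (\<lambda>(n, \<Phi>) (m, \<Psi>). disjnt (\<Phi> ` disc_interior n) (\<Psi> ` disc_interior m)) E \<and>
     (\<forall>(n, \<Phi>)\<in>E. \<exists>F\<subseteq>E. finite F \<and> (\<forall>(m, \<Psi>)\<in>F. m < n) \<and>
        \<Phi> ` disc_sphere n \<subseteq> (\<Union>(m, \<Psi>)\<in>F. \<Psi> ` disc_interior m)) \<and>
     (\<forall>A\<subseteq>X. closedin (top_of_set X) A \<longleftrightarrow>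
        (\<forall>(n, \<Phi>)\<in>E. closedin (closed_disc n) {x \<in> topspace (closed_disc n). \<Phi> x \<in> A}))"

definition cw_complex :: "'a::topological_space set \<Rightarrow> bool" where
  "cw_complex X \<longleftrightarrow> (\<exists>E. cw_structure X E)"


section \<open>Fundamental group and universal covering\<close>

definition based_loops :: "'a::topological_space set \<Rightarrow> 'a \<Rightarrow> (real \<Rightarrow> 'a) set" where
  "based_loops X x = {\<gamma>. path \<gamma> \<and> path_image \<gamma> \<subseteq> X \<and> pathstart \<gamma> = x \<and> pathfinish \<gamma> = x}"

definition loop_class :: "'a::topological_space set \<Rightarrow> (real \<Rightarrow> 'a) \<Rightarrow> (real \<Rightarrow> 'a) set" where
  "loop_class X \<gamma> = {\<delta>. homotopic_paths X \<gamma> \<delta>}"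

definition fundamental_group :: "'a::topological_space set \<Rightarrow> 'a \<Rightarrow> (real \<Rightarrow> 'a) set monoid" where
  "fundamental_group X x =
     \<lparr>carrier = loop_class X ` based_loops X x,
      monoid.mult = (\<lambda>U V. \<Union>\<alpha>\<in>U. \<Union>\<beta>\<in>V. loop_class X (\<alpha> +++ \<beta>)),
      one = loop_class X (\<lambda>_. x)\<rparr>"

definition additive_cyclic_group :: "'p::prime_card mod_ring monoid" where
  "additive_cyclic_group = \<lparr>carrier = UNIV, monoid.mult = (+), one = 0\<rparr>"

definition universal_covering ::
    "'b::topological_space set \<Rightarrow> ('b \<Rightarrow> 'a::topological_space) \<Rightarrow> 'a set \<Rightarrow> bool" where
  "universal_covering E \<pi> X \<longleftrightarrow> covering_space E \<pi> X \<and> E \<noteq> {} \<and> simply_connected E"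

definition deck_transformation :: "'b::topological_space set \<Rightarrow> ('b \<Rightarrow> 'a) \<Rightarrow> ('b \<Rightarrow> 'b) \<Rightarrow> bool" where
  "deck_transformation E \<pi> f \<longleftrightarrow>
     f \<in> extensional E \<and> (\<exists>f'. homeomorphism E E f f') \<and> (\<forall>y\<in>E. \<pi> (f y) = \<pi> y)"

text \<open>
  The left action of the fundamental group: g acts by the deck transformation which moves the base
  point e to the end point of the lift, starting at e, of a loop representing g.  With products of
  loops written in the order in which they are traversed, this is a left action.
\<close>

definition deck_action ::
    "'b::topological_space set \<Rightarrow> ('b \<Rightarrow> 'a) \<Rightarrow> 'b \<Rightarrow> (real \<Rightarrow> 'a) set \<Rightarrow> 'b \<Rightarrow> 'b" where
  "deck_action E \<pi> e g =
     (THE f. deck_transformation E \<pi> f \<and>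
        (\<exists>\<alpha>\<in>g. \<exists>\<gamma>. path \<gamma> \<and> path_image \<gamma> \<subseteq> E \<and> pathstart \<gamma> = e \<and> pathfinish \<gamma> = f e \<and>
           (\<forall>t\<in>{0..1}. \<pi> (\<gamma> t) = \<alpha> t)))"


section \<open>The complex of the maps rho\<close>

definition path_simplex :: "(real \<Rightarrow> 'a) \<Rightarrow> 'a simplex" where
  "path_simplex \<gamma> = (\<lambda>x\<in>standard_simplex 1. \<gamma> (x 1))"

text \<open>
  The map induced by \<open>\<nu>\<close> on first homology: the linear map that sends the Hurewicz image of a loop
  class g to \<open>\<nu> g\<close>, where the first homology of the cyclic group of order p with coefficients in the
  field with p elements is identified with the field by sending the class of an element x of the
  group to x.
\<close>

definition nu_star ::
    "'a::topological_space set \<Rightarrow> 'a \<Rightarrow> ((real \<Rightarrow> 'a) set \<Rightarrow> 'p::prime_card mod_ring) \<Rightarrow>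
     ('a simplex \<Rightarrow>\<^sub>0 'p mod_ring) set \<Rightarrow> 'p mod_ring" where
  "nu_star X x \<nu> =
     (THE f. f \<in> module_maps (sing_homology (top_of_set X) 1) scalar_module \<and>
        (\<forall>\<gamma>\<in>based_loops X x.
           f (complex_class (chain_module (top_of_set X)) chain_diff 1
                (Poly_Mapping.single (path_simplex \<gamma>) 1)) = \<nu> (loop_class X \<gamma>)))"

text \<open>The target of \<open>\<nu>\<^sub>* \<otimes> id\<close> is identified with homology in degree \<open>q - 1\<close> via \<open>a \<otimes> V \<mapsto> a V\<close>.\<close>

definition rho ::
    "'a::topological_space set \<Rightarrow> 'a \<Rightarrow> ((real \<Rightarrow> 'a) set \<Rightarrow> 'p::prime_card mod_ring) \<Rightarrow> nat \<Rightarrow>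
     ('a simplex \<Rightarrow>\<^sub>0 'p mod_ring) set \<Rightarrow> ('a simplex \<Rightarrow>\<^sub>0 'p mod_ring) set" where
  "rho X x \<nu> q U =
     (let H = sing_homology (top_of_set X) (q - 1) in
       tensor_lift H (module.smult H)
         (tensor_map UNIV scalar_module H (nu_star X x \<nu>) id (nabla (top_of_set X) q U)))"
  \<comment> \<open>meaningful for \<open>q \<ge> 1\<close>; in degree 0 the map to the zero module in degree \<open>-1\<close> is accounted
      for by \<open>complex_cycles\<close>\<close>


section \<open>Homology with coefficients in the group ring of the cyclic group\<close>

type_synonym 'p group_algebra = "'p mod_ring \<Rightarrow>\<^sub>0 'p mod_ring"

definition group_algebra :: "'p::prime_card group_algebra ring" where
  "group_algebra = \<lparr>carrier = UNIV, monoid.mult = (*), one = 1, zero = 0, add = (+)\<rparr>"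

definition augmentation_ideal :: "'p::prime_card group_algebra set" where
  "augmentation_ideal = PIdl\<^bsub>group_algebra\<^esub> (Poly_Mapping.single 1 1 - 1)"

definition group_ring_carrier :: "'g monoid \<Rightarrow> ('g \<Rightarrow>\<^sub>0 'k::comm_ring_1) set" where
  "group_ring_carrier G = {r. Poly_Mapping.keys r \<subseteq> carrier G}"

text \<open>The right module structure, with \<open>h g = h \<nu>(g)\<close> for g in the fundamental group.\<close>

definition coeff_module ::
    "('g \<Rightarrow> 'p::prime_card mod_ring) \<Rightarrow> ('g \<Rightarrow>\<^sub>0 'p mod_ring, 'p group_algebra) module" where
  "coeff_module \<nu> =
     \<lparr>carrier = UNIV, monoid.mult = undefined, one = undefined, zero = 0, add = (+),
      module.smult = (\<lambda>r h. h * lin_extend (\<lambda>g. Poly_Mapping.single (\<nu> g) 1) r)\<rparr>"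

definition cover_chain_module ::
    "'b::topological_space set \<Rightarrow> ('b \<Rightarrow> 'a) \<Rightarrow> 'b \<Rightarrow> nat \<Rightarrow>
     ((real \<Rightarrow> 'a) set \<Rightarrow>\<^sub>0 'k::comm_ring_1, 'b simplex \<Rightarrow>\<^sub>0 'k) module" where
  "cover_chain_module E \<pi> e n =
     \<lparr>carrier = carrier (chain_module (top_of_set E) n :: ('k, _) module),
      monoid.mult = undefined, one = undefined, zero = 0, add = (+),
      module.smult = (\<lambda>r c. lin_extend (\<lambda>g. chain_push n (deck_action E \<pi> e g) c) r)\<rparr>"

definition twisted_chain_module ::
    "'a::topological_space set \<Rightarrow> 'b::topological_space set \<Rightarrow> ('b \<Rightarrow> 'a) \<Rightarrow> 'b \<Rightarrow>
     ((real \<Rightarrow> 'a) set \<Rightarrow> 'p::prime_card mod_ring) \<Rightarrow> nat \<Rightarrow>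
     ('p group_algebra, ('p group_algebra \<times> ('b simplex \<Rightarrow>\<^sub>0 'p mod_ring) \<Rightarrow>\<^sub>0 int) set) module" where
  "twisted_chain_module X E \<pi> e \<nu> n =
     tensor_module (*) (group_ring_carrier (fundamental_group X (\<pi> e)))
       (coeff_module \<nu>) (cover_chain_module E \<pi> e n)"

definition twisted_chain_diff ::
    "'a::topological_space set \<Rightarrow> 'b::topological_space set \<Rightarrow> ('b \<Rightarrow> 'a) \<Rightarrow> 'b \<Rightarrow>
     ((real \<Rightarrow> 'a) set \<Rightarrow> 'p::prime_card mod_ring) \<Rightarrow> nat \<Rightarrow>
     ('p group_algebra \<times> ('b simplex \<Rightarrow>\<^sub>0 'p mod_ring) \<Rightarrow>\<^sub>0 int) set \<Rightarrow>
     ('p group_algebra \<times> ('b simplex \<Rightarrow>\<^sub>0 'p mod_ring) \<Rightarrow>\<^sub>0 int) set" where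
  "twisted_chain_diff X E \<pi> e \<nu> n =
     tensor_map (group_ring_carrier (fundamental_group X (\<pi> e)))
       (coeff_module \<nu>) (cover_chain_module E \<pi> e (n - 1)) id (chain_diff n)"

definition twisted_homology ::
    "'a::topological_space set \<Rightarrow> 'b::topological_space set \<Rightarrow> ('b \<Rightarrow> 'a) \<Rightarrow> 'b \<Rightarrow>
     ((real \<Rightarrow> 'a) set \<Rightarrow> 'p::prime_card mod_ring) \<Rightarrow> nat \<Rightarrow>
     ('p group_algebra,
      ('p group_algebra \<times> ('b simplex \<Rightarrow>\<^sub>0 'p mod_ring) \<Rightarrow>\<^sub>0 int) set set) module" where
  "twisted_homology X E \<pi> e \<nu> =
     complex_homology (twisted_chain_module X E \<pi> e \<nu>) (twisted_chain_diff X E \<pi> e \<nu>)"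

end

theory Submission
  imports Defs "HOL-Analysis.Henstock_Kurzweil_Integration"
begin

text \<open>
  Put \<open>s = t - 1\<close> and filter the group algebra by the powers of \<open>s\<close>.  A lift of every singular simplex
  of X to the universal covering identifies the twisted chains with the singular chains of X over the
  group algebra; there the differential sends a simplex to its boundary plus \<open>t\<^sup>k - 1\<close> times its face
  opposite to the first vertex, where k is the value of a cocycle representing \<open>\<nu>\<close> on the first edge.
  Since \<open>t\<^sup>k - 1\<close> is \<open>k s\<close> modulo \<open>s\<^sup>2\<close>, the differential is the boundary plus s times the cap product
  with the cocycle, modulo \<open>s\<^sup>2\<close>, and by the Alexander-Whitney formula this cap product induces \<open>\<rho>\<close>.
  If z is a cycle, its reduction modulo s is a cycle whose cap product is a boundary, so acyclicity of
  \<open>\<rho>\<close> gives \<open>s z = D w + s\<^sup>2 z'\<close>.  As \<open>s\<^sup>p = 0\<close>, the same argument applies to \<open>z'\<close>, and so on, until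
  \<open>s z = D w + s\<^bsup>p-1\<^esup> z'\<close>; multiplying by s shows that \<open>s\<^sup>2 z\<close> is a boundary.
\<close>

text \<open>One round does not return a cycle: from \<open>s z = D w + s\<^sup>2 z'\<close> only
  \<open>s\<^sup>2 D z' = 0\<close> follows. The induction therefore runs on chains x with
  \<open>s^(p-2) D x = 0\<close>. This suffices because an element of the group algebra killed by
  \<open>s^(p-1)\<close> has augmentation zero. Applied to \<open>D x\<close>, this shows that the
  reduction of x is a cycle; then \<open>D x = s u\<close>, and applied to u it shows that the cap
  product of that reduction is a boundary. The exponent p - 2 is also what stops the iteration at
  \<open>s^(p-1)\<close>, one factor short of zero, whence the square of J.

  \<open>rho\<close> contains an inverse of the Kuenneth map that is given by a choice of preimage,
  so it is evaluated indirectly: the map \<open>\<phi> \<otimes> 1\<close> on the tensor complex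
  descends to homology and reads the relevant component off any preimage. Preimages exist since the
  singular complex over a field splits.

  The map induced by \<nu> is a definite description; it is identified with evaluation of the
  cocycle once loops are known to generate first homology. The cocycle itself is a difference of
  values of a function on the covering which deck transformations shift by \<nu>.\<close>

section \<open>Local path connectedness of CW complexes\<close>

lemma path_linear_fun:
  fixes x y :: "'i \<Rightarrow> real"
  shows "path (\<lambda>t i. (1 - t) * x i + t * y i)"
  unfolding path_def by (intro continuous_on_coordinatewise_then_product continuous_intros)

text \<open>A neighbourhood in the product topology contains a box; shrinking its factors to balls
  makes the box convex, so its trace on \<open>C\<close> is connected by straight segments. This
  covers both closed discs and standard simplices.\<close>

lemma locally_path_connected_convex_fun:
  fixes C :: "('i \<Rightarrow> real) set"
  assumes conv: "\<And>x y t. x \<in> C \<Longrightarrow> y \<in> C \<Longrightarrow> t \<in> {0..1} \<Longrightarrow> (\<lambda>i. (1 - t) * x i + t * y i) \<in> C"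
  shows "locally_path_connected_space (top_of_set C)"
  unfolding locally_path_connected_space
proof (intro allI impI, elim conjE)
  fix W x assume W: "openin (top_of_set C) W" "x \<in> W"
  then obtain S where S: "open S" "W = C \<inter> S" by (auto simp: openin_open)
  then have "openin (product_topology (\<lambda>i. euclidean) UNIV) S" "x \<in> S"
    using W by (auto simp: euclidean_product_topology)
  then obtain Y where Y: "x \<in> (\<Pi>\<^sub>E i\<in>UNIV. Y i)" "\<And>i. open (Y i)"
      "finite {i. Y i \<noteq> UNIV}" "(\<Pi>\<^sub>E i\<in>UNIV. Y i) \<subseteq> S"
    using product_topology_open_contains_basis[of "\<lambda>i. euclidean" UNIV S x]
    by (metis open_openin topspace_euclidean)
  have "\<exists>r>0. ball (x i) r \<subseteq> Y i" for i
    using Y(1,2) open_contains_ball by (metis PiE_UNIV_domain UNIV_I Pi_iff)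
  then obtain r where r: "\<And>i. r i > 0" "\<And>i. ball (x i) (r i) \<subseteq> Y i" by metis
  \<comment> \<open>Unrestricted factors stay unrestricted: only finitely many balls occur, which
    keeps the box open.\<close>
  define B where "B i = (if Y i = UNIV then UNIV else ball (x i) (r i))" for i
  have cB: "convex (B i)" and BY: "B i \<subseteq> Y i" and xB: "x i \<in> B i" and oB: "open (B i)" for i
    using r[of i] by (auto simp: B_def)
  have oPi: "open (Pi\<^sub>E UNIV B)"
  proof (rule open_PiE)
    have "{i. B i \<noteq> UNIV} \<subseteq> {i. Y i \<noteq> UNIV}" by (auto simp: B_def)
    then show "finite {i. B i \<noteq> UNIV}" using Y(3) finite_subset by blast
  qed (rule oB)
  define N where "N = C \<inter> Pi\<^sub>E UNIV B"
  have "path_connected N"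
    unfolding path_connected_def
  proof (intro ballI)
    fix y z assume yz: "y \<in> N" "z \<in> N"
    have "(1 - t) * y i + t * z i \<in> B i" if "t \<in> {0..1}" for t i
      using convexD[OF cB, of "y i" i "z i" "1 - t" t] yz that by (auto simp: N_def PiE_iff)
    then have "(\<lambda>i. (1 - t) * y i + t * z i) \<in> N" if "t \<in> {0..1}" for t
      using conv[of y z t] yz that by (auto simp: N_def PiE_iff)
    then show "\<exists>g. path g \<and> path_image g \<subseteq> N \<and> pathstart g = y \<and> pathfinish g = z"
      by (intro exI[of _ "\<lambda>t i. (1 - t) * y i + t * z i"])
        (auto simp: path_linear_fun path_image_def pathstart_def pathfinish_def)
  qed
  moreover have "openin (top_of_set C) N" using oPi by (auto simp: N_def)
  moreover have "x \<in> N" using xB W(2) S(2) by (auto simp: N_def)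
  moreover have "N \<subseteq> W" using Y(4) BY unfolding N_def S(2) by (auto simp: PiE_iff)
  ultimately show "\<exists>U. openin (top_of_set C) U \<and> path_connectedin (top_of_set C) U \<and> x \<in> U \<and> U \<subseteq> W"
    by (intro exI[of _ N]) (auto simp: path_connectedin_subtopology N_def)
qed

lemma closed_disc_eq:
  "closed_disc n = top_of_set {x. (\<forall>i\<ge>n. x i = 0) \<and> (\<Sum>i<n. (x i)\<^sup>2) \<le> 1}"
  unfolding closed_disc_def Euclidean_space_def subtopology_subtopology euclidean_product_topology
  by (simp add: Collect_conj_eq)

text \<open>The disc is convex because squaring is: the defect in the convexity inequality for the
  square is \<open>t (1 - t) (a - b)^2\<close>.\<close>

lemma locally_path_connected_closed_disc: "locally_path_connected_space (closed_disc n)"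
  unfolding closed_disc_eq
proof (rule locally_path_connected_convex_fun, safe)
  fix x y :: "nat \<Rightarrow> real" and t :: real
  assume t: "t \<in> {0..1}" and x: "(\<Sum>i<n. (x i)\<^sup>2) \<le> 1" and y: "(\<Sum>i<n. (y i)\<^sup>2) \<le> 1"
  have "((1 - t) * a + t * b)\<^sup>2 \<le> (1 - t) * a\<^sup>2 + t * b\<^sup>2" for a b
  proof -
    have "(1 - t) * a\<^sup>2 + t * b\<^sup>2 - ((1 - t) * a + t * b)\<^sup>2 = t * (1 - t) * (a - b)\<^sup>2"
      by (simp add: power2_eq_square algebra_simps)
    also have "\<dots> \<ge> 0" using t by simp
    finally show ?thesis by simp
  qed
  then have "(\<Sum>i<n. ((1 - t) * x i + t * y i)\<^sup>2) \<le> (\<Sum>i<n. (1 - t) * (x i)\<^sup>2 + t * (y i)\<^sup>2)"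
    by (intro sum_mono)
  also have "\<dots> = (1 - t) * (\<Sum>i<n. (x i)\<^sup>2) + t * (\<Sum>i<n. (y i)\<^sup>2)"
    by (simp add: sum.distrib sum_distrib_left)
  also have "\<dots> \<le> (1 - t) * 1 + t * 1"
    using t x y by (intro add_mono mult_left_mono) auto
  finally show "(\<Sum>i<n. ((1 - t) * x i + t * y i)\<^sup>2) \<le> 1" by simp
qed auto

text \<open>The weak topology is the quotient topology for the map from the disjoint union of the
  closed discs given by the characteristic maps, and local path connectedness passes to sums and to
  quotients.\<close>

lemma cw_complex_locally_path_connected:
  assumes "cw_complex X"
  shows "locally_path_connected_space (top_of_set X)"
proof -
  obtain C where C: "cw_structure X C" using assms unfolding cw_complex_def by blast
  note cw = C[unfolded cw_structure_def split_beta', THEN conjunct2]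
  let ?D = "sum_topology (\<lambda>c. closed_disc (fst c)) C"
  let ?q = "\<lambda>(c, z). snd c z"
  have disc: "disc_interior n \<subseteq> topspace (closed_disc n)" for n
    unfolding closed_disc_def disc_interior_def by auto
  have cont: "continuous_map (closed_disc (fst c)) (top_of_set X) (snd c)" if "c \<in> C" for c
    using cw[THEN conjunct1] that by simp
  have cover: "X = (\<Union>c\<in>C. snd c ` disc_interior (fst c))"
    by (rule cw[THEN conjunct2, THEN conjunct1])
  have closed: "closedin (top_of_set X) A \<longleftrightarrow>
      (\<forall>c\<in>C. closedin (closed_disc (fst c)) {x \<in> topspace (closed_disc (fst c)). snd c x \<in> A})" if "A \<subseteq> X" for A
    using cw[THEN conjunct2, THEN conjunct2, THEN conjunct2, THEN conjunct2] that by simp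
  have "quotient_map ?D (top_of_set X) ?q"
    unfolding quotient_map_closedin
  proof (intro conjI allI impI)
    have sub: "snd c z \<in> X" if "c \<in> C" "z \<in> topspace (closed_disc (fst c))" for c z
      using continuous_map_image_subset_topspace[OF cont[OF that(1)]] that(2) by auto
    show "?q ` topspace ?D = topspace (top_of_set X)"
    proof
      show "?q ` topspace ?D \<subseteq> topspace (top_of_set X)" using sub by auto
      show "topspace (top_of_set X) \<subseteq> ?q ` topspace ?D"
      proof
        fix x assume "x \<in> topspace (top_of_set X)"
        then have "x \<in> (\<Union>c\<in>C. snd c ` disc_interior (fst c))" using cover by simp
        then obtain c z where "c \<in> C" "z \<in> disc_interior (fst c)" "x = snd c z" by blast
        then show "x \<in> ?q ` topspace ?D" using disc[of "fst c"] by (intro image_eqI[of _ _ "(c, z)"]) auto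
      qed
    qed
    fix A assume A: "A \<subseteq> topspace (top_of_set X)"
    have *: "{z. (c, z) \<in> topspace ?D - {x \<in> topspace ?D. ?q x \<in> A}} =
        topspace (closed_disc (fst c)) - {x \<in> topspace (closed_disc (fst c)). snd c x \<in> A}" if "c \<in> C" for c
      using that by auto
    have "closedin ?D {x \<in> topspace ?D. ?q x \<in> A} \<longleftrightarrow>
        openin ?D (topspace ?D - {x \<in> topspace ?D. ?q x \<in> A})"
      by (auto simp: closedin_def)
    also have "\<dots> \<longleftrightarrow> (\<forall>c\<in>C. openin (closed_disc (fst c))
        (topspace (closed_disc (fst c)) - {x \<in> topspace (closed_disc (fst c)). snd c x \<in> A}))"
      unfolding openin_sum_topology using * by (simp add: Diff_subset cong: ball_cong del: topspace_sum_topology) auto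
    also have "\<dots> \<longleftrightarrow> closedin (top_of_set X) A"
      using A closed[of A] by (simp add: closedin_def)
    finally show "closedin ?D {x \<in> topspace ?D. ?q x \<in> A} = closedin (top_of_set X) A" .
  qed
  moreover have "locally_path_connected_space ?D"
    by (simp add: locally_path_connected_space_sum_topology locally_path_connected_closed_disc)
  ultimately show ?thesis
    by (rule locally_path_connected_space_quotient_map_image)
qed

lemma locally_path_connected_standard_simplex:
  "locally_path_connected_space (top_of_set (standard_simplex n))"
  by (rule locally_path_connected_convex_fun) (auto intro: convex_standard_simplex)

section \<open>Lifting through covering maps\<close>

text \<open>\<open>\<V>\<close> is the set of sheets over \<open>T\<close>. The predicate packs the
  condition inside \<open>covering_space\<close> into one fact that can be passed around.\<close>

definition evenly_covered ::
    "'b::topological_space set \<Rightarrow> ('b \<Rightarrow> 'a) \<Rightarrow> 'a::topological_space set \<Rightarrow> 'a set \<Rightarrow> 'b set set \<Rightarrow> bool" where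
  "evenly_covered E \<pi> X T \<V> \<longleftrightarrow> openin (top_of_set X) T \<and> \<Union>\<V> = E \<inter> \<pi> -` T \<and>
     (\<forall>u\<in>\<V>. openin (top_of_set E) u) \<and> pairwise disjnt \<V> \<and> (\<forall>u\<in>\<V>. \<exists>q. homeomorphism u T \<pi> q)"

lemma covering_neighbourhood:
  assumes "covering_space E \<pi> X" "x \<in> X"
  obtains T \<V> where "x \<in> T" "evenly_covered E \<pi> X T \<V>"
proof -
  have "\<exists>T. x \<in> T \<and> (\<exists>\<V>. evenly_covered E \<pi> X T \<V>)"
    using assms unfolding covering_space_def evenly_covered_def ex_simps by (elim conjE) (erule (1) bspec)
  then show thesis by (elim exE conjE) (rule that)
qed

lemma evenly_coveredD:
  assumes "evenly_covered E \<pi> X T \<V>"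
  shows "openin (top_of_set X) T" "\<Union>\<V> = E \<inter> \<pi> -` T" "u \<in> \<V> \<Longrightarrow> openin (top_of_set E) u"
    "pairwise disjnt \<V>" "u \<in> \<V> \<Longrightarrow> \<exists>q. homeomorphism u T \<pi> q"
  using assms unfolding evenly_covered_def by simp_all

text \<open>The set of agreement is open and closed. Near a point each lift stays in one sheet: in a
  common sheet both are recovered from the projection by the inverse homeomorphism, and distinct
  sheets are disjoint.\<close>

lemma covering_lift_unique:
  fixes g1 g2 :: "'c::topological_space \<Rightarrow> 'b::topological_space"
  assumes cov: "covering_space E \<pi> X" and K: "connected K"
    and g1: "continuous_on K g1" "g1 ` K \<subseteq> E" and g2: "continuous_on K g2" "g2 ` K \<subseteq> E"
    and eq: "\<And>x. x \<in> K \<Longrightarrow> \<pi> (g1 x) = \<pi> (g2 x)" and a: "a \<in> K" "g1 a = g2 a" and "x \<in> K"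
  shows "g1 x = g2 x"
proof -
  have loc: "\<exists>W. openin (top_of_set K) W \<and> y \<in> W \<and>
      (g1 y = g2 y \<longrightarrow> (\<forall>z\<in>W. g1 z = g2 z)) \<and> (g1 y \<noteq> g2 y \<longrightarrow> (\<forall>z\<in>W. g1 z \<noteq> g2 z))"
    if y: "y \<in> K" for y
  proof -
    have "\<pi> (g1 y) \<in> X"
      using cov g1(2) y covering_space_imp_surjective by blast
    then obtain T \<V> where T: "\<pi> (g1 y) \<in> T" "evenly_covered E \<pi> X T \<V>"
      by (rule covering_neighbourhood[OF cov])
    note ec = evenly_coveredD[OF T(2)]
    have "g1 y \<in> \<Union>\<V>" "g2 y \<in> \<Union>\<V>"
      using T(1) ec(2) g1(2) g2(2) y eq by auto
    then obtain u1 u2 where u: "u1 \<in> \<V>" "u2 \<in> \<V>" "g1 y \<in> u1" "g2 y \<in> u2" by blast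
    define W where "W = (K \<inter> g1 -` u1) \<inter> (K \<inter> g2 -` u2)"
    have "openin (top_of_set K) W"
      unfolding W_def using g1 g2 ec(3) u
      by (intro openin_Int continuous_openin_preimage[where T=E]) auto
    moreover have "y \<in> W" using y u by (auto simp: W_def)
    moreover have eqW: "g1 z = g2 z" if "z \<in> W" "u1 = u2" for z
    proof -
      obtain q where q: "homeomorphism u1 T \<pi> q" using ec(5) u(1) by blast
      have z: "z \<in> K" "g1 z \<in> u1" "g2 z \<in> u1" using that by (auto simp: W_def)
      have "g1 z = q (\<pi> (g1 z))" using homeomorphism_apply1[OF q z(2)] by simp
      also have "\<dots> = q (\<pi> (g2 z))" using eq[OF z(1)] by simp
      also have "\<dots> = g2 z" using homeomorphism_apply1[OF q z(3)] .
      finally show ?thesis .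
    qed
    moreover have neW: "g1 z \<noteq> g2 z" if "z \<in> W" "u1 \<noteq> u2" for z
    proof -
      have "u1 \<inter> u2 = {}" using ec(4) u that(2) by (auto simp: pairwise_def disjnt_def)
      then show ?thesis using that(1) by (auto simp: W_def)
    qed
    ultimately show ?thesis
      by (intro exI[of _ W]) (cases "u1 = u2"; simp)
  qed
  let ?G = "{x \<in> K. g1 x = g2 x}" and ?N = "{x \<in> K. g1 x \<noteq> g2 x}"
  have "openin (top_of_set K) ?G"
  proof (subst openin_subopen, intro ballI)
    fix y assume y: "y \<in> ?G"
    then obtain W where W: "openin (top_of_set K) W" "y \<in> W" "\<forall>z\<in>W. g1 z = g2 z"
      using loc[of y] by auto
    with openin_imp_subset[OF W(1)] show "\<exists>T. openin (top_of_set K) T \<and> y \<in> T \<and> T \<subseteq> ?G"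
      by (intro exI[of _ W]) auto
  qed
  moreover have N: "openin (top_of_set K) ?N"
  proof (subst openin_subopen, intro ballI)
    fix y assume y: "y \<in> ?N"
    then obtain W where W: "openin (top_of_set K) W" "y \<in> W" "\<forall>z\<in>W. g1 z \<noteq> g2 z"
      using loc[of y] by auto
    with openin_imp_subset[OF W(1)] show "\<exists>T. openin (top_of_set K) T \<and> y \<in> T \<and> T \<subseteq> ?N"
      by (intro exI[of _ W]) auto
  qed
  moreover have "closedin (top_of_set K) ?G"
  proof -
    have "K - ?N = ?G" by auto
    then show ?thesis using closedin_diff[OF closedin_topspace N] by simp
  qed
  ultimately have "?G = {} \<or> ?G = K"
    by (intro K[unfolded connected_clopen, rule_format]) simp
  then show ?thesis using a \<open>x \<in> K\<close> by blast
qed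

text \<open>The starting point ranges over all of \<open>K\<close> and over the whole fibre, so that
  pieces of a domain can be glued starting from either of them.\<close>

definition lifts_from_points ::
    "'b::topological_space set \<Rightarrow> ('b \<Rightarrow> 'a) \<Rightarrow> ('c::topological_space \<Rightarrow> 'a) \<Rightarrow> 'c set \<Rightarrow> bool" where
  "lifts_from_points E \<pi> f K \<longleftrightarrow> (\<forall>k\<in>K. \<forall>y\<in>E. \<pi> y = f k \<longrightarrow>
     (\<exists>g. continuous_on K g \<and> g ` K \<subseteq> E \<and> g k = y \<and> (\<forall>z\<in>K. \<pi> (g z) = f z)))"

lemma lifts_from_points_subset:
  assumes "lifts_from_points E \<pi> f K" "L \<subseteq> K"
  shows "lifts_from_points E \<pi> f L"
  unfolding lifts_from_points_def
proof (intro ballI impI)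
  fix k y assume "k \<in> L" "y \<in> E" "\<pi> y = f k"
  then obtain g where "continuous_on K g" "g ` K \<subseteq> E" "g k = y" "\<forall>z\<in>K. \<pi> (g z) = f z"
    using assms unfolding lifts_from_points_def by blast
  then show "\<exists>g. continuous_on L g \<and> g ` L \<subseteq> E \<and> g k = y \<and> (\<forall>z\<in>L. \<pi> (g z) = f z)"
    using assms(2) continuous_on_subset by (intro exI[of _ g]) blast
qed

lemma lifts_from_points_evenly_covered:
  assumes "continuous_on K f" "f ` K \<subseteq> T" and ec: "evenly_covered E \<pi> X T \<V>"
  shows "lifts_from_points E \<pi> f K"
  unfolding lifts_from_points_def
proof (intro ballI impI)
  note \<V> = evenly_coveredD(2)[OF ec] and hom = evenly_coveredD(5)[OF ec]
  fix k y assume k: "k \<in> K" and y: "y \<in> E" "\<pi> y = f k"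
  then have "y \<in> \<Union>\<V>" using assms(2) unfolding \<V> by auto
  then obtain u q where u: "u \<in> \<V>" "y \<in> u" and q: "homeomorphism u T \<pi> q"
    using hom by blast
  have "continuous_on K (q \<circ> f)"
    using q assms(1,2) by (meson continuous_on_compose continuous_on_subset homeomorphism_def)
  moreover have "(q \<circ> f) ` K \<subseteq> E"
  proof -
    have "q ` T = u" "u \<subseteq> E" using q u(1) \<V> by (auto simp: homeomorphism_def)
    then show ?thesis using assms(2) by auto
  qed
  moreover have "(q \<circ> f) k = y" using q u y by (metis comp_apply homeomorphism_apply1)
  moreover have "\<forall>z\<in>K. \<pi> ((q \<circ> f) z) = f z"
    using q assms(2) by (auto simp: homeomorphism_def image_subset_iff)
  ultimately show "\<exists>g. continuous_on K g \<and> g ` K \<subseteq> E \<and> g k = y \<and> (\<forall>z\<in>K. \<pi> (g z) = f z)"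
    by blast
qed

text \<open>Lift over the piece that contains the starting point, then over the other piece from the
  value at a common point. Uniqueness on the connected intersection makes the two lifts agree there,
  and closedness of the pieces makes the glued map continuous.\<close>

lemma lifts_from_points_Un:
  fixes A B :: "'c::topological_space set"
  assumes cov: "covering_space E \<pi> X"
    and cl: "closedin (top_of_set (A \<union> B)) A" "closedin (top_of_set (A \<union> B)) B"
    and AB: "connected (A \<inter> B)" "A \<inter> B \<noteq> {}"
    and lift: "lifts_from_points E \<pi> f A" "lifts_from_points E \<pi> f B"
  shows "lifts_from_points E \<pi> f (A \<union> B)"
proof -
  have ext: "\<exists>g. continuous_on (A \<union> B) g \<and> g ` (A \<union> B) \<subseteq> E \<and> g k = y \<and> (\<forall>z\<in>A \<union> B. \<pi> (g z) = f z)"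
    if cl: "closedin (top_of_set (A \<union> B)) A" "closedin (top_of_set (A \<union> B)) B"
      and AB: "connected (A \<inter> B)" "A \<inter> B \<noteq> {}"
      and lift: "lifts_from_points E \<pi> f A" "lifts_from_points E \<pi> f B"
      and k: "k \<in> A" "y \<in> E" "\<pi> y = f k" for A B :: "'c set" and k y
  proof -
    obtain g where g: "continuous_on A g" "g ` A \<subseteq> E" "g k = y" "\<forall>z\<in>A. \<pi> (g z) = f z"
      using lift(1) k unfolding lifts_from_points_def by blast
    obtain m where m: "m \<in> A" "m \<in> B" using AB by blast
    then have "g m \<in> E" "\<pi> (g m) = f m" using g by auto
    then obtain h where h: "continuous_on B h" "h ` B \<subseteq> E" "h m = g m" "\<forall>z\<in>B. \<pi> (h z) = f z"
      using lift(2) m unfolding lifts_from_points_def by meson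
    have agree: "g z = h z" if "z \<in> A \<inter> B" for z
    proof (rule covering_lift_unique[OF cov AB(1), of g h m])
      show "continuous_on (A \<inter> B) g" by (rule continuous_on_subset[OF g(1)]) auto
      show "continuous_on (A \<inter> B) h" by (rule continuous_on_subset[OF h(1)]) auto
    qed (use g h m that in auto)
    have "continuous_on (A \<union> B) (\<lambda>z. if z \<in> A then g z else h z)"
      using cl g(1) h(1) by (rule continuous_on_cases_local) (use agree in auto)
    then show ?thesis
      using g h k by (intro exI[of _ "\<lambda>z. if z \<in> A then g z else h z"]) auto
  qed
  show ?thesis
    unfolding lifts_from_points_def
  proof (intro ballI impI)
    fix k y assume k: "k \<in> A \<union> B" "y \<in> E" "\<pi> y = f k"
    show "\<exists>g. continuous_on (A \<union> B) g \<and> g ` (A \<union> B) \<subseteq> E \<and> g k = y \<and> (\<forall>z\<in>A \<union> B. \<pi> (g z) = f z)"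
    proof (cases "k \<in> A")
      case True
      then show ?thesis using ext[OF cl AB lift] k by blast
    next
      case False
      then have "k \<in> B" using k by blast
      then show ?thesis
        using ext[of B A k y] cl AB lift k by (simp add: Un_commute Int_commute)
    qed
  qed
qed

text \<open>A gauge fine for the evenly covered sets reduces the claim to boxes that lie over one of them.\<close>

lemma lifts_from_points_cbox:
  fixes a b :: "'c::euclidean_space"
  assumes cov: "covering_space E \<pi> X" and f: "continuous_on (cbox a b) f" "f ` cbox a b \<subseteq> X"
    and ne: "box a b \<noteq> {}"
  shows "lifts_from_points E \<pi> f (cbox a b)"
proof -
  \<comment> \<open>The guard makes \<open>P\<close> true on degenerate boxes, as an operative
    predicate has to be.\<close>
  define P where "P K \<longleftrightarrow> interior K \<noteq> {} \<longrightarrow> lifts_from_points E \<pi> f K" for K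
  have op: "operative (\<and>) True P"
  proof -
    interpret Groups.comm_monoid "(\<and>)" True
      by standard auto
    show ?thesis
  proof
    show "P (cbox a b) = True" if "box a b = {}" for a b
      using that by (simp add: P_def interior_cbox)
    fix a b k :: 'c and c :: real
    assume k: "k \<in> Basis"
    let ?A = "cbox a b \<inter> {x. x \<bullet> k \<le> c}" and ?B = "cbox a b \<inter> {x. c \<le> x \<bullet> k}"
    have U: "?A \<union> ?B = cbox a b" by auto
    show "P (cbox a b) = (P ?A \<and> P ?B)"
    proof
      assume "P (cbox a b)"
      then show "P ?A \<and> P ?B"
        unfolding P_def by (metis Int_lower1 interior_mono lifts_from_points_subset subset_empty)
    next
      assume PAB: "P ?A \<and> P ?B"
      show "P (cbox a b)"
        unfolding P_def
      proof
        assume ne: "interior (cbox a b) \<noteq> {}"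
        have cA: "closed ?A" and cB: "closed ?B"
          by (auto intro!: closed_Int closed_halfspace_component_le closed_halfspace_component_ge
              simp: inner_commute)
        have A0: "interior ?A = box a b \<inter> {x. x \<bullet> k < c}"
          and B0: "interior ?B = box a b \<inter> {x. c < x \<bullet> k}"
          using k nonzero_Basis[OF k] interior_halfspace_le[of k c] interior_halfspace_ge[of k c]
          by (auto simp: interior_cbox inner_commute)
        show "lifts_from_points E \<pi> f (cbox a b)"
        proof (cases "interior ?A = {} \<or> interior ?B = {}")
          case True
          \<comment> \<open>If one half is flat, the open box lies in the other closed half-space,
            and so does its closure, which is the whole box.\<close>
          have ab: "cbox a b = closure (box a b)"
            using ne by (simp add: interior_cbox closure_box)
          from True have "?A = cbox a b \<or> ?B = cbox a b"
          proof
            assume "interior ?A = {}"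
            then have "box a b \<subseteq> {x. c \<le> x \<bullet> k}" unfolding A0 by force
            then have "cbox a b \<subseteq> {x. c \<le> x \<bullet> k}"
              unfolding ab by (intro closure_minimal) (auto simp: closed_halfspace_component_ge)
            then show ?thesis by blast
          next
            assume "interior ?B = {}"
            then have "box a b \<subseteq> {x. x \<bullet> k \<le> c}" unfolding B0 by force
            then have "cbox a b \<subseteq> {x. x \<bullet> k \<le> c}"
              unfolding ab by (intro closure_minimal) (auto simp: closed_halfspace_component_le)
            then show ?thesis by blast
          qed
          then show ?thesis using PAB ne unfolding P_def by metis
        next
          case False
          then have lift: "lifts_from_points E \<pi> f ?A" "lifts_from_points E \<pi> f ?B"
            using PAB by (auto simp: P_def)
          have I: "?A \<inter> ?B = cbox a b \<inter> {x. x \<bullet> k = c}" by auto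
          have conv: "convex (cbox a b)" by simp
          \<comment> \<open>Points on the two sides of the hyperplane: the segment between them
            meets it inside the box, so the halves intersect. The intersection is convex, hence
            connected, as gluing requires.\<close>
          obtain u v where uv: "u \<in> cbox a b" "u \<bullet> k \<le> c" "v \<in> cbox a b" "c \<le> v \<bullet> k"
            using False interior_subset by blast
          have "\<exists>z\<in>closed_segment u v. z \<bullet> k = c"
            using connected_ivt_hyperplane[of "closed_segment u v" u v k c] uv
            by (auto simp: inner_commute)
          then have "?A \<inter> ?B \<noteq> {}"
            using uv conv convex_contains_segment unfolding I by blast
          moreover have "connected (?A \<inter> ?B)"
            unfolding I using convex_hyperplane[of k c]
            by (intro convex_connected convex_Int conv) (simp add: inner_commute)
          ultimately have "lifts_from_points E \<pi> f (?A \<union> ?B)"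
            using cA cB lift
            by (intro lifts_from_points_Un[OF cov]) (auto intro: closed_subset)
          then show ?thesis by (simp only: U)
        qed
      qed
    qed
  qed
  qed
  \<comment> \<open>On the box, the open set is the preimage of an evenly covered set. A point
    outside may take the whole space, since the tags of a division lie in the box.\<close>
  have "\<exists>G. open G \<and> x \<in> G \<and> (x \<in> cbox a b \<longrightarrow>
      (\<forall>K \<subseteq> cbox a b \<inter> G. lifts_from_points E \<pi> f K))" for x
  proof (cases "x \<in> cbox a b")
    case True
    have "f x \<in> f ` cbox a b" using True by (rule imageI)
    with f(2) have "f x \<in> X" by (rule subsetD)
    then obtain T \<V> where T: "f x \<in> T" "evenly_covered E \<pi> X T \<V>"
      by (rule covering_neighbourhood[OF cov])
    note ec = evenly_coveredD[OF T(2)]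
    have "openin (top_of_set (cbox a b)) (cbox a b \<inter> f -` T)"
      using f ec(1) by (intro continuous_openin_preimage[where T=X]) auto
    then obtain G where G: "open G" "cbox a b \<inter> f -` T = cbox a b \<inter> G"
      by (auto simp: openin_open)
    have "lifts_from_points E \<pi> f K" if "K \<subseteq> cbox a b \<inter> G" for K
      using that G f by (intro lifts_from_points_evenly_covered[OF _ _ T(2)])
        (auto intro: continuous_on_subset)
    then show ?thesis using G True T by (intro exI[of _ G]) blast
  qed (auto intro: exI[of _ UNIV])
  then obtain G where G: "\<And>x. open (G x) \<and> x \<in> G x \<and> (x \<in> cbox a b \<longrightarrow>
      (\<forall>K \<subseteq> cbox a b \<inter> G x. lifts_from_points E \<pi> f K))"
    by metis
  then have "gauge G" by (auto simp: gauge_def)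
  then obtain p where p: "p tagged_division_of cbox a b" "G fine p"
    using fine_division_exists by blast
  interpret operative "(\<and>)" True P by (rule op)
  have "F P (snd ` p) = P (cbox a b)"
    by (rule division[OF division_of_tagged_division[OF p(1)]])
  moreover have "F P (snd ` p)"
    unfolding comm_monoid_set_F_and
  proof (intro impI ballI)
    fix K assume "K \<in> snd ` p"
    then obtain x where xK: "(x, K) \<in> p" by auto
    then have "K \<subseteq> G x" "x \<in> K" "K \<subseteq> cbox a b"
      using p tagged_division_ofD(2,3)[OF p(1)] by (auto simp: fine_def)
    then show "P K" using G[of x] by (auto simp: P_def)
  qed
  ultimately show ?thesis using ne by (simp add: P_def interior_cbox)
qed

lemma covering_lift_path:
  assumes "covering_space E \<pi> X" "path \<gamma>" "path_image \<gamma> \<subseteq> X" "y \<in> E" "\<pi> y = pathstart \<gamma>"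
  obtains \<delta> where "path \<delta>" "path_image \<delta> \<subseteq> E" "pathstart \<delta> = y" "\<And>t. t \<in> {0..1} \<Longrightarrow> \<pi> (\<delta> t) = \<gamma> t"
proof -
  have "lifts_from_points E \<pi> \<gamma> (cbox 0 1)"
    using assms by (intro lifts_from_points_cbox) (auto simp: path_def path_image_def)
  then obtain \<delta> where "continuous_on {0..1} \<delta>" "\<delta> ` {0..1} \<subseteq> E" "\<delta> 0 = y" "\<forall>t\<in>{0..1}. \<pi> (\<delta> t) = \<gamma> t"
    using assms unfolding lifts_from_points_def box_real
    by (metis atLeastAtMost_iff order_refl pathstart_def zero_le_one)
  then show thesis by (intro that[of \<delta>]) (auto simp: path_def path_image_def pathstart_def)
qed

text \<open>Lift the homotopy on the whole square from one corner. The two sides along which the end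
  points stay fixed lift to constants, and the other two sides lift to \<open>\<delta>1\<close> and
  \<open>\<delta>2\<close>, all by uniqueness of lifts.\<close>

lemma covering_monodromy:
  assumes cov: "covering_space E \<pi> X" and hom: "homotopic_paths X \<gamma>1 \<gamma>2"
    and d1: "path \<delta>1" "path_image \<delta>1 \<subseteq> E" "\<And>t. t \<in> {0..1} \<Longrightarrow> \<pi> (\<delta>1 t) = \<gamma>1 t"
    and d2: "path \<delta>2" "path_image \<delta>2 \<subseteq> E" "\<And>t. t \<in> {0..1} \<Longrightarrow> \<pi> (\<delta>2 t) = \<gamma>2 t"
    and eq: "pathstart \<delta>1 = pathstart \<delta>2"
  shows "pathfinish \<delta>1 = pathfinish \<delta>2"
proof -
  let ?I = "{0..1::real}"
  obtain h where h: "continuous_on (?I \<times> ?I) h" "h \<in> ?I \<times> ?I \<rightarrow> X"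
    and h0: "\<forall>t\<in>?I. h (0, t) = \<gamma>1 t" and h1: "\<forall>t\<in>?I. h (1, t) = \<gamma>2 t"
    and ends: "\<forall>t\<in>?I. pathstart (h \<circ> Pair t) = pathstart \<gamma>1 \<and> pathfinish (h \<circ> Pair t) = pathfinish \<gamma>1"
    using hom unfolding homotopic_paths by blast
  have sq: "cbox (0, 0) (1, 1) = ?I \<times> ?I" by (simp add: cbox_Pair_eq)
  have "(1/2, 1/2) \<in> box (0, 0) (1::real, 1::real)"
    by (auto simp: mem_box Basis_prod_def)
  then have sq0: "box (0, 0) (1::real, 1::real) \<noteq> {}" by blast
  have "lifts_from_points E \<pi> h (?I \<times> ?I)"
    using lifts_from_points_cbox[OF cov _ _ sq0] h unfolding sq by blast
  moreover have "\<delta>1 0 \<in> E" "\<pi> (\<delta>1 0) = h (0, 0)" using d1 h0 by (auto simp: path_image_def)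
  ultimately obtain H where H: "continuous_on (?I \<times> ?I) H" "H ` (?I \<times> ?I) \<subseteq> E" "H (0, 0) = \<delta>1 0"
      "\<forall>z\<in>?I \<times> ?I. \<pi> (H z) = h z"
    unfolding lifts_from_points_def by (metis SigmaI atLeastAtMost_iff order_refl zero_le_one)
  have comp: "continuous_on ?I (\<lambda>t. H (u t))" if "continuous_on ?I u" "u ` ?I \<subseteq> ?I \<times> ?I" for u
    using continuous_on_compose2[OF H(1) that] .
  have left: "H (s, 0) = \<delta>1 0" if "s \<in> ?I" for s
  proof (rule covering_lift_unique[OF cov, of ?I "\<lambda>s. H (s, 0)" "\<lambda>s. \<delta>1 0" 0])
    show "continuous_on ?I (\<lambda>s. H (s, 0))" by (rule comp) (auto intro!: continuous_intros)
    show "\<pi> (H (s, 0)) = \<pi> (\<delta>1 0)" if "s \<in> ?I" for s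
      using H(4) ends that d1(3)[of 0] by (auto simp: pathstart_def)
  qed (use H that d1 in \<open>auto simp: path_image_def\<close>)
  have right: "H (s, 1) = H (0, 1)" if "s \<in> ?I" for s
  proof (rule covering_lift_unique[OF cov, of ?I "\<lambda>s. H (s, 1)" "\<lambda>s. H (0, 1)" 0])
    show "continuous_on ?I (\<lambda>s. H (s, 1))" by (rule comp) (auto intro!: continuous_intros)
    show "\<pi> (H (s, 1)) = \<pi> (H (0, 1))" if "s \<in> ?I" for s
      using H(4) ends that h0 by (auto simp: pathfinish_def)
  qed (use H that in auto)
  have "H (0, 1) = \<delta>1 1"
  proof (rule covering_lift_unique[OF cov, of ?I "\<lambda>s. H (0, s)" \<delta>1 0])
    show "continuous_on ?I (\<lambda>s. H (0, s))" by (rule comp) (auto intro!: continuous_intros)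
  qed (use H d1 h0 in \<open>auto simp: path_def path_image_def\<close>)
  moreover have "H (1, 1) = \<delta>2 1"
  proof (rule covering_lift_unique[OF cov, of ?I "\<lambda>s. H (1, s)" \<delta>2 0])
    show "continuous_on ?I (\<lambda>s. H (1, s))" by (rule comp) (auto intro!: continuous_intros)
  qed (use H d2 h1 eq left[of 1] in \<open>auto simp: path_def path_image_def pathstart_def\<close>)
  ultimately show ?thesis using right[of 1] by (simp add: pathfinish_def)
qed

lemma continuous_on_openin_local:
  assumes "\<And>y. y \<in> Y \<Longrightarrow> \<exists>V. openin (top_of_set Y) V \<and> y \<in> V \<and> continuous_on V g"
  shows "continuous_on Y g"
  unfolding continuous_on_def
proof
  fix y assume y: "y \<in> Y"
  obtain V where V: "openin (top_of_set Y) V" "y \<in> V" "continuous_on V g"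
    using assms[OF y] by (elim exE conjE)
  then obtain S where S: "open S" "V = Y \<inter> S" by (auto simp: openin_open)
  have "at y within V = at y within Y"
    by (rule at_within_nhd[of y S]) (use S V in auto)
  moreover have "(g \<longlongrightarrow> g y) (at y within V)"
    using V by (simp add: continuous_on_def)
  ultimately show "(g \<longlongrightarrow> g y) (at y within Y)" by simp
qed

lemma locally_path_connected_spaceE:
  assumes "locally_path_connected_space (top_of_set Y)" "openin (top_of_set Y) W" "y \<in> W"
  obtains V where "openin (top_of_set Y) V" "path_connected V" "y \<in> V" "V \<subseteq> W"
proof -
  have "\<exists>U. openin (top_of_set Y) U \<and> path_connectedin (top_of_set Y) U \<and> y \<in> U \<and> U \<subseteq> W"
    using assms(1)[unfolded locally_path_connected_space, rule_format, of W y] assms(2,3) by simp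
  then show thesis by (elim exE conjE) (rule that, auto simp: path_connectedin_subtopology)
qed

text \<open>Small path connected sets of the base are carried back by the inverse \<open>q\<close>
  of the projection on a sheet \<open>u\<close>. The result is open because it is the intersection
  of \<open>u\<close> with the preimage of an open set.\<close>

lemma covering_locally_path_connected:
  assumes cov: "covering_space E \<pi> X" and lpc: "locally_path_connected_space (top_of_set X)"
  shows "locally_path_connected_space (top_of_set E)"
  unfolding locally_path_connected_space
proof (intro allI impI, elim conjE)
  fix W y assume W: "openin (top_of_set E) W" "y \<in> W"
  then have yE: "y \<in> E" using openin_imp_subset by auto
  then have "\<pi> y \<in> X" using covering_space_imp_surjective[OF cov] by auto
  then obtain T \<V> where T: "\<pi> y \<in> T" "evenly_covered E \<pi> X T \<V>"
    by (rule covering_neighbourhood[OF cov])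
  note ec = evenly_coveredD[OF T(2)]
  have "y \<in> \<Union>\<V>" using T(1) yE ec(2) by simp
  then obtain u where u: "u \<in> \<V>" "y \<in> u" by blast
  obtain q where q: "homeomorphism u T \<pi> q" using ec(5)[OF u(1)] by (elim exE)
  have quT: "q ` T = u" "continuous_on T q" "\<And>z. z \<in> T \<Longrightarrow> \<pi> (q z) = z" "\<And>z. z \<in> u \<Longrightarrow> q (\<pi> z) = z"
      "\<pi> ` u = T"
    using q by (auto simp: homeomorphism_def)
  have uW: "openin (top_of_set u) (u \<inter> W)"
    using W(1) by (metis Int_absorb1 openin_Int_open openin_imp_subset openin_open ec(3) u(1) openin_subtopology_Int2
        inf_commute openin_subset_trans inf_le1 openin_Int)
  have "openin (top_of_set T) (T \<inter> q -` (u \<inter> W))"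
    using quT(1,2) uW by (intro continuous_openin_preimage[where T=u]) auto
  then have "openin (top_of_set X) (T \<inter> q -` (u \<inter> W))"
    using ec(1) openin_trans by blast
  moreover have "\<pi> y \<in> T \<inter> q -` (u \<inter> W)" using T(1) quT(4)[OF u(2)] u W by simp
  ultimately obtain V where V: "openin (top_of_set X) V" "path_connected V" "\<pi> y \<in> V" "V \<subseteq> T \<inter> q -` (u \<inter> W)"
    by (rule locally_path_connected_spaceE[OF lpc])
  have qV: "q ` V = u \<inter> \<pi> -` V"
  proof
    show "q ` V \<subseteq> u \<inter> \<pi> -` V" using V(4) quT(3) by auto
    show "u \<inter> \<pi> -` V \<subseteq> q ` V" using quT(4) by (auto simp: image_iff) metis
  qed
  have "openin (top_of_set E) (E \<inter> \<pi> -` V)"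
    using covering_space_imp_continuous[OF cov] covering_space_imp_surjective[OF cov] V(1)
    by (intro continuous_openin_preimage[where T=X]) auto
  then have "openin (top_of_set E) (u \<inter> (E \<inter> \<pi> -` V))" by (rule openin_Int[OF ec(3)[OF u(1)]])
  moreover have "u \<inter> (E \<inter> \<pi> -` V) = q ` V"
    using openin_imp_subset[OF ec(3)[OF u(1)]] unfolding qV by auto
  ultimately have o: "openin (top_of_set E) (q ` V)" by simp
  moreover have "path_connected (q ` V)"
    using V(4) by (intro path_connected_continuous_image V(2) continuous_on_subset[OF quT(2)]) auto
  moreover have "y \<in> q ` V" using V(3) u unfolding qV by simp
  moreover have "q ` V \<subseteq> W" using V(4) by auto
  ultimately show "\<exists>U. openin (top_of_set E) U \<and> path_connectedin (top_of_set E) U \<and> y \<in> U \<and> U \<subseteq> W"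
    using openin_imp_subset[OF o] by (intro exI[of _ "q ` V"]) (simp add: path_connectedin_subtopology)
qed

text \<open>The lift of \<open>f\<close> at \<open>y\<close> is the end point of the lift of \<open>f \<circ> \<gamma>\<close> for any path \<open>\<gamma>\<close> to \<open>y\<close>.\<close>

lemma covering_lift_exists:
  fixes f :: "'c::topological_space \<Rightarrow> 'a::topological_space"
  assumes cov: "covering_space E \<pi> X"
    and Y: "locally_path_connected_space (top_of_set Y)" "path_connected Y"
    and f: "continuous_on Y f" "f ` Y \<subseteq> X" and y0: "y0 \<in> Y" "e0 \<in> E" "\<pi> e0 = f y0"
    and hom: "\<And>\<gamma> \<delta>. \<lbrakk>path \<gamma>; path_image \<gamma> \<subseteq> Y; path \<delta>; path_image \<delta> \<subseteq> Y; pathstart \<gamma> = y0;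
      pathstart \<delta> = y0; pathfinish \<gamma> = pathfinish \<delta>\<rbrakk> \<Longrightarrow> homotopic_paths X (f \<circ> \<gamma>) (f \<circ> \<delta>)"
  obtains g where "continuous_on Y g" "g ` Y \<subseteq> E" "g y0 = e0" "\<And>y. y \<in> Y \<Longrightarrow> \<pi> (g y) = f y"
proof -
  define R where "R y z \<longleftrightarrow> (\<exists>\<gamma> \<delta>. path \<gamma> \<and> path_image \<gamma> \<subseteq> Y \<and> pathstart \<gamma> = y0 \<and> pathfinish \<gamma> = y \<and>
      path \<delta> \<and> path_image \<delta> \<subseteq> E \<and> pathstart \<delta> = e0 \<and> pathfinish \<delta> = z \<and>
      (\<forall>t\<in>{0..1}. \<pi> (\<delta> t) = f (\<gamma> t)))" for y z
  have fpath: "path (f \<circ> \<gamma>)" "path_image (f \<circ> \<gamma>) \<subseteq> X" if "path \<gamma>" "path_image \<gamma> \<subseteq> Y" for \<gamma>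
    using that f by (auto intro!: path_continuous_image intro: continuous_on_subset simp: path_image_compose)
  have ex: "\<exists>z. R y z" if "y \<in> Y" for y
  proof -
    obtain \<gamma> where \<gamma>: "path \<gamma>" "path_image \<gamma> \<subseteq> Y" "pathstart \<gamma> = y0" "pathfinish \<gamma> = y"
      using Y(2)[unfolded path_connected_def, rule_format, OF y0(1) \<open>y \<in> Y\<close>] by (elim exE conjE)
    have "\<pi> e0 = pathstart (f \<circ> \<gamma>)" using \<gamma>(3) y0 by (simp add: pathstart_def)
    then obtain \<delta> where "path \<delta>" "path_image \<delta> \<subseteq> E" "pathstart \<delta> = e0"
        "\<And>t. t \<in> {0..1} \<Longrightarrow> \<pi> (\<delta> t) = (f \<circ> \<gamma>) t"
      by (rule covering_lift_path[OF cov fpath[OF \<gamma>(1,2)] y0(2)]) (rule that)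
    then show ?thesis unfolding R_def using \<gamma> by (intro exI[of _ "pathfinish \<delta>"] exI[of _ \<gamma>] exI[of _ \<delta>]) simp
  qed
  have uniq: "z = z'" if "R y z" "R y z'" for y z z'
  proof -
    obtain \<gamma> \<delta> where g: "path \<gamma>" "path_image \<gamma> \<subseteq> Y" "pathstart \<gamma> = y0" "pathfinish \<gamma> = y"
        "path \<delta>" "path_image \<delta> \<subseteq> E" "pathstart \<delta> = e0" "pathfinish \<delta> = z" "\<forall>t\<in>{0..1}. \<pi> (\<delta> t) = f (\<gamma> t)"
      using \<open>R y z\<close> unfolding R_def by (elim exE conjE)
    obtain \<gamma>' \<delta>' where g': "path \<gamma>'" "path_image \<gamma>' \<subseteq> Y" "pathstart \<gamma>' = y0" "pathfinish \<gamma>' = y"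
        "path \<delta>'" "path_image \<delta>' \<subseteq> E" "pathstart \<delta>' = e0" "pathfinish \<delta>' = z'" "\<forall>t\<in>{0..1}. \<pi> (\<delta>' t) = f (\<gamma>' t)"
      using \<open>R y z'\<close> unfolding R_def by (elim exE conjE)
    have "homotopic_paths X (f \<circ> \<gamma>) (f \<circ> \<gamma>')" using g g' by (intro hom) simp_all
    then have "pathfinish \<delta> = pathfinish \<delta>'"
      by (rule covering_monodromy[OF cov]) (use g g' in simp_all)
    then show ?thesis using g g' by simp
  qed
  define g where "g y = (SOME z. R y z)" for y
  have R: "R y (g y)" if "y \<in> Y" for y
    unfolding g_def using ex[OF that] by (rule someI_ex)
  have gE: "g y \<in> E" "\<pi> (g y) = f y" if "y \<in> Y" for y
  proof -
    obtain \<gamma> \<delta> where g: "path \<gamma>" "path_image \<gamma> \<subseteq> Y" "pathstart \<gamma> = y0" "pathfinish \<gamma> = y"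
        "path \<delta>" "path_image \<delta> \<subseteq> E" "pathstart \<delta> = e0" "pathfinish \<delta> = g y" "\<forall>t\<in>{0..1}. \<pi> (\<delta> t) = f (\<gamma> t)"
      using R[OF \<open>y \<in> Y\<close>] unfolding R_def by (elim exE conjE)
    have "\<delta> 1 \<in> E" using g(6) by (auto simp: path_image_def)
    then show "g y \<in> E" "\<pi> (g y) = f y" using g(4,8) g(9)[rule_format, of 1] by (auto simp: pathfinish_def)
  qed
  have "R y0 e0"
    unfolding R_def using y0
    by (intro exI[of _ "\<lambda>_. y0"] exI[of _ "\<lambda>_. e0"]) (auto simp: path_def path_image_def pathstart_def pathfinish_def)
  then have gy0: "g y0 = e0" using uniq R[OF y0(1)] by blast
  have "continuous_on Y g"
  proof (rule continuous_on_openin_local)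
    fix y assume y: "y \<in> Y"
    then have "f y \<in> X" using f(2) by auto
    then obtain T \<V> where T: "f y \<in> T" "evenly_covered E \<pi> X T \<V>"
      by (rule covering_neighbourhood[OF cov])
    note ec = evenly_coveredD[OF T(2)]
    have "g y \<in> \<Union>\<V>" using T(1) gE[OF y] ec(2) by simp
    then obtain u where u: "u \<in> \<V>" "g y \<in> u" by (rule UnionE)
    obtain q where q: "homeomorphism u T \<pi> q" using ec(5)[OF u(1)] by (elim exE)
    have quT: "q ` T = u" "continuous_on T q" "\<And>z. z \<in> T \<Longrightarrow> \<pi> (q z) = z" "\<And>z. z \<in> u \<Longrightarrow> q (\<pi> z) = z"
      using q by (auto simp: homeomorphism_def)
    have uE: "u \<subseteq> E" using openin_imp_subset[OF ec(3)[OF u(1)]] .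
    have "openin (top_of_set Y) (Y \<inter> f -` T)"
      using f ec(1) by (intro continuous_openin_preimage[where T=X]) auto
    moreover have "y \<in> Y \<inter> f -` T" using y T(1) by simp
    ultimately obtain V where V: "openin (top_of_set Y) V" "path_connected V" "y \<in> V" "V \<subseteq> Y \<inter> f -` T"
      by (rule locally_path_connected_spaceE[OF Y(1)])
    have fV: "f ` V \<subseteq> T" "V \<subseteq> Y" using V(4) by auto
    have contV: "continuous_on V (q \<circ> f)"
      by (rule continuous_on_compose[OF continuous_on_subset[OF f(1) fV(2)] continuous_on_subset[OF quT(2) fV(1)]])
    have qfV: "q (f z) \<in> E" if "z \<in> V" for z
      using that V(4) quT(1) uE by auto
    obtain \<gamma> \<delta> where g: "path \<gamma>" "path_image \<gamma> \<subseteq> Y" "pathstart \<gamma> = y0" "pathfinish \<gamma> = y"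
        "path \<delta>" "path_image \<delta> \<subseteq> E" "pathstart \<delta> = e0" "pathfinish \<delta> = g y" "\<forall>t\<in>{0..1}. \<pi> (\<delta> t) = f (\<gamma> t)"
      using R[OF y] unfolding R_def by (elim exE conjE)
    \<comment> \<open>Continue the chosen path to \<open>y\<close> by a path inside
      \<open>V\<close>, whose lift is its image under \<open>q \<circ> f\<close>. So
      \<open>g\<close> is given by this continuous formula on all of \<open>V\<close>.\<close>
    have gq: "g z = q (f z)" if z: "z \<in> V" for z
    proof -
      obtain \<epsilon> where \<epsilon>: "path \<epsilon>" "path_image \<epsilon> \<subseteq> V" "pathstart \<epsilon> = y" "pathfinish \<epsilon> = z"
        using V(2)[unfolded path_connected_def, rule_format, OF V(3) z] by (elim exE conjE)
      have \<epsilon>V: "\<epsilon> t \<in> V" if "t \<in> {0..1}" for t using that \<epsilon>(2) by (auto simp: path_image_def)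
      let ?\<epsilon> = "q \<circ> f \<circ> \<epsilon>"
      have e: "path ?\<epsilon>" "path_image ?\<epsilon> \<subseteq> E" "pathstart ?\<epsilon> = g y" "pathfinish ?\<epsilon> = q (f z)"
      proof -
        show "path ?\<epsilon>" by (intro path_continuous_image \<epsilon>(1) continuous_on_subset[OF contV] \<epsilon>(2))
        show "path_image ?\<epsilon> \<subseteq> E" using qfV \<epsilon>V by (auto simp: path_image_def)
        show "pathstart ?\<epsilon> = g y"
          using \<epsilon>(3) gE(2)[OF y] quT(4)[OF u(2)] by (simp add: pathstart_def)
        show "pathfinish ?\<epsilon> = q (f z)" using \<epsilon>(4) by (simp add: pathfinish_def)
      qed
      have "R z (q (f z))"
        unfolding R_def
      proof (intro exI conjI)
        show "path (\<gamma> +++ \<epsilon>)" "pathstart (\<gamma> +++ \<epsilon>) = y0" "pathfinish (\<gamma> +++ \<epsilon>) = z"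
          using g \<epsilon> by simp_all
        show "path_image (\<gamma> +++ \<epsilon>) \<subseteq> Y" using g \<epsilon> V(4) by (intro subset_path_image_join) auto
        show "path (\<delta> +++ ?\<epsilon>)" "pathstart (\<delta> +++ ?\<epsilon>) = e0" "pathfinish (\<delta> +++ ?\<epsilon>) = q (f z)"
          using g e by simp_all
        show "path_image (\<delta> +++ ?\<epsilon>) \<subseteq> E" using g e by (intro subset_path_image_join)
        show "\<forall>t\<in>{0..1}. \<pi> ((\<delta> +++ ?\<epsilon>) t) = f ((\<gamma> +++ \<epsilon>) t)"
        proof
          fix t :: real assume t: "t \<in> {0..1}"
          show "\<pi> ((\<delta> +++ ?\<epsilon>) t) = f ((\<gamma> +++ \<epsilon>) t)"
          proof (cases "t \<le> 1/2")
            case True then show ?thesis using t g(9) by (simp add: joinpaths_def)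
          next
            case False
            then have "\<epsilon> (2 * t - 1) \<in> V" using t by (intro \<epsilon>V) auto
            then have "f (\<epsilon> (2 * t - 1)) \<in> T" using V(4) by auto
            then show ?thesis using False quT(3) by (simp add: joinpaths_def)
          qed
        qed
      qed
      moreover have "z \<in> Y" using z V(4) by auto
      ultimately show ?thesis using uniq R by blast
    qed
    have "continuous_on V g"
      using contV by (rule continuous_on_eq) (simp add: gq)
    then show "\<exists>V. openin (top_of_set Y) V \<and> y \<in> V \<and> continuous_on V g"
      using V(1,3) by (intro exI[of _ V] conjI)
  qed
  moreover have "g ` Y \<subseteq> E" using gE(1) by auto
  ultimately show thesis using gy0 gE(2) by (rule that)
qed

section \<open>Simply connected spaces and the fundamental group\<close>

text \<open>Simple connectedness is phrased by free homotopies of loops. Such a homotopy between the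
  constant loops at \<open>x\<close> and at \<open>y\<close> moves one point from \<open>x\<close>
  to \<open>y\<close>.\<close>

lemma simply_connected_path_connected:
  fixes S :: "'a::topological_space set"
  assumes "simply_connected S"
  shows "path_connected S"
  unfolding path_connected_def
proof (intro ballI)
  fix x y assume xy: "x \<in> S" "y \<in> S"
  have "homotopic_loops S (\<lambda>_. x) (\<lambda>_. y)"
    using assms[unfolded simply_connected_def, rule_format, of "\<lambda>_. x" "\<lambda>_. y"] xy
    by (auto simp: path_def path_image_def pathstart_def pathfinish_def)
  then obtain h where h: "continuous_on ({0..1::real} \<times> {0..1::real}) h" "h \<in> {0..1} \<times> {0..1} \<rightarrow> S"
      "\<forall>t\<in>{0..1}. h (0, t) = x" "\<forall>t\<in>{0..1}. h (1, t) = y"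
    unfolding homotopic_loops by (elim exE conjE)
  have "continuous_on {0..1} (\<lambda>s. h (s, 0))"
    by (rule continuous_on_compose2[OF h(1)]) (auto intro!: continuous_intros)
  moreover have "(\<lambda>s. h (s, 0)) ` {0..1} \<subseteq> S" using h(2) by auto
  ultimately show "\<exists>g. path g \<and> path_image g \<subseteq> S \<and> pathstart g = x \<and> pathfinish g = y"
    using h(3,4) by (intro exI[of _ "\<lambda>s. h (s, 0)"]) (simp add: path_def path_image_def pathstart_def pathfinish_def)
qed

text \<open>A free null homotopy \<open>h\<close> of the loop \<open>p +++ reversepath q\<close> moves \<open>p\<close> and \<open>q\<close> to the same path:
  both travel along the trace of the base point, pause at the constant, and return along the trace of
  the common end point.\<close>

lemma simply_connected_homotopic_paths:
  fixes S :: "'a::topological_space set"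
  assumes S: "simply_connected S" and p: "path p" "path_image p \<subseteq> S" and q: "path q" "path_image q \<subseteq> S"
    and ends: "pathstart p = pathstart q" "pathfinish p = pathfinish q"
  shows "homotopic_paths S p q"
proof -
  let ?I = "{0..1::real}"
  have p0: "pathstart p \<in> S" using p by auto
  have "homotopic_loops S (p +++ reversepath q) (\<lambda>_. pathstart p)"
    by (rule S[unfolded simply_connected_def, rule_format])
      (use p q ends p0 in \<open>auto simp: path_image_join path_def[of "\<lambda>_. _"] path_image_def[of "\<lambda>_. _"]
        pathstart_def[of "\<lambda>_. _"] pathfinish_def[of "\<lambda>_. _"]\<close>)
  then obtain h where h: "continuous_on (?I \<times> ?I) h" "h \<in> ?I \<times> ?I \<rightarrow> S"
      and h0: "\<forall>t\<in>?I. h (0, t) = (p +++ reversepath q) t" and h1: "\<forall>t\<in>?I. h (1, t) = pathstart p"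
      and hl: "\<forall>t\<in>?I. pathfinish (h \<circ> Pair t) = pathstart (h \<circ> Pair t)"
    unfolding homotopic_loops by (elim exE conjE)
  \<comment> \<open>\<open>\<phi>\<close> runs through the unit interval during the middle third and
    pauses outside it. \<open>w s t\<close> is the time of the free homotopy: for s = 1 it rises
    from 0 to 1 in the first third, stays at 1 where \<open>h\<close> is constant, and falls back in
    the last third; for s = 0 it is zero throughout.\<close>
  define \<phi> where "\<phi> t = max 0 (min 1 (3 * t - 1))" for t :: real
  define w where "w s t = min s (min (3 * t) (3 - 3 * t))" for s t :: real
  have \<phi>: "\<phi> t \<in> ?I" for t by (auto simp: \<phi>_def)
  have w: "w s t \<in> ?I" if "s \<in> ?I" "t \<in> ?I" for s t using that by (auto simp: w_def)
  \<comment> \<open>First reparametrize \<open>r\<close> so that it pauses in the outer thirds, then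
    let \<open>s\<close> in \<open>w s t\<close> push it along \<open>h\<close>. The end points stay
    fixed because \<open>w s t\<close> vanishes at both ends.\<close>
  have move: "homotopic_paths S r (\<lambda>t. h (w 1 t, \<psi> (\<phi> t)))"
    if \<psi>: "continuous_on ?I \<psi>" "\<And>t. t \<in> ?I \<Longrightarrow> \<psi> t \<in> ?I" and r: "path r" "path_image r \<subseteq> S"
      "\<And>t. t \<in> ?I \<Longrightarrow> h (0, \<psi> t) = r t" for \<psi> r
  proof -
    have c\<phi>: "continuous_on ?I (\<lambda>t. \<psi> (\<phi> t))"
      by (rule continuous_on_compose2[OF \<psi>(1)]) (use \<phi> in \<open>auto simp: \<phi>_def intro!: continuous_intros\<close>)
    have "homotopic_paths S r (\<lambda>t. h (0, \<psi> (\<phi> t)))"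
    proof (rule homotopic_paths_reparametrize[OF r(1,2), where f = \<phi>])
      show "continuous_on ?I \<phi>" unfolding \<phi>_def by (intro continuous_intros)
    qed (use \<phi> r(3) in \<open>auto simp: \<phi>_def\<close>)
    moreover have "homotopic_paths S (\<lambda>t. h (0, \<psi> (\<phi> t))) (\<lambda>t. h (w 1 t, \<psi> (\<phi> t)))"
      unfolding homotopic_paths
    proof (intro exI[of _ "\<lambda>z. h (w (fst z) (snd z), \<psi> (\<phi> (snd z)))"] conjI ballI)
      have "continuous_on (?I \<times> ?I) (\<lambda>z. (w (fst z) (snd z), \<psi> (\<phi> (snd z))))"
        unfolding w_def by (intro continuous_intros continuous_on_compose2[OF c\<phi>]) auto
      then show "continuous_on (?I \<times> ?I) (\<lambda>z. h (w (fst z) (snd z), \<psi> (\<phi> (snd z))))"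
        by (rule continuous_on_compose2[OF h(1)]) (use w \<phi> \<psi> in auto)
      show "(\<lambda>z. h (w (fst z) (snd z), \<psi> (\<phi> (snd z)))) \<in> ?I \<times> ?I \<rightarrow> S"
      proof
        fix z :: "real \<times> real" assume z: "z \<in> ?I \<times> ?I"
        then have "(w (fst z) (snd z), \<psi> (\<phi> (snd z))) \<in> ?I \<times> ?I" using w \<psi>(2) \<phi> by (intro SigmaI) auto
        then show "h (w (fst z) (snd z), \<psi> (\<phi> (snd z))) \<in> S" using h(2) by (rule funcset_mem[rotated])
      qed
    qed (auto simp: w_def pathstart_def pathfinish_def)
    ultimately show ?thesis by (rule homotopic_paths_trans)
  qed
  have 1: "homotopic_paths S p (\<lambda>t. h (w 1 t, \<phi> t / 2))"
    by (rule move[of "\<lambda>t. t / 2"]) (use p h0 in \<open>auto simp: joinpaths_def intro!: continuous_intros\<close>)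
  \<comment> \<open>The second half of the joined loop is \<open>q\<close> run backwards, hence the
    parameter \<open>1 - t / 2\<close>; at t = 1 the join is evaluated through \<open>p\<close>,
    whose end point is that of \<open>q\<close>.\<close>
  have 2: "homotopic_paths S q (\<lambda>t. h (w 1 t, 1 - \<phi> t / 2))"
  proof (rule move[of "\<lambda>t. 1 - t / 2"])
    fix t assume t: "t \<in> ?I"
    then have "h (0, 1 - t / 2) = (p +++ reversepath q) (1 - t / 2)" using h0 by simp
    also have "\<dots> = q t"
      using t ends(2) by (cases "t = 1") (auto simp: joinpaths_def reversepath_def pathfinish_def)
    finally show "h (0, 1 - t / 2) = q t" .
  qed (use q in \<open>auto intro!: continuous_intros\<close>)
  \<comment> \<open>In the first third the parameters are 0 and 1, where the free homotopy of loops
    agrees; in the middle third \<open>h\<close> is constant; in the last third both parameters are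
    1/2.\<close>
  have "h (w 1 t, \<phi> t / 2) = h (w 1 t, 1 - \<phi> t / 2)" if t: "t \<in> ?I" for t
  proof -
    consider "t \<le> 1/3" | "1/3 < t" "t < 2/3" | "2/3 \<le> t" by linarith
    then show ?thesis
    proof cases
      case 1
      then have "\<phi> t = 0" "w 1 t = 3 * t" using t by (auto simp: \<phi>_def w_def)
      then show ?thesis using hl t 1 by (simp add: pathstart_def pathfinish_def)
    next
      case 2
      then have "w 1 t = 1" by (auto simp: w_def)
      then show ?thesis using h1 \<phi>[of t] by simp
    next
      case 3
      then have "\<phi> t = 1" by (auto simp: \<phi>_def)
      then show ?thesis by simp
    qed
  qed
  then have "homotopic_paths S (\<lambda>t. h (w 1 t, 1 - \<phi> t / 2)) (\<lambda>t. h (w 1 t, \<phi> t / 2))"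
    using homotopic_paths_imp_path[OF 2] homotopic_paths_imp_subset[OF 2]
    by (intro homotopic_paths_eq) auto
  then show ?thesis using 1 2 homotopic_paths_sym homotopic_paths_trans by blast
qed

lemma loop_class_eq_iff:
  assumes "path \<gamma>" "path_image \<gamma> \<subseteq> X"
  shows "loop_class X \<gamma> = loop_class X \<delta> \<longleftrightarrow> homotopic_paths X \<gamma> \<delta>"
proof
  assume "loop_class X \<gamma> = loop_class X \<delta>"
  moreover have "\<gamma> \<in> loop_class X \<gamma>" using assms by (simp add: loop_class_def)
  ultimately have "\<gamma> \<in> loop_class X \<delta>" by simp
  then show "homotopic_paths X \<gamma> \<delta>" by (simp add: loop_class_def homotopic_paths_sym_eq)
next
  assume h: "homotopic_paths X \<gamma> \<delta>"
  show "loop_class X \<gamma> = loop_class X \<delta>"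
    unfolding loop_class_def
    by (rule Collect_cong, rule iffI)
      (erule homotopic_paths_trans[OF homotopic_paths_sym[OF h]] homotopic_paths_trans[OF h])+
qed

text \<open>The product is a union over all representatives; joins of homotopic paths are homotopic,
  so all members of the union coincide.\<close>

lemma fundamental_group_mult:
  assumes "\<alpha> \<in> based_loops X x" "\<beta> \<in> based_loops X x"
  shows "loop_class X \<alpha> \<otimes>\<^bsub>fundamental_group X x\<^esub> loop_class X \<beta> = loop_class X (\<alpha> +++ \<beta>)"
proof -
  have ab: "path \<alpha>" "path_image \<alpha> \<subseteq> X" "path \<beta>" "path_image \<beta> \<subseteq> X" "pathfinish \<alpha> = pathstart \<beta>"
    using assms by (auto simp: based_loops_def)
  have eq: "loop_class X (\<alpha>' +++ \<beta>') = loop_class X (\<alpha> +++ \<beta>)"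
    if "\<alpha>' \<in> loop_class X \<alpha>" "\<beta>' \<in> loop_class X \<beta>" for \<alpha>' \<beta>'
  proof -
    have h: "homotopic_paths X (\<alpha> +++ \<beta>) (\<alpha>' +++ \<beta>')"
      using that ab(5) unfolding loop_class_def by (intro homotopic_paths_join) auto
    have "path (\<alpha> +++ \<beta>)" "path_image (\<alpha> +++ \<beta>) \<subseteq> X"
      using homotopic_paths_imp_path[OF h] homotopic_paths_imp_subset[OF h] by auto
    from loop_class_eq_iff[OF this, THEN iffD2, OF h] show ?thesis by simp
  qed
  have "\<alpha> \<in> loop_class X \<alpha>" "\<beta> \<in> loop_class X \<beta>" using ab by (simp_all add: loop_class_def)
  then have ne: "loop_class X \<alpha> \<noteq> {}" "loop_class X \<beta> \<noteq> {}" by auto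
  have "loop_class X \<alpha> \<otimes>\<^bsub>fundamental_group X x\<^esub> loop_class X \<beta> =
      (\<Union>\<alpha>'\<in>loop_class X \<alpha>. \<Union>\<beta>'\<in>loop_class X \<beta>. loop_class X (\<alpha>' +++ \<beta>'))"
    by (simp add: fundamental_group_def)
  also have "\<dots> = (\<Union>\<alpha>'\<in>loop_class X \<alpha>. \<Union>\<beta>'\<in>loop_class X \<beta>. loop_class X (\<alpha> +++ \<beta>))"
    by (intro SUP_cong refl eq)
  also have "\<dots> = loop_class X (\<alpha> +++ \<beta>)" using ne by simp
  finally show ?thesis .
qed

lemma fundamental_group_carrierE:
  assumes "g \<in> carrier (fundamental_group X x)"
  obtains \<alpha> where "\<alpha> \<in> based_loops X x" "g = loop_class X \<alpha>"
  using assms by (auto simp: fundamental_group_def)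

lemma fundamental_group_carrierI:
  "\<alpha> \<in> based_loops X x \<Longrightarrow> loop_class X \<alpha> \<in> carrier (fundamental_group X x)"
  by (auto simp: fundamental_group_def)

lemma deck_transformationD:
  assumes "deck_transformation E \<pi> f"
  shows "f \<in> extensional E" "continuous_on E f" "y \<in> E \<Longrightarrow> f y \<in> E" "y \<in> E \<Longrightarrow> \<pi> (f y) = \<pi> y"
  using assms by (auto simp: deck_transformation_def homeomorphism_def)

lemma homotopic_paths_standard_simplex:
  assumes "path \<gamma>" "path_image \<gamma> \<subseteq> standard_simplex n" "path \<delta>" "path_image \<delta> \<subseteq> standard_simplex n"
    and ends: "pathstart \<gamma> = pathstart \<delta>" "pathfinish \<gamma> = pathfinish \<delta>"
  shows "homotopic_paths (standard_simplex n) \<gamma> \<delta>"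
  unfolding homotopic_paths
proof (intro exI[of _ "\<lambda>z i. (1 - fst z) * \<gamma> (snd z) i + fst z * \<delta> (snd z) i"] conjI ballI)
  have co: "continuous_on ({0..1} \<times> {0..1}) (\<lambda>z. \<epsilon> (snd z) i)"
    if "path \<epsilon>" for \<epsilon> :: "real \<Rightarrow> nat \<Rightarrow> real" and i
  proof -
    have "continuous_on {0..1} (\<lambda>t. \<epsilon> t i)"
      by (rule continuous_on_product_then_coordinatewise) (use that in \<open>simp add: path_def\<close>)
    then show ?thesis by (rule continuous_on_compose2) (auto intro!: continuous_intros)
  qed
  show "continuous_on ({0..1} \<times> {0..1}) (\<lambda>z i. (1 - fst z) * \<gamma> (snd z) i + fst z * \<delta> (snd z) i)"
    by (intro continuous_on_coordinatewise_then_product continuous_intros co assms)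
  show "(\<lambda>z i. (1 - fst z) * \<gamma> (snd z) i + fst z * \<delta> (snd z) i) \<in> {0..1} \<times> {0..1} \<rightarrow> standard_simplex n"
    using assms by (intro funcsetI convex_standard_simplex) (auto simp: path_image_def)
qed (use ends in \<open>auto simp: pathstart_def pathfinish_def algebra_simps\<close>)

section \<open>Deck transformations and lifts of simplices\<close>

locale universal_cover =
  fixes X :: "'a::topological_space set" and E :: "'b::topological_space set" and \<pi> :: "'b \<Rightarrow> 'a" and e :: 'b
  assumes ucov: "universal_covering E \<pi> X"
    and lpc: "locally_path_connected_space (top_of_set X)"
    and e: "e \<in> E"
begin

abbreviation "G \<equiv> fundamental_group X (\<pi> e)"

abbreviation "deck \<equiv> deck_action E \<pi> e"

lemma cov: "covering_space E \<pi> X" and sc: "simply_connected E"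
  using ucov by (auto simp: universal_covering_def)

lemma cont: "continuous_on E \<pi>" and img: "\<pi> ` E = X"
  using cov by (auto simp: covering_space_def)

lemma pcE: "path_connected E"
  by (rule simply_connected_path_connected[OF sc])

lemma path_in_E:
  assumes "y \<in> E" "z \<in> E"
  obtains \<gamma> where "path \<gamma>" "path_image \<gamma> \<subseteq> E" "pathstart \<gamma> = y" "pathfinish \<gamma> = z"
  using pcE[unfolded path_connected_def, rule_format, OF assms] by (elim exE conjE)

lemma pcX: "path_connected X"
  using path_connected_continuous_image[OF cont pcE] by (simp add: img)

lemma path_proj:
  assumes "path \<gamma>" "path_image \<gamma> \<subseteq> E"
  shows "path (\<pi> \<circ> \<gamma>)" "path_image (\<pi> \<circ> \<gamma>) \<subseteq> X"
  using assms path_continuous_image[OF assms(1) continuous_on_subset[OF cont assms(2)]] img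
  by (auto simp: path_image_compose)

lemma homotopic_proj:
  assumes "path \<gamma>" "path_image \<gamma> \<subseteq> E" "path \<delta>" "path_image \<delta> \<subseteq> E"
    "pathstart \<gamma> = pathstart \<delta>" "pathfinish \<gamma> = pathfinish \<delta>"
  shows "homotopic_paths X (\<pi> \<circ> \<gamma>) (\<pi> \<circ> \<delta>)"
  by (rule homotopic_paths_continuous_image[OF simply_connected_homotopic_paths[OF sc assms] cont])
    (use img in auto)

text \<open>The lifting criterion applied to the projection itself: paths in the simply connected
  total space with equal ends are homotopic, and so are their images in the base.\<close>

lemma deck_lift:
  assumes "y \<in> E" "y' \<in> E" "\<pi> y = \<pi> y'"
  obtains f where "continuous_on E f" "f ` E \<subseteq> E" "f y = y'" "\<And>z. z \<in> E \<Longrightarrow> \<pi> (f z) = \<pi> z"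
proof (rule covering_lift_exists[OF cov covering_locally_path_connected[OF cov lpc] pcE cont _ assms(1,2)])
  show "\<pi> ` E \<subseteq> X" using img by simp
  show "\<pi> y' = \<pi> y" using assms by simp
  show "homotopic_paths X (\<pi> \<circ> \<gamma>) (\<pi> \<circ> \<delta>)"
    if "path \<gamma>" "path_image \<gamma> \<subseteq> E" "path \<delta>" "path_image \<delta> \<subseteq> E" "pathstart \<gamma> = y" "pathstart \<delta> = y"
      "pathfinish \<gamma> = pathfinish \<delta>" for \<gamma> \<delta>
    using that by (intro homotopic_proj) simp_all
qed (rule that)

lemma deck_lift_unique:
  assumes "continuous_on E f" "f ` E \<subseteq> E" "\<And>z. z \<in> E \<Longrightarrow> \<pi> (f z) = \<pi> z"
    and "continuous_on E g" "g ` E \<subseteq> E" "\<And>z. z \<in> E \<Longrightarrow> \<pi> (g z) = \<pi> z"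
    and "y \<in> E" "f y = g y" "z \<in> E"
  shows "f z = g z"
  by (rule covering_lift_unique[OF cov path_connected_imp_connected[OF pcE] assms(1,2,4,5) _ assms(7,8,9)])
    (simp add: assms(3,6))

text \<open>Lift the projection once from \<open>y\<close> to \<open>y'\<close> and once back. Each
  composite is a lift of the projection that fixes a point, hence the identity on \<open>E\<close>.
  Restricting to \<open>E\<close> supplies the extensionality that deck transformations
  carry.\<close>

lemma deck_transformation_exists:
  assumes y: "y \<in> E" "y' \<in> E" "\<pi> y = \<pi> y'"
  obtains f where "deck_transformation E \<pi> f" "f y = y'"
proof -
  obtain f where f: "continuous_on E f" "f ` E \<subseteq> E" "f y = y'" "\<And>z. z \<in> E \<Longrightarrow> \<pi> (f z) = \<pi> z"
    by (rule deck_lift[OF y]) (rule that)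
  obtain g where g: "continuous_on E g" "g ` E \<subseteq> E" "g y' = y" "\<And>z. z \<in> E \<Longrightarrow> \<pi> (g z) = \<pi> z"
    by (rule deck_lift[OF y(2,1) y(3)[symmetric]]) (rule that)
  have gf: "g (f z) = z" if "z \<in> E" for z
    using deck_lift_unique[of "g \<circ> f" id y z] f g y that continuous_on_compose[OF f(1)]
      continuous_on_subset[OF g(1) f(2)] by (force simp: image_subset_iff)
  have fg: "f (g z) = z" if "z \<in> E" for z
    using deck_lift_unique[of "f \<circ> g" id y' z] f g y that continuous_on_compose[OF g(1)]
      continuous_on_subset[OF f(1) g(2)] by (force simp: image_subset_iff)
  have "homeomorphism E E (restrict f E) g"
    unfolding homeomorphism_def
  proof (intro conjI ballI)
    show "continuous_on E (restrict f E)" by (rule continuous_on_eq[OF f(1)]) simp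
    show "restrict f E ` E = E"
    proof
      show "restrict f E ` E \<subseteq> E" using f(2) by auto
      show "E \<subseteq> restrict f E ` E"
      proof
        fix z assume z: "z \<in> E"
        then have "g z \<in> E" using g(2) by auto
        then show "z \<in> restrict f E ` E" using fg[OF z] by (intro image_eqI[of _ _ "g z"]) auto
      qed
    qed
    show "g ` E = E"
    proof
      show "g ` E \<subseteq> E" by (rule g(2))
      show "E \<subseteq> g ` E"
      proof
        fix z assume z: "z \<in> E"
        then have "f z \<in> E" using f(2) by auto
        then show "z \<in> g ` E" using gf[OF z] by (intro image_eqI[of _ _ "f z"]) auto
      qed
    qed
    show "g (restrict f E z) = z" if "z \<in> E" for z using gf that by simp
    show "restrict f E (g z) = z" if "z \<in> E" for z using fg that g(2) by (auto simp: image_subset_iff)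
  qed (rule g(1))
  then have "deck_transformation E \<pi> (restrict f E)"
    unfolding deck_transformation_def using f(4) by auto
  moreover have "restrict f E y = y'" using f(3) y by simp
  ultimately show thesis by (rule that)
qed

lemma deck_transformation_unique:
  assumes f: "deck_transformation E \<pi> f" and g: "deck_transformation E \<pi> g" and y: "y \<in> E" "f y = g y"
  shows "f = g"
proof (rule extensionalityI[OF deck_transformationD(1)[OF f] deck_transformationD(1)[OF g]])
  fix z assume "z \<in> E"
  then show "f z = g z"
    using y deck_transformationD(2,3,4)[OF f] deck_transformationD(2,3,4)[OF g]
    by (intro deck_lift_unique[of f g y z]) auto
qed

text \<open>Justifies the definite description in \<open>deck_action\<close>: by monodromy the end
  point of the lift depends only on the class, and a deck transformation is determined by the image
  of \<open>e\<close>.\<close>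

lemma deck_ex1:
  assumes "g \<in> carrier G"
  shows "\<exists>!f. deck_transformation E \<pi> f \<and>
     (\<exists>\<alpha>\<in>g. \<exists>\<gamma>. path \<gamma> \<and> path_image \<gamma> \<subseteq> E \<and> pathstart \<gamma> = e \<and> pathfinish \<gamma> = f e \<and>
        (\<forall>t\<in>{0..1}. \<pi> (\<gamma> t) = \<alpha> t))"
proof (rule ex_ex1I)
  obtain \<alpha> where \<alpha>: "\<alpha> \<in> based_loops X (\<pi> e)" "g = loop_class X \<alpha>"
    using assms by (rule fundamental_group_carrierE)
  then have a: "path \<alpha>" "path_image \<alpha> \<subseteq> X" "pathstart \<alpha> = \<pi> e" "pathfinish \<alpha> = \<pi> e"
    by (auto simp: based_loops_def)
  obtain \<gamma> where \<gamma>: "path \<gamma>" "path_image \<gamma> \<subseteq> E" "pathstart \<gamma> = e" "\<And>t. t \<in> {0..1} \<Longrightarrow> \<pi> (\<gamma> t) = \<alpha> t"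
    by (rule covering_lift_path[OF cov a(1,2) e a(3)[symmetric]]) (rule that)
  have fin: "pathfinish \<gamma> \<in> E" using \<gamma>(2) by auto
  have "\<pi> e = \<pi> (pathfinish \<gamma>)" using \<gamma>(4)[of 1] a(4) by (simp add: pathfinish_def)
  then obtain f where f: "deck_transformation E \<pi> f" "f e = pathfinish \<gamma>"
    by (rule deck_transformation_exists[OF e fin]) (rule that)
  have "\<alpha> \<in> g" using a \<alpha>(2) by (simp add: loop_class_def)
  then show "\<exists>f. deck_transformation E \<pi> f \<and>
     (\<exists>\<alpha>\<in>g. \<exists>\<gamma>. path \<gamma> \<and> path_image \<gamma> \<subseteq> E \<and> pathstart \<gamma> = e \<and> pathfinish \<gamma> = f e \<and>
        (\<forall>t\<in>{0..1}. \<pi> (\<gamma> t) = \<alpha> t))"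
    using f \<gamma> by (intro exI[of _ f] conjI bexI[of _ \<alpha>] exI[of _ \<gamma>] ballI) simp_all
next
  fix f f'
  assume "deck_transformation E \<pi> f \<and>
     (\<exists>\<alpha>\<in>g. \<exists>\<gamma>. path \<gamma> \<and> path_image \<gamma> \<subseteq> E \<and> pathstart \<gamma> = e \<and> pathfinish \<gamma> = f e \<and>
        (\<forall>t\<in>{0..1}. \<pi> (\<gamma> t) = \<alpha> t))"
    and "deck_transformation E \<pi> f' \<and>
     (\<exists>\<alpha>\<in>g. \<exists>\<gamma>. path \<gamma> \<and> path_image \<gamma> \<subseteq> E \<and> pathstart \<gamma> = e \<and> pathfinish \<gamma> = f' e \<and>
        (\<forall>t\<in>{0..1}. \<pi> (\<gamma> t) = \<alpha> t))"
  then obtain \<alpha> \<gamma> \<alpha>' \<gamma>' where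
    f: "deck_transformation E \<pi> f" "\<alpha> \<in> g" "path \<gamma>" "path_image \<gamma> \<subseteq> E" "pathstart \<gamma> = e" "pathfinish \<gamma> = f e"
      "\<forall>t\<in>{0..1}. \<pi> (\<gamma> t) = \<alpha> t"
    and f': "deck_transformation E \<pi> f'" "\<alpha>' \<in> g" "path \<gamma>'" "path_image \<gamma>' \<subseteq> E" "pathstart \<gamma>' = e"
      "pathfinish \<gamma>' = f' e" "\<forall>t\<in>{0..1}. \<pi> (\<gamma>' t) = \<alpha>' t"
    by (elim exE conjE bexE)
  obtain \<beta> where "g = loop_class X \<beta>" using assms by (rule fundamental_group_carrierE)
  then have "homotopic_paths X \<alpha> \<alpha>'"
    using f(2) f'(2) homotopic_paths_trans[OF homotopic_paths_sym] by (auto simp: loop_class_def)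
  then have "pathfinish \<gamma> = pathfinish \<gamma>'"
    by (rule covering_monodromy[OF cov]) (use f f' in simp_all)
  then have "f e = f' e" using f f' by simp
  then show "f = f'" by (rule deck_transformation_unique[OF f(1) f'(1) e])
qed

lemma deck_actionE:
  assumes "g \<in> carrier G"
  obtains \<alpha> \<gamma> where "deck_transformation E \<pi> (deck g)" "g = loop_class X \<alpha>" "\<alpha> \<in> based_loops X (\<pi> e)"
    "path \<gamma>" "path_image \<gamma> \<subseteq> E" "pathstart \<gamma> = e" "pathfinish \<gamma> = deck g e" "\<And>t. t \<in> {0..1} \<Longrightarrow> \<pi> (\<gamma> t) = \<alpha> t"
proof -
  have "deck_transformation E \<pi> (deck g) \<and>
     (\<exists>\<alpha>\<in>g. \<exists>\<gamma>. path \<gamma> \<and> path_image \<gamma> \<subseteq> E \<and> pathstart \<gamma> = e \<and> pathfinish \<gamma> = deck g e \<and>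
        (\<forall>t\<in>{0..1}. \<pi> (\<gamma> t) = \<alpha> t))"
    unfolding deck_action_def by (rule theI'[OF deck_ex1[OF assms]])
  then obtain \<alpha> \<gamma> where a: "deck_transformation E \<pi> (deck g)" "\<alpha> \<in> g" "path \<gamma>" "path_image \<gamma> \<subseteq> E"
      "pathstart \<gamma> = e" "pathfinish \<gamma> = deck g e" "\<forall>t\<in>{0..1}. \<pi> (\<gamma> t) = \<alpha> t"
    by (elim exE conjE bexE)
  obtain \<beta> where b: "\<beta> \<in> based_loops X (\<pi> e)" "g = loop_class X \<beta>"
    using assms by (rule fundamental_group_carrierE)
  then have h: "homotopic_paths X \<beta> \<alpha>" using a(2) by (simp add: loop_class_def)
  then have "\<alpha> \<in> based_loops X (\<pi> e)"
    using b(1) homotopic_paths_imp_path[OF h] homotopic_paths_imp_subset[OF h]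
      homotopic_paths_imp_pathstart[OF h] homotopic_paths_imp_pathfinish[OF h]
    by (auto simp: based_loops_def)
  moreover have "g = loop_class X \<alpha>"
    using h b loop_class_eq_iff[of \<beta> X \<alpha>] by (simp add: based_loops_def)
  ultimately show thesis using a by (intro that[of \<alpha> \<gamma>]) simp_all
qed

lemma deck_transformation_deck: "g \<in> carrier G \<Longrightarrow> deck_transformation E \<pi> (deck g)"
  by (erule deck_actionE)

lemmas deck = deck_transformationD[OF deck_transformation_deck]

text \<open>The action read backwards: any path from \<open>e\<close> to its image under a deck
  transformation projects to a loop whose class acts by that transformation.\<close>

lemma deck_actionI:
  assumes f: "deck_transformation E \<pi> f"
    and \<gamma>: "path \<gamma>" "path_image \<gamma> \<subseteq> E" "pathstart \<gamma> = e" "pathfinish \<gamma> = f e"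
  shows "loop_class X (\<pi> \<circ> \<gamma>) \<in> carrier G" "deck (loop_class X (\<pi> \<circ> \<gamma>)) = f"
proof -
  have l: "\<pi> \<circ> \<gamma> \<in> based_loops X (\<pi> e)"
    using path_proj[OF \<gamma>(1,2)] \<gamma>(3,4) deck_transformationD(4)[OF f e]
    by (simp add: based_loops_def pathstart_compose pathfinish_compose)
  then show c: "loop_class X (\<pi> \<circ> \<gamma>) \<in> carrier G" by (rule fundamental_group_carrierI)
  have "\<pi> \<circ> \<gamma> \<in> loop_class X (\<pi> \<circ> \<gamma>)" using l by (simp add: loop_class_def based_loops_def)
  then show "deck (loop_class X (\<pi> \<circ> \<gamma>)) = f"
    unfolding deck_action_def using f \<gamma>
    by (intro the1_equality[OF deck_ex1[OF c]] conjI bexI[of _ "\<pi> \<circ> \<gamma>"] exI[of _ \<gamma>]) simp_all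
qed

lemma deck_transitive:
  assumes "y \<in> E" "y' \<in> E" "\<pi> y = \<pi> y'"
  obtains g where "g \<in> carrier G" "deck g y = y'"
proof -
  obtain f where f: "deck_transformation E \<pi> f" "f y = y'"
    by (rule deck_transformation_exists[OF assms]) (rule that)
  obtain \<gamma> where \<gamma>: "path \<gamma>" "path_image \<gamma> \<subseteq> E" "pathstart \<gamma> = e" "pathfinish \<gamma> = f e"
    by (rule path_in_E[OF e deck_transformationD(3)[OF f(1) e]]) (rule that)
  show thesis using deck_actionI[OF f(1) \<gamma>] f(2) by (intro that[of "loop_class X (\<pi> \<circ> \<gamma>)"]) auto
qed

lemma loop_class_cong:
  assumes "path \<gamma>" "path_image \<gamma> \<subseteq> X" "\<And>t. t \<in> {0..1} \<Longrightarrow> \<gamma> t = \<delta> t"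
  shows "loop_class X \<gamma> = loop_class X \<delta>"
  using loop_class_eq_iff[OF assms(1,2)] homotopic_paths_eq[OF assms(1,2)] assms(3) by auto

text \<open>The lift from \<open>e\<close> of \<open>\<alpha> +++ \<beta>\<close> is the lift of
  \<alpha> followed by the translate under \<open>deck g\<close> of the lift of \<beta>; its end
  point is \<open>deck g (deck h e)\<close>, and uniqueness of lifts spreads this from
  \<open>e\<close> to all of \<open>E\<close>.\<close>

lemma deck_mult:
  assumes g: "g \<in> carrier G" and h: "h \<in> carrier G"
  shows "g \<otimes>\<^bsub>G\<^esub> h \<in> carrier G" "y \<in> E \<Longrightarrow> deck (g \<otimes>\<^bsub>G\<^esub> h) y = deck g (deck h y)"
proof -
  obtain \<alpha> \<gamma> where G: "deck_transformation E \<pi> (deck g)" "g = loop_class X \<alpha>" "\<alpha> \<in> based_loops X (\<pi> e)"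
    "path \<gamma>" "path_image \<gamma> \<subseteq> E" "pathstart \<gamma> = e" "pathfinish \<gamma> = deck g e" "\<And>t. t \<in> {0..1} \<Longrightarrow> \<pi> (\<gamma> t) = \<alpha> t"
    using g by (rule deck_actionE) (rule that)
  obtain \<beta> \<delta> where H: "deck_transformation E \<pi> (deck h)" "h = loop_class X \<beta>" "\<beta> \<in> based_loops X (\<pi> e)"
    "path \<delta>" "path_image \<delta> \<subseteq> E" "pathstart \<delta> = e" "pathfinish \<delta> = deck h e" "\<And>t. t \<in> {0..1} \<Longrightarrow> \<pi> (\<delta> t) = \<beta> t"
    using h by (rule deck_actionE) (rule that)
  have hE: "deck h e \<in> E" "deck g (deck h e) \<in> E" using deck(3) g h e by auto
  obtain f where f: "deck_transformation E \<pi> f" "f e = deck g (deck h e)"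
    by (rule deck_transformation_exists[OF e hE(2)]) (use deck g h e in auto)
  have feq: "f z = deck g (deck h z)" if "z \<in> E" for z
  proof (rule deck_lift_unique[of f "\<lambda>z. deck g (deck h z)" e z])
    show "continuous_on E (\<lambda>z. deck g (deck h z))"
      by (rule continuous_on_compose2[OF deck(2)[OF g] deck(2)[OF h]]) (use deck(3) h in auto)
  qed (use deck_transformationD[OF f(1)] f(2) deck(3,4) g h e that in auto)
  have D: "path (deck g \<circ> \<delta>)" "path_image (deck g \<circ> \<delta>) \<subseteq> E" "pathstart (deck g \<circ> \<delta>) = deck g e"
      "pathfinish (deck g \<circ> \<delta>) = f e"
    using path_continuous_image[OF H(4) continuous_on_subset[OF deck(2)[OF g] H(5)]] H(5,6,7) deck(3)[OF g] f(2)
    by (auto simp: path_image_compose pathstart_compose pathfinish_compose)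
  let ?\<epsilon> = "\<gamma> +++ (deck g \<circ> \<delta>)"
  have E: "path ?\<epsilon>" "path_image ?\<epsilon> \<subseteq> E" "pathstart ?\<epsilon> = e" "pathfinish ?\<epsilon> = f e"
    using G(4,5,6,7) D subset_path_image_join[OF G(5) D(2)] by simp_all
  have "loop_class X (\<pi> \<circ> ?\<epsilon>) = loop_class X (\<alpha> +++ \<beta>)"
  proof (rule loop_class_cong[OF path_proj[OF E(1,2)]])
    fix t :: real assume t: "t \<in> {0..1}"
    show "(\<pi> \<circ> ?\<epsilon>) t = (\<alpha> +++ \<beta>) t"
    proof (cases "t \<le> 1/2")
      case True then show ?thesis using t G(8) by (simp add: joinpaths_def)
    next
      case False
      then have "2 * t - 1 \<in> {0..1}" using t by auto
      moreover from this have "\<delta> (2 * t - 1) \<in> E" using H(5) unfolding path_image_def by auto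
      ultimately show ?thesis using False H(8) deck(4)[OF g] by (simp add: joinpaths_def)
    qed
  qed
  also have "\<dots> = g \<otimes>\<^bsub>G\<^esub> h"
    unfolding G(2) H(2) using fundamental_group_mult[OF G(3) H(3)] by simp
  finally have eq: "loop_class X (\<pi> \<circ> ?\<epsilon>) = g \<otimes>\<^bsub>G\<^esub> h" .
  show "g \<otimes>\<^bsub>G\<^esub> h \<in> carrier G" using deck_actionI(1)[OF f(1) E] unfolding eq .
  show "deck (g \<otimes>\<^bsub>G\<^esub> h) y = deck g (deck h y)" if "y \<in> E"
    using deck_actionI(2)[OF f(1) E] feq[OF that] unfolding eq by simp
qed

text \<open>Agreement at one point forces equal transformations, so the lifts of the two loops end
  at the same point. They are then homotopic upstairs, and the loops are homotopic
  downstairs.\<close>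

lemma deck_free:
  assumes g: "g \<in> carrier G" and h: "h \<in> carrier G" and y: "y \<in> E" "deck g y = deck h y"
  shows "g = h"
proof -
  have "deck g = deck h"
    by (rule deck_transformation_unique[OF deck_transformation_deck[OF g] deck_transformation_deck[OF h] y])
  obtain \<alpha> \<gamma> where G: "deck_transformation E \<pi> (deck g)" "g = loop_class X \<alpha>" "\<alpha> \<in> based_loops X (\<pi> e)"
    "path \<gamma>" "path_image \<gamma> \<subseteq> E" "pathstart \<gamma> = e" "pathfinish \<gamma> = deck g e" "\<And>t. t \<in> {0..1} \<Longrightarrow> \<pi> (\<gamma> t) = \<alpha> t"
    using g by (rule deck_actionE) (rule that)
  obtain \<beta> \<delta> where H: "deck_transformation E \<pi> (deck h)" "h = loop_class X \<beta>" "\<beta> \<in> based_loops X (\<pi> e)"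
    "path \<delta>" "path_image \<delta> \<subseteq> E" "pathstart \<delta> = e" "pathfinish \<delta> = deck h e" "\<And>t. t \<in> {0..1} \<Longrightarrow> \<pi> (\<delta> t) = \<beta> t"
    using h by (rule deck_actionE) (rule that)
  have "homotopic_paths X (\<pi> \<circ> \<gamma>) (\<pi> \<circ> \<delta>)"
    using G H \<open>deck g = deck h\<close> by (intro homotopic_proj) simp_all
  then have "loop_class X (\<pi> \<circ> \<gamma>) = loop_class X (\<pi> \<circ> \<delta>)"
    using loop_class_eq_iff[OF path_proj[OF G(4,5)]] by blast
  moreover have "loop_class X (\<pi> \<circ> \<gamma>) = g" "loop_class X (\<pi> \<circ> \<delta>) = h"
    unfolding G(2) H(2) using G(8) H(8)
    by (auto intro!: loop_class_cong[OF path_proj[OF G(4,5)]] loop_class_cong[OF path_proj[OF H(4,5)]])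
  ultimately show ?thesis by simp
qed

text \<open>The standard simplex is convex, so paths in it with equal ends are homotopic and the
  hypothesis of the lifting criterion holds for every \<sigma>.\<close>

lemma simplex_lift:
  assumes "singular_simplex n (top_of_set X) \<sigma>"
  obtains \<tau> where "singular_simplex n (top_of_set E) \<tau>" "simplex_map n \<pi> \<tau> = \<sigma>"
proof -
  let ?D = "standard_simplex n"
  have s: "continuous_on ?D \<sigma>" "\<sigma> ` ?D \<subseteq> X" "\<sigma> \<in> extensional ?D"
    using assms by (auto simp: singular_simplex_def euclidean_product_topology)
  obtain v where v: "v \<in> ?D" using nonempty_standard_simplex by blast
  then have "\<sigma> v \<in> \<pi> ` E" using s(2) img by auto
  then obtain y where y: "y \<in> E" "\<sigma> v = \<pi> y" by auto
  have pc: "path_connected ?D"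
    using path_connectedin_standard_simplex[of n] by (simp add: euclidean_product_topology)
  have hom: "homotopic_paths X (\<sigma> \<circ> \<gamma>) (\<sigma> \<circ> \<delta>)"
    if "path \<gamma>" "path_image \<gamma> \<subseteq> ?D" "path \<delta>" "path_image \<delta> \<subseteq> ?D" "pathstart \<gamma> = v" "pathstart \<delta> = v"
      "pathfinish \<gamma> = pathfinish \<delta>" for \<gamma> \<delta>
    by (rule homotopic_paths_continuous_image[OF homotopic_paths_standard_simplex s(1)]) (use s(2) that in auto)
  obtain g where g: "continuous_on ?D g" "g ` ?D \<subseteq> E" "g v = y" "\<And>z. z \<in> ?D \<Longrightarrow> \<pi> (g z) = \<sigma> z"
    by (rule covering_lift_exists[OF cov locally_path_connected_standard_simplex pc s(1,2) v y(1) y(2)[symmetric] hom])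
      (assumption | rule that)+
  have "continuous_on ?D (restrict g ?D)" by (rule continuous_on_eq[OF g(1)]) simp
  then have "singular_simplex n (top_of_set E) (restrict g ?D)"
    using g(2) by (auto simp: singular_simplex_def euclidean_product_topology)
  moreover have "simplex_map n \<pi> (restrict g ?D) = \<sigma>"
    using s(3) g(4) by (intro extensionalityI[of _ ?D]) (auto simp: simplex_map_def)
  ultimately show thesis by (rule that)
qed

lemma deck_simplex:
  assumes g: "g \<in> carrier G" and s: "singular_simplex n (top_of_set E) \<sigma>"
  shows "singular_simplex n (top_of_set E) (simplex_map n (deck g) \<sigma>)"
    and "simplex_map n \<pi> (simplex_map n (deck g) \<sigma>) = simplex_map n \<pi> \<sigma>"
proof -
  show "singular_simplex n (top_of_set E) (simplex_map n (deck g) \<sigma>)"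
    using deck(2,3)[OF g] by (intro singular_simplex_simplex_map[OF s]) auto
  have "\<sigma> z \<in> E" if "z \<in> standard_simplex n" for z
    using s that by (auto simp: singular_simplex_def euclidean_product_topology)
  then show "simplex_map n \<pi> (simplex_map n (deck g) \<sigma>) = simplex_map n \<pi> \<sigma>"
    using deck(4)[OF g] by (auto simp: simplex_map_def fun_eq_iff restrict_def)
qed

text \<open>A group element that matches the two lifts at one point matches them everywhere, since
  lifts on a connected domain are unique.\<close>

lemma simplex_deck_transitive:
  assumes s: "singular_simplex n (top_of_set E) \<sigma>" "singular_simplex n (top_of_set E) \<tau>"
    and eq: "simplex_map n \<pi> \<sigma> = simplex_map n \<pi> \<tau>"
  obtains g where "g \<in> carrier G" "simplex_map n (deck g) \<sigma> = \<tau>"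
proof -
  let ?D = "standard_simplex n"
  have c: "continuous_on ?D \<sigma>" "\<sigma> ` ?D \<subseteq> E" "\<sigma> \<in> extensional ?D" "continuous_on ?D \<tau>" "\<tau> ` ?D \<subseteq> E" "\<tau> \<in> extensional ?D"
    using s by (auto simp: singular_simplex_def euclidean_product_topology)
  have p: "\<pi> (\<sigma> z) = \<pi> (\<tau> z)" if "z \<in> ?D" for z
    using fun_cong[OF eq, of z] that by (simp add: simplex_map_def)
  obtain v where v: "v \<in> ?D" using nonempty_standard_simplex by blast
  then have v': "\<sigma> v \<in> E" "\<tau> v \<in> E" using c by auto
  obtain g where g: "g \<in> carrier G" "deck g (\<sigma> v) = \<tau> v"
    by (rule deck_transitive[OF v' p[OF v]]) (rule that)
  have conn: "connected ?D"
    using connectedin_standard_simplex[of n] by (simp add: euclidean_product_topology)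
  have "deck g (\<sigma> z) = \<tau> z" if "z \<in> ?D" for z
  proof (rule covering_lift_unique[OF cov conn, of "\<lambda>z. deck g (\<sigma> z)" \<tau> v z])
    show "continuous_on ?D (\<lambda>z. deck g (\<sigma> z))"
      by (rule continuous_on_compose2[OF deck(2)[OF g(1)] c(1,2)])
    show "\<pi> (deck g (\<sigma> z)) = \<pi> (\<tau> z)" if "z \<in> ?D" for z
      using deck(4)[OF g(1), of "\<sigma> z"] p[OF that] c(2) that by auto
  qed (use c deck(3)[OF g(1)] g(2) v that in auto)
  then have "simplex_map n (deck g) \<sigma> = \<tau>"
    using c(6) by (intro extensionalityI[of _ ?D]) (auto simp: simplex_map_def)
  then show thesis using g(1) by (intro that[of g])
qed

end

section \<open>Modules, submodules and quotients\<close>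

text \<open>The scalars of the two modules may differ, as they do for
  \<open>m \<mapsto> m \<otimes> n\<close> into a tensor product whose scalars come from another
  action.\<close>

definition additive_map :: "('r, 'm) module \<Rightarrow> ('s, 'n) module \<Rightarrow> ('m \<Rightarrow> 'n) \<Rightarrow> bool" where
  "additive_map M N f \<longleftrightarrow> f \<in> carrier M \<rightarrow> carrier N \<and>
     (\<forall>x\<in>carrier M. \<forall>y\<in>carrier M. f (x \<oplus>\<^bsub>M\<^esub> y) = f x \<oplus>\<^bsub>N\<^esub> f y)"

definition linear_map :: "('r, 'm) module \<Rightarrow> ('r, 'n) module \<Rightarrow> ('m \<Rightarrow> 'n) \<Rightarrow> bool" where
  "linear_map M N f \<longleftrightarrow> additive_map M N f \<and> (\<forall>r. \<forall>x\<in>carrier M. f (r \<odot>\<^bsub>M\<^esub> x) = r \<odot>\<^bsub>N\<^esub> f x)"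

lemma additive_mapD:
  assumes "additive_map M N f"
  shows "x \<in> carrier M \<Longrightarrow> f x \<in> carrier N"
    "x \<in> carrier M \<Longrightarrow> y \<in> carrier M \<Longrightarrow> f (x \<oplus>\<^bsub>M\<^esub> y) = f x \<oplus>\<^bsub>N\<^esub> f y"
  using assms by (auto simp: additive_map_def)

lemma linear_mapD:
  assumes "linear_map M N f"
  shows "additive_map M N f" "x \<in> carrier M \<Longrightarrow> f (r \<odot>\<^bsub>M\<^esub> x) = r \<odot>\<^bsub>N\<^esub> f x"
    "x \<in> carrier M \<Longrightarrow> f x \<in> carrier N"
    "x \<in> carrier M \<Longrightarrow> y \<in> carrier M \<Longrightarrow> f (x \<oplus>\<^bsub>M\<^esub> y) = f x \<oplus>\<^bsub>N\<^esub> f y"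
  using assms by (auto simp: linear_map_def additive_map_def)

lemma additive_map_compose:
  assumes "additive_map M N f" "additive_map N P g"
  shows "additive_map M P (\<lambda>x. g (f x))"
  using assms by (auto simp: additive_map_def Pi_iff)

lemma linear_map_compose:
  assumes "linear_map M N f" "linear_map N P g"
  shows "linear_map M P (\<lambda>x. g (f x))"
  using assms by (auto simp: linear_map_def additive_map_def Pi_iff)

lemma linear_map_id: "linear_map M M id"
  by (auto simp: linear_map_def additive_map_def)

lemma (in abelian_group) add_self_zero:
  assumes x: "x \<in> carrier G" and eq: "x \<oplus> x = x"
  shows "x = \<zero>"
proof -
  have "x = (x \<oplus> x) \<oplus> \<ominus> x" using x by (simp add: a_assoc r_neg)
  also have "\<dots> = \<zero>" unfolding eq using x by (simp add: r_neg)
  finally show ?thesis .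
qed

lemma additive_map_zero:
  assumes "abelian_group M" "abelian_group N" "additive_map M N f"
  shows "f \<zero>\<^bsub>M\<^esub> = \<zero>\<^bsub>N\<^esub>"
proof -
  interpret M: abelian_group M by fact
  interpret N: abelian_group N by fact
  show ?thesis
    using additive_mapD(2)[OF assms(3), of "\<zero>\<^bsub>M\<^esub>" "\<zero>\<^bsub>M\<^esub>"] additive_mapD(1)[OF assms(3), of "\<zero>\<^bsub>M\<^esub>"]
    by (intro N.add_self_zero) simp_all
qed

lemma additive_map_neg:
  assumes "abelian_group M" "abelian_group N" "additive_map M N f" "x \<in> carrier M"
  shows "f (\<ominus>\<^bsub>M\<^esub> x) = \<ominus>\<^bsub>N\<^esub> f x"
proof -
  interpret M: abelian_group M by fact
  interpret N: abelian_group N by fact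
  note f = additive_mapD[OF assms(3)]
  have "f (\<ominus>\<^bsub>M\<^esub> x) \<oplus>\<^bsub>N\<^esub> f x = f (\<ominus>\<^bsub>M\<^esub> x \<oplus>\<^bsub>M\<^esub> x)" using f(2) assms(4) by simp
  also have "\<dots> = \<zero>\<^bsub>N\<^esub>"
    using additive_map_zero[OF assms(1,2,3)] assms(4) M.l_neg by simp
  finally show ?thesis using f(1) assms(4) N.minus_equality[of "f (\<ominus>\<^bsub>M\<^esub> x)" "f x"] by simp
qed

lemma additive_map_finsum:
  assumes "abelian_group M" "abelian_group N" "additive_map M N f" "finite A" "g \<in> A \<rightarrow> carrier M"
  shows "f (finsum M g A) = finsum N (\<lambda>a. f (g a)) A"
  using assms(4,5)
proof (induction A rule: finite_induct)
  case empty
  interpret M: abelian_group M by fact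
  interpret N: abelian_group N by fact
  show ?case using additive_map_zero[OF assms(1,2,3)] by simp
next
  case (insert a A)
  interpret M: abelian_group M by fact
  interpret N: abelian_group N by fact
  note f = additive_mapD[OF assms(3)]
  have g: "g a \<in> carrier M" "g \<in> A \<rightarrow> carrier M" using insert.prems by auto
  moreover from this have "finsum M g A \<in> carrier M" by (intro M.finsum_closed)
  moreover have "(\<lambda>a. f (g a)) \<in> A \<rightarrow> carrier N" using g f(1) by auto
  ultimately show ?case
    using insert.hyps insert.IH f by (simp add: M.finsum_insert N.finsum_insert)
qed

text \<open>Linear extension from a basis, in a module given by a record: the summand at the basis element
  \<open>x\<close> with coefficient \<open>k\<close> is \<open>F x k\<close>.\<close>

lemma (in abelian_group) finsum_keys_superset:
  assumes "finite A" "Poly_Mapping.keys u \<subseteq> A"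
    and "\<And>x. x \<in> A \<Longrightarrow> F x 0 = \<zero>" "\<And>x k. x \<in> A \<Longrightarrow> F x k \<in> carrier G"
  shows "(\<Oplus>x\<in>Poly_Mapping.keys u. F x (Poly_Mapping.lookup u x)) = (\<Oplus>x\<in>A. F x (Poly_Mapping.lookup u x))"
  using assms by (intro add.finprod_mono_neutral_cong_left) (auto simp: in_keys_iff)

text \<open>The support of a sum can be smaller than the union of the supports. All three sums are
  therefore taken over the union, where a zero coefficient contributes zero.\<close>

lemma (in abelian_group) finsum_keys_add:
  assumes S: "Poly_Mapping.keys u \<subseteq> S" "Poly_Mapping.keys v \<subseteq> S"
    and F: "\<And>x k l. x \<in> S \<Longrightarrow> F x (k + l) = F x k \<oplus> F x l" "\<And>x k. x \<in> S \<Longrightarrow> F x k \<in> carrier G"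
  shows "(\<Oplus>x\<in>Poly_Mapping.keys (u + v). F x (Poly_Mapping.lookup (u + v) x)) =
     (\<Oplus>x\<in>Poly_Mapping.keys u. F x (Poly_Mapping.lookup u x)) \<oplus> (\<Oplus>x\<in>Poly_Mapping.keys v. F x (Poly_Mapping.lookup v x))"
proof -
  let ?A = "Poly_Mapping.keys u \<union> Poly_Mapping.keys v"
  have F0: "F x 0 = \<zero>" if "x \<in> ?A" for x
  proof -
    have "x \<in> S" using S that by auto
    then show ?thesis using F(1)[of x 0 0] F(2)[of x 0] by (intro add_self_zero) simp_all
  qed
  have A: "finite ?A" "x \<in> ?A \<Longrightarrow> F x k \<in> carrier G" for x k using S F(2) by auto
  have 1: "(\<Oplus>x\<in>Poly_Mapping.keys (u + v). F x (Poly_Mapping.lookup (u + v) x)) = (\<Oplus>x\<in>?A. F x (Poly_Mapping.lookup (u + v) x))"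
    by (rule finsum_keys_superset[where F = F, OF A(1) keys_add]) (rule F0 A(2), assumption)+
  have 2: "(\<Oplus>x\<in>Poly_Mapping.keys u. F x (Poly_Mapping.lookup u x)) = (\<Oplus>x\<in>?A. F x (Poly_Mapping.lookup u x))"
    by (rule finsum_keys_superset[where F = F, OF A(1)]) (rule Un_upper1 Un_upper2 | rule F0 A(2), assumption)+
  have 3: "(\<Oplus>x\<in>Poly_Mapping.keys v. F x (Poly_Mapping.lookup v x)) = (\<Oplus>x\<in>?A. F x (Poly_Mapping.lookup v x))"
    by (rule finsum_keys_superset[where F = F, OF A(1)]) (rule Un_upper1 Un_upper2 | rule F0 A(2), assumption)+
  have "(\<Oplus>x\<in>?A. F x (Poly_Mapping.lookup (u + v) x)) =
      (\<Oplus>x\<in>?A. F x (Poly_Mapping.lookup u x) \<oplus> F x (Poly_Mapping.lookup v x))"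
    using S F by (intro finsum_cong') (auto simp: lookup_add)
  also have "\<dots> = (\<Oplus>x\<in>?A. F x (Poly_Mapping.lookup u x)) \<oplus> (\<Oplus>x\<in>?A. F x (Poly_Mapping.lookup v x))"
    using S F by (intro finsum_addf) auto
  finally show ?thesis unfolding 1 2 3 .
qed

text \<open>A group with operators: the scalars carry no structure here, which is enough to form
  submodules and quotients.\<close>

locale amod = abelian_group M for M :: "('r, 'm) module" (structure) +
  assumes smult_closed [simp]: "x \<in> carrier M \<Longrightarrow> r \<odot> x \<in> carrier M"
    and smult_add: "x \<in> carrier M \<Longrightarrow> y \<in> carrier M \<Longrightarrow> r \<odot> (x \<oplus> y) = r \<odot> x \<oplus> r \<odot> y"
begin

lemma smult_additive: "additive_map M M (\<lambda>x. r \<odot> x)"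
  using smult_add by (auto simp: additive_map_def)

lemma smult_zero_right [simp]: "r \<odot> \<zero> = \<zero>"
  by (rule additive_map_zero[OF abelian_group_axioms abelian_group_axioms smult_additive])

lemma smult_neg: "x \<in> carrier M \<Longrightarrow> r \<odot> (\<ominus> x) = \<ominus> (r \<odot> x)"
  by (rule additive_map_neg[OF abelian_group_axioms abelian_group_axioms smult_additive])

end

locale kmod = amod M for M :: "('k::comm_ring_1, 'm) module" (structure) +
  assumes add_smult: "x \<in> carrier M \<Longrightarrow> (a + b) \<odot> x = a \<odot> x \<oplus> b \<odot> x"
    and mult_smult: "x \<in> carrier M \<Longrightarrow> (a * b) \<odot> x = a \<odot> (b \<odot> x)"
    and one_smult [simp]: "x \<in> carrier M \<Longrightarrow> 1 \<odot> x = x"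
begin

lemma zero_smult [simp]:
  assumes "x \<in> carrier M"
  shows "0 \<odot> x = \<zero>"
  using add_smult[OF assms, of 0 0] assms by (intro add_self_zero) simp_all

lemma neg_smult:
  assumes "x \<in> carrier M"
  shows "(- a) \<odot> x = \<ominus> (a \<odot> x)"
proof -
  have "(- a) \<odot> x \<oplus> a \<odot> x = \<zero>" using add_smult[OF assms, of "- a" a] assms by simp
  then show ?thesis using assms minus_equality[of "(- a) \<odot> x" "a \<odot> x"] by simp
qed

lemma neg_one_power_twice: "x \<in> carrier M \<Longrightarrow> ((-1) ^ i) \<odot> (((-1) ^ i) \<odot> x) = x"
  using mult_smult[of x "(-1) ^ i" "(-1) ^ i"] by (simp flip: power_add)

end

lemma abelian_group_carrier_update:
  assumes M: "abelian_group M" and Z: "Z \<subseteq> carrier M" "\<zero>\<^bsub>M\<^esub> \<in> Z"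
    "\<And>x y. x \<in> Z \<Longrightarrow> y \<in> Z \<Longrightarrow> x \<oplus>\<^bsub>M\<^esub> y \<in> Z" "\<And>x. x \<in> Z \<Longrightarrow> \<ominus>\<^bsub>M\<^esub> x \<in> Z"
  shows "abelian_group (M\<lparr>carrier := Z\<rparr>)"
proof -
  interpret abelian_group M by fact
  show ?thesis
  proof (rule abelian_groupI)
    show "\<exists>y\<in>carrier (M\<lparr>carrier := Z\<rparr>). y \<oplus>\<^bsub>M\<lparr>carrier := Z\<rparr>\<^esub> x = \<zero>\<^bsub>M\<lparr>carrier := Z\<rparr>\<^esub>"
      if "x \<in> carrier (M\<lparr>carrier := Z\<rparr>)" for x
      using that Z l_neg by (intro bexI[of _ "\<ominus>\<^bsub>M\<^esub> x"]) auto
  qed (use Z in \<open>auto intro!: a_assoc a_comm\<close>)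
qed

locale submodule_of = amod M for M :: "('r, 'm) module" (structure) +
  fixes B assumes sub: "B \<subseteq> carrier M" "\<zero> \<in> B" "x \<in> B \<Longrightarrow> y \<in> B \<Longrightarrow> x \<oplus> y \<in> B" "x \<in> B \<Longrightarrow> \<ominus> x \<in> B"
    "x \<in> B \<Longrightarrow> r \<odot> x \<in> B"
begin

lemma additive_subgroup_axioms': "additive_subgroup B M"
  by (rule additive_subgroup.intro, rule add.subgroupI) (use sub in \<open>auto simp: a_inv_def\<close>)

sublocale abelian_subgroup B M
  by (rule abelian_subgroupI3[OF additive_subgroup_axioms' abelian_group_axioms])

abbreviation "Q \<equiv> quotient_module M B"

lemma coset_eq_iff:
  assumes "x \<in> carrier M" "y \<in> carrier M"
  shows "B +> x = B +> y \<longleftrightarrow> x \<ominus> y \<in> B"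
proof
  assume "B +> x = B +> y"
  then have "x \<in> B +> y" using a_rcos_self[OF assms(1)] by simp
  then show "x \<ominus> y \<in> B" using a_rcos_module assms by (simp add: a_minus_def)
next
  assume "x \<ominus> y \<in> B"
  then have "x \<in> B +> y" using a_rcos_module assms by (simp add: a_minus_def)
  then show "B +> x = B +> y" using a_repr_independence[OF _ assms(2) a_subgroup] by simp
qed

lemma coset_zero: "B +> \<zero> = B"
  by (rule a_coset_join2) (use sub(1,2) a_subgroup in auto)

lemma mem_cosetD: "u \<in> B +> x \<Longrightarrow> x \<in> carrier M \<Longrightarrow> u \<in> carrier M \<and> B +> u = B +> x"
  using a_repr_independence[OF _ _ a_subgroup, of u x] a_elemrcos_carrier[of x u] by simp

lemma quotient_simps:
  "carrier Q = (\<lambda>x. B +> x) ` carrier M" "\<zero>\<^bsub>Q\<^esub> = B" "U \<oplus>\<^bsub>Q\<^esub> V = U <+> V"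
  by (auto simp: quotient_module_def A_RCOSETS_def' )

lemma quotient_add: "x \<in> carrier M \<Longrightarrow> y \<in> carrier M \<Longrightarrow> (B +> x) \<oplus>\<^bsub>Q\<^esub> (B +> y) = B +> (x \<oplus> y)"
  unfolding quotient_simps by (rule a_rcos_sum)

text \<open>Operations on classes are defined as unions over representatives; this evaluates such a
  union once independence of the representative is known.\<close>

lemma union_coset:
  assumes x: "x \<in> carrier M" and c: "\<And>u. u \<in> carrier M \<Longrightarrow> B +> u = B +> x \<Longrightarrow> F u = F x"
  shows "(\<Union>u\<in>B +> x. F u) = F x"
proof -
  have "(\<Union>u\<in>B +> x. F u) = (\<Union>u\<in>B +> x. F x)"
    using c mem_cosetD[OF _ x] by (intro SUP_cong) auto
  also have "\<dots> = F x" using a_rcos_self[OF x] by auto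
  finally show ?thesis .
qed

lemma quotient_smult:
  assumes x: "x \<in> carrier M"
  shows "r \<odot>\<^bsub>Q\<^esub> (B +> x) = B +> (r \<odot> x)"
proof -
  have "(\<Union>u\<in>B +> x. B +> (r \<odot> u)) = B +> (r \<odot> x)"
  proof (rule union_coset[OF x])
    fix u assume u: "u \<in> carrier M" "B +> u = B +> x"
    have "r \<odot> (u \<ominus> x) \<in> B" using u x coset_eq_iff sub(5) by simp
    then show "B +> (r \<odot> u) = B +> (r \<odot> x)"
      using u x coset_eq_iff[of "r \<odot> u" "r \<odot> x"] by (simp add: a_minus_def smult_add smult_neg)
  qed
  then show ?thesis by (simp add: quotient_module_def)
qed

lemma quotient_zero: "\<zero>\<^bsub>Q\<^esub> = B +> \<zero>"
  by (simp add: quotient_simps(2) coset_zero)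

lemma quotient_abelian_group: "abelian_group Q"
proof (rule abelian_groupI)
  have zM: "\<zero> \<in> carrier M" using sub(1,2) by auto
  show "\<zero>\<^bsub>Q\<^esub> \<in> carrier Q"
    unfolding quotient_zero quotient_simps(1) using zM by (rule imageI)
  fix U assume U: "U \<in> carrier Q"
  then obtain x where x: "x \<in> carrier M" "U = B +> x" unfolding quotient_simps(1) by (rule imageE)
  show "\<exists>y\<in>carrier Q. y \<oplus>\<^bsub>Q\<^esub> U = \<zero>\<^bsub>Q\<^esub>"
    using x by (intro bexI[of _ "B +> (\<ominus> x)"]) (simp_all add: quotient_zero quotient_simps(1) quotient_add l_neg)
  show "\<zero>\<^bsub>Q\<^esub> \<oplus>\<^bsub>Q\<^esub> U = U" using x zM by (simp add: quotient_zero quotient_add)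
  fix V assume V: "V \<in> carrier Q"
  then obtain y where y: "y \<in> carrier M" "V = B +> y" unfolding quotient_simps(1) by (rule imageE)
  show "U \<oplus>\<^bsub>Q\<^esub> V \<in> carrier Q" using x y by (simp add: quotient_add quotient_simps(1))
  show "U \<oplus>\<^bsub>Q\<^esub> V = V \<oplus>\<^bsub>Q\<^esub> U" using x y by (simp add: quotient_add a_comm)
  fix W assume W: "W \<in> carrier Q"
  then obtain z where z: "z \<in> carrier M" "W = B +> z" unfolding quotient_simps(1) by (rule imageE)
  show "U \<oplus>\<^bsub>Q\<^esub> V \<oplus>\<^bsub>Q\<^esub> W = U \<oplus>\<^bsub>Q\<^esub> (V \<oplus>\<^bsub>Q\<^esub> W)" using x y z by (simp add: quotient_add a_assoc)
qed

lemma quotient_amod: "amod Q"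
  by (rule amod.intro[OF quotient_abelian_group], unfold_locales)
    (auto simp: quotient_simps(1) quotient_add quotient_smult smult_add)

lemma coset_linear: "linear_map M Q (\<lambda>x. B +> x)"
  by (auto simp: linear_map_def additive_map_def quotient_simps(1) quotient_add quotient_smult)

end

lemma submodule_of_quotient_kmod:
  assumes "submodule_of M B" "kmod M"
  shows "kmod (quotient_module M B)"
proof -
  interpret submodule_of M B by fact
  interpret kmod M by fact
  interpret Q: amod Q by (rule quotient_amod)
  show ?thesis
    by unfold_locales (auto simp: quotient_simps(1) quotient_smult quotient_add add_smult mult_smult)
qed

section \<open>Tensor products and their universal property\<close>

text \<open>\<open>R\<close> is a set of scalars because the group ring of the fundamental group is
  only a part of a type of finitely supported functions.\<close>

locale tensor_pair =
  fixes R :: "'r set" and M :: "('r, 'm) module" and N :: "('r, 'n) module"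
  assumes abM: "abelian_group M" and abN: "abelian_group N"
    and actM: "r \<in> R \<Longrightarrow> m \<in> carrier M \<Longrightarrow> r \<odot>\<^bsub>M\<^esub> m \<in> carrier M"
    and actN: "r \<in> R \<Longrightarrow> n \<in> carrier N \<Longrightarrow> r \<odot>\<^bsub>N\<^esub> n \<in> carrier N"
begin

sublocale M: abelian_group M by (rule abM)

sublocale N: abelian_group N by (rule abN)

abbreviation "S \<equiv> carrier M \<times> carrier N"

abbreviation "K \<equiv> tensor_kernel R M N"

abbreviation "cls \<equiv> tensor_class R M N"

abbreviation "pure \<equiv> tensor_pure R M N"

abbreviation "T act \<equiv> tensor_module act R M N"

lemma relations_keys: "u \<in> tensor_relations R M N \<Longrightarrow> Poly_Mapping.keys u \<subseteq> S"
proof -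
  have d: "Poly_Mapping.keys (frag_of x - y) \<subseteq> S" if "x \<in> S" "Poly_Mapping.keys y \<subseteq> S" for x y
    using keys_diff[of "frag_of x" y] that by auto
  have d2: "Poly_Mapping.keys (frag_of x - y - z) \<subseteq> S"
    if "x \<in> S" "Poly_Mapping.keys y \<subseteq> S" "Poly_Mapping.keys z \<subseteq> S" for x y z
    using keys_diff[of "frag_of x - y" z] d[OF that(1,2)] that by auto
  show "Poly_Mapping.keys u \<subseteq> S" if "u \<in> tensor_relations R M N"
    using that unfolding tensor_relations_def
    by (elim UnE CollectE exE conjE; simp only:) (intro d d2; simp add: actM actN)+
qed

lemma kernel_subgroup: "subgroup K (free_Abelian_group S)"
  unfolding tensor_kernel_def
  by (rule group.generate_is_subgroup[OF group_free_Abelian_group]) (use relations_keys in auto)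

lemma kernel_normal: "K \<lhd> free_Abelian_group S"
  by (rule comm_group.subgroup_imp_normal[OF abelian_free_Abelian_group kernel_subgroup])

lemma kernel_keys: "u \<in> K \<Longrightarrow> Poly_Mapping.keys u \<subseteq> S"
  using subsetD[OF subgroup.subset[OF kernel_subgroup], of u] by simp

lemma kernel_closed: "0 \<in> K" "u \<in> K \<Longrightarrow> v \<in> K \<Longrightarrow> u + v \<in> K" "u \<in> K \<Longrightarrow> - u \<in> K"
  using subgroup.one_closed[OF kernel_subgroup] subgroup.m_closed[OF kernel_subgroup, of u v]
    subgroup.m_inv_closed[OF kernel_subgroup, of u] kernel_keys[of u] by simp_all

lemma kernel_diff: "u \<in> K \<Longrightarrow> v \<in> K \<Longrightarrow> u - v \<in> K"
  using kernel_closed(2)[of u "- v"] kernel_closed(3)[of v] by simp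

lemma relations_kernel: "u \<in> tensor_relations R M N \<Longrightarrow> u \<in> K"
  unfolding tensor_kernel_def by (rule generate.incl)

lemma cls_mem: "v \<in> cls u \<longleftrightarrow> v - u \<in> K"
proof
  assume "v \<in> cls u"
  then show "v - u \<in> K" by (auto simp: tensor_class_def r_coset_def)
next
  assume "v - u \<in> K"
  then show "v \<in> cls u" unfolding tensor_class_def r_coset_def by (auto intro!: bexI[of _ "v - u"])
qed

lemma cls_eqI:
  assumes uv: "u - v \<in> K"
  shows "cls u = cls v"
proof (rule Set.set_eqI)
  fix w
  have "w - u \<in> K \<Longrightarrow> w - v \<in> K" using kernel_closed(2)[OF _ uv, of "w - u"] by simp
  moreover have "w - v \<in> K \<Longrightarrow> w - u \<in> K" using kernel_diff[OF _ uv, of "w - v"] by simp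
  ultimately show "w \<in> cls u \<longleftrightarrow> w \<in> cls v" unfolding cls_mem by blast
qed

lemma T_carrier: "carrier (T act) = cls ` {u. Poly_Mapping.keys u \<subseteq> S}"
  unfolding tensor_module_def tensor_group_def tensor_class_def
  by (simp add: carrier_FactGroup) (simp add: free_Abelian_group_def)

lemma T_zero: "\<zero>\<^bsub>T act\<^esub> = cls 0"
proof -
  have "K = cls 0" by (rule Set.set_eqI) (simp add: cls_mem)
  then show ?thesis by (simp add: tensor_module_def tensor_group_def)
qed

lemma T_add:
  assumes "Poly_Mapping.keys u \<subseteq> S" "Poly_Mapping.keys v \<subseteq> S"
  shows "cls u \<oplus>\<^bsub>T act\<^esub> cls v = cls (u + v)"
  using normal.rcos_sum[OF kernel_normal, of u v] assms
  by (simp add: tensor_module_def tensor_group_def tensor_class_def)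

lemma T_abelian: "abelian_group (T act)"
proof -
  interpret G: comm_group "tensor_group R M N"
    unfolding tensor_group_def
    by (rule comm_group.abelian_FactGroup[OF abelian_free_Abelian_group kernel_subgroup])
  have e: "carrier (T act) = carrier (tensor_group R M N)" "add (T act) = monoid.mult (tensor_group R M N)"
      "\<zero>\<^bsub>T act\<^esub> = \<one>\<^bsub>tensor_group R M N\<^esub>"
    by (simp_all add: tensor_module_def)
  show ?thesis
  proof (rule abelian_groupI; unfold e)
    show "\<exists>y\<in>carrier (tensor_group R M N). y \<otimes>\<^bsub>tensor_group R M N\<^esub> x = \<one>\<^bsub>tensor_group R M N\<^esub>"
      if "x \<in> carrier (tensor_group R M N)" for x
      using G.l_inv[OF that] G.inv_closed[OF that] by blast
  qed (simp_all add: G.m_ac)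
qed

lemma frag_keys: "m \<in> carrier M \<Longrightarrow> n \<in> carrier N \<Longrightarrow> Poly_Mapping.keys (frag_of (m, n)) \<subseteq> S"
  by simp

lemma pure_closed [simp]: "m \<in> carrier M \<Longrightarrow> n \<in> carrier N \<Longrightarrow> pure m n \<in> carrier (T act)"
  unfolding T_carrier tensor_pure_def using frag_keys by blast

lemma pure_add_left:
  assumes "m \<in> carrier M" "m' \<in> carrier M" "n \<in> carrier N"
  shows "pure (m \<oplus>\<^bsub>M\<^esub> m') n = pure m n \<oplus>\<^bsub>T act\<^esub> pure m' n"
proof -
  have "frag_of (m \<oplus>\<^bsub>M\<^esub> m', n) - frag_of (m, n) - frag_of (m', n) \<in> K"
    by (rule relations_kernel) (use assms in \<open>auto simp: tensor_relations_def\<close>)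
  then show ?thesis
    using assms unfolding tensor_pure_def
    by (subst T_add) (auto intro!: cls_eqI simp: algebra_simps)
qed

lemma pure_add_right:
  assumes "m \<in> carrier M" "n \<in> carrier N" "n' \<in> carrier N"
  shows "pure m (n \<oplus>\<^bsub>N\<^esub> n') = pure m n \<oplus>\<^bsub>T act\<^esub> pure m n'"
proof -
  have "frag_of (m, n \<oplus>\<^bsub>N\<^esub> n') - frag_of (m, n) - frag_of (m, n') \<in> K"
    by (rule relations_kernel) (use assms in \<open>auto simp: tensor_relations_def\<close>)
  then show ?thesis
    using assms unfolding tensor_pure_def
    by (subst T_add) (auto intro!: cls_eqI simp: algebra_simps)
qed

lemma pure_balanced:
  assumes "r \<in> R" "m \<in> carrier M" "n \<in> carrier N"
  shows "pure (r \<odot>\<^bsub>M\<^esub> m) n = pure m (r \<odot>\<^bsub>N\<^esub> n)"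
proof -
  have "frag_of (r \<odot>\<^bsub>M\<^esub> m, n) - frag_of (m, r \<odot>\<^bsub>N\<^esub> n) \<in> K"
    by (rule relations_kernel) (use assms in \<open>auto simp: tensor_relations_def\<close>)
  then show ?thesis unfolding tensor_pure_def by (rule cls_eqI)
qed

lemma pure_additive_left: "n \<in> carrier N \<Longrightarrow> additive_map M (T act) (\<lambda>m. pure m n)"
  by (auto simp: additive_map_def pure_add_left)

lemma pure_additive_right: "m \<in> carrier M \<Longrightarrow> additive_map N (T act) (\<lambda>n. pure m n)"
  by (auto simp: additive_map_def pure_add_right)

text \<open>Integer combinations of pure tensors are sums of pure tensors, because a minus sign can
  be moved into the left factor.\<close>

lemma tensor_induct [consumes 1, case_names zero pure add]:
  assumes x: "x \<in> carrier (T act)" and P0: "P \<zero>\<^bsub>T act\<^esub>"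
    and Pp: "\<And>m n. m \<in> carrier M \<Longrightarrow> n \<in> carrier N \<Longrightarrow> P (pure m n)"
    and Pa: "\<And>y z. \<lbrakk>y \<in> carrier (T act); z \<in> carrier (T act); P y; P z\<rbrakk> \<Longrightarrow> P (y \<oplus>\<^bsub>T act\<^esub> z)"
  shows "P x"
proof -
  interpret T: abelian_group "T act" by (rule T_abelian)
  obtain u where u: "x = cls u" "Poly_Mapping.keys u \<subseteq> S" using x unfolding T_carrier by blast
  \<comment> \<open>The induction rule for free abelian groups steps to differences, so the claim is
    carried for an element together with its negative.\<close>
  have "P (cls u) \<and> P (cls (- u))"
  proof (rule free_Abelian_group_induct[OF u(2)], goal_cases)
    case 1
    then show ?case using P0 by (simp add: T_zero)
  next
    case (2 v w)
    have c: "cls v \<in> carrier (T act)" "cls (- v) \<in> carrier (T act)" "cls w \<in> carrier (T act)" "cls (- w) \<in> carrier (T act)"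
      unfolding T_carrier using 2 by auto
    have "cls (v - w) = cls v \<oplus>\<^bsub>T act\<^esub> cls (- w)" "cls (- (v - w)) = cls (- v) \<oplus>\<^bsub>T act\<^esub> cls w"
      using 2 by (simp_all add: T_add)
    then show ?case using 2 c Pa by simp
  next
    case (3 mn)
    obtain m n where mn: "mn = (m, n)" "m \<in> carrier M" "n \<in> carrier N" using 3 by auto
    have z: "cls (- frag_of mn) \<oplus>\<^bsub>T act\<^esub> pure m n = \<zero>\<^bsub>T act\<^esub>"
      unfolding tensor_pure_def mn(1) T_zero using mn by (subst T_add) auto
    have neg: "pure (\<ominus>\<^bsub>M\<^esub> m) n = \<ominus>\<^bsub>T act\<^esub> pure m n"
      by (rule additive_map_neg[OF abM T_abelian pure_additive_left[OF mn(3)] mn(2)])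
    have "cls (- frag_of mn) \<in> carrier (T act)" unfolding T_carrier using 3 by auto
    then have "\<ominus>\<^bsub>T act\<^esub> pure m n = cls (- frag_of mn)"
      using z mn by (intro T.minus_equality) simp_all
    then have "cls (- frag_of mn) = pure (\<ominus>\<^bsub>M\<^esub> m) n" using neg by simp
    moreover have "P (pure m n)" "P (pure (\<ominus>\<^bsub>M\<^esub> m) n)" using mn by (auto intro!: Pp)
    ultimately show ?case by (simp add: tensor_pure_def mn(1))
  qed
  then show ?thesis using u by simp
qed

lemma additive_map_tensor_eq:
  assumes "additive_map (T act) P f" "additive_map (T act) P g" "abelian_group P"
    and "\<And>m n. m \<in> carrier M \<Longrightarrow> n \<in> carrier N \<Longrightarrow> f (pure m n) = g (pure m n)"
    and "x \<in> carrier (T act)"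
  shows "f x = g x"
  using assms(5)
proof (induction x rule: tensor_induct)
  case zero
  show ?case
    by (simp add: additive_map_zero[OF T_abelian assms(3,1)] additive_map_zero[OF T_abelian assms(3,2)])
next
  case (add y z)
  then show ?case by (simp add: additive_mapD(2)[OF assms(1)] additive_mapD(2)[OF assms(2)])
qed (rule assms(4))

lemma hom_kernel:
  assumes P: "abelian_group P"
    and add: "\<And>u v. Poly_Mapping.keys u \<subseteq> S \<Longrightarrow> Poly_Mapping.keys v \<subseteq> S \<Longrightarrow> h (u + v) = h u \<oplus>\<^bsub>P\<^esub> h v"
    and cl: "\<And>u. Poly_Mapping.keys u \<subseteq> S \<Longrightarrow> h u \<in> carrier P"
    and rel: "\<And>u. u \<in> tensor_relations R M N \<Longrightarrow> h u = \<zero>\<^bsub>P\<^esub>"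
    and u: "u \<in> K"
  shows "h u = \<zero>\<^bsub>P\<^esub>"
proof -
  interpret P: abelian_group P by fact
  have h0: "h 0 = \<zero>\<^bsub>P\<^esub>" using add[of 0 0] cl[of 0] by (intro P.add_self_zero) simp_all
  show ?thesis
    using u unfolding tensor_kernel_def
  proof (induction u rule: generate.induct)
    case one show ?case using h0 by simp
  next
    case (incl v) then show ?case by (rule rel)
  next
    case (inv v)
    then have k: "Poly_Mapping.keys v \<subseteq> S" by (rule relations_keys)
    then have "h (- v) \<oplus>\<^bsub>P\<^esub> h v = h (- v + v)" using add[of "- v" v] by simp
    then have "h (- v) = \<zero>\<^bsub>P\<^esub>" using rel[OF inv] h0 cl[of "- v"] k by simp
    then show ?case using k by simp
  next
    case (eng v w)
    then have "Poly_Mapping.keys v \<subseteq> S" "Poly_Mapping.keys w \<subseteq> S"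
      using kernel_keys unfolding tensor_kernel_def by auto
    then show ?case using add[of v w] eng by simp
  qed
qed

text \<open>This is what makes \<open>tensor_lift\<close> and \<open>tensor_map\<close>, both
  defined through representatives, well defined: killing the relations means killing the subgroup
  they generate.\<close>

lemma cls_const:
  assumes P: "abelian_group P"
    and add: "\<And>u v. Poly_Mapping.keys u \<subseteq> S \<Longrightarrow> Poly_Mapping.keys v \<subseteq> S \<Longrightarrow> h (u + v) = h u \<oplus>\<^bsub>P\<^esub> h v"
    and cl: "\<And>u. Poly_Mapping.keys u \<subseteq> S \<Longrightarrow> h u \<in> carrier P"
    and rel: "\<And>u. u \<in> tensor_relations R M N \<Longrightarrow> h u = \<zero>\<^bsub>P\<^esub>"
    and u: "Poly_Mapping.keys u \<subseteq> S" and v: "v \<in> cls u"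
  shows "h v = h u"
proof -
  interpret P: abelian_group P by fact
  have k: "v - u \<in> K" using v by (simp add: cls_mem)
  have "h v = h (v - u + u)" by simp
  also have "\<dots> = h (v - u) \<oplus>\<^bsub>P\<^esub> h u" by (rule add[OF kernel_keys[OF k] u])
  also have "h (v - u) = \<zero>\<^bsub>P\<^esub>" by (rule hom_kernel[OF P add cl rel k])
  finally show ?thesis using cl[OF u] by simp
qed

lemma cls_self: "u \<in> cls u"
  using kernel_closed(1) by (simp add: cls_mem)

text \<open>The universal property. The additive extension of \<open>b\<close> to the free abelian
  group kills the three families of relations, by biadditivity and balance respectively.\<close>

lemma tensor_lift:
  assumes P: "abelian_group P"
    and cl: "\<And>m n. m \<in> carrier M \<Longrightarrow> n \<in> carrier N \<Longrightarrow> b m n \<in> carrier P"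
    and left: "\<And>m m' n. \<lbrakk>m \<in> carrier M; m' \<in> carrier M; n \<in> carrier N\<rbrakk> \<Longrightarrow> b (m \<oplus>\<^bsub>M\<^esub> m') n = b m n \<oplus>\<^bsub>P\<^esub> b m' n"
    and right: "\<And>m n n'. \<lbrakk>m \<in> carrier M; n \<in> carrier N; n' \<in> carrier N\<rbrakk> \<Longrightarrow> b m (n \<oplus>\<^bsub>N\<^esub> n') = b m n \<oplus>\<^bsub>P\<^esub> b m n'"
    and bal: "\<And>r m n. \<lbrakk>r \<in> R; m \<in> carrier M; n \<in> carrier N\<rbrakk> \<Longrightarrow> b (r \<odot>\<^bsub>M\<^esub> m) n = b m (r \<odot>\<^bsub>N\<^esub> n)"
  shows "additive_map (T act) P (tensor_lift P b)"
    and "m \<in> carrier M \<Longrightarrow> n \<in> carrier N \<Longrightarrow> tensor_lift P b (pure m n) = b m n"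
proof -
  interpret P: abelian_group P by fact
  define F where "F k j = [j] \<cdot>\<^bsub>P\<^esub> b (fst k) (snd k)" for k and j :: int
  define h where "h u = (\<Oplus>\<^bsub>P\<^esub>k\<in>Poly_Mapping.keys u. F k (Poly_Mapping.lookup u k))" for u
  have F: "F k j \<in> carrier P" "F k (i + j) = F k i \<oplus>\<^bsub>P\<^esub> F k j" if "k \<in> S" for k i j
    using that cl[of "fst k" "snd k"] P.add.int_pow_mult[of "b (fst k) (snd k)" i j]
    by (auto simp: F_def mem_Times_iff)
  have hcl: "h u \<in> carrier P" if "Poly_Mapping.keys u \<subseteq> S" for u
    unfolding h_def using that F by (intro P.finsum_closed) auto
  have hadd: "h (u + v) = h u \<oplus>\<^bsub>P\<^esub> h v" if "Poly_Mapping.keys u \<subseteq> S" "Poly_Mapping.keys v \<subseteq> S" for u v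
    unfolding h_def by (rule P.finsum_keys_add[OF that]) (use F in auto)
  have hfrag: "h (frag_of (m, n)) = b m n" if "m \<in> carrier M" "n \<in> carrier N" for m n
    using that cl[OF that] by (simp add: h_def F_def P.add.int_pow_1)
  have h0: "h 0 = \<zero>\<^bsub>P\<^esub>" by (simp add: h_def)
  have hneg: "h (- u) = \<ominus>\<^bsub>P\<^esub> h u" if "Poly_Mapping.keys u \<subseteq> S" for u
    using hadd[of "- u" u] hcl[of u] hcl[of "- u"] that h0 P.minus_equality[of "h (- u)" "h u"] by simp
  have hdiff: "h (u - v) = h u \<ominus>\<^bsub>P\<^esub> h v" if "Poly_Mapping.keys u \<subseteq> S" "Poly_Mapping.keys v \<subseteq> S" for u v
    using hadd[of u "- v"] hneg that by (simp add: a_minus_def)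
  have cancel2: "(x \<oplus>\<^bsub>P\<^esub> y) \<ominus>\<^bsub>P\<^esub> x \<ominus>\<^bsub>P\<^esub> y = \<zero>\<^bsub>P\<^esub>" if "x \<in> carrier P" "y \<in> carrier P" for x y
  proof -
    have "(x \<oplus>\<^bsub>P\<^esub> y) \<ominus>\<^bsub>P\<^esub> x \<ominus>\<^bsub>P\<^esub> y = (x \<oplus>\<^bsub>P\<^esub> y) \<oplus>\<^bsub>P\<^esub> \<ominus>\<^bsub>P\<^esub> (x \<oplus>\<^bsub>P\<^esub> y)"
      using that by (simp add: a_minus_def P.a_assoc P.minus_add)
    then show ?thesis using that by (simp add: P.r_neg)
  qed
  have kd: "Poly_Mapping.keys (u - v) \<subseteq> S" if "Poly_Mapping.keys u \<subseteq> S" "Poly_Mapping.keys v \<subseteq> S"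
    for u v :: "'m \<times> 'n \<Rightarrow>\<^sub>0 int" using keys_diff[of u v] that by auto
  have hrel: "h u = \<zero>\<^bsub>P\<^esub>" if "u \<in> tensor_relations R M N" for u
    using that unfolding tensor_relations_def
  proof (elim UnE CollectE exE conjE)
    fix m m' n
    assume u: "u = frag_of (m \<oplus>\<^bsub>M\<^esub> m', n) - frag_of (m, n) - frag_of (m', n)"
      and c: "m \<in> carrier M" "m' \<in> carrier M" "n \<in> carrier N"
    have "h u = h (frag_of (m \<oplus>\<^bsub>M\<^esub> m', n)) \<ominus>\<^bsub>P\<^esub> h (frag_of (m, n)) \<ominus>\<^bsub>P\<^esub> h (frag_of (m', n))"
      unfolding u using c by (subst hdiff hdiff[of "frag_of _" "frag_of _"]; (intro kd)?; simp)+
    then show "h u = \<zero>\<^bsub>P\<^esub>" using c cl by (simp add: hfrag left cancel2)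
  next
    fix m n n'
    assume u: "u = frag_of (m, n \<oplus>\<^bsub>N\<^esub> n') - frag_of (m, n) - frag_of (m, n')"
      and c: "m \<in> carrier M" "n \<in> carrier N" "n' \<in> carrier N"
    have "h u = h (frag_of (m, n \<oplus>\<^bsub>N\<^esub> n')) \<ominus>\<^bsub>P\<^esub> h (frag_of (m, n)) \<ominus>\<^bsub>P\<^esub> h (frag_of (m, n'))"
      unfolding u using c by (subst hdiff hdiff[of "frag_of _" "frag_of _"]; (intro kd)?; simp)+
    then show "h u = \<zero>\<^bsub>P\<^esub>" using c cl by (simp add: hfrag right cancel2)
  next
    fix r m n
    assume u: "u = frag_of (r \<odot>\<^bsub>M\<^esub> m, n) - frag_of (m, r \<odot>\<^bsub>N\<^esub> n)"
      and c: "r \<in> R" "m \<in> carrier M" "n \<in> carrier N"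
    have "h u = h (frag_of (r \<odot>\<^bsub>M\<^esub> m, n)) \<ominus>\<^bsub>P\<^esub> h (frag_of (m, r \<odot>\<^bsub>N\<^esub> n))"
      unfolding u using c by (intro hdiff) (simp_all add: actM actN)
    then show "h u = \<zero>\<^bsub>P\<^esub>" using c cl actM actN by (simp add: hfrag bal a_minus_def P.r_neg)
  qed
  have val: "tensor_lift P b (cls u) = h u" if "Poly_Mapping.keys u \<subseteq> S" for u
  proof -
    have "h v = h u" if "v \<in> cls u" for v
      by (rule cls_const[OF P hadd hcl hrel \<open>Poly_Mapping.keys u \<subseteq> S\<close> that])
    then have "h ` cls u = {h u}" using cls_self[of u] by blast
    then show ?thesis unfolding tensor_lift_def h_def F_def by simp
  qed
  show "additive_map (T act) P (tensor_lift P b)"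
    unfolding additive_map_def
  proof (intro conjI ballI funcsetI)
    fix x assume "x \<in> carrier (T act)"
    then obtain u where u: "x = cls u" "Poly_Mapping.keys u \<subseteq> S" unfolding T_carrier by blast
    then show "tensor_lift P b x \<in> carrier P" by (simp add: val hcl)
    fix y assume "y \<in> carrier (T act)"
    then obtain v where v: "y = cls v" "Poly_Mapping.keys v \<subseteq> S" unfolding T_carrier by blast
    have "Poly_Mapping.keys (u + v) \<subseteq> S" using keys_add[of u v] u v by blast
    then show "tensor_lift P b (x \<oplus>\<^bsub>T act\<^esub> y) = tensor_lift P b x \<oplus>\<^bsub>P\<^esub> tensor_lift P b y"
      using u v by (simp add: T_add val hadd)
  qed
  show "tensor_lift P b (pure m n) = b m n" if "m \<in> carrier M" "n \<in> carrier N"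
    using val[of "frag_of (m, n)"] hfrag[OF that] that by (simp add: tensor_pure_def)
qed

end

text \<open>Compatibility with scalars is formulated in the target tensor product, so that source
  and target may have different rings and \<open>f\<close> and \<open>g\<close> need only be
  additive.\<close>

lemma tensor_map:
  assumes A: "tensor_pair R M N" and B: "tensor_pair R' M' N'"
    and f: "additive_map M M' f" and g: "additive_map N N' g"
    and bal: "\<And>r m n. \<lbrakk>r \<in> R; m \<in> carrier M; n \<in> carrier N\<rbrakk> \<Longrightarrow>
      tensor_pure R' M' N' (f (r \<odot>\<^bsub>M\<^esub> m)) (g n) = tensor_pure R' M' N' (f m) (g (r \<odot>\<^bsub>N\<^esub> n))"
  shows "additive_map (tensor_module act R M N) (tensor_module act' R' M' N') (tensor_map R' M' N' f g)"
    and "m \<in> carrier M \<Longrightarrow> n \<in> carrier N \<Longrightarrow>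
      tensor_map R' M' N' f g (tensor_pure R M N m n) = tensor_pure R' M' N' (f m) (g n)"
proof -
  interpret A: tensor_pair R M N by fact
  interpret B: tensor_pair R' M' N' by fact
  let ?e = "frag_extend (\<lambda>(a, b). frag_of (f a, g b))"
  have ek: "Poly_Mapping.keys (?e u) \<subseteq> B.S" if "Poly_Mapping.keys u \<subseteq> A.S" for u
  proof -
    have "Poly_Mapping.keys (?e u) \<subseteq> (\<Union>x\<in>Poly_Mapping.keys u. Poly_Mapping.keys ((\<lambda>(a, b). frag_of (f a, g b)) x))"
      by (rule keys_frag_extend)
    also have "\<dots> \<subseteq> B.S" using that additive_mapD(1)[OF f] additive_mapD(1)[OF g] by auto
    finally show ?thesis .
  qed
  define h where "h u = B.cls (?e u)" for u
  interpret P: abelian_group "B.T act'" by (rule B.T_abelian)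
  have hcl: "h u \<in> carrier (B.T act')" if "Poly_Mapping.keys u \<subseteq> A.S" for u
    unfolding h_def B.T_carrier using ek[OF that] by blast
  have hadd: "h (u + v) = h u \<oplus>\<^bsub>B.T act'\<^esub> h v" if "Poly_Mapping.keys u \<subseteq> A.S" "Poly_Mapping.keys v \<subseteq> A.S" for u v
    unfolding h_def using ek that by (simp add: frag_extend_add B.T_add)
  have hrel: "h u = \<zero>\<^bsub>B.T act'\<^esub>" if "u \<in> tensor_relations R M N" for u
    using that unfolding tensor_relations_def
  proof (elim UnE CollectE exE conjE)
    fix m m' n
    assume u: "u = frag_of (m \<oplus>\<^bsub>M\<^esub> m', n) - frag_of (m, n) - frag_of (m', n)"
      and c: "m \<in> carrier M" "m' \<in> carrier M" "n \<in> carrier N"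
    have "?e u = frag_of (f m \<oplus>\<^bsub>M'\<^esub> f m', g n) - frag_of (f m, g n) - frag_of (f m', g n)"
      using c additive_mapD(2)[OF f] unfolding u by (simp add: frag_extend_diff)
    also have "\<dots> \<in> tensor_relations R' M' N'"
      using c additive_mapD(1)[OF f] additive_mapD(1)[OF g] unfolding tensor_relations_def by blast
    finally show "h u = \<zero>\<^bsub>B.T act'\<^esub>" unfolding h_def B.T_zero by (intro B.cls_eqI) (simp add: B.relations_kernel)
  next
    fix m n n'
    assume u: "u = frag_of (m, n \<oplus>\<^bsub>N\<^esub> n') - frag_of (m, n) - frag_of (m, n')"
      and c: "m \<in> carrier M" "n \<in> carrier N" "n' \<in> carrier N"
    have "?e u = frag_of (f m, g n \<oplus>\<^bsub>N'\<^esub> g n') - frag_of (f m, g n) - frag_of (f m, g n')"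
      using c additive_mapD(2)[OF g] unfolding u by (simp add: frag_extend_diff)
    also have "\<dots> \<in> tensor_relations R' M' N'"
      using c additive_mapD(1)[OF f] additive_mapD(1)[OF g] unfolding tensor_relations_def by blast
    finally show "h u = \<zero>\<^bsub>B.T act'\<^esub>" unfolding h_def B.T_zero by (intro B.cls_eqI) (simp add: B.relations_kernel)
  next
    fix r m n
    assume u: "u = frag_of (r \<odot>\<^bsub>M\<^esub> m, n) - frag_of (m, r \<odot>\<^bsub>N\<^esub> n)"
      and c: "r \<in> R" "m \<in> carrier M" "n \<in> carrier N"
    have e: "?e u = frag_of (f (r \<odot>\<^bsub>M\<^esub> m), g n) - frag_of (f m, g (r \<odot>\<^bsub>N\<^esub> n))"
      unfolding u by (simp add: frag_extend_diff)
    have "frag_of (f (r \<odot>\<^bsub>M\<^esub> m), g n) \<in> B.cls (frag_of (f m, g (r \<odot>\<^bsub>N\<^esub> n)))"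
      using bal[OF c] B.cls_self unfolding tensor_pure_def by blast
    then show "h u = \<zero>\<^bsub>B.T act'\<^esub>"
      unfolding h_def B.T_zero e by (intro B.cls_eqI) (simp add: B.cls_mem)
  qed
  have val: "tensor_map R' M' N' f g (A.cls u) = h u" if "Poly_Mapping.keys u \<subseteq> A.S" for u
  proof -
    have "h v = h u" if "v \<in> A.cls u" for v
      by (rule A.cls_const[OF B.T_abelian hadd hcl hrel \<open>Poly_Mapping.keys u \<subseteq> A.S\<close> that])
    then have "(\<Union>v\<in>A.cls u. h v) = (\<Union>v\<in>A.cls u. h u)" by (intro SUP_cong) auto
    also have "\<dots> = h u" using A.cls_self[of u] by auto
    finally show ?thesis unfolding tensor_map_def h_def .
  qed
  show "additive_map (A.T act) (B.T act') (tensor_map R' M' N' f g)"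
    unfolding additive_map_def
  proof (intro conjI ballI funcsetI)
    fix x assume "x \<in> carrier (A.T act)"
    then obtain u where u: "x = A.cls u" "Poly_Mapping.keys u \<subseteq> A.S" unfolding A.T_carrier by blast
    then show "tensor_map R' M' N' f g x \<in> carrier (B.T act')" by (simp add: val hcl)
    fix y assume "y \<in> carrier (A.T act)"
    then obtain v where v: "y = A.cls v" "Poly_Mapping.keys v \<subseteq> A.S" unfolding A.T_carrier by blast
    have "Poly_Mapping.keys (u + v) \<subseteq> A.S" using keys_add[of u v] u v by blast
    then show "tensor_map R' M' N' f g (x \<oplus>\<^bsub>A.T act\<^esub> y) =
        tensor_map R' M' N' f g x \<oplus>\<^bsub>B.T act'\<^esub> tensor_map R' M' N' f g y"
      using u v by (simp add: A.T_add val hadd)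
  qed
  show "tensor_map R' M' N' f g (A.pure m n) = B.pure (f m) (g n)" if "m \<in> carrier M" "n \<in> carrier N"
    using val[of "frag_of (m, n)"] that by (simp add: tensor_pure_def h_def)
qed

text \<open>By additivity the module laws can be verified on pure tensors, where they are the laws
  of \<open>act\<close>. For twisted chains \<open>act\<close> is left multiplication in the group
  algebra, which commutes with the right action.\<close>

lemma (in tensor_pair) tensor_module_kmod:
  fixes act :: "'s::comm_ring_1 \<Rightarrow> 'm \<Rightarrow> 'm"
  assumes add: "\<And>s. additive_map M M (act s)"
    and comm: "\<And>s r m. r \<in> R \<Longrightarrow> m \<in> carrier M \<Longrightarrow> act s (r \<odot>\<^bsub>M\<^esub> m) = r \<odot>\<^bsub>M\<^esub> act s m"
    and plus: "\<And>s t m. m \<in> carrier M \<Longrightarrow> act (s + t) m = act s m \<oplus>\<^bsub>M\<^esub> act t m"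
    and times: "\<And>s t m. m \<in> carrier M \<Longrightarrow> act (s * t) m = act s (act t m)"
    and one: "\<And>m. m \<in> carrier M \<Longrightarrow> act 1 m = m"
  shows "kmod (T act)"
    and "m \<in> carrier M \<Longrightarrow> n \<in> carrier N \<Longrightarrow> s \<odot>\<^bsub>T act\<^esub> pure m n = pure (act s m) n"
proof -
  interpret T: abelian_group "T act" by (rule T_abelian)
  have sm: "s \<odot>\<^bsub>T act\<^esub> x = tensor_map R M N (act s) id x" for s x
    by (simp add: tensor_module_def)
  have idN: "additive_map N N id" by (simp add: additive_map_def)
  have acl: "m \<in> carrier M \<Longrightarrow> act s m \<in> carrier M" for s m by (rule additive_mapD(1)[OF add])
  have bal: "pure (act s (r \<odot>\<^bsub>M\<^esub> m)) (id n) = pure (act s m) (id (r \<odot>\<^bsub>N\<^esub> n))"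
    if "r \<in> R" "m \<in> carrier M" "n \<in> carrier N" for s r m n
    using that by (simp add: comm pure_balanced acl)
  have smadd: "additive_map (T act) (T act) (\<lambda>x. s \<odot>\<^bsub>T act\<^esub> x)" for s
    unfolding sm by (rule tensor_map(1)[OF tensor_pair_axioms tensor_pair_axioms add idN]) (rule bal)
  show pure: "s \<odot>\<^bsub>T act\<^esub> pure m n = pure (act s m) n" if "m \<in> carrier M" "n \<in> carrier N" for s m n
    unfolding sm
    by (subst tensor_map(2)[OF tensor_pair_axioms tensor_pair_axioms add idN _ that]) (erule (2) bal, simp)
  have scl: "s \<odot>\<^bsub>T act\<^esub> x \<in> carrier (T act)" if "x \<in> carrier (T act)" for s x
    by (rule additive_mapD(1)[OF smadd that])
  show "kmod (T act)"
  proof unfold_locales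
    fix x s t assume x: "x \<in> carrier (T act)"
    show "s \<odot>\<^bsub>T act\<^esub> x \<in> carrier (T act)" by (rule scl[OF x])
    show "s \<odot>\<^bsub>T act\<^esub> (x \<oplus>\<^bsub>T act\<^esub> y) = s \<odot>\<^bsub>T act\<^esub> x \<oplus>\<^bsub>T act\<^esub> s \<odot>\<^bsub>T act\<^esub> y" if "y \<in> carrier (T act)" for y
      by (rule additive_mapD(2)[OF smadd x that])
    show "(s + t) \<odot>\<^bsub>T act\<^esub> x = s \<odot>\<^bsub>T act\<^esub> x \<oplus>\<^bsub>T act\<^esub> t \<odot>\<^bsub>T act\<^esub> x"
    proof (rule additive_map_tensor_eq[OF smadd _ T_abelian _ x])
      show "additive_map (T act) (T act) (\<lambda>x. s \<odot>\<^bsub>T act\<^esub> x \<oplus>\<^bsub>T act\<^esub> t \<odot>\<^bsub>T act\<^esub> x)"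
        using scl additive_mapD(2)[OF smadd] by (auto simp: additive_map_def T.a_ac)
    qed (use acl in \<open>simp add: pure plus pure_add_left\<close>)
    show "(s * t) \<odot>\<^bsub>T act\<^esub> x = s \<odot>\<^bsub>T act\<^esub> (t \<odot>\<^bsub>T act\<^esub> x)"
      by (rule additive_map_tensor_eq[OF smadd additive_map_compose[OF smadd smadd] T_abelian _ x])
        (use acl in \<open>simp add: pure times\<close>)
    show "1 \<odot>\<^bsub>T act\<^esub> x = x"
    proof (rule additive_map_tensor_eq[OF smadd _ T_abelian _ x])
      show "additive_map (T act) (T act) (\<lambda>x. x)" by (simp add: additive_map_def)
    qed (use acl in \<open>simp add: pure one\<close>)
  qed
qed

lemma kmod_tensor_pair:
  assumes "kmod M" "kmod N"
  shows "tensor_pair UNIV M N"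
proof -
  interpret M: kmod M by fact
  interpret N: kmod N by fact
  show ?thesis by unfold_locales auto
qed

lemma ctensor_kmod:
  assumes M: "kmod M" and N: "kmod N"
  shows "kmod (ctensor M N)"
    and "m \<in> carrier M \<Longrightarrow> n \<in> carrier N \<Longrightarrow>
      s \<odot>\<^bsub>ctensor M N\<^esub> tensor_pure UNIV M N m n = tensor_pure UNIV M N (s \<odot>\<^bsub>M\<^esub> m) n"
proof -
  interpret M: kmod M by fact
  interpret N: kmod N by fact
  interpret tensor_pair UNIV M N by (rule kmod_tensor_pair[OF M N])
  have comm: "s \<odot>\<^bsub>M\<^esub> (r \<odot>\<^bsub>M\<^esub> m) = r \<odot>\<^bsub>M\<^esub> (s \<odot>\<^bsub>M\<^esub> m)" if "m \<in> carrier M" for s r m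
    using that by (simp flip: M.mult_smult add: mult.commute)
  show "kmod (ctensor M N)"
    by (rule tensor_module_kmod(1)) (auto simp: M.smult_additive M.add_smult M.mult_smult comm)
  show "m \<in> carrier M \<Longrightarrow> n \<in> carrier N \<Longrightarrow>
      s \<odot>\<^bsub>ctensor M N\<^esub> tensor_pure UNIV M N m n = tensor_pure UNIV M N (s \<odot>\<^bsub>M\<^esub> m) n"
    by (rule tensor_module_kmod(2)) (auto simp: M.smult_additive M.add_smult M.mult_smult comm)
qed

lemma ctensor_map:
  assumes M: "kmod M" and N: "kmod N" and M': "kmod M'" and N': "kmod N'"
    and f: "linear_map M M' f" and g: "linear_map N N' g"
  shows "linear_map (ctensor M N) (ctensor M' N') (tensor_map UNIV M' N' f g)"
    and "m \<in> carrier M \<Longrightarrow> n \<in> carrier N \<Longrightarrow>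
      tensor_map UNIV M' N' f g (tensor_pure UNIV M N m n) = tensor_pure UNIV M' N' (f m) (g n)"
proof -
  interpret M: kmod M by fact
  interpret N: kmod N by fact
  interpret A: tensor_pair UNIV M N by (rule kmod_tensor_pair[OF M N])
  interpret B: tensor_pair UNIV M' N' by (rule kmod_tensor_pair[OF M' N'])
  interpret T: kmod "ctensor M N" by (rule ctensor_kmod[OF M N])
  interpret T': kmod "ctensor M' N'" by (rule ctensor_kmod[OF M' N'])
  have bal: "B.pure (f (r \<odot>\<^bsub>M\<^esub> m)) (g n) = B.pure (f m) (g (r \<odot>\<^bsub>N\<^esub> n))"
    if "m \<in> carrier M" "n \<in> carrier N" for r m n
    using that linear_mapD[OF f] linear_mapD[OF g] by (simp add: B.pure_balanced)
  note tm = tensor_map[OF A.tensor_pair_axioms B.tensor_pair_axioms linear_mapD(1)[OF f] linear_mapD(1)[OF g]]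
  show pure: "tensor_map UNIV M' N' f g (A.pure m n) = B.pure (f m) (g n)"
    if "m \<in> carrier M" "n \<in> carrier N" for m n
    by (rule tm(2)[OF _ that]) (rule bal)
  have add: "additive_map (ctensor M N) (ctensor M' N') (tensor_map UNIV M' N' f g)"
    by (rule tm(1)) (rule bal)
  show "linear_map (ctensor M N) (ctensor M' N') (tensor_map UNIV M' N' f g)"
    unfolding linear_map_def
  proof (intro conjI allI ballI add)
    fix r x assume x: "x \<in> carrier (ctensor M N)"
    show "tensor_map UNIV M' N' f g (r \<odot>\<^bsub>ctensor M N\<^esub> x) = r \<odot>\<^bsub>ctensor M' N'\<^esub> tensor_map UNIV M' N' f g x"
      by (rule A.additive_map_tensor_eq[OF additive_map_compose[OF T.smult_additive add]
            additive_map_compose[OF add T'.smult_additive] B.T_abelian _ x])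
        (use linear_mapD[OF f] linear_mapD[OF g] in \<open>simp add: ctensor_kmod(2)[OF M N] ctensor_kmod(2)[OF M' N'] pure\<close>)
  qed
qed

lemma ctensor_lift:
  assumes M: "kmod M" and N: "kmod N" and P: "kmod P"
    and cl: "\<And>m n. m \<in> carrier M \<Longrightarrow> n \<in> carrier N \<Longrightarrow> b m n \<in> carrier P"
    and left: "\<And>n. n \<in> carrier N \<Longrightarrow> linear_map M P (\<lambda>m. b m n)"
    and right: "\<And>m. m \<in> carrier M \<Longrightarrow> linear_map N P (b m)"
  shows "linear_map (ctensor M N) P (tensor_lift P b)"
    and "m \<in> carrier M \<Longrightarrow> n \<in> carrier N \<Longrightarrow> tensor_lift P b (tensor_pure UNIV M N m n) = b m n"
proof -
  interpret M: kmod M by fact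
  interpret N: kmod N by fact
  interpret P: kmod P by fact
  interpret A: tensor_pair UNIV M N by (rule kmod_tensor_pair[OF M N])
  interpret T: kmod "ctensor M N" by (rule ctensor_kmod[OF M N])
  have l: "b (m \<oplus>\<^bsub>M\<^esub> m') n = b m n \<oplus>\<^bsub>P\<^esub> b m' n" if "m \<in> carrier M" "m' \<in> carrier M" "n \<in> carrier N" for m m' n
    using linear_mapD(4)[OF left[OF that(3)] that(1,2)] .
  have r: "b m (n \<oplus>\<^bsub>N\<^esub> n') = b m n \<oplus>\<^bsub>P\<^esub> b m n'" if "m \<in> carrier M" "n \<in> carrier N" "n' \<in> carrier N" for m n n'
    using linear_mapD(4)[OF right[OF that(1)] that(2,3)] .
  have ba: "b (k \<odot>\<^bsub>M\<^esub> m) n = b m (k \<odot>\<^bsub>N\<^esub> n)" if "m \<in> carrier M" "n \<in> carrier N" for k m n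
    using linear_mapD(2)[OF left[OF that(2)] that(1)] linear_mapD(2)[OF right[OF that(1)] that(2)] by simp
  note tl = A.tensor_lift[of P b, OF P.abelian_group_axioms]
  have add: "additive_map (ctensor M N) P (tensor_lift P b)"
    by (rule tl(1)) (rule cl l r ba; assumption)+
  show pure: "tensor_lift P b (A.pure m n) = b m n" if "m \<in> carrier M" "n \<in> carrier N" for m n
    by (rule tl(2)[OF _ _ _ _ that]) (rule cl l r ba; assumption)+
  show "linear_map (ctensor M N) P (tensor_lift P b)"
    unfolding linear_map_def
  proof (intro conjI allI ballI add)
    fix k x assume x: "x \<in> carrier (ctensor M N)"
    show "tensor_lift P b (k \<odot>\<^bsub>ctensor M N\<^esub> x) = k \<odot>\<^bsub>P\<^esub> tensor_lift P b x"
      by (rule A.additive_map_tensor_eq[OF additive_map_compose[OF T.smult_additive add]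
            additive_map_compose[OF add P.smult_additive] P.abelian_group_axioms _ x])
        (use linear_mapD(2)[OF left] in \<open>simp add: ctensor_kmod(2)[OF M N] pure\<close>)
  qed
qed

section \<open>Direct sums\<close>

lemma direct_sum_simps:
  "carrier (direct_sum I M) = (\<Pi>\<^sub>E i\<in>I. carrier (M i))" "\<zero>\<^bsub>direct_sum I M\<^esub> = (\<lambda>i\<in>I. \<zero>\<^bsub>M i\<^esub>)"
  "x \<oplus>\<^bsub>direct_sum I M\<^esub> y = (\<lambda>i\<in>I. x i \<oplus>\<^bsub>M i\<^esub> y i)" "r \<odot>\<^bsub>direct_sum I M\<^esub> x = (\<lambda>i\<in>I. r \<odot>\<^bsub>M i\<^esub> x i)"
  by (simp_all add: direct_sum_def)

lemma direct_sum_kmod: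
  assumes M: "\<And>i. i \<in> I \<Longrightarrow> kmod (M i)"
  shows "kmod (direct_sum I M)"
proof -
  have ab: "abelian_group (M i)" if "i \<in> I" for i
    using M[OF that] by (simp add: kmod_def amod_def)
  note ag = abelian_groupE[OF ab]
  have "abelian_group (direct_sum I M)"
  proof (rule abelian_groupI)
    fix x assume x: "x \<in> carrier (direct_sum I M)"
    have inv: "\<exists>y\<in>carrier (M i). y \<oplus>\<^bsub>M i\<^esub> x i = \<zero>\<^bsub>M i\<^esub>" if "i \<in> I" for i
      using x that by (intro ag(6)) (auto simp: direct_sum_simps)
    define y where "y = (\<lambda>i\<in>I. SOME y. y \<in> carrier (M i) \<and> y \<oplus>\<^bsub>M i\<^esub> x i = \<zero>\<^bsub>M i\<^esub>)"
    have "y i \<in> carrier (M i) \<and> y i \<oplus>\<^bsub>M i\<^esub> x i = \<zero>\<^bsub>M i\<^esub>" if "i \<in> I" for i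
      using someI_ex[OF inv[OF that, unfolded Bex_def]] that by (simp add: y_def)
    then show "\<exists>y\<in>carrier (direct_sum I M). y \<oplus>\<^bsub>direct_sum I M\<^esub> x = \<zero>\<^bsub>direct_sum I M\<^esub>"
      by (intro bexI[of _ y]) (auto simp: direct_sum_simps y_def intro: restrict_ext)
    show "x \<oplus>\<^bsub>direct_sum I M\<^esub> y = y \<oplus>\<^bsub>direct_sum I M\<^esub> x" if "y \<in> carrier (direct_sum I M)" for y
      using x that by (auto simp: direct_sum_simps intro!: restrict_ext ag(4))
  qed (auto simp: direct_sum_simps PiE_iff extensional_def ag(1,2,3,5) intro!: ext)
  then interpret abelian_group "direct_sum I M" .
  have km: "amod (M i)" "kmod_axioms (M i)" if "i \<in> I" for i using M[OF that] by (auto simp: kmod_def)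
  show ?thesis
  proof unfold_locales
    fix x r assume x: "x \<in> carrier (direct_sum I M)"
    then have xi: "x i \<in> carrier (M i)" if "i \<in> I" for i using that by (auto simp: direct_sum_simps)
    have x_eq: "x = (\<lambda>i\<in>I. x i)" using x by (auto simp: direct_sum_simps)
    show "r \<odot>\<^bsub>direct_sum I M\<^esub> x \<in> carrier (direct_sum I M)"
      using xi amod.smult_closed[OF km(1)] by (auto simp: direct_sum_simps)
    show "r \<odot>\<^bsub>direct_sum I M\<^esub> (x \<oplus>\<^bsub>direct_sum I M\<^esub> y) =
        r \<odot>\<^bsub>direct_sum I M\<^esub> x \<oplus>\<^bsub>direct_sum I M\<^esub> r \<odot>\<^bsub>direct_sum I M\<^esub> y"
      if "y \<in> carrier (direct_sum I M)" for y
      using xi that amod.smult_add[OF km(1)] by (auto simp: direct_sum_simps PiE_iff intro!: restrict_ext)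
    fix a b
    show "(a + b) \<odot>\<^bsub>direct_sum I M\<^esub> x = a \<odot>\<^bsub>direct_sum I M\<^esub> x \<oplus>\<^bsub>direct_sum I M\<^esub> b \<odot>\<^bsub>direct_sum I M\<^esub> x"
      using xi kmod.add_smult[OF M] by (auto simp: direct_sum_simps PiE_iff intro!: restrict_ext)
    show "(a * b) \<odot>\<^bsub>direct_sum I M\<^esub> x = a \<odot>\<^bsub>direct_sum I M\<^esub> (b \<odot>\<^bsub>direct_sum I M\<^esub> x)"
      using xi kmod.mult_smult[OF M] by (auto simp: direct_sum_simps PiE_iff intro!: restrict_ext)
    show "1 \<odot>\<^bsub>direct_sum I M\<^esub> x = x"
      using xi kmod.one_smult[OF M] by (subst (2) x_eq) (auto simp: direct_sum_simps PiE_iff intro!: restrict_ext)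
  qed
qed

definition summand :: "'i set \<Rightarrow> ('i \<Rightarrow> ('r, 'm) module) \<Rightarrow> 'i \<Rightarrow> 'm \<Rightarrow> 'i \<Rightarrow> 'm" where
  "summand I M i x = (\<lambda>j\<in>I. if j = i then x else \<zero>\<^bsub>M j\<^esub>)"

lemma summand_linear:
  assumes M: "\<And>i. i \<in> I \<Longrightarrow> kmod (M i)" and i: "i \<in> I"
  shows "linear_map (M i) (direct_sum I M) (summand I M i)"
proof -
  have ab: "abelian_group (M i)" if "i \<in> I" for i
    using M[OF that] by (simp add: kmod_def amod_def)
  have am: "amod (M i)" if "i \<in> I" for i using M[OF that] by (simp add: kmod_def)
  show ?thesis
    unfolding linear_map_def additive_map_def summand_def
    using abelian_groupE(2,5)[OF ab] amod.smult_zero_right[OF am] i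
    by (auto simp: direct_sum_simps PiE_iff intro!: restrict_ext)
qed

lemma proj_additive:
  "i \<in> I \<Longrightarrow> additive_map (direct_sum I M) (M i) (\<lambda>x. x i)"
  by (auto simp: additive_map_def direct_sum_simps)

lemma direct_sum_decompose:
  assumes M: "\<And>i. i \<in> I \<Longrightarrow> kmod (M i)" and I: "finite I" and x: "x \<in> carrier (direct_sum I M)"
  shows "x = (\<Oplus>\<^bsub>direct_sum I M\<^esub>i\<in>I. summand I M i (x i))"
proof -
  interpret S: kmod "direct_sum I M" by (rule direct_sum_kmod) (rule M)
  have xi: "x i \<in> carrier (M i)" if "i \<in> I" for i using x that by (auto simp: direct_sum_simps)
  have cl: "(\<lambda>i. summand I M i (x i)) \<in> I \<rightarrow> carrier (direct_sum I M)"
    by (intro funcsetI linear_mapD(3)[OF summand_linear] M xi)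
  then have fs: "(\<Oplus>\<^bsub>direct_sum I M\<^esub>i\<in>I. summand I M i (x i)) \<in> carrier (direct_sum I M)"
    by (rule S.finsum_closed)
  show ?thesis
  proof (rule extensionalityI[of _ I])
    show "x \<in> extensional I" "(\<Oplus>\<^bsub>direct_sum I M\<^esub>i\<in>I. summand I M i (x i)) \<in> extensional I"
      using x fs by (auto simp: direct_sum_simps PiE_def)
    fix j assume j: "j \<in> I"
    interpret Mj: kmod "M j" by (rule M[OF j])
    have "(\<Oplus>\<^bsub>direct_sum I M\<^esub>i\<in>I. summand I M i (x i)) j = (\<Oplus>\<^bsub>M j\<^esub>i\<in>I. summand I M i (x i) j)"
      by (rule additive_map_finsum[OF S.abelian_group_axioms Mj.abelian_group_axioms proj_additive[OF j] I cl])
    also have "\<dots> = (\<Oplus>\<^bsub>M j\<^esub>i\<in>I. if j = i then x j else \<zero>\<^bsub>M j\<^esub>)"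
      using xi[OF j] j by (intro Mj.finsum_cong') (auto simp: summand_def)
    also have "\<dots> = x j"
      using Mj.add.finprod_singleton[OF j I, of "\<lambda>_. x j"] xi[OF j] by simp
    finally show "x j = (\<Oplus>\<^bsub>direct_sum I M\<^esub>i\<in>I. summand I M i (x i)) j" by simp
  qed
qed

section \<open>Chain complexes and their homology\<close>

text \<open>Differentials are constrained in positive degrees only: \<open>complex_cycles\<close>
  counts all of degree 0 as cycles.\<close>

locale kcomplex =
  fixes C :: "nat \<Rightarrow> ('k::comm_ring_1, 'm) module" and d :: "nat \<Rightarrow> 'm \<Rightarrow> 'm"
  assumes km: "kmod (C n)"
    and lin: "linear_map (C (Suc n)) (C n) (d (Suc n))"
    and dd: "x \<in> carrier (C (Suc (Suc n))) \<Longrightarrow> d (Suc n) (d (Suc (Suc n)) x) = \<zero>\<^bsub>C n\<^esub>"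
begin

abbreviation "Z n \<equiv> complex_cycles C d n"

abbreviation "Bd n \<equiv> complex_boundaries C d n"

abbreviation "H n \<equiv> complex_homology C d n"

abbreviation "Zmod n \<equiv> C n\<lparr>carrier := Z n\<rparr>"

abbreviation "cl n \<equiv> complex_class C d n"

lemma abC: "abelian_group (C n)" and amC: "amod (C n)"
  using km[of n] by (simp_all add: kmod_def amod_def)

lemma cycleD: "x \<in> Z n \<Longrightarrow> x \<in> carrier (C n)" "x \<in> Z (Suc n) \<Longrightarrow> d (Suc n) x = \<zero>\<^bsub>C n\<^esub>"
  by (auto simp: complex_cycles_def)

lemma cycleI: "x \<in> carrier (C n) \<Longrightarrow> (\<And>m. n = Suc m \<Longrightarrow> d (Suc m) x = \<zero>\<^bsub>C m\<^esub>) \<Longrightarrow> x \<in> Z n"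
  by (cases n) (auto simp: complex_cycles_def)

lemma boundary_cycle: "x \<in> Bd n \<Longrightarrow> x \<in> Z n"
  using dd linear_mapD(3)[OF lin, of _ n] by (auto simp: complex_boundaries_def intro!: cycleI)

lemma boundaryI: "y \<in> carrier (C (Suc n)) \<Longrightarrow> d (Suc n) y \<in> Bd n"
  by (simp add: complex_boundaries_def)

lemma boundary_linear:
  shows "\<zero>\<^bsub>C n\<^esub> \<in> Bd n" "x \<in> Bd n \<Longrightarrow> y \<in> Bd n \<Longrightarrow> x \<oplus>\<^bsub>C n\<^esub> y \<in> Bd n"
    "x \<in> Bd n \<Longrightarrow> \<ominus>\<^bsub>C n\<^esub> x \<in> Bd n" "x \<in> Bd n \<Longrightarrow> r \<odot>\<^bsub>C n\<^esub> x \<in> Bd n"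
proof -
  interpret C: kmod "C (Suc n)" by (rule km)
  show "\<zero>\<^bsub>C n\<^esub> \<in> Bd n"
    using boundaryI[of "\<zero>\<^bsub>C (Suc n)\<^esub>" n] additive_map_zero[OF abC abC linear_mapD(1)[OF lin[of n]]] by simp
  show "x \<oplus>\<^bsub>C n\<^esub> y \<in> Bd n" if xy: "x \<in> Bd n" "y \<in> Bd n"
  proof -
    obtain u v where "x = d (Suc n) u" "u \<in> carrier (C (Suc n))" "y = d (Suc n) v" "v \<in> carrier (C (Suc n))"
      using xy unfolding complex_boundaries_def by (elim imageE)
    then show ?thesis
      using boundaryI[of "u \<oplus>\<^bsub>C (Suc n)\<^esub> v" n] linear_mapD(4)[OF lin[of n]] by simp
  qed
  show "\<ominus>\<^bsub>C n\<^esub> x \<in> Bd n" if x: "x \<in> Bd n"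
  proof -
    obtain u where "x = d (Suc n) u" "u \<in> carrier (C (Suc n))"
      using x unfolding complex_boundaries_def by (elim imageE)
    then show ?thesis
      using boundaryI[of "\<ominus>\<^bsub>C (Suc n)\<^esub> u" n] additive_map_neg[OF abC abC linear_mapD(1)[OF lin[of n]]] by simp
  qed
  show "r \<odot>\<^bsub>C n\<^esub> x \<in> Bd n" if x: "x \<in> Bd n"
  proof -
    obtain u where "x = d (Suc n) u" "u \<in> carrier (C (Suc n))"
      using x unfolding complex_boundaries_def by (elim imageE)
    then show ?thesis
      using boundaryI[of "r \<odot>\<^bsub>C (Suc n)\<^esub> u" n] linear_mapD(2)[OF lin[of n]] by simp
  qed
qed

lemma cycle_linear:
  shows "\<zero>\<^bsub>C n\<^esub> \<in> Z n" "x \<in> Z n \<Longrightarrow> y \<in> Z n \<Longrightarrow> x \<oplus>\<^bsub>C n\<^esub> y \<in> Z n"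
    "x \<in> Z n \<Longrightarrow> \<ominus>\<^bsub>C n\<^esub> x \<in> Z n" "x \<in> Z n \<Longrightarrow> r \<odot>\<^bsub>C n\<^esub> x \<in> Z n"
proof -
  interpret C: kmod "C n" by (rule km)
  show "\<zero>\<^bsub>C n\<^esub> \<in> Z n" by (rule boundary_cycle[OF boundary_linear(1)])
  show "x \<oplus>\<^bsub>C n\<^esub> y \<in> Z n" if "x \<in> Z n" "y \<in> Z n"
  proof (rule cycleI)
    fix m assume m: "n = Suc m"
    interpret Cm: kmod "C m" by (rule km)
    show "d (Suc m) (x \<oplus>\<^bsub>C n\<^esub> y) = \<zero>\<^bsub>C m\<^esub>"
      using that linear_mapD(4)[OF lin, of x m y] by (simp add: m cycleD)
  qed (use that cycleD(1) in auto)
  show "\<ominus>\<^bsub>C n\<^esub> x \<in> Z n" if "x \<in> Z n"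
  proof (rule cycleI)
    fix m assume m: "n = Suc m"
    interpret Cm: kmod "C m" by (rule km)
    show "d (Suc m) (\<ominus>\<^bsub>C n\<^esub> x) = \<zero>\<^bsub>C m\<^esub>"
      using that additive_map_neg[OF abC abC linear_mapD(1)[OF lin], of x m] by (simp add: m cycleD)
  qed (use that cycleD(1) in auto)
  show "r \<odot>\<^bsub>C n\<^esub> x \<in> Z n" if "x \<in> Z n"
  proof (rule cycleI)
    fix m assume m: "n = Suc m"
    interpret Cm: kmod "C m" by (rule km)
    show "d (Suc m) (r \<odot>\<^bsub>C n\<^esub> x) = \<zero>\<^bsub>C m\<^esub>"
      using that linear_mapD(2)[OF lin, of x m] by (simp add: m cycleD)
  qed (use that cycleD(1) in auto)
qed

lemma Zmod_simps:
  "carrier (Zmod n) = Z n" "x \<oplus>\<^bsub>Zmod n\<^esub> y = x \<oplus>\<^bsub>C n\<^esub> y" "r \<odot>\<^bsub>Zmod n\<^esub> x = r \<odot>\<^bsub>C n\<^esub> x"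
  by simp_all

lemma Zmod_abelian: "abelian_group (Zmod n)"
  by (rule abelian_group_carrier_update[OF abC]) (use cycleD(1) cycle_linear in auto)

lemma Zmod_kmod: "kmod (Zmod n)"
proof -
  interpret C: kmod "C n" by (rule km)
  interpret abelian_group "Zmod n" by (rule Zmod_abelian)
  show ?thesis
    by unfold_locales (use cycleD(1) cycle_linear in \<open>auto simp: C.smult_add C.add_smult C.mult_smult\<close>)
qed

lemma Zmod_neg:
  assumes "x \<in> Z n"
  shows "\<ominus>\<^bsub>Zmod n\<^esub> x = \<ominus>\<^bsub>C n\<^esub> x"
proof -
  interpret C: kmod "C n" by (rule km)
  interpret Z: abelian_group "Zmod n" by (rule Zmod_abelian)
  show ?thesis
    using assms cycle_linear(3)[OF assms] cycleD(1)[OF assms] C.l_neg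
    by (intro Z.minus_equality) simp_all
qed

lemma submodule: "submodule_of (Zmod n) (Bd n)"
proof -
  interpret Z: kmod "Zmod n" by (rule Zmod_kmod)
  show ?thesis
    by unfold_locales (use boundary_cycle boundary_linear in \<open>auto simp: Zmod_neg\<close>)
qed

lemma cl_eq: "cl n z = Bd n +>\<^bsub>Zmod n\<^esub> z"
  by (simp add: complex_class_def a_r_coset_def r_coset_def)

lemma H_eq: "H n = quotient_module (Zmod n) (Bd n)"
  by (simp add: complex_homology_def)

lemma H_kmod: "kmod (H n)"
  unfolding H_eq by (rule submodule_of_quotient_kmod[OF submodule Zmod_kmod])

lemma H_carrier: "carrier (H n) = cl n ` Z n"
  using submodule_of.quotient_simps(1)[OF submodule] by (simp add: H_eq cl_eq)

lemma H_carrierE: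
  assumes "U \<in> carrier (H n)"
  obtains z where "z \<in> Z n" "U = cl n z"
  using assms unfolding H_carrier by blast

lemma cl_linear: "linear_map (Zmod n) (H n) (cl n)"
  using submodule_of.coset_linear[OF submodule] by (simp add: H_eq cl_eq[abs_def])

lemma cl_in_H: "z \<in> Z n \<Longrightarrow> cl n z \<in> carrier (H n)"
  by (simp add: H_carrier)

lemma cl_add: "z \<in> Z n \<Longrightarrow> w \<in> Z n \<Longrightarrow> cl n (z \<oplus>\<^bsub>C n\<^esub> w) = cl n z \<oplus>\<^bsub>H n\<^esub> cl n w"
  by (rule linear_mapD(4)[OF cl_linear, of z n w, unfolded Zmod_simps])

lemma cl_smult: "z \<in> Z n \<Longrightarrow> cl n (r \<odot>\<^bsub>C n\<^esub> z) = r \<odot>\<^bsub>H n\<^esub> cl n z"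
  by (rule linear_mapD(2)[OF cl_linear, of z n r, unfolded Zmod_simps])

lemma cl_eq_iff:
  assumes "z \<in> Z n" "w \<in> Z n"
  shows "cl n z = cl n w \<longleftrightarrow> z \<ominus>\<^bsub>C n\<^esub> w \<in> Bd n"
  using submodule_of.coset_eq_iff[OF submodule, unfolded Zmod_simps a_minus_def, OF assms] assms
  by (simp only: cl_eq a_minus_def Zmod_neg)

lemma H_zero: "\<zero>\<^bsub>H n\<^esub> = cl n \<zero>\<^bsub>C n\<^esub>"
proof -
  have "\<zero>\<^bsub>Zmod n\<^esub> = \<zero>\<^bsub>C n\<^esub>" by simp
  then show ?thesis using submodule_of.quotient_zero[OF submodule, of n] by (simp only: H_eq cl_eq)
qed

lemma cl_zero_iff:
  assumes "z \<in> Z n"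
  shows "cl n z = \<zero>\<^bsub>H n\<^esub> \<longleftrightarrow> z \<in> Bd n"
proof -
  interpret C: kmod "C n" by (rule km)
  have "\<ominus>\<^bsub>C n\<^esub> \<zero>\<^bsub>C n\<^esub> = \<zero>\<^bsub>C n\<^esub>" by (rule C.minus_equality) simp_all
  then have "z \<ominus>\<^bsub>C n\<^esub> \<zero>\<^bsub>C n\<^esub> = z" unfolding a_minus_def using cycleD(1)[OF assms] by (simp only: C.r_zero)
  then show ?thesis
    using cl_eq_iff[OF assms cycle_linear(1)] by (simp only: H_zero)
qed

lemma union_cl:
  assumes "z \<in> Z n" and "\<And>u. u \<in> Z n \<Longrightarrow> cl n u = cl n z \<Longrightarrow> F u = F z"
  shows "(\<Union>u\<in>cl n z. F u) = F z"
  unfolding cl_eq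
proof (rule submodule_of.union_coset[OF submodule])
  show "z \<in> carrier (Zmod n)" using assms(1) by simp
  show "F u = F z" if "u \<in> carrier (Zmod n)" "Bd n +>\<^bsub>Zmod n\<^esub> u = Bd n +>\<^bsub>Zmod n\<^esub> z" for u
  proof (rule assms(2))
    show "u \<in> Z n" using that(1) by simp
    show "cl n u = cl n z" using that(2) by (simp only: cl_eq)
  qed
qed

end

text \<open>The degrees \<open>n\<close> and \<open>m\<close> may differ, since the cap product
  lowers the degree by one.\<close>

lemma homology_map:
  assumes C: "kcomplex C d" and C': "kcomplex C' d'"
    and f: "linear_map (C n) (C' m) f"
    and Z: "\<And>z. z \<in> complex_cycles C d n \<Longrightarrow> f z \<in> complex_cycles C' d' m"
    and B: "\<And>z. z \<in> complex_boundaries C d n \<Longrightarrow> f z \<in> complex_boundaries C' d' m"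
  shows "linear_map (complex_homology C d n) (complex_homology C' d' m) (homology_map C' d' m f)"
    and "z \<in> complex_cycles C d n \<Longrightarrow>
      homology_map C' d' m f (complex_class C d n z) = complex_class C' d' m (f z)"
proof -
  interpret C: kcomplex C d by fact
  interpret C': kcomplex C' d' by fact
  interpret Cn: kmod "C n" by (rule C.km)
  show cl: "homology_map C' d' m f (C.cl n z) = C'.cl m (f z)" if z: "z \<in> C.Z n" for z
    unfolding homology_map_def
  proof (rule C.union_cl[OF z])
    fix u assume u: "u \<in> C.Z n" "C.cl n u = C.cl n z"
    then have "u \<ominus>\<^bsub>C n\<^esub> z \<in> C.Bd n" using C.cl_eq_iff[OF u(1) z] by simp
    then have "f (u \<ominus>\<^bsub>C n\<^esub> z) \<in> C'.Bd m" by (rule B)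
    moreover have "f (u \<ominus>\<^bsub>C n\<^esub> z) = f u \<ominus>\<^bsub>C' m\<^esub> f z"
      using C.cycleD(1)[OF u(1)] C.cycleD(1)[OF z] linear_mapD(4)[OF f]
        additive_map_neg[OF C.abC C'.abC linear_mapD(1)[OF f]] by (simp add: a_minus_def)
    ultimately show "C'.cl m (f u) = C'.cl m (f z)"
      using C'.cl_eq_iff[OF Z[OF u(1)] Z[OF z]] by simp
  qed
  show "linear_map (C.H n) (C'.H m) (homology_map C' d' m f)"
    unfolding linear_map_def additive_map_def
  proof (intro conjI ballI allI funcsetI)
    fix U r assume "U \<in> carrier (C.H n)"
    then obtain z where z: "z \<in> C.Z n" "U = C.cl n z" by (rule C.H_carrierE)
    show "homology_map C' d' m f U \<in> carrier (C'.H m)" using z Z C'.cl_in_H by (simp add: cl)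
    have "homology_map C' d' m f (r \<odot>\<^bsub>C.H n\<^esub> U) = homology_map C' d' m f (C.cl n (r \<odot>\<^bsub>C n\<^esub> z))"
      using z by (simp add: C.cl_smult)
    then show "homology_map C' d' m f (r \<odot>\<^bsub>C.H n\<^esub> U) = r \<odot>\<^bsub>C'.H m\<^esub> homology_map C' d' m f U"
      using z C.cycle_linear(4)[OF z(1)] C.cycleD(1)[OF z(1)] Z
      by (simp add: cl linear_mapD(2)[OF f] C'.cl_smult)
    fix V assume "V \<in> carrier (C.H n)"
    then obtain w where w: "w \<in> C.Z n" "V = C.cl n w" by (rule C.H_carrierE)
    have "homology_map C' d' m f (U \<oplus>\<^bsub>C.H n\<^esub> V) = homology_map C' d' m f (C.cl n (z \<oplus>\<^bsub>C n\<^esub> w))"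
      using z w by (simp add: C.cl_add)
    then show "homology_map C' d' m f (U \<oplus>\<^bsub>C.H n\<^esub> V) =
        homology_map C' d' m f U \<oplus>\<^bsub>C'.H m\<^esub> homology_map C' d' m f V"
      using z w C.cycle_linear(2)[OF z(1) w(1)] C.cycleD(1)[OF z(1)] C.cycleD(1)[OF w(1)] Z
      by (simp add: cl linear_mapD(4)[OF f] C'.cl_add)
  qed
qed

section \<open>The tensor product of complexes and the cross product\<close>

lemma ctensor_eqI:
  assumes "kmod M" "kmod N" "abelian_group P"
    and "additive_map (ctensor M N) P F" "additive_map (ctensor M N) P G"
    and "\<And>m n. m \<in> carrier M \<Longrightarrow> n \<in> carrier N \<Longrightarrow> F (tensor_pure UNIV M N m n) = G (tensor_pure UNIV M N m n)"
    and "x \<in> carrier (ctensor M N)"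
  shows "F x = G x"
  using tensor_pair.additive_map_tensor_eq[OF kmod_tensor_pair[OF assms(1,2)] assms(4,5,3,6,7)] .

lemma additive_map_add:
  assumes "abelian_group N" "additive_map M N f" "additive_map M N g"
  shows "additive_map M N (\<lambda>x. f x \<oplus>\<^bsub>N\<^esub> g x)"
proof -
  interpret abelian_group N by fact
  show ?thesis using assms(2,3) by (auto simp: additive_map_def Pi_iff a_ac)
qed

lemma additive_map_const_zero: "abelian_group N \<Longrightarrow> additive_map M N (\<lambda>x. \<zero>\<^bsub>N\<^esub>)"
  using abelian_groupE[of N] by (auto simp: additive_map_def)

lemma linear_map_add:
  assumes "kmod N" "linear_map M N f" "linear_map M N g"
  shows "linear_map M N (\<lambda>x. f x \<oplus>\<^bsub>N\<^esub> g x)"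
proof -
  interpret kmod N by fact
  show ?thesis
    using assms(2,3) additive_map_add[OF abelian_group_axioms, of M f g]
    by (auto simp: linear_map_def smult_add additive_map_def Pi_iff)
qed

lemma linear_map_const_zero: "kmod N \<Longrightarrow> linear_map M N (\<lambda>x. \<zero>\<^bsub>N\<^esub>)"
  using additive_map_const_zero[of N M] amod.smult_zero_right[of N]
  by (auto simp: linear_map_def kmod_def amod_def)

lemma linear_map_neg:
  assumes "kmod N" "linear_map M N f"
  shows "linear_map M N (\<lambda>x. \<ominus>\<^bsub>N\<^esub> f x)"
proof -
  interpret kmod N by fact
  show ?thesis
    using assms(2) by (auto simp: linear_map_def additive_map_def Pi_iff smult_neg minus_add)
qed

lemma linear_map_smult:
  assumes "kmod N" "linear_map M N f"
  shows "linear_map M N (\<lambda>x. r \<odot>\<^bsub>N\<^esub> f x)"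
proof -
  interpret kmod N by fact
  have "r \<odot>\<^bsub>N\<^esub> (s \<odot>\<^bsub>N\<^esub> x) = s \<odot>\<^bsub>N\<^esub> (r \<odot>\<^bsub>N\<^esub> x)" if "x \<in> carrier N" for s x
    using that by (simp flip: mult_smult add: mult.commute)
  then show ?thesis
    using assms(2) by (auto simp: linear_map_def additive_map_def Pi_iff smult_add)
qed

lemma ctensor_pure_zero:
  assumes M: "kmod M" and N: "kmod N"
  shows "n \<in> carrier N \<Longrightarrow> tensor_pure UNIV M N \<zero>\<^bsub>M\<^esub> n = \<zero>\<^bsub>ctensor M N\<^esub>"
    and "m \<in> carrier M \<Longrightarrow> tensor_pure UNIV M N m \<zero>\<^bsub>N\<^esub> = \<zero>\<^bsub>ctensor M N\<^esub>"
proof -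
  interpret tensor_pair UNIV M N by (rule kmod_tensor_pair[OF M N])
  show "n \<in> carrier N \<Longrightarrow> tensor_pure UNIV M N \<zero>\<^bsub>M\<^esub> n = \<zero>\<^bsub>ctensor M N\<^esub>"
    by (rule additive_map_zero[OF abM T_abelian pure_additive_left])
  show "m \<in> carrier M \<Longrightarrow> tensor_pure UNIV M N m \<zero>\<^bsub>N\<^esub> = \<zero>\<^bsub>ctensor M N\<^esub>"
    by (rule additive_map_zero[OF abN T_abelian pure_additive_right])
qed

lemma ctensor_pure_linear:
  assumes M: "kmod M" and N: "kmod N"
  shows "n \<in> carrier N \<Longrightarrow> linear_map M (ctensor M N) (\<lambda>m. tensor_pure UNIV M N m n)"
    and "m \<in> carrier M \<Longrightarrow> linear_map N (ctensor M N) (tensor_pure UNIV M N m)"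
    and "m \<in> carrier M \<Longrightarrow> n \<in> carrier N \<Longrightarrow> tensor_pure UNIV M N m n \<in> carrier (ctensor M N)"
proof -
  interpret tensor_pair UNIV M N by (rule kmod_tensor_pair[OF M N])
  show "n \<in> carrier N \<Longrightarrow> linear_map M (ctensor M N) (\<lambda>m. tensor_pure UNIV M N m n)"
    using pure_additive_left ctensor_kmod(2)[OF M N] by (auto simp: linear_map_def)
  show "m \<in> carrier M \<Longrightarrow> linear_map N (ctensor M N) (tensor_pure UNIV M N m)"
    using pure_additive_right ctensor_kmod(2)[OF M N] pure_balanced by (auto simp: linear_map_def)
  show "m \<in> carrier M \<Longrightarrow> n \<in> carrier N \<Longrightarrow> tensor_pure UNIV M N m n \<in> carrier (ctensor M N)"
    by simp
qed

locale complex_pair = A: kcomplex C d + B: kcomplex C' d'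
  for C :: "nat \<Rightarrow> ('k::comm_ring_1, 'm) module" and d and C' :: "nat \<Rightarrow> ('k, 'n) module" and d'
begin

abbreviation "t i j \<equiv> ctensor (C i) (C' j)"

abbreviation "pt i j \<equiv> tensor_pure UNIV (C i) (C' j)"

abbreviation "tm i j \<equiv> tensor_map UNIV (C i) (C' j)"

abbreviation "T \<equiv> tensor_complex C C'"

abbreviation "D \<equiv> tensor_diff C d C' d'"

lemma t_kmod: "kmod (t i j)" and t_abelian: "abelian_group (t i j)" and t_amod: "amod (t i j)"
  using ctensor_kmod(1)[OF A.km B.km, of i j] by (simp_all add: kmod_def amod_def)

lemma T_kmod: "kmod (T n)"
  unfolding tensor_complex_def by (rule direct_sum_kmod) (rule t_kmod)

lemma T_carrier: "x \<in> carrier (T n) \<Longrightarrow> i \<le> n \<Longrightarrow> x i \<in> carrier (t i (n - i))"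
  by (auto simp: tensor_complex_def direct_sum_simps)

lemma T_ext: "x \<in> carrier (T n) \<Longrightarrow> x \<in> extensional {..n}"
  by (auto simp: tensor_complex_def direct_sum_simps PiE_def)

lemma T_simps: "i \<le> n \<Longrightarrow> (x \<oplus>\<^bsub>T n\<^esub> y) i = x i \<oplus>\<^bsub>t i (n - i)\<^esub> y i"
  "i \<le> n \<Longrightarrow> \<zero>\<^bsub>T n\<^esub> i = \<zero>\<^bsub>t i (n - i)\<^esub>"
  "i \<le> n \<Longrightarrow> (r \<odot>\<^bsub>T n\<^esub> x) i = r \<odot>\<^bsub>t i (n - i)\<^esub> x i"
  by (auto simp: tensor_complex_def direct_sum_simps)

lemma T_eqI:
  assumes "x \<in> carrier (T n)" "y \<in> carrier (T n)" "\<And>i. i \<le> n \<Longrightarrow> x i = y i"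
  shows "x = y"
  by (rule extensionalityI[OF T_ext[OF assms(1)] T_ext[OF assms(2)]]) (use assms(3) in auto)

lemma t_eqI:
  assumes "abelian_group P" "additive_map (t i j) P F" "additive_map (t i j) P G"
    and "\<And>a b. a \<in> carrier (C i) \<Longrightarrow> b \<in> carrier (C' j) \<Longrightarrow> F (pt i j a b) = G (pt i j a b)"
    and "x \<in> carrier (t i j)"
  shows "F x = G x"
  by (rule ctensor_eqI[OF A.km B.km assms])

lemma tm_linear:
  "linear_map (C i) (C i') f \<Longrightarrow> linear_map (C' j) (C' j') g \<Longrightarrow> linear_map (t i j) (t i' j') (tm i' j' f g)"
  by (rule ctensor_map(1)[OF A.km B.km A.km B.km])

lemma tm_pure:
  "linear_map (C i) (C i') f \<Longrightarrow> linear_map (C' j) (C' j') g \<Longrightarrow> a \<in> carrier (C i) \<Longrightarrow> b \<in> carrier (C' j) \<Longrightarrow>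
    tm i' j' f g (pt i j a b) = pt i' j' (f a) (g b)"
  by (rule ctensor_map(2)[OF A.km B.km A.km B.km])

lemma pt_closed: "a \<in> carrier (C i) \<Longrightarrow> b \<in> carrier (C' j) \<Longrightarrow> pt i j a b \<in> carrier (t i j)"
  by (rule ctensor_pure_linear(3)[OF A.km B.km])

lemma tm_compose:
  assumes l: "linear_map (C i) (C i') f" "linear_map (C' j) (C' j') g"
    "linear_map (C i') (C i'') f'" "linear_map (C' j') (C' j'') g'" and x: "x \<in> carrier (t i j)"
  shows "tm i'' j'' f' g' (tm i' j' f g x) = tm i'' j'' (\<lambda>a. f' (f a)) (\<lambda>b. g' (g b)) x"
proof (rule t_eqI[OF t_abelian _ _ _ x])
  show "additive_map (t i j) (t i'' j'') (\<lambda>x. tm i'' j'' f' g' (tm i' j' f g x))"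
    by (intro linear_mapD(1) linear_map_compose[OF tm_linear tm_linear] l)
  show "additive_map (t i j) (t i'' j'') (tm i'' j'' (\<lambda>a. f' (f a)) (\<lambda>b. g' (g b)))"
    by (intro linear_mapD(1) tm_linear linear_map_compose[OF l(1,3)] linear_map_compose[OF l(2,4)])
  fix a b assume ab: "a \<in> carrier (C i)" "b \<in> carrier (C' j)"
  have fg: "f a \<in> carrier (C i')" "g b \<in> carrier (C' j')"
    by (rule linear_mapD(3)[OF l(1) ab(1)], rule linear_mapD(3)[OF l(2) ab(2)])
  show "tm i'' j'' f' g' (tm i' j' f g (pt i j a b)) = tm i'' j'' (\<lambda>a. f' (f a)) (\<lambda>b. g' (g b)) (pt i j a b)"
    unfolding tm_pure[OF l(1,2) ab] tm_pure[OF l(3,4) fg]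
      tm_pure[OF linear_map_compose[OF l(1,3)] linear_map_compose[OF l(2,4)] ab] ..
qed

lemma tm_zero:
  assumes l: "linear_map (C i) (C i') f" "linear_map (C' j) (C' j') g"
    and z: "(\<forall>a\<in>carrier (C i). f a = \<zero>\<^bsub>C i'\<^esub>) \<or> (\<forall>b\<in>carrier (C' j). g b = \<zero>\<^bsub>C' j'\<^esub>)"
    and x: "x \<in> carrier (t i j)"
  shows "tm i' j' f g x = \<zero>\<^bsub>t i' j'\<^esub>"
proof (rule t_eqI[OF t_abelian _ _ _ x])
  show "additive_map (t i j) (t i' j') (tm i' j' f g)" by (intro linear_mapD(1) tm_linear l)
  show "additive_map (t i j) (t i' j') (\<lambda>x. \<zero>\<^bsub>t i' j'\<^esub>)" by (rule additive_map_const_zero[OF t_abelian])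
  fix a b assume ab: "a \<in> carrier (C i)" "b \<in> carrier (C' j)"
  have fg: "f a \<in> carrier (C i')" "g b \<in> carrier (C' j')"
    by (rule linear_mapD(3)[OF l(1) ab(1)], rule linear_mapD(3)[OF l(2) ab(2)])
  show "tm i' j' f g (pt i j a b) = \<zero>\<^bsub>t i' j'\<^esub>"
    using z ab fg tm_pure[OF l ab] ctensor_pure_zero[OF A.km B.km] by auto
qed

text \<open>\<open>L\<close> and \<open>R\<close> are the halves \<open>d \<otimes> 1\<close> and
  \<open>1 \<otimes> d'\<close> of the tensor differential, without its sign; the indices name the
  component in which they land.\<close>

definition L where "L i m = tm i m (d (Suc i)) id"

definition R where "R i m = tm i m id (d' (Suc m))"

lemma L_linear: "linear_map (t (Suc i) m) (t i m) (L i m)"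
  unfolding L_def by (rule tm_linear[OF A.lin linear_map_id])

lemma R_linear: "linear_map (t i (Suc m)) (t i m) (R i m)"
  unfolding R_def by (rule tm_linear[OF linear_map_id B.lin])

lemma L_pure: "a \<in> carrier (C (Suc i)) \<Longrightarrow> b \<in> carrier (C' m) \<Longrightarrow> L i m (pt (Suc i) m a b) = pt i m (d (Suc i) a) b"
  unfolding L_def using tm_pure[OF A.lin linear_map_id] by simp

lemma R_pure: "a \<in> carrier (C i) \<Longrightarrow> b \<in> carrier (C' (Suc m)) \<Longrightarrow> R i m (pt i (Suc m) a b) = pt i m a (d' (Suc m) b)"
  unfolding R_def using tm_pure[OF linear_map_id B.lin] by simp

lemma LL: "x \<in> carrier (t (Suc (Suc i)) m) \<Longrightarrow> L i m (L (Suc i) m x) = \<zero>\<^bsub>t i m\<^esub>"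
  unfolding L_def
  by (subst tm_compose[OF A.lin linear_map_id A.lin linear_map_id], assumption,
      rule tm_zero[OF linear_map_compose[OF A.lin A.lin] linear_map_compose[OF linear_map_id linear_map_id]])
    (auto simp: A.dd)

lemma RR: "x \<in> carrier (t i (Suc (Suc m))) \<Longrightarrow> R i m (R i (Suc m) x) = \<zero>\<^bsub>t i m\<^esub>"
  unfolding R_def
  by (subst tm_compose[OF linear_map_id B.lin linear_map_id B.lin], assumption,
      rule tm_zero[OF linear_map_compose[OF linear_map_id linear_map_id] linear_map_compose[OF B.lin B.lin]])
    (auto simp: B.dd)

lemma LR: "x \<in> carrier (t (Suc i) (Suc m)) \<Longrightarrow> L i m (R (Suc i) m x) = R i m (L i (Suc m) x)"
  unfolding L_def R_def
  by (simp add: tm_compose[OF linear_map_id B.lin A.lin linear_map_id]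
      tm_compose[OF A.lin linear_map_id linear_map_id B.lin])

lemma D_apply:
  assumes "i \<le> n"
  shows "D (Suc n) x i = L i (n - i) (x (Suc i)) \<oplus>\<^bsub>t i (n - i)\<^esub> ((-1) ^ i) \<odot>\<^bsub>t i (n - i)\<^esub> R i (n - i) (x i)"
  using assms by (simp add: tensor_diff_def L_def R_def Let_def Suc_diff_le)

lemma component:
  assumes "x \<in> carrier (T (Suc n))" "i \<le> n"
  shows "x (Suc i) \<in> carrier (t (Suc i) (n - i))" "x i \<in> carrier (t i (Suc (n - i)))"
  using T_carrier[OF assms(1), of "Suc i"] T_carrier[OF assms(1), of i] assms(2) by (auto simp: Suc_diff_le)

lemma D_closed:
  assumes x: "x \<in> carrier (T (Suc n))"
  shows "D (Suc n) x \<in> carrier (T n)"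
proof -
  have "D (Suc n) x i \<in> carrier (t i (n - i))" if i: "i \<le> n" for i
  proof -
    interpret kmod "t i (n - i)" by (rule t_kmod)
    show ?thesis
      unfolding D_apply[OF i] using component[OF x i] linear_mapD(3)[OF L_linear] linear_mapD(3)[OF R_linear] by simp
  qed
  moreover have "D (Suc n) x \<in> extensional {..n}" by (simp add: tensor_diff_def)
  ultimately show ?thesis by (auto simp: tensor_complex_def direct_sum_simps PiE_def)
qed

lemma D_linear: "linear_map (T (Suc n)) (T n) (D (Suc n))"
proof -
  interpret T: kmod "T n" by (rule T_kmod)
  interpret T1: kmod "T (Suc n)" by (rule T_kmod)
  show ?thesis
    unfolding linear_map_def additive_map_def
  proof (intro conjI ballI allI funcsetI D_closed)
    fix x r assume x: "x \<in> carrier (T (Suc n))"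
    show "D (Suc n) (r \<odot>\<^bsub>T (Suc n)\<^esub> x) = r \<odot>\<^bsub>T n\<^esub> D (Suc n) x"
    proof (rule T_eqI)
      fix i assume i: "i \<le> n"
      interpret tt: kmod "t i (n - i)" by (rule t_kmod)
      have Rc: "R i (n - i) (x i) \<in> carrier (t i (n - i))" "L i (n - i) (x (Suc i)) \<in> carrier (t i (n - i))"
        using component[OF x i] linear_mapD(3)[OF L_linear] linear_mapD(3)[OF R_linear] by auto
      have comm: "(-1) ^ i \<odot>\<^bsub>t i (n - i)\<^esub> (r \<odot>\<^bsub>t i (n - i)\<^esub> R i (n - i) (x i)) =
          r \<odot>\<^bsub>t i (n - i)\<^esub> ((-1) ^ i \<odot>\<^bsub>t i (n - i)\<^esub> R i (n - i) (x i))"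
        using Rc by (simp flip: tt.mult_smult add: mult.commute)
      show "D (Suc n) (r \<odot>\<^bsub>T (Suc n)\<^esub> x) i = (r \<odot>\<^bsub>T n\<^esub> D (Suc n) x) i"
        using i component[OF x i] Rc T_simps(3)[of i "Suc n" r x] T_simps(3)[of "Suc i" "Suc n" r x]
        by (simp add: T_simps(3)[OF i] D_apply[OF i] Suc_diff_le linear_mapD(2)[OF L_linear] linear_mapD(2)[OF R_linear]
            tt.smult_add comm)
    qed (use x D_closed[OF x] D_closed[OF T1.smult_closed[OF x]] in simp_all)
    fix y assume y: "y \<in> carrier (T (Suc n))"
    show "D (Suc n) (x \<oplus>\<^bsub>T (Suc n)\<^esub> y) = D (Suc n) x \<oplus>\<^bsub>T n\<^esub> D (Suc n) y"
    proof (rule T_eqI)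
      fix i assume i: "i \<le> n"
      interpret tt: kmod "t i (n - i)" by (rule t_kmod)
      have c: "R i (n - i) (x i) \<in> carrier (t i (n - i))" "L i (n - i) (x (Suc i)) \<in> carrier (t i (n - i))"
          "R i (n - i) (y i) \<in> carrier (t i (n - i))" "L i (n - i) (y (Suc i)) \<in> carrier (t i (n - i))"
        using component[OF x i] component[OF y i] linear_mapD(3)[OF L_linear] linear_mapD(3)[OF R_linear] by auto
      show "D (Suc n) (x \<oplus>\<^bsub>T (Suc n)\<^esub> y) i = (D (Suc n) x \<oplus>\<^bsub>T n\<^esub> D (Suc n) y) i"
        using i component[OF x i] component[OF y i] c T_simps(1)[of i "Suc n" x y] T_simps(1)[of "Suc i" "Suc n" x y]
        by (simp add: T_simps(1)[OF i] D_apply[OF i] Suc_diff_le linear_mapD(4)[OF L_linear] linear_mapD(4)[OF R_linear]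
            tt.smult_add tt.a_ac)
    qed (use x y in \<open>auto intro: D_closed\<close>)
  qed
qed

text \<open>The two halves square to zero and commute. The mixed terms arriving in component i carry
  the signs \<open>(-1)^(i+1)\<close> and \<open>(-1)^i\<close>, so they cancel.\<close>

lemma DD:
  assumes x: "x \<in> carrier (T (Suc (Suc n)))"
  shows "D (Suc n) (D (Suc (Suc n)) x) = \<zero>\<^bsub>T n\<^esub>"
proof (rule T_eqI)
  interpret T: kmod "T n" by (rule T_kmod)
  show "D (Suc n) (D (Suc (Suc n)) x) \<in> carrier (T n)" "\<zero>\<^bsub>T n\<^esub> \<in> carrier (T n)"
    using x D_closed by auto
  fix i assume i: "i \<le> n"
  interpret kmod "t i (n - i)" by (rule t_kmod)
  interpret k1: kmod "t (Suc i) (n - i)" by (rule t_kmod)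
  interpret k2: kmod "t i (Suc (n - i))" by (rule t_kmod)
  let ?a = "x (Suc (Suc i))" and ?b = "x (Suc i)" and ?c = "x i"
  have c: "?a \<in> carrier (t (Suc (Suc i)) (n - i))" "?b \<in> carrier (t (Suc i) (Suc (n - i)))"
      "?c \<in> carrier (t i (Suc (Suc (n - i))))"
    using component[OF x, of "Suc i"] component[OF x, of i] i by (auto simp: Suc_diff_le)
  have cl: "L (Suc i) (n - i) ?a \<in> carrier (t (Suc i) (n - i))" "R (Suc i) (n - i) ?b \<in> carrier (t (Suc i) (n - i))"
      "L i (Suc (n - i)) ?b \<in> carrier (t i (Suc (n - i)))" "R i (Suc (n - i)) ?c \<in> carrier (t i (Suc (n - i)))"
    using c linear_mapD(3)[OF L_linear] linear_mapD(3)[OF R_linear] by auto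
  let ?e = "R i (n - i) (L i (Suc (n - i)) ?b)"
  have e: "?e \<in> carrier (t i (n - i))" using cl linear_mapD(3)[OF R_linear] by auto
  have y1: "D (Suc (Suc n)) x (Suc i) = L (Suc i) (n - i) ?a \<oplus>\<^bsub>t (Suc i) (n - i)\<^esub>
      ((-1) ^ Suc i) \<odot>\<^bsub>t (Suc i) (n - i)\<^esub> R (Suc i) (n - i) ?b"
    using D_apply[of "Suc i" "Suc n" x] i by simp
  have y0: "D (Suc (Suc n)) x i = L i (Suc (n - i)) ?b \<oplus>\<^bsub>t i (Suc (n - i))\<^esub>
      ((-1) ^ i) \<odot>\<^bsub>t i (Suc (n - i))\<^esub> R i (Suc (n - i)) ?c"
    using D_apply[of i "Suc n" x] i by (simp add: Suc_diff_le)
  have 1: "L i (n - i) (D (Suc (Suc n)) x (Suc i)) = ((-1) ^ Suc i) \<odot>\<^bsub>t i (n - i)\<^esub> ?e"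
    unfolding y1 using cl c e
    by (simp add: linear_mapD(4)[OF L_linear] linear_mapD(2)[OF L_linear] LL LR del: power_Suc)
  have 2: "R i (n - i) (D (Suc (Suc n)) x i) = ?e"
    unfolding y0 using cl c e
    by (simp add: linear_mapD(4)[OF R_linear] linear_mapD(2)[OF R_linear] RR)
  have "((-1) ^ Suc i) \<odot>\<^bsub>t i (n - i)\<^esub> ?e = \<ominus>\<^bsub>t i (n - i)\<^esub> (((-1) ^ i) \<odot>\<^bsub>t i (n - i)\<^esub> ?e)"
    using neg_smult[OF e, of "(-1) ^ i"] by simp
  then show "D (Suc n) (D (Suc (Suc n)) x) i = \<zero>\<^bsub>T n\<^esub> i"
    unfolding D_apply[OF i] 1 2 T_simps(2)[OF i] using e by (simp add: l_neg)
qed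

sublocale TC: kcomplex T D
  by (rule kcomplex.intro) (rule T_kmod, rule D_linear, rule DD)

abbreviation "S n \<equiv> summand {..n} (\<lambda>i. t i (n - i))"

lemma S_linear: "i \<le> n \<Longrightarrow> linear_map (t i (n - i)) (T n) (S n i)"
  unfolding tensor_complex_def by (rule summand_linear) (auto simp: t_kmod)

lemma S_apply: "j \<le> n \<Longrightarrow> S n i x j = (if j = i then x else \<zero>\<^bsub>t j (n - j)\<^esub>)"
  by (simp add: summand_def)

text \<open>When one factor is a cycle only the other half of the differential survives, and the
  result sits in a single component. With the roles of the factors exchanged the sign
  \<open>(-1)^i\<close> appears.\<close>

lemma D_S_left:
  assumes i: "i \<le> n" and a: "a \<in> carrier (C (Suc i))" and b: "b \<in> B.Z (n - i)"
  shows "D (Suc n) (S (Suc n) (Suc i) (pt (Suc i) (n - i) a b)) = S n i (pt i (n - i) (d (Suc i) a) b)"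
proof (rule T_eqI)
  have b': "b \<in> carrier (C' (n - i))" using B.cycleD(1)[OF b] .
  have da: "d (Suc i) a \<in> carrier (C i)" using linear_mapD(3)[OF A.lin a] .
  let ?x = "S (Suc n) (Suc i) (pt (Suc i) (n - i) a b)"
  have x: "?x \<in> carrier (T (Suc n))"
    using linear_mapD(3)[OF S_linear[of "Suc i" "Suc n"]] i pt_closed[OF a b'] by simp
  show "D (Suc n) ?x \<in> carrier (T n)" by (rule D_closed[OF x])
  show "S n i (pt i (n - i) (d (Suc i) a) b) \<in> carrier (T n)"
    by (rule linear_mapD(3)[OF S_linear[OF i] pt_closed[OF da b']])
  fix j assume j: "j \<le> n"
  interpret kmod "t j (n - j)" by (rule t_kmod)
  have xj: "?x (Suc j) = (if j = i then pt (Suc i) (n - i) a b else \<zero>\<^bsub>t (Suc j) (n - j)\<^esub>)"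
    using S_apply[of "Suc j" "Suc n"] j by simp
  have xj': "?x j = (if j = Suc i then pt (Suc i) (n - i) a b else \<zero>\<^bsub>t j (Suc (n - j))\<^esub>)"
    using S_apply[of j "Suc n"] j by (simp add: Suc_diff_le)
  have l: "L j (n - j) (?x (Suc j)) = S n i (pt i (n - i) (d (Suc i) a) b) j"
    unfolding xj S_apply[OF j] using L_pure[OF a b'] additive_map_zero[OF t_abelian t_abelian linear_mapD(1)[OF L_linear]]
    by auto
  have r: "R j (n - j) (?x j) = \<zero>\<^bsub>t j (n - j)\<^esub>"
  proof (cases "j = Suc i")
    case True
    then have m: "n - i = Suc (n - j)" using j by simp
    have "R j (n - j) (pt j (Suc (n - j)) a b) = pt j (n - j) a (d' (Suc (n - j)) b)"
      by (rule R_pure) (use a b' True m in auto)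
    also have "d' (Suc (n - j)) b = \<zero>\<^bsub>C' (n - j)\<^esub>" using b B.cycleD(2)[of b "n - j"] m by simp
    finally show ?thesis using True m a ctensor_pure_zero(2)[OF A.km B.km, of a "Suc i" "n - j"] unfolding xj' by simp
  next
    case False
    then show ?thesis
      unfolding xj' using additive_map_zero[OF t_abelian t_abelian linear_mapD(1)[OF R_linear]] by auto
  qed
  have "S n i (pt i (n - i) (d (Suc i) a) b) j \<in> carrier (t j (n - j))"
    by (rule T_carrier[OF linear_mapD(3)[OF S_linear[OF i] pt_closed[OF da b']] j])
  then show "D (Suc n) ?x j = S n i (pt i (n - i) (d (Suc i) a) b) j"
    unfolding D_apply[OF j] l r by simp
qed

lemma D_S_right:
  assumes i: "i \<le> n" and a: "a \<in> A.Z i" and b: "b \<in> carrier (C' (Suc (n - i)))"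
  shows "D (Suc n) (S (Suc n) i (pt i (Suc (n - i)) a b)) =
    ((-1) ^ i) \<odot>\<^bsub>T n\<^esub> S n i (pt i (n - i) a (d' (Suc (n - i)) b))"
proof (rule T_eqI)
  interpret Tn: kmod "T n" by (rule T_kmod)
  have a': "a \<in> carrier (C i)" using A.cycleD(1)[OF a] .
  have db: "d' (Suc (n - i)) b \<in> carrier (C' (n - i))" using linear_mapD(3)[OF B.lin b] .
  let ?x = "S (Suc n) i (pt i (Suc (n - i)) a b)"
  have x: "?x \<in> carrier (T (Suc n))"
    using linear_mapD(3)[OF S_linear[of i "Suc n"]] i pt_closed[OF a' b] by (simp add: Suc_diff_le)
  let ?y = "S n i (pt i (n - i) a (d' (Suc (n - i)) b))"
  have y: "?y \<in> carrier (T n)"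
    by (rule linear_mapD(3)[OF S_linear[OF i] pt_closed[OF a' db]])
  show "D (Suc n) ?x \<in> carrier (T n)" by (rule D_closed[OF x])
  show "((-1) ^ i) \<odot>\<^bsub>T n\<^esub> ?y \<in> carrier (T n)" using y by simp
  fix j assume j: "j \<le> n"
  interpret kmod "t j (n - j)" by (rule t_kmod)
  have xj: "?x (Suc j) = (if Suc j = i then pt i (Suc (n - i)) a b else \<zero>\<^bsub>t (Suc j) (n - j)\<^esub>)"
    using S_apply[of "Suc j" "Suc n"] j by simp
  have xj': "?x j = (if j = i then pt i (Suc (n - i)) a b else \<zero>\<^bsub>t j (Suc (n - j))\<^esub>)"
    using S_apply[of j "Suc n"] j by (simp add: Suc_diff_le)
  have l: "L j (n - j) (?x (Suc j)) = \<zero>\<^bsub>t j (n - j)\<^esub>"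
  proof (cases "Suc j = i")
    case True
    then have m: "Suc (n - i) = n - j" using i by simp
    have "L j (n - j) (pt (Suc j) (n - j) a b) = pt j (n - j) (d (Suc j) a) b"
      by (rule L_pure) (use a' b True m in auto)
    also have "d (Suc j) a = \<zero>\<^bsub>C j\<^esub>" using a A.cycleD(2)[of a j] True by simp
    finally show ?thesis using True m b ctensor_pure_zero(1)[OF A.km B.km, of b "n - j" j] unfolding xj by simp
  next
    case False
    then show ?thesis
      unfolding xj using additive_map_zero[OF t_abelian t_abelian linear_mapD(1)[OF L_linear]] by auto
  qed
  have r: "R j (n - j) (?x j) = ?y j"
    unfolding xj' S_apply[OF j] using R_pure[OF a' b] additive_map_zero[OF t_abelian t_abelian linear_mapD(1)[OF R_linear]]
    by auto
  have "(-1) ^ j \<odot>\<^bsub>t j (n - j)\<^esub> ?y j = (-1) ^ i \<odot>\<^bsub>t j (n - j)\<^esub> ?y j"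
    using S_apply[OF j] by (cases "j = i") simp_all
  then show "D (Suc n) ?x j = (((-1) ^ i) \<odot>\<^bsub>T n\<^esub> ?y) j"
    unfolding D_apply[OF j] l r T_simps(3)[OF j] using T_carrier[OF y j] by (simp only: l_zero smult_closed)
qed

lemma S_cycle:
  assumes i: "i \<le> n" and u: "u \<in> carrier (t i (n - i))"
    and L0: "\<And>i'. i = Suc i' \<Longrightarrow> L i' (n - i) u = \<zero>\<^bsub>t i' (n - i)\<^esub>"
    and R0: "\<And>m. n - i = Suc m \<Longrightarrow> R i m u = \<zero>\<^bsub>t i m\<^esub>"
  shows "S n i u \<in> TC.Z n"
proof (rule TC.cycleI)
  show Su: "S n i u \<in> carrier (T n)" by (rule linear_mapD(3)[OF S_linear[OF i] u])
  fix m assume n: "n = Suc m"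
  interpret Tm: kmod "T m" by (rule T_kmod)
  show "D (Suc m) (S n i u) = \<zero>\<^bsub>T m\<^esub>"
  proof (rule T_eqI)
    show "D (Suc m) (S n i u) \<in> carrier (T m)" "\<zero>\<^bsub>T m\<^esub> \<in> carrier (T m)" using Su n D_closed by auto
    fix j assume j: "j \<le> m"
    interpret kmod "t j (m - j)" by (rule t_kmod)
    have "L j (m - j) (S n i u (Suc j)) = \<zero>\<^bsub>t j (m - j)\<^esub>"
      using S_apply[of "Suc j" n i u] j n L0[of j] additive_map_zero[OF t_abelian t_abelian linear_mapD(1)[OF L_linear]]
      by (cases "Suc j = i") auto
    moreover have "R j (m - j) (S n i u j) = \<zero>\<^bsub>t j (m - j)\<^esub>"
      using S_apply[of j n i u] j n R0[of "m - j"] additive_map_zero[OF t_abelian t_abelian linear_mapD(1)[OF R_linear]]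
      by (cases "j = i") (auto simp: Suc_diff_le)
    ultimately show "D (Suc m) (S n i u) j = \<zero>\<^bsub>T m\<^esub> j"
      unfolding D_apply[OF j] T_simps(2)[OF j] by simp
  qed
qed

lemma S_pure_cycle:
  assumes i: "i \<le> n" and a: "a \<in> A.Z i" and b: "b \<in> B.Z (n - i)"
  shows "S n i (pt i (n - i) a b) \<in> TC.Z n"
proof (rule S_cycle[OF i])
  have ab: "a \<in> carrier (C i)" "b \<in> carrier (C' (n - i))" using A.cycleD(1)[OF a] B.cycleD(1)[OF b] .
  show "pt i (n - i) a b \<in> carrier (t i (n - i))" by (rule pt_closed[OF ab])
  show "L i' (n - i) (pt i (n - i) a b) = \<zero>\<^bsub>t i' (n - i)\<^esub>" if "i = Suc i'" for i'
    using L_pure[of a i' b "n - i"] ab that A.cycleD(2)[of a i'] a ctensor_pure_zero(1)[OF A.km B.km, of b] by simp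
  show "R i m (pt i (n - i) a b) = \<zero>\<^bsub>t i m\<^esub>" if "n - i = Suc m" for m
    using R_pure[of a i b m] ab that B.cycleD(2)[of b m] b ctensor_pure_zero(2)[OF A.km B.km, of a] by simp
qed

lemma S_boundary_left:
  assumes i: "i \<le> n" and a: "a \<in> A.Bd i" and b: "b \<in> B.Z (n - i)"
  shows "S n i (pt i (n - i) a b) \<in> TC.Bd n"
proof -
  obtain a' where a': "a = d (Suc i) a'" "a' \<in> carrier (C (Suc i))"
    using a unfolding complex_boundaries_def by (elim imageE)
  have "S (Suc n) (Suc i) (pt (Suc i) (n - i) a' b) \<in> carrier (T (Suc n))"
    using linear_mapD(3)[OF S_linear[of "Suc i" "Suc n"]] i pt_closed[OF a'(2) B.cycleD(1)[OF b]] by simp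
  from TC.boundaryI[OF this] show ?thesis using D_S_left[OF i a'(2) b] a' by simp
qed

lemma S_boundary_right:
  assumes i: "i \<le> n" and a: "a \<in> A.Z i" and b: "b \<in> B.Bd (n - i)"
  shows "S n i (pt i (n - i) a b) \<in> TC.Bd n"
proof -
  interpret Tn: kmod "T n" by (rule T_kmod)
  obtain b' where b': "b = d' (Suc (n - i)) b'" "b' \<in> carrier (C' (Suc (n - i)))"
    using b unfolding complex_boundaries_def by (elim imageE)
  have "S (Suc n) i (pt i (Suc (n - i)) a b') \<in> carrier (T (Suc n))"
    using linear_mapD(3)[OF S_linear[of i "Suc n"]] i pt_closed[OF A.cycleD(1)[OF a] b'(2)] by (simp add: Suc_diff_le)
  from TC.boundaryI[OF this] have "((-1) ^ i) \<odot>\<^bsub>T n\<^esub> S n i (pt i (n - i) a b) \<in> TC.Bd n"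
    using D_S_right[OF i a b'(2)] b' by simp
  \<comment> \<open>The sign is removed by multiplying with itself.\<close>
  from TC.boundary_linear(4)[OF this, of "(-1) ^ i"] show ?thesis
    using Tn.neg_one_power_twice[OF TC.cycleD(1)[OF S_pure_cycle[OF i a B.boundary_cycle[OF b]]]] by simp
qed

lemma finsum_Zmod:
  assumes "finite I" "f \<in> I \<rightarrow> TC.Z n"
  shows "finsum (TC.Zmod n) f I = finsum (T n) f I"
proof -
  have "additive_map (TC.Zmod n) (T n) id" using TC.cycleD(1) by (auto simp: additive_map_def)
  from additive_map_finsum[OF TC.Zmod_abelian TC.abC this assms(1), of f] assms(2) show ?thesis by simp
qed

lemma finsum_cycle:
  assumes "finite I" "f \<in> I \<rightarrow> TC.Z n"
  shows "finsum (T n) f I \<in> TC.Z n" "TC.cl n (finsum (T n) f I) = finsum (TC.H n) (\<lambda>i. TC.cl n (f i)) I"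
proof -
  interpret Z: abelian_group "TC.Zmod n" by (rule TC.Zmod_abelian)
  interpret H: kmod "TC.H n" by (rule TC.H_kmod)
  have f: "f \<in> I \<rightarrow> carrier (TC.Zmod n)" using assms(2) by simp
  show "finsum (T n) f I \<in> TC.Z n"
    using Z.finsum_closed[OF f] unfolding finsum_Zmod[OF assms] by simp
  show "TC.cl n (finsum (T n) f I) = finsum (TC.H n) (\<lambda>i. TC.cl n (f i)) I"
    using additive_map_finsum[OF TC.Zmod_abelian H.abelian_group_axioms linear_mapD(1)[OF TC.cl_linear] assms(1) f]
    unfolding finsum_Zmod[OF assms] .
qed

text \<open>The pairing inside \<open>homology_cross\<close>, named so that it can be lifted to the
  tensor product; its inner function is the summand inclusion \<open>S n i\<close> spelled
  out.\<close>

definition cross_pair where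
  "cross_pair n i U V = (\<Union>a\<in>U. \<Union>b\<in>V. complex_class T D n
     (\<lambda>j\<in>{..n}. if j = i then tensor_pure UNIV (C i) (C' (n - i)) a b else \<zero>\<^bsub>ctensor (C j) (C' (n - j))\<^esub>))"

text \<open>Another choice of cycles changes the tensor by one of the form boundary times cycle or
  cycle times boundary, which is a boundary; so all members of the double union coincide.\<close>

lemma cross_pair_cl:
  assumes i: "i \<le> n" and a: "a \<in> A.Z i" and b: "b \<in> B.Z (n - i)"
  shows "cross_pair n i (A.cl i a) (B.cl (n - i) b) = TC.cl n (S n i (pt i (n - i) a b))"
proof -
  let ?F = "\<lambda>a b. TC.cl n (S n i (pt i (n - i) a b))"
  interpret Ai: kmod "C i" by (rule A.km)
  interpret Bi: kmod "C' (n - i)" by (rule B.km)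
  have diff: "TC.cl n (S n i u) = TC.cl n (S n i v)"
    if uv: "u \<in> carrier (t i (n - i))" "v \<in> carrier (t i (n - i))" "S n i u \<in> TC.Z n" "S n i v \<in> TC.Z n"
      "S n i (u \<ominus>\<^bsub>t i (n - i)\<^esub> v) \<in> TC.Bd n" for u v
  proof -
    have "S n i u \<ominus>\<^bsub>T n\<^esub> S n i v = S n i (u \<ominus>\<^bsub>t i (n - i)\<^esub> v)"
    proof -
      interpret k: kmod "t i (n - i)" by (rule t_kmod)
      show ?thesis
        using uv linear_mapD(4)[OF S_linear[OF i]]
          additive_map_neg[OF t_abelian TC.abC linear_mapD(1)[OF S_linear[OF i]]] by (simp add: a_minus_def)
    qed
    then show ?thesis using TC.cl_eq_iff[OF uv(3,4)] uv(5) by simp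
  qed
  have sub: "pt i (n - i) a b \<ominus>\<^bsub>t i (n - i)\<^esub> pt i (n - i) a' b = pt i (n - i) (a \<ominus>\<^bsub>C i\<^esub> a') b"
    if "a \<in> carrier (C i)" "a' \<in> carrier (C i)" "b \<in> carrier (C' (n - i))" for a a' b
    using that linear_mapD(4)[OF ctensor_pure_linear(1)[OF A.km B.km that(3)]]
      additive_map_neg[OF A.abC t_abelian linear_mapD(1)[OF ctensor_pure_linear(1)[OF A.km B.km that(3)]]]
    by (simp add: a_minus_def)
  have sub': "pt i (n - i) a b \<ominus>\<^bsub>t i (n - i)\<^esub> pt i (n - i) a b' = pt i (n - i) a (b \<ominus>\<^bsub>C' (n - i)\<^esub> b')"
    if "a \<in> carrier (C i)" "b \<in> carrier (C' (n - i))" "b' \<in> carrier (C' (n - i))" for a b b'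
    using that linear_mapD(4)[OF ctensor_pure_linear(2)[OF A.km B.km that(1)]]
      additive_map_neg[OF B.abC t_abelian linear_mapD(1)[OF ctensor_pure_linear(2)[OF A.km B.km that(1)]]]
    by (simp add: a_minus_def)
  have right: "?F a' b' = ?F a' b" if "a' \<in> A.Z i" "b' \<in> B.Z (n - i)" "B.cl (n - i) b' = B.cl (n - i) b" for a' b'
  proof (rule diff)
    have "b' \<ominus>\<^bsub>C' (n - i)\<^esub> b \<in> B.Bd (n - i)" using that B.cl_eq_iff[OF that(2) b] by simp
    then show "S n i (pt i (n - i) a' b' \<ominus>\<^bsub>t i (n - i)\<^esub> pt i (n - i) a' b) \<in> TC.Bd n"
      using sub'[of a' b' b] that A.cycleD(1) B.cycleD(1) b S_boundary_right[OF i that(1)] by simp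
  qed (use that b A.cycleD(1) B.cycleD(1) in \<open>auto intro!: pt_closed S_pure_cycle[OF i]\<close>)
  have left: "?F a' b = ?F a b" if "a' \<in> A.Z i" "A.cl i a' = A.cl i a" for a'
  proof (rule diff)
    have "a' \<ominus>\<^bsub>C i\<^esub> a \<in> A.Bd i" using that A.cl_eq_iff[OF that(1) a] by simp
    then show "S n i (pt i (n - i) a' b \<ominus>\<^bsub>t i (n - i)\<^esub> pt i (n - i) a b) \<in> TC.Bd n"
      using sub[of a' a b] that A.cycleD(1) a B.cycleD(1) b S_boundary_left[OF i _ b] by simp
  qed (use that a b A.cycleD(1) B.cycleD(1) in \<open>auto intro!: pt_closed S_pure_cycle[OF i]\<close>)
  have inner: "(\<Union>b'\<in>B.cl (n - i) b. ?F a' b') = ?F a' b" if "a' \<in> A.Z i" for a'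
    by (rule B.union_cl[OF b]) (rule right[OF that])
  have "cross_pair n i (A.cl i a) (B.cl (n - i) b) = (\<Union>a'\<in>A.cl i a. \<Union>b'\<in>B.cl (n - i) b. ?F a' b')"
    unfolding cross_pair_def summand_def ..
  also have "\<dots> = (\<Union>b'\<in>B.cl (n - i) b. ?F a b')"
  proof (rule A.union_cl[OF a])
    fix a' assume a': "a' \<in> A.Z i" "A.cl i a' = A.cl i a"
    show "(\<Union>b'\<in>B.cl (n - i) b. ?F a' b') = (\<Union>b'\<in>B.cl (n - i) b. ?F a b')"
      unfolding inner[OF a'(1)] inner[OF a] by (rule left[OF a'])
  qed
  also have "\<dots> = ?F a b" by (rule inner[OF a])
  finally show ?thesis .
qed

lemma homology_cross_eq:
  "homology_cross C d C' d' n x = (\<Oplus>\<^bsub>TC.H n\<^esub>i\<in>{..n}. tensor_lift (TC.H n) (cross_pair n i) (x i))"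
  by (simp add: homology_cross_def cross_pair_def[abs_def] Let_def)

lemma cross_lift:
  assumes i: "i \<le> n"
  shows "linear_map (ctensor (A.H i) (B.H (n - i))) (TC.H n) (tensor_lift (TC.H n) (cross_pair n i))"
    and "a \<in> A.Z i \<Longrightarrow> b \<in> B.Z (n - i) \<Longrightarrow>
      tensor_lift (TC.H n) (cross_pair n i) (tensor_pure UNIV (A.H i) (B.H (n - i)) (A.cl i a) (B.cl (n - i) b)) =
      TC.cl n (S n i (pt i (n - i) a b))"
proof -
  have cl: "cross_pair n i U V \<in> carrier (TC.H n)"
    if UV: "U \<in> carrier (A.H i)" "V \<in> carrier (B.H (n - i))" for U V
  proof -
    obtain a where a: "a \<in> A.Z i" "U = A.cl i a" using UV(1) by (rule A.H_carrierE)
    obtain b where b: "b \<in> B.Z (n - i)" "V = B.cl (n - i) b" using UV(2) by (rule B.H_carrierE)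
    show ?thesis
      unfolding a(2) b(2) cross_pair_cl[OF i a(1) b(1)] by (rule TC.cl_in_H[OF S_pure_cycle[OF i a(1) b(1)]])
  qed
  have left: "linear_map (A.H i) (TC.H n) (\<lambda>U. cross_pair n i U V)" if V: "V \<in> carrier (B.H (n - i))" for V
    unfolding linear_map_def additive_map_def
  proof (intro conjI ballI allI funcsetI cl V)
    obtain b where b: "b \<in> B.Z (n - i)" "V = B.cl (n - i) b" using V by (rule B.H_carrierE)
    note pl = ctensor_pure_linear(1)[OF A.km B.km B.cycleD(1)[OF b(1)], of i]
    fix U r assume "U \<in> carrier (A.H i)"
    then obtain a where a: "a \<in> A.Z i" "U = A.cl i a" by (rule A.H_carrierE)
    note pa = pt_closed[OF A.cycleD(1)[OF a(1)] B.cycleD(1)[OF b(1)]]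
    show "cross_pair n i (r \<odot>\<^bsub>A.H i\<^esub> U) V = r \<odot>\<^bsub>TC.H n\<^esub> cross_pair n i U V"
      using a b A.cycle_linear(4)[OF a(1)] A.cycleD(1)[OF a(1)] pa
      by (simp flip: A.cl_smult add: cross_pair_cl[OF i] linear_mapD(2)[OF pl] linear_mapD(2)[OF S_linear[OF i]]
          TC.cl_smult S_pure_cycle[OF i])
    fix U' assume "U' \<in> carrier (A.H i)"
    then obtain a' where a': "a' \<in> A.Z i" "U' = A.cl i a'" by (rule A.H_carrierE)
    note pa' = pt_closed[OF A.cycleD(1)[OF a'(1)] B.cycleD(1)[OF b(1)]]
    show "cross_pair n i (U \<oplus>\<^bsub>A.H i\<^esub> U') V = cross_pair n i U V \<oplus>\<^bsub>TC.H n\<^esub> cross_pair n i U' V"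
      using a a' b A.cycle_linear(2)[OF a(1) a'(1)] A.cycleD(1)[OF a(1)] A.cycleD(1)[OF a'(1)] pa pa'
      by (simp flip: A.cl_add add: cross_pair_cl[OF i] linear_mapD(4)[OF pl] linear_mapD(4)[OF S_linear[OF i]]
          TC.cl_add S_pure_cycle[OF i])
  qed
  have right: "linear_map (B.H (n - i)) (TC.H n) (cross_pair n i U)" if U: "U \<in> carrier (A.H i)" for U
    unfolding linear_map_def additive_map_def
  proof (intro conjI ballI allI funcsetI cl U)
    obtain a where a: "a \<in> A.Z i" "U = A.cl i a" using U by (rule A.H_carrierE)
    note pl = ctensor_pure_linear(2)[OF A.km B.km A.cycleD(1)[OF a(1)], of "n - i"]
    fix V r assume "V \<in> carrier (B.H (n - i))"
    then obtain b where b: "b \<in> B.Z (n - i)" "V = B.cl (n - i) b" by (rule B.H_carrierE)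
    note pb = pt_closed[OF A.cycleD(1)[OF a(1)] B.cycleD(1)[OF b(1)]]
    show "cross_pair n i U (r \<odot>\<^bsub>B.H (n - i)\<^esub> V) = r \<odot>\<^bsub>TC.H n\<^esub> cross_pair n i U V"
      using a b B.cycle_linear(4)[OF b(1)] B.cycleD(1)[OF b(1)] pb
      by (simp flip: B.cl_smult add: cross_pair_cl[OF i] linear_mapD(2)[OF pl] linear_mapD(2)[OF S_linear[OF i]]
          TC.cl_smult S_pure_cycle[OF i])
    fix V' assume "V' \<in> carrier (B.H (n - i))"
    then obtain b' where b': "b' \<in> B.Z (n - i)" "V' = B.cl (n - i) b'" by (rule B.H_carrierE)
    note pb' = pt_closed[OF A.cycleD(1)[OF a(1)] B.cycleD(1)[OF b'(1)]]
    show "cross_pair n i U (V \<oplus>\<^bsub>B.H (n - i)\<^esub> V') = cross_pair n i U V \<oplus>\<^bsub>TC.H n\<^esub> cross_pair n i U V'"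
      using a b b' B.cycle_linear(2)[OF b(1) b'(1)] B.cycleD(1)[OF b(1)] B.cycleD(1)[OF b'(1)] pb pb'
      by (simp flip: B.cl_add add: cross_pair_cl[OF i] linear_mapD(4)[OF pl] linear_mapD(4)[OF S_linear[OF i]]
          TC.cl_add S_pure_cycle[OF i])
  qed
  show "linear_map (ctensor (A.H i) (B.H (n - i))) (TC.H n) (tensor_lift (TC.H n) (cross_pair n i))"
    by (rule ctensor_lift(1)[OF A.H_kmod B.H_kmod TC.H_kmod]) (erule (1) cl, erule left, erule right)
  show "tensor_lift (TC.H n) (cross_pair n i) (tensor_pure UNIV (A.H i) (B.H (n - i)) (A.cl i a) (B.cl (n - i) b)) =
      TC.cl n (S n i (pt i (n - i) a b))" if "a \<in> A.Z i" "b \<in> B.Z (n - i)"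
    unfolding cross_pair_cl[OF i that, symmetric]
    by (rule ctensor_lift(2)[OF A.H_kmod B.H_kmod TC.H_kmod _ _ _ A.cl_in_H[OF that(1)] B.cl_in_H[OF that(2)]])
      (erule (1) cl, erule left, erule right)
qed

end

section \<open>Split complexes and the surjectivity of the cross product\<close>

lemma (in abelian_group) add_diff_cancel_left:
  assumes "a \<in> carrier G" "b \<in> carrier G"
  shows "(a \<oplus> b) \<ominus> a = b"
proof -
  have "(a \<oplus> b) \<ominus> a = (b \<oplus> a) \<oplus> \<ominus> a" using assms by (simp add: a_minus_def a_comm)
  also have "\<dots> = b" using assms by (simp add: a_assoc r_neg)
  finally show ?thesis .
qed

text \<open>\<open>g\<close> inverts the differential on boundaries. Then \<open>d g\<close> is a
  projection onto the boundaries, and \<open>g d\<close> is a projection onto a subspace on which d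
  is injective.\<close>

locale split_complex = kcomplex C d
  for C :: "nat \<Rightarrow> ('k::comm_ring_1, 'm) module" and d +
  fixes g :: "nat \<Rightarrow> 'm \<Rightarrow> 'm"
  assumes g: "linear_map (C n) (C (Suc n)) (g n)"
    and dgd: "x \<in> carrier (C (Suc n)) \<Longrightarrow> d (Suc n) (g n (d (Suc n) x)) = d (Suc n) x"
begin

text \<open>Zero in degree 0, because the complex is extended by zero and every element there is a
  cycle.\<close>

definition gd where "gd n x = (if n = 0 then \<zero>\<^bsub>C n\<^esub> else g (n - 1) (d n x))"

definition dg where "dg n x = d (Suc n) (g n x)"

text \<open>Since \<open>d g d = d\<close>, the chain map \<open>1 - d g - g d\<close> kills boundaries and takes values in cycles.\<close>

definition retr where "retr n x = x \<oplus>\<^bsub>C n\<^esub> \<ominus>\<^bsub>C n\<^esub> (dg n x \<oplus>\<^bsub>C n\<^esub> gd n x)"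

lemma gd_linear: "linear_map (C n) (C n) (gd n)"
proof (cases n)
  case 0
  have "gd 0 = (\<lambda>x. \<zero>\<^bsub>C 0\<^esub>)" by (simp add: gd_def fun_eq_iff)
  then show ?thesis using linear_map_const_zero[OF km[of 0], of "C 0"] 0 by simp
next
  case (Suc m)
  have "gd (Suc m) = (\<lambda>x. g m (d (Suc m) x))" by (simp add: gd_def fun_eq_iff)
  then show ?thesis using linear_map_compose[OF lin[of m] g[of m]] Suc by simp
qed

lemma dg_linear: "linear_map (C n) (C n) (dg n)"
  using linear_map_compose[OF g lin, of n] by (simp add: dg_def[abs_def])

lemma retr_linear: "linear_map (C n) (C n) (retr n)"
proof -
  have id: "linear_map (C n) (C n) (\<lambda>x. x)" using linear_map_id[of "C n"] by (simp add: id_def)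
  show ?thesis
    unfolding retr_def[abs_def]
    by (intro linear_map_add[OF km id] linear_map_neg[OF km] linear_map_add[OF km] dg_linear gd_linear)
qed

lemma decompose:
  assumes x: "x \<in> carrier (C n)"
  shows "x = retr n x \<oplus>\<^bsub>C n\<^esub> (dg n x \<oplus>\<^bsub>C n\<^esub> gd n x)"
proof -
  interpret kmod "C n" by (rule km)
  have "dg n x \<oplus>\<^bsub>C n\<^esub> gd n x \<in> carrier (C n)"
    using x linear_mapD(3)[OF dg_linear] linear_mapD(3)[OF gd_linear] by simp
  then show ?thesis unfolding retr_def using x by (simp add: a_assoc l_neg)
qed

lemma d_retr:
  assumes x: "x \<in> carrier (C (Suc n))"
  shows "d (Suc n) (retr (Suc n) x) = \<zero>\<^bsub>C n\<^esub>"
proof -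
  interpret kmod "C n" by (rule km)
  interpret S: kmod "C (Suc n)" by (rule km)
  have c: "dg (Suc n) x \<in> carrier (C (Suc n))" "gd (Suc n) x \<in> carrier (C (Suc n))"
    using x linear_mapD(3)[OF dg_linear] linear_mapD(3)[OF gd_linear] by auto
  have dx: "d (Suc n) x \<in> carrier (C n)" by (rule linear_mapD(3)[OF lin x])
  have "d (Suc n) (dg (Suc n) x) = \<zero>\<^bsub>C n\<^esub>" unfolding dg_def by (rule dd[OF linear_mapD(3)[OF g x]])
  moreover have "d (Suc n) (gd (Suc n) x) = d (Suc n) x" using dgd[OF x] by (simp add: gd_def)
  ultimately show ?thesis
    unfolding retr_def using x c dx
    by (simp add: linear_mapD(4)[OF lin] additive_map_neg[OF abC abC linear_mapD(1)[OF lin]] r_neg)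
qed

lemma retr_d:
  assumes x: "x \<in> carrier (C (Suc n))"
  shows "retr n (d (Suc n) x) = \<zero>\<^bsub>C n\<^esub>"
proof -
  interpret kmod "C n" by (rule km)
  have dx: "d (Suc n) x \<in> carrier (C n)" by (rule linear_mapD(3)[OF lin x])
  have "gd n (d (Suc n) x) = \<zero>\<^bsub>C n\<^esub>"
  proof (cases n)
    case (Suc m)
    then show ?thesis
      using dd[of x m] x additive_map_zero[OF abC abC linear_mapD(1)[OF g[of m]]] by (simp add: gd_def)
  qed (simp add: gd_def)
  then show ?thesis unfolding retr_def dg_def dgd[OF x] using dx by (simp add: r_neg)
qed

lemma retr_cycle: "x \<in> carrier (C n) \<Longrightarrow> retr n x \<in> Z n"
  using linear_mapD(3)[OF retr_linear] d_retr by (auto intro!: cycleI)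

end

locale split_pair = A: split_complex C d g + B: split_complex C' d' g'
  for C :: "nat \<Rightarrow> ('k::comm_ring_1, 'm) module" and d g and C' :: "nat \<Rightarrow> ('k, 'n) module" and d' g'
begin

sublocale complex_pair C d C' d' ..

text \<open>The homotopy \<open>g \<otimes> 1 + (-1)^j (r \<otimes> g')\<close> between
  \<open>r \<otimes> r'\<close> and the identity, where r and r' are the retractions. In component j
  the first term comes from component j - 1 of \<open>x\<close> and the second from component j;
  where the needed component is absent the term is zero.\<close>

definition hmap where
  "hmap n x = (\<lambda>j\<in>{..Suc n}.
     (if j = 0 then \<zero>\<^bsub>t j (Suc n - j)\<^esub> else tm j (Suc n - j) (g (j - 1)) id (x (j - 1))) \<oplus>\<^bsub>t j (Suc n - j)\<^esub>
     (if j = Suc n then \<zero>\<^bsub>t j (Suc n - j)\<^esub>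
      else ((-1) ^ j) \<odot>\<^bsub>t j (Suc n - j)\<^esub> tm j (Suc n - j) (A.retr j) (g' (n - j)) (x j)))"

lemma tm_split_left:
  assumes x: "x \<in> carrier (t i j)"
  shows "x = tm i j (A.retr i) id x \<oplus>\<^bsub>t i j\<^esub> (tm i j (A.dg i) id x \<oplus>\<^bsub>t i j\<^esub> tm i j (A.gd i) id x)"
proof (rule t_eqI[OF t_abelian, where F = "\<lambda>x. x", OF _ _ _ x])
  interpret k: kmod "t i j" by (rule t_kmod)
  show "additive_map (t i j) (t i j) (\<lambda>x. x)" by (simp add: additive_map_def)
  show "additive_map (t i j) (t i j)
     (\<lambda>x. tm i j (A.retr i) id x \<oplus>\<^bsub>t i j\<^esub> (tm i j (A.dg i) id x \<oplus>\<^bsub>t i j\<^esub> tm i j (A.gd i) id x))"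
    by (intro additive_map_add[OF t_abelian] linear_mapD(1)[OF tm_linear] A.retr_linear A.dg_linear A.gd_linear linear_map_id)
  fix a b assume ab: "a \<in> carrier (C i)" "b \<in> carrier (C' j)"
  interpret Ci: kmod "C i" by (rule A.km)
  have c: "A.retr i a \<in> carrier (C i)" "A.dg i a \<in> carrier (C i)" "A.gd i a \<in> carrier (C i)"
    using ab linear_mapD(3)[OF A.retr_linear] linear_mapD(3)[OF A.dg_linear] linear_mapD(3)[OF A.gd_linear] by auto
  note pl = linear_mapD(4)[OF ctensor_pure_linear(1)[OF A.km B.km ab(2)]]
  have "pt i j a b = pt i j (A.retr i a \<oplus>\<^bsub>C i\<^esub> (A.dg i a \<oplus>\<^bsub>C i\<^esub> A.gd i a)) b"
    using A.decompose[OF ab(1)] by simp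
  also have "\<dots> = pt i j (A.retr i a) b \<oplus>\<^bsub>t i j\<^esub> (pt i j (A.dg i a) b \<oplus>\<^bsub>t i j\<^esub> pt i j (A.gd i a) b)"
    using c by (simp add: pl)
  finally show "pt i j a b = tm i j (A.retr i) id (pt i j a b) \<oplus>\<^bsub>t i j\<^esub>
      (tm i j (A.dg i) id (pt i j a b) \<oplus>\<^bsub>t i j\<^esub> tm i j (A.gd i) id (pt i j a b))"
    unfolding tm_pure[OF A.retr_linear linear_map_id ab] tm_pure[OF A.dg_linear linear_map_id ab]
      tm_pure[OF A.gd_linear linear_map_id ab] id_apply .
qed

lemma tm_split_right:
  assumes x: "x \<in> carrier (t i j)"
  shows "tm i j (A.retr i) id x = tm i j (A.retr i) (B.retr j) x \<oplus>\<^bsub>t i j\<^esub>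
    (tm i j (A.retr i) (B.dg j) x \<oplus>\<^bsub>t i j\<^esub> tm i j (A.retr i) (B.gd j) x)"
proof (rule t_eqI[OF t_abelian _ _ _ x])
  interpret k: kmod "t i j" by (rule t_kmod)
  show "additive_map (t i j) (t i j) (tm i j (A.retr i) id)"
    by (intro linear_mapD(1)[OF tm_linear] A.retr_linear linear_map_id)
  show "additive_map (t i j) (t i j) (\<lambda>x. tm i j (A.retr i) (B.retr j) x \<oplus>\<^bsub>t i j\<^esub>
    (tm i j (A.retr i) (B.dg j) x \<oplus>\<^bsub>t i j\<^esub> tm i j (A.retr i) (B.gd j) x))"
    by (intro additive_map_add[OF t_abelian] linear_mapD(1)[OF tm_linear] A.retr_linear B.retr_linear B.dg_linear B.gd_linear)
  fix a b assume ab: "a \<in> carrier (C i)" "b \<in> carrier (C' j)"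
  interpret Cj: kmod "C' j" by (rule B.km)
  have c: "B.retr j b \<in> carrier (C' j)" "B.dg j b \<in> carrier (C' j)" "B.gd j b \<in> carrier (C' j)"
    using ab linear_mapD(3)[OF B.retr_linear] linear_mapD(3)[OF B.dg_linear] linear_mapD(3)[OF B.gd_linear] by auto
  have ra: "A.retr i a \<in> carrier (C i)" by (rule linear_mapD(3)[OF A.retr_linear ab(1)])
  note pl = linear_mapD(4)[OF ctensor_pure_linear(2)[OF A.km B.km ra]]
  have "pt i j (A.retr i a) b = pt i j (A.retr i a) (B.retr j b \<oplus>\<^bsub>C' j\<^esub> (B.dg j b \<oplus>\<^bsub>C' j\<^esub> B.gd j b))"
    using B.decompose[OF ab(2)] by simp
  also have "\<dots> = pt i j (A.retr i a) (B.retr j b) \<oplus>\<^bsub>t i j\<^esub>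
      (pt i j (A.retr i a) (B.dg j b) \<oplus>\<^bsub>t i j\<^esub> pt i j (A.retr i a) (B.gd j b))"
    using c by (simp add: pl)
  finally show "tm i j (A.retr i) id (pt i j a b) = tm i j (A.retr i) (B.retr j) (pt i j a b) \<oplus>\<^bsub>t i j\<^esub>
    (tm i j (A.retr i) (B.dg j) (pt i j a b) \<oplus>\<^bsub>t i j\<^esub> tm i j (A.retr i) (B.gd j) (pt i j a b))"
    unfolding tm_pure[OF A.retr_linear linear_map_id ab] tm_pure[OF A.retr_linear B.retr_linear ab]
      tm_pure[OF A.retr_linear B.dg_linear ab] tm_pure[OF A.retr_linear B.gd_linear ab] id_apply .
qed

lemma hmap_closed:
  assumes x: "x \<in> carrier (T n)"
  shows "hmap n x \<in> carrier (T (Suc n))"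
proof -
  have "hmap n x j \<in> carrier (t j (Suc n - j))" if j: "j \<le> Suc n" for j
  proof -
    interpret k: kmod "t j (Suc n - j)" by (rule t_kmod)
    have 1: "tm j (Suc n - j) (g (j - 1)) id (x (j - 1)) \<in> carrier (t j (Suc n - j))" if j0: "j \<noteq> 0"
    proof -
      obtain i where i: "j = Suc i" using j0 not0_implies_Suc by blast
      have "x i \<in> carrier (t i (n - i))" by (rule T_carrier[OF x]) (use i j in simp)
      then show ?thesis using linear_mapD(3)[OF tm_linear[OF A.g linear_map_id]] i by simp
    qed
    have 2: "tm j (Suc n - j) (A.retr j) (g' (n - j)) (x j) \<in> carrier (t j (Suc n - j))" if jn: "j \<noteq> Suc n"
    proof -
      have "x j \<in> carrier (t j (n - j))" by (rule T_carrier[OF x]) (use jn j in simp)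
      moreover have "Suc n - j = Suc (n - j)" using jn j by simp
      ultimately show ?thesis using linear_mapD(3)[OF tm_linear[OF A.retr_linear B.g]] by simp
    qed
    have "(if j = 0 then \<zero>\<^bsub>t j (Suc n - j)\<^esub> else tm j (Suc n - j) (g (j - 1)) id (x (j - 1))) \<in> carrier (t j (Suc n - j))"
    proof (cases "j = 0")
      case True show ?thesis unfolding if_P[OF True] by (rule k.zero_closed)
    next
      case False show ?thesis unfolding if_not_P[OF False] by (rule 1[OF False])
    qed
    moreover have "(if j = Suc n then \<zero>\<^bsub>t j (Suc n - j)\<^esub>
        else ((-1) ^ j) \<odot>\<^bsub>t j (Suc n - j)\<^esub> tm j (Suc n - j) (A.retr j) (g' (n - j)) (x j)) \<in> carrier (t j (Suc n - j))"
    proof (cases "j = Suc n")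
      case True show ?thesis unfolding if_P[OF True] by (rule k.zero_closed)
    next
      case False show ?thesis unfolding if_not_P[OF False] by (rule k.smult_closed[OF 2[OF False]])
    qed
    moreover have "j \<in> {..Suc n}" using j by simp
    ultimately show ?thesis unfolding hmap_def restrict_apply by (simp only: if_True k.a_closed)
  qed
  moreover have "hmap n x \<in> extensional {..Suc n}" by (simp add: hmap_def)
  ultimately show ?thesis by (auto simp: tensor_complex_def direct_sum_simps PiE_def)
qed

text \<open>On a cycle the other term of the homotopy formula vanishes. Split 1 as \<open>r
  \<otimes> r' + r \<otimes> (d g' + g' d) + (d g + g d) \<otimes> 1\<close>; the cycle equation
  kills \<open>r \<otimes> g' d\<close>, and the remaining terms are the differential of
  \<open>hmap n x\<close>.\<close>

lemma homotopy:
  assumes x: "x \<in> TC.Z n" and j: "j \<le> n"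
  shows "x j = tm j (n - j) (A.retr j) (B.retr (n - j)) (x j) \<oplus>\<^bsub>t j (n - j)\<^esub> D (Suc n) (hmap n x) j"
proof -
  have xT: "x \<in> carrier (T n)" by (rule TC.cycleD(1)[OF x])
  let ?m = "n - j"
  have xj: "x j \<in> carrier (t j ?m)" by (rule T_carrier[OF xT j])
  interpret k: kmod "t j ?m" by (rule t_kmod)
  have cyc: "L i (m - i) (x (Suc i)) \<oplus>\<^bsub>t i (m - i)\<^esub> ((-1) ^ i) \<odot>\<^bsub>t i (m - i)\<^esub> R i (m - i) (x i) = \<zero>\<^bsub>t i (m - i)\<^esub>"
    if "n = Suc m" "i \<le> m" for i m
  proof -
    have "D (Suc m) x i = \<zero>\<^bsub>T m\<^esub> i" using TC.cycleD(2)[of x m] x that by simp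
    then show ?thesis unfolding D_apply[OF that(2)] T_simps(2)[OF that(2)] .
  qed
  \<comment> \<open>Apply \<open>r \<otimes> g'\<close> to the cycle equation: the part coming from
    \<open>x (Suc j)\<close> vanishes because the retraction kills boundaries, which leaves
    \<open>r \<otimes> g' d\<close> up to sign.\<close>
  have pg': "tm j ?m (A.retr j) (B.gd ?m) (x j) = \<zero>\<^bsub>t j ?m\<^esub>"
  proof (cases ?m)
    case 0
    then show ?thesis
      using tm_zero[OF A.retr_linear B.gd_linear _ xj] by (simp add: B.gd_def)
  next
    case (Suc m)
    have jn: "n = Suc (j + m)" "j \<le> j + m" "j + m - j = m" using Suc j by auto
    interpret k': kmod "t j m" by (rule t_kmod)
    have sx: "x (Suc j) \<in> carrier (t (Suc j) m)" using T_carrier[OF xT, of "Suc j"] jn by simp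
    have xj': "x j \<in> carrier (t j (Suc m))" using xj Suc by simp
    let ?F = "tm j (Suc m) (A.retr j) (g' m)"
    have F: "linear_map (t j m) (t j (Suc m)) ?F" by (rule tm_linear[OF A.retr_linear B.g])
    have Lc: "L j m (x (Suc j)) \<in> carrier (t j m)" "R j m (x j) \<in> carrier (t j m)"
      using linear_mapD(3)[OF L_linear sx] linear_mapD(3)[OF R_linear xj'] .
    have 1: "?F (L j m (x (Suc j))) = \<zero>\<^bsub>t j (Suc m)\<^esub>"
      unfolding L_def tm_compose[OF A.lin linear_map_id A.retr_linear B.g sx]
      by (rule tm_zero[OF linear_map_compose[OF A.lin A.retr_linear] linear_map_compose[OF linear_map_id B.g] _ sx])
        (simp add: A.retr_d)
    have 2: "?F (R j m (x j)) = tm j (Suc m) (A.retr j) (B.gd (Suc m)) (x j)"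
      unfolding R_def tm_compose[OF linear_map_id B.lin A.retr_linear B.g xj'] by (simp add: B.gd_def[abs_def])
    let ?e = "tm j (Suc m) (A.retr j) (B.gd (Suc m)) (x j)"
    interpret k1: kmod "t j (Suc m)" by (rule t_kmod)
    have e: "?e \<in> carrier (t j (Suc m))" by (rule linear_mapD(3)[OF tm_linear[OF A.retr_linear B.gd_linear] xj'])
    have "?F (L j m (x (Suc j)) \<oplus>\<^bsub>t j m\<^esub> ((-1) ^ j) \<odot>\<^bsub>t j m\<^esub> R j m (x j)) = \<zero>\<^bsub>t j (Suc m)\<^esub>"
      using cyc[OF jn(1,2)] additive_map_zero[OF t_abelian t_abelian linear_mapD(1)[OF F]] by (simp only: jn(3))
    then have "((-1) ^ j) \<odot>\<^bsub>t j (Suc m)\<^esub> ?e = \<zero>\<^bsub>t j (Suc m)\<^esub>"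
      using Lc e by (simp add: linear_mapD(4)[OF F] linear_mapD(2)[OF F] 1 2)
    then have "?e = \<zero>\<^bsub>t j (Suc m)\<^esub>"
      using k1.neg_one_power_twice[OF e, of j] by simp
    then show ?thesis using Suc by simp
  qed
  have hj1: "hmap n x (Suc j) = tm (Suc j) ?m (g j) id (x j) \<oplus>\<^bsub>t (Suc j) ?m\<^esub>
      (if j = n then \<zero>\<^bsub>t (Suc j) ?m\<^esub>
       else ((-1) ^ Suc j) \<odot>\<^bsub>t (Suc j) ?m\<^esub> tm (Suc j) ?m (A.retr (Suc j)) (g' (n - Suc j)) (x (Suc j)))"
    using j by (simp add: hmap_def)
  have gx: "tm (Suc j) ?m (g j) id (x j) \<in> carrier (t (Suc j) ?m)"
    by (rule linear_mapD(3)[OF tm_linear[OF A.g linear_map_id] xj])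
  interpret kS: kmod "t (Suc j) ?m" by (rule t_kmod)
  \<comment> \<open>The first half of the differential yields \<open>d g \<otimes> 1\<close>; the
    \<open>r \<otimes> g'\<close> part dies because the retraction takes values in cycles.\<close>
  have l: "L j ?m (hmap n x (Suc j)) = tm j ?m (A.dg j) id (x j)"
  proof -
    have a: "L j ?m (tm (Suc j) ?m (g j) id (x j)) = tm j ?m (A.dg j) id (x j)"
      unfolding L_def tm_compose[OF A.g linear_map_id A.lin linear_map_id xj] by (simp add: A.dg_def[abs_def] id_def)
    have dgc: "tm j ?m (A.dg j) id (x j) \<in> carrier (t j ?m)"
      by (rule linear_mapD(3)[OF tm_linear[OF A.dg_linear linear_map_id] xj])
    show ?thesis
    proof (cases "j = n")
      case True
      show ?thesis using gx a dgc additive_map_zero[OF t_abelian t_abelian linear_mapD(1)[OF L_linear]]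
        unfolding hj1 if_P[OF True] by (simp add: linear_mapD(4)[OF L_linear])
    next
      case False
      then have m: "?m = Suc (n - Suc j)" using j by simp
      have sx: "x (Suc j) \<in> carrier (t (Suc j) (n - Suc j))" by (rule T_carrier[OF xT]) (use False j in simp)
      let ?f = "tm (Suc j) ?m (A.retr (Suc j)) (g' (n - Suc j)) (x (Suc j))"
      have f: "?f \<in> carrier (t (Suc j) ?m)"
        using linear_mapD(3)[OF tm_linear[OF A.retr_linear B.g] sx] m by simp
      have g'l: "linear_map (C' (n - Suc j)) (C' ?m) (g' (n - Suc j))" using B.g[of "n - Suc j"] m by simp
      have "L j ?m ?f = \<zero>\<^bsub>t j ?m\<^esub>"
        unfolding L_def tm_compose[OF A.retr_linear g'l A.lin linear_map_id sx]
        by (rule tm_zero[OF linear_map_compose[OF A.retr_linear A.lin] linear_map_compose[OF g'l linear_map_id] _ sx])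
          (simp add: A.d_retr)
      then show ?thesis
        using gx f a dgc unfolding hj1 if_not_P[OF False]
        by (simp add: linear_mapD(4)[OF L_linear] linear_mapD(2)[OF L_linear] del: power_Suc)
    qed
  qed
  \<comment> \<open>The term \<open>g \<otimes> d'\<close> on component j - 1 turns by the cycle
    equation into \<open>g d \<otimes> 1\<close> on component j. In the term
    \<open>r \<otimes> d g'\<close> the sign of the homotopy cancels that of the
    differential.\<close>
  have r: "((-1) ^ j) \<odot>\<^bsub>t j ?m\<^esub> R j ?m (hmap n x j) = tm j ?m (A.gd j) id (x j) \<oplus>\<^bsub>t j ?m\<^esub> tm j ?m (A.retr j) (B.dg ?m) (x j)"
  proof -
    have mS: "Suc n - j = Suc ?m" using j by (rule Suc_diff_le)
    interpret kS': kmod "t j (Suc ?m)" by (rule t_kmod)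
    let ?f = "tm j (Suc ?m) (A.retr j) (g' ?m) (x j)"
    have f: "?f \<in> carrier (t j (Suc ?m))" by (rule linear_mapD(3)[OF tm_linear[OF A.retr_linear B.g] xj])
    have Rf: "R j ?m ?f = tm j ?m (A.retr j) (B.dg ?m) (x j)"
      unfolding R_def tm_compose[OF A.retr_linear B.g linear_map_id B.lin xj] by (simp add: B.dg_def[abs_def] id_def)
    have Rfc: "tm j ?m (A.retr j) (B.dg ?m) (x j) \<in> carrier (t j ?m)"
      by (rule linear_mapD(3)[OF tm_linear[OF A.retr_linear B.dg_linear] xj])
    have hj: "hmap n x j = (if j = 0 then \<zero>\<^bsub>t j (Suc ?m)\<^esub> else tm j (Suc ?m) (g (j - 1)) id (x (j - 1)))
        \<oplus>\<^bsub>t j (Suc ?m)\<^esub> ((-1) ^ j) \<odot>\<^bsub>t j (Suc ?m)\<^esub> ?f"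
      using j by (simp add: hmap_def mS)
    show ?thesis
    proof (cases j)
      case 0
      have "hmap n x j = ((-1) ^ j) \<odot>\<^bsub>t j (Suc ?m)\<^esub> ?f"
        using f unfolding hj if_P[OF 0] by simp
      moreover have "tm j ?m (A.gd j) id (x j) = \<zero>\<^bsub>t j ?m\<^esub>"
        using tm_zero[OF A.gd_linear linear_map_id _ xj] 0 by (simp add: A.gd_def)
      ultimately show ?thesis
        using f Rf Rfc by (simp add: linear_mapD(2)[OF R_linear] k.neg_one_power_twice)
    next
      case (Suc i)
      have ni: "n = Suc (i + ?m)" "i \<le> i + ?m" "i + ?m - i = ?m" "n - i = Suc ?m" using Suc j by auto
      have xi: "x i \<in> carrier (t i (Suc ?m))" using T_carrier[OF xT, of i] ni by simp
      let ?u = "tm j (Suc ?m) (g i) id (x i)"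
      have gi: "linear_map (C i) (C j) (g i)" using A.g[of i] Suc by simp
      have u: "?u \<in> carrier (t j (Suc ?m))" by (rule linear_mapD(3)[OF tm_linear[OF gi linear_map_id] xi])
      have h: "hmap n x j = ?u \<oplus>\<^bsub>t j (Suc ?m)\<^esub> ((-1) ^ j) \<odot>\<^bsub>t j (Suc ?m)\<^esub> ?f"
      proof -
        have j0: "j \<noteq> 0" "j - 1 = i" using Suc by auto
        show ?thesis unfolding hj if_not_P[OF j0(1)] j0(2) ..
      qed
      let ?v = "tm j ?m (g i) (d' (Suc ?m)) (x i)"
      have v: "?v \<in> carrier (t j ?m)" by (rule linear_mapD(3)[OF tm_linear[OF gi B.lin] xi])
      have Ru: "R j ?m ?u = ?v"
        unfolding R_def tm_compose[OF gi linear_map_id linear_map_id B.lin xi] by (simp add: id_def)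
      interpret ki: kmod "t i ?m" by (rule t_kmod)
      let ?F = "tm j ?m (g i) id"
      have F: "linear_map (t i ?m) (t j ?m) ?F" by (rule tm_linear[OF gi linear_map_id])
      have xSi: "x (Suc i) \<in> carrier (t (Suc i) ?m)" using xj Suc by simp
      have Lc: "L i ?m (x (Suc i)) \<in> carrier (t i ?m)" "R i ?m (x i) \<in> carrier (t i ?m)"
        using linear_mapD(3)[OF L_linear xSi] linear_mapD(3)[OF R_linear xi] .
      have 1: "?F (L i ?m (x (Suc i))) = tm j ?m (A.gd j) id (x j)"
        unfolding L_def tm_compose[OF A.lin linear_map_id gi linear_map_id xSi]
        using Suc by (simp add: A.gd_def[abs_def] id_def)
      have 2: "?F (R i ?m (x i)) = ?v"
        unfolding R_def tm_compose[OF linear_map_id B.lin gi linear_map_id xi] by (simp add: id_def)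
      have gdc: "tm j ?m (A.gd j) id (x j) \<in> carrier (t j ?m)"
        by (rule linear_mapD(3)[OF tm_linear[OF A.gd_linear linear_map_id] xj])
      have "?F (L i ?m (x (Suc i)) \<oplus>\<^bsub>t i ?m\<^esub> ((-1) ^ i) \<odot>\<^bsub>t i ?m\<^esub> R i ?m (x i)) = \<zero>\<^bsub>t j ?m\<^esub>"
        using cyc[OF ni(1,2)] additive_map_zero[OF t_abelian t_abelian linear_mapD(1)[OF F]] by (simp only: ni(3))
      then have z: "tm j ?m (A.gd j) id (x j) \<oplus>\<^bsub>t j ?m\<^esub> ((-1) ^ i) \<odot>\<^bsub>t j ?m\<^esub> ?v = \<zero>\<^bsub>t j ?m\<^esub>"
        using Lc by (simp add: linear_mapD(4)[OF F] linear_mapD(2)[OF F] 1 2)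
      have neg: "((-1) ^ j) \<odot>\<^bsub>t j ?m\<^esub> ?v = \<ominus>\<^bsub>t j ?m\<^esub> (((-1) ^ i) \<odot>\<^bsub>t j ?m\<^esub> ?v)"
        using k.neg_smult[OF v, of "(-1) ^ i"] Suc by simp
      have "((-1) ^ j) \<odot>\<^bsub>t j ?m\<^esub> ?v = tm j ?m (A.gd j) id (x j)"
        unfolding neg using z gdc v by (intro k.minus_equality) simp_all
      then show ?thesis
        unfolding h using u f v Rfc
        by (simp add: linear_mapD(4)[OF R_linear] linear_mapD(2)[OF R_linear] Ru Rf k.smult_add k.neg_one_power_twice)
    qed
  qed
  let ?rr = "tm j ?m (A.retr j) (B.retr ?m) (x j)" and ?rd = "tm j ?m (A.retr j) (B.dg ?m) (x j)"
  let ?d1 = "tm j ?m (A.dg j) id (x j)" and ?g1 = "tm j ?m (A.gd j) id (x j)"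
  have c: "?rr \<in> carrier (t j ?m)" "?rd \<in> carrier (t j ?m)" "?d1 \<in> carrier (t j ?m)" "?g1 \<in> carrier (t j ?m)"
    using linear_mapD(3)[OF tm_linear[OF A.retr_linear B.retr_linear] xj]
      linear_mapD(3)[OF tm_linear[OF A.retr_linear B.dg_linear] xj]
      linear_mapD(3)[OF tm_linear[OF A.dg_linear linear_map_id] xj]
      linear_mapD(3)[OF tm_linear[OF A.gd_linear linear_map_id] xj] .
  have "x j = (?rr \<oplus>\<^bsub>t j ?m\<^esub> (?rd \<oplus>\<^bsub>t j ?m\<^esub> \<zero>\<^bsub>t j ?m\<^esub>)) \<oplus>\<^bsub>t j ?m\<^esub> (?d1 \<oplus>\<^bsub>t j ?m\<^esub> ?g1)"
    using tm_split_left[OF xj] unfolding tm_split_right[OF xj] pg' .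
  also have "\<dots> = ?rr \<oplus>\<^bsub>t j ?m\<^esub> (?d1 \<oplus>\<^bsub>t j ?m\<^esub> (?g1 \<oplus>\<^bsub>t j ?m\<^esub> ?rd))"
    using c by (simp add: k.a_ac)
  also have "?d1 \<oplus>\<^bsub>t j ?m\<^esub> (?g1 \<oplus>\<^bsub>t j ?m\<^esub> ?rd) = D (Suc n) (hmap n x) j"
    unfolding D_apply[OF j] l r ..
  finally show ?thesis .
qed

text \<open>The surjective half of the algebraic Kuenneth theorem: a cycle \<open>x\<close> is homologous to its image
  under the tensor square of the retractions, which consists of tensors of cycles.\<close>

lemma cross_surj:
  assumes x: "x \<in> TC.Z n"
  obtains y where "y \<in> carrier (direct_sum {..n} (\<lambda>i. ctensor (A.H i) (B.H (n - i))))"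
    "homology_cross C d C' d' n y = TC.cl n x"
proof -
  have xT: "x \<in> carrier (T n)" by (rule TC.cycleD(1)[OF x])
  define rA where "rA i a = A.cl i (A.retr i a)" for i a
  define rB where "rB i b = B.cl i (B.retr i b)" for i b
  \<comment> \<open>Both tensor factors are retracted to cycles and replaced by their classes. This
    is possible for every chain, although a cycle of the tensor complex need not be given as a sum
    of tensors of cycles.\<close>
  define y where "y = (\<lambda>i\<in>{..n}. tensor_map UNIV (A.H i) (B.H (n - i)) (rA i) (rB (n - i)) (x i))"
  have rA: "linear_map (C i) (A.H i) (rA i)" for i
    unfolding rA_def linear_map_def additive_map_def
    using linear_mapD[OF A.retr_linear] A.retr_cycle
    by (auto simp: A.cl_add A.cl_smult A.cl_in_H)
  have rB: "linear_map (C' i) (B.H i) (rB i)" for i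
    unfolding rB_def linear_map_def additive_map_def
    using linear_mapD[OF B.retr_linear] B.retr_cycle
    by (auto simp: B.cl_add B.cl_smult B.cl_in_H)
  note tH = ctensor_map[OF A.km B.km A.H_kmod B.H_kmod rA rB]
  define f where "f i = S n i (tm i (n - i) (A.retr i) (B.retr (n - i)) (x i))" for i
  have rrl: "linear_map (t i (n - i)) (t i (n - i)) (tm i (n - i) (A.retr i) (B.retr (n - i)))" for i
    by (rule tm_linear[OF A.retr_linear B.retr_linear])
  have Scyc: "S n i (tm i (n - i) (A.retr i) (B.retr (n - i)) u) \<in> TC.Z n" if i: "i \<le> n" and u: "u \<in> carrier (t i (n - i))" for i u
  proof (rule S_cycle[OF i linear_mapD(3)[OF rrl u]])
    show "L i' (n - i) (tm i (n - i) (A.retr i) (B.retr (n - i)) u) = \<zero>\<^bsub>t i' (n - i)\<^esub>" if "i = Suc i'" for i'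
    proof -
      have l: "linear_map (C i) (C i') (d (Suc i'))" using A.lin[of i'] that by simp
      have "L i' (n - i) (tm i (n - i) (A.retr i) (B.retr (n - i)) u) =
          tm i' (n - i) (\<lambda>a. d (Suc i') (A.retr i a)) (\<lambda>b. id (B.retr (n - i) b)) u"
        unfolding L_def by (rule tm_compose[OF A.retr_linear B.retr_linear l linear_map_id u])
      also have "\<dots> = \<zero>\<^bsub>t i' (n - i)\<^esub>"
        by (rule tm_zero[OF linear_map_compose[OF A.retr_linear l] linear_map_compose[OF B.retr_linear linear_map_id] _ u])
          (use that A.d_retr in auto)
      finally show ?thesis .
    qed
    show "R i m (tm i (n - i) (A.retr i) (B.retr (n - i)) u) = \<zero>\<^bsub>t i m\<^esub>" if "n - i = Suc m" for m
    proof -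
      have l: "linear_map (C' (n - i)) (C' m) (d' (Suc m))" using B.lin[of m] that by simp
      have "R i m (tm i (n - i) (A.retr i) (B.retr (n - i)) u) =
          tm i m (\<lambda>a. id (A.retr i a)) (\<lambda>b. d' (Suc m) (B.retr (n - i) b)) u"
        unfolding R_def by (rule tm_compose[OF A.retr_linear B.retr_linear linear_map_id l u])
      also have "\<dots> = \<zero>\<^bsub>t i m\<^esub>"
        by (rule tm_zero[OF linear_map_compose[OF A.retr_linear linear_map_id] linear_map_compose[OF B.retr_linear l] _ u])
          (use that B.d_retr in auto)
      finally show ?thesis .
    qed
  qed
  have yi: "y i = tensor_map UNIV (A.H i) (B.H (n - i)) (rA i) (rB (n - i)) (x i)" if "i \<le> n" for i
    using that by (simp add: y_def)
  have val: "tensor_lift (TC.H n) (cross_pair n i) (y i) = TC.cl n (f i)" if i: "i \<le> n" for i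
    unfolding yi[OF i] f_def
  proof (rule t_eqI[OF TC.H_kmod[unfolded kmod_def amod_def, THEN conjunct1, THEN conjunct1] _ _ _ T_carrier[OF xT i]])
    show "additive_map (t i (n - i)) (TC.H n)
      (\<lambda>u. tensor_lift (TC.H n) (cross_pair n i) (tensor_map UNIV (A.H i) (B.H (n - i)) (rA i) (rB (n - i)) u))"
      by (rule linear_mapD(1)[OF linear_map_compose[OF tH(1) cross_lift(1)[OF i]]])
    show "additive_map (t i (n - i)) (TC.H n) (\<lambda>u. TC.cl n (S n i (tm i (n - i) (A.retr i) (B.retr (n - i)) u)))"
      unfolding additive_map_def
      using Scyc[OF i] linear_mapD(3)[OF rrl] linear_mapD(4)[OF rrl] linear_mapD(4)[OF S_linear[OF i]]
      by (auto simp: TC.cl_in_H TC.cl_add)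
    fix a b assume ab: "a \<in> carrier (C i)" "b \<in> carrier (C' (n - i))"
    have "tensor_map UNIV (A.H i) (B.H (n - i)) (rA i) (rB (n - i)) (pt i (n - i) a b) =
        tensor_pure UNIV (A.H i) (B.H (n - i)) (A.cl i (A.retr i a)) (B.cl (n - i) (B.retr (n - i) b))"
      using tH(2)[OF ab] by (simp only: rA_def rB_def)
    then show "tensor_lift (TC.H n) (cross_pair n i)
        (tensor_map UNIV (A.H i) (B.H (n - i)) (rA i) (rB (n - i)) (pt i (n - i) a b)) =
      TC.cl n (S n i (tm i (n - i) (A.retr i) (B.retr (n - i)) (pt i (n - i) a b)))"
      using cross_lift(2)[OF i A.retr_cycle[OF ab(1)] B.retr_cycle[OF ab(2)]]
      by (simp only: tm_pure[OF A.retr_linear B.retr_linear ab])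
  qed
  interpret H: kmod "TC.H n" by (rule TC.H_kmod)
  interpret Tn: kmod "T n" by (rule T_kmod)
  have fZ: "f \<in> {..n} \<rightarrow> TC.Z n"
    unfolding f_def using Scyc T_carrier[OF xT] by auto
  have yc: "y \<in> carrier (direct_sum {..n} (\<lambda>i. ctensor (A.H i) (B.H (n - i))))"
    unfolding direct_sum_simps y_def using linear_mapD(3)[OF tH(1) T_carrier[OF xT]] by auto
  have "homology_cross C d C' d' n y = (\<Oplus>\<^bsub>TC.H n\<^esub>i\<in>{..n}. TC.cl n (f i))"
    unfolding homology_cross_eq using fZ TC.cl_in_H by (intro H.finsum_cong') (auto simp: val)
  also have "\<dots> = TC.cl n (finsum (T n) f {..n})"
    by (rule finsum_cycle(2)[symmetric]) (use fZ in auto)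
  also have "\<dots> = TC.cl n x"
  proof -
    define z where "z = (\<lambda>i\<in>{..n}. tm i (n - i) (A.retr i) (B.retr (n - i)) (x i))"
    have zT: "z \<in> carrier (T n)"
      unfolding z_def tensor_complex_def direct_sum_simps using linear_mapD(3)[OF rrl T_carrier[OF xT]] by auto
    have "z = (\<Oplus>\<^bsub>T n\<^esub>i\<in>{..n}. S n i (z i))"
      unfolding tensor_complex_def
      by (rule direct_sum_decompose) (use zT t_kmod in \<open>auto simp: tensor_complex_def\<close>)
    also have "\<dots> = finsum (T n) f {..n}"
      by (rule Tn.finsum_cong') (use fZ TC.cycleD(1) in \<open>auto simp: z_def f_def\<close>)
    finally have zf: "z = finsum (T n) f {..n}" .
    have zZ: "z \<in> TC.Z n" unfolding zf by (rule finsum_cycle(1)) (use fZ in auto)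
    have hT: "D (Suc n) (hmap n x) \<in> carrier (T n)" by (rule D_closed[OF hmap_closed[OF xT]])
    have "x = z \<oplus>\<^bsub>T n\<^esub> D (Suc n) (hmap n x)"
      by (rule T_eqI[OF xT Tn.a_closed[OF zT hT]]) (use homotopy[OF x] in \<open>simp add: T_simps z_def\<close>)
    then have "x \<ominus>\<^bsub>T n\<^esub> z = D (Suc n) (hmap n x)"
      using Tn.add_diff_cancel_left[OF zT hT] by simp
    moreover have "D (Suc n) (hmap n x) \<in> TC.Bd n" by (rule TC.boundaryI[OF hmap_closed[OF xT]])
    ultimately have "TC.cl n x = TC.cl n z" using TC.cl_eq_iff[OF x zZ] by simp
    then show ?thesis unfolding zf by simp
  qed
  finally show thesis by (rule that[OF yc])
qed

end

section \<open>Evaluating a cocycle on the tensor complex\<close>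

lemma scalar_module_kmod: "kmod (scalar_module :: ('k::comm_ring_1, 'k) module)"
proof -
  have "abelian_group (scalar_module :: ('k, 'k) module)"
    by (rule abelian_groupI) (auto simp: scalar_module_def algebra_simps intro!: exI[of _ "- _"])
  then interpret abelian_group "scalar_module :: ('k, 'k) module" .
  show ?thesis by unfold_locales (auto simp: scalar_module_def algebra_simps)
qed

lemma scalar_module_simps:
  "carrier scalar_module = UNIV" "a \<oplus>\<^bsub>scalar_module\<^esub> b = a + b" "r \<odot>\<^bsub>scalar_module\<^esub> a = r * a"
  "\<zero>\<^bsub>scalar_module\<^esub> = 0"
  by (simp_all add: scalar_module_def)

context complex_pair
begin

text \<open>The map \<open>\<phi> \<otimes> 1\<close> on component 1, with the scalars absorbed into
  \<open>C' q\<close>. After the diagonal and the Alexander-Whitney map it becomes the cap product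
  with \<phi>.\<close>

definition cap where
  "cap \<phi> q x = tensor_lift (C' q) (\<lambda>a b. \<phi> a \<odot>\<^bsub>C' q\<^esub> b) (x 1)"

context
  fixes \<phi> :: "'m \<Rightarrow> 'k"
  assumes \<phi>: "linear_map (C 1) scalar_module \<phi>" and coc: "\<And>x. x \<in> carrier (C 2) \<Longrightarrow> \<phi> (d 2 x) = 0"
  notes [simp del] = One_nat_def
begin

lemma cap_lift:
  "linear_map (t 1 q) (C' q) (tensor_lift (C' q) (\<lambda>a b. \<phi> a \<odot>\<^bsub>C' q\<^esub> b))"
  "a \<in> carrier (C 1) \<Longrightarrow> b \<in> carrier (C' q) \<Longrightarrow>
    tensor_lift (C' q) (\<lambda>a b. \<phi> a \<odot>\<^bsub>C' q\<^esub> b) (pt 1 q a b) = \<phi> a \<odot>\<^bsub>C' q\<^esub> b"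
proof -
  interpret C'q: kmod "C' q" by (rule B.km)
  have left: "linear_map (C 1) (C' q) (\<lambda>m. \<phi> m \<odot>\<^bsub>C' q\<^esub> n)" if "n \<in> carrier (C' q)" for n
    using that linear_mapD[OF \<phi>]
    by (auto simp: linear_map_def additive_map_def scalar_module_simps C'q.add_smult C'q.mult_smult)
  have right: "linear_map (C' q) (C' q) (\<lambda>n. \<phi> m \<odot>\<^bsub>C' q\<^esub> n)" for m
    using linear_map_smult[OF B.km linear_map_id, of q "\<phi> m"] by simp
  show "linear_map (t 1 q) (C' q) (tensor_lift (C' q) (\<lambda>a b. \<phi> a \<odot>\<^bsub>C' q\<^esub> b))"
    by (rule ctensor_lift(1)[OF A.km B.km B.km]) (simp_all add: left right)
  show "tensor_lift (C' q) (\<lambda>a b. \<phi> a \<odot>\<^bsub>C' q\<^esub> b) (pt 1 q a b) = \<phi> a \<odot>\<^bsub>C' q\<^esub> b"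
    if "a \<in> carrier (C 1)" "b \<in> carrier (C' q)"
    by (rule ctensor_lift(2)[OF A.km B.km B.km _ _ _ that]) (simp_all add: left right)
qed

lemma proj1_linear: "linear_map (T (Suc q)) (t 1 q) (\<lambda>x. x 1)"
  using T_carrier[of _ "Suc q" 1] T_simps[of 1 "Suc q"] by (auto simp: linear_map_def additive_map_def)

lemma cap_linear: "linear_map (T (Suc q)) (C' q) (cap \<phi> q)"
  unfolding cap_def[abs_def] by (rule linear_map_compose[OF proj1_linear cap_lift(1)])

text \<open>Component 1 of the differential consists of \<open>d \<otimes> 1\<close> on component 2,
  which the cocycle kills, and \<open>1 \<otimes> d'\<close> on component 1 with the sign
  \<open>(-1)^1\<close>.\<close>

lemma cap_D:
  assumes x: "x \<in> carrier (T (Suc (Suc q)))"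
  shows "cap \<phi> q (D (Suc (Suc q)) x) = \<ominus>\<^bsub>C' q\<^esub> d' (Suc q) (cap \<phi> (Suc q) x)"
proof -
  let ?M = "\<lambda>q. tensor_lift (C' q) (\<lambda>a b. \<phi> a \<odot>\<^bsub>C' q\<^esub> b)"
  interpret C'q: kmod "C' q" by (rule B.km)
  interpret tq: kmod "t 1 q" by (rule t_kmod)
  have x2: "x 2 \<in> carrier (t 2 q)" and x1: "x 1 \<in> carrier (t 1 (Suc q))"
    using T_carrier[OF x, of 2] T_carrier[OF x, of 1] by (auto simp: numeral_2_eq_2)
  have L2: "linear_map (t 2 q) (t 1 q) (L 1 q)" using L_linear[of 1 q] by (simp add: numeral_2_eq_2)
  have Lc: "L 1 q (x 2) \<in> carrier (t 1 q)" "R 1 q (x 1) \<in> carrier (t 1 q)"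
    using linear_mapD(3)[OF L2 x2] linear_mapD(3)[OF R_linear x1] .
  have 1: "?M q (L 1 q (x 2)) = \<zero>\<^bsub>C' q\<^esub>"
  proof (rule t_eqI[OF B.abC _ _ _ x2, where F = "\<lambda>x. ?M q (L 1 q x)"])
    show "additive_map (t 2 q) (C' q) (\<lambda>x. ?M q (L 1 q x))"
      by (rule linear_mapD(1)[OF linear_map_compose[OF L2 cap_lift(1)]])
    show "additive_map (t 2 q) (C' q) (\<lambda>x. \<zero>\<^bsub>C' q\<^esub>)" by (rule additive_map_const_zero[OF B.abC])
    fix a b assume ab: "a \<in> carrier (C 2)" "b \<in> carrier (C' q)"
    have da: "d 2 a \<in> carrier (C 1)" using linear_mapD(3)[OF A.lin[of 1]] ab by (simp add: numeral_2_eq_2)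
    have "L 1 q (pt 2 q a b) = pt 1 q (d 2 a) b"
      using L_pure[of a 1 b q] ab by (simp add: numeral_2_eq_2)
    then show "?M q (L 1 q (pt 2 q a b)) = \<zero>\<^bsub>C' q\<^esub>"
      using cap_lift(2)[OF da ab(2)] coc[OF ab(1)] ab(2) by simp
  qed
  have 2: "?M q (R 1 q (x 1)) = d' (Suc q) (?M (Suc q) (x 1))"
  proof (rule t_eqI[OF B.abC _ _ _ x1, where F = "\<lambda>x. ?M q (R 1 q x)"])
    show "additive_map (t 1 (Suc q)) (C' q) (\<lambda>x. ?M q (R 1 q x))"
      by (rule linear_mapD(1)[OF linear_map_compose[OF R_linear cap_lift(1)]])
    show "additive_map (t 1 (Suc q)) (C' q) (\<lambda>x. d' (Suc q) (?M (Suc q) x))"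
      by (rule linear_mapD(1)[OF linear_map_compose[OF cap_lift(1) B.lin]])
    fix a b assume ab: "a \<in> carrier (C 1)" "b \<in> carrier (C' (Suc q))"
    have db: "d' (Suc q) b \<in> carrier (C' q)" by (rule linear_mapD(3)[OF B.lin ab(2)])
    show "?M q (R 1 q (pt 1 (Suc q) a b)) = d' (Suc q) (?M (Suc q) (pt 1 (Suc q) a b))"
      unfolding R_pure[OF ab] cap_lift(2)[OF ab] cap_lift(2)[OF ab(1) db] linear_mapD(2)[OF B.lin ab(2)] ..
  qed
  have D1: "D (Suc (Suc q)) x 1 = L 1 q (x 2) \<oplus>\<^bsub>t 1 q\<^esub> \<ominus>\<^bsub>t 1 q\<^esub> R 1 q (x 1)"
    using D_apply[of 1 "Suc q" x] tq.neg_smult[OF Lc(2), of 1] Lc by (simp add: numeral_2_eq_2)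
  have Mc: "?M q (R 1 q (x 1)) \<in> carrier (C' q)" by (rule linear_mapD(3)[OF cap_lift(1) Lc(2)])
  show ?thesis
    unfolding cap_def D1 using Lc Mc
    by (simp add: linear_mapD(4)[OF cap_lift(1)] additive_map_neg[OF t_abelian B.abC linear_mapD(1)[OF cap_lift(1)]] 1)
      (simp add: 2)
qed

lemma cap_cycle:
  assumes x: "x \<in> TC.Z (Suc q)"
  shows "cap \<phi> q x \<in> B.Z q"
proof (rule B.cycleI)
  show "cap \<phi> q x \<in> carrier (C' q)" by (rule linear_mapD(3)[OF cap_linear TC.cycleD(1)[OF x]])
  fix m assume q: "q = Suc m"
  interpret C'm: kmod "C' m" by (rule B.km)
  have "cap \<phi> m (D (Suc (Suc m)) x) = \<zero>\<^bsub>C' m\<^esub>"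
    using TC.cycleD(2)[of x "Suc m"] x q additive_map_zero[OF TC.abC B.abC linear_mapD(1)[OF cap_linear]] by simp
  then have "\<ominus>\<^bsub>C' m\<^esub> d' (Suc m) (cap \<phi> (Suc m) x) = \<zero>\<^bsub>C' m\<^esub>"
    using cap_D[of x m] TC.cycleD(1)[OF x] q by simp
  moreover have c: "d' (Suc m) (cap \<phi> (Suc m) x) \<in> carrier (C' m)"
    using linear_mapD(3)[OF B.lin linear_mapD(3)[OF cap_linear]] TC.cycleD(1)[OF x] q by simp
  ultimately have "\<ominus>\<^bsub>C' m\<^esub> \<zero>\<^bsub>C' m\<^esub> = d' (Suc m) (cap \<phi> (Suc m) x)"
    using C'm.minus_minus[OF c] by simp
  moreover have "\<ominus>\<^bsub>C' m\<^esub> \<zero>\<^bsub>C' m\<^esub> = \<zero>\<^bsub>C' m\<^esub>" by (rule C'm.minus_equality) simp_all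
  ultimately show "d' (Suc m) (cap \<phi> q x) = \<zero>\<^bsub>C' m\<^esub>" using q by simp
qed

lemma cap_boundary:
  assumes x: "x \<in> TC.Bd (Suc q)"
  shows "cap \<phi> q x \<in> B.Bd q"
proof -
  obtain y where y: "x = D (Suc (Suc q)) y" "y \<in> carrier (T (Suc (Suc q)))"
    using x unfolding complex_boundaries_def by (elim imageE)
  have "d' (Suc q) (cap \<phi> (Suc q) y) \<in> B.Bd q" by (rule B.boundaryI[OF linear_mapD(3)[OF cap_linear y(2)]])
  then show ?thesis unfolding y(1) cap_D[OF y(2)] by (rule B.boundary_linear(3))
qed

text \<open>\<open>y\<close> is any preimage under the cross product, because
  \<open>kunneth_iso\<close> merely chooses one. Applying the map induced by \<open>cap\<close> to
  the equation for \<open>y\<close> isolates its component 1, which is the one that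
  \<open>nabla\<close> extracts.\<close>

lemma cap_cross:
  assumes y: "y \<in> carrier (direct_sum {..Suc q} (\<lambda>i. ctensor (A.H i) (B.H (Suc q - i))))"
    and w: "w \<in> TC.Z (Suc q)" and cross: "homology_cross C d C' d' (Suc q) y = TC.cl (Suc q) w"
    and f: "linear_map (A.H 1) scalar_module f" "\<And>a. a \<in> A.Z 1 \<Longrightarrow> f (A.cl 1 a) = \<phi> a"
  shows "tensor_lift (B.H q) (module.smult (B.H q)) (tensor_map UNIV scalar_module (B.H q) f id (y 1)) =
    B.cl q (cap \<phi> q w)"
proof -
  let ?n = "Suc q"
  let ?M = "homology_map C' d' q (cap \<phi> q)"
  let ?c = "\<lambda>i. tensor_lift (TC.H ?n) (cross_pair ?n i)"
  let ?r = "\<lambda>u. tensor_lift (B.H q) (module.smult (B.H q)) (tensor_map UNIV scalar_module (B.H q) f id u)"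
  note M = homology_map[OF TC.kcomplex_axioms B.kcomplex_axioms cap_linear]
  have Ml: "linear_map (TC.H ?n) (B.H q) ?M" by (rule M(1)) (erule cap_cycle, erule cap_boundary)
  have Mcl: "?M (TC.cl ?n z) = B.cl q (cap \<phi> q z)" if "z \<in> TC.Z ?n" for z
    by (rule M(2)[OF _ _ that]) (erule cap_cycle, erule cap_boundary)
  interpret HB: kmod "B.H q" by (rule B.H_kmod)
  interpret HT: kmod "TC.H ?n" by (rule TC.H_kmod)
  have yi: "y i \<in> carrier (ctensor (A.H i) (B.H (?n - i)))" if "i \<le> ?n" for i
    using y that by (auto simp: direct_sum_simps)
  have smult_lift:
    "linear_map (ctensor scalar_module (B.H q)) (B.H q) (tensor_lift (B.H q) (module.smult (B.H q)))"
    "V \<in> carrier (B.H q) \<Longrightarrow> tensor_lift (B.H q) (module.smult (B.H q)) (tensor_pure UNIV scalar_module (B.H q) k V) =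
      k \<odot>\<^bsub>B.H q\<^esub> V" for k V
  proof -
    have left: "linear_map scalar_module (B.H q) (\<lambda>m. m \<odot>\<^bsub>B.H q\<^esub> n)" if "n \<in> carrier (B.H q)" for n
      using that by (auto simp: linear_map_def additive_map_def scalar_module_simps HB.add_smult HB.mult_smult)
    have right: "linear_map (B.H q) (B.H q) (\<lambda>n. m \<odot>\<^bsub>B.H q\<^esub> n)" for m
      using linear_map_smult[OF B.H_kmod[of q] linear_map_id, of m] by simp
    show "linear_map (ctensor scalar_module (B.H q)) (B.H q) (tensor_lift (B.H q) (module.smult (B.H q)))"
      by (rule ctensor_lift(1)[OF scalar_module_kmod B.H_kmod B.H_kmod]) (simp_all add: left right)
    show "tensor_lift (B.H q) (module.smult (B.H q)) (tensor_pure UNIV scalar_module (B.H q) k V) = k \<odot>\<^bsub>B.H q\<^esub> V"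
      if "V \<in> carrier (B.H q)"
      by (rule ctensor_lift(2)[OF scalar_module_kmod B.H_kmod B.H_kmod]) (use that in \<open>simp_all add: left right scalar_module_simps\<close>)
  qed
  \<comment> \<open>\<open>cap\<close> reads component 1 only, so the cross products of the other
    summands are sent to zero, while on summand 1 it evaluates \<phi> on the first factor.\<close>
  have comp: "?M (?c i u) = (if i = 1 then ?r u else \<zero>\<^bsub>B.H q\<^esub>)"
    if i: "i \<le> ?n" and u: "u \<in> carrier (ctensor (A.H i) (B.H (?n - i)))" for i u
  proof (rule ctensor_eqI[OF A.H_kmod B.H_kmod HB.abelian_group_axioms _ _ _ u, where F = "\<lambda>u. ?M (?c i u)"])
    show "additive_map (ctensor (A.H i) (B.H (?n - i))) (B.H q) (\<lambda>u. ?M (?c i u))"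
      by (rule linear_mapD(1)[OF linear_map_compose[OF cross_lift(1)[OF i] Ml]])
    show "additive_map (ctensor (A.H i) (B.H (?n - i))) (B.H q) (\<lambda>u. if i = 1 then ?r u else \<zero>\<^bsub>B.H q\<^esub>)"
    proof (cases "i = 1")
      case True
      have "linear_map (ctensor (A.H 1) (B.H q)) (B.H q) ?r"
        by (rule linear_map_compose[OF ctensor_map(1)[OF A.H_kmod B.H_kmod scalar_module_kmod B.H_kmod f(1) linear_map_id]
              smult_lift(1)])
      then show ?thesis using True linear_mapD(1) by simp
    next
      case False
      then show ?thesis using additive_map_const_zero[OF HB.abelian_group_axioms] by simp
    qed
    fix U V assume UV: "U \<in> carrier (A.H i)" "V \<in> carrier (B.H (?n - i))"
    obtain a where a: "a \<in> A.Z i" "U = A.cl i a" using UV(1) by (rule A.H_carrierE)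
    obtain b where b: "b \<in> B.Z (?n - i)" "V = B.cl (?n - i) b" using UV(2) by (rule B.H_carrierE)
    have "?M (?c i (tensor_pure UNIV (A.H i) (B.H (?n - i)) U V)) =
        B.cl q (cap \<phi> q (S ?n i (pt i (?n - i) a b)))"
      unfolding a(2) b(2) cross_lift(2)[OF i a(1) b(1)] by (rule Mcl[OF S_pure_cycle[OF i a(1) b(1)]])
    also have "\<dots> = (if i = 1 then ?r (tensor_pure UNIV (A.H i) (B.H (?n - i)) U V) else \<zero>\<^bsub>B.H q\<^esub>)"
    proof (cases "i = 1")
      case True
      have a1: "a \<in> A.Z 1" and bq: "b \<in> B.Z q" using a(1) b(1) True by auto
      have "cap \<phi> q (S ?n i (pt i (?n - i) a b)) = \<phi> a \<odot>\<^bsub>C' q\<^esub> b"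
        unfolding cap_def using True S_apply[of 1 ?n i "pt i (?n - i) a b"]
          cap_lift(2)[OF A.cycleD(1)[OF a1] B.cycleD(1)[OF bq]] by simp
      moreover have "?r (tensor_pure UNIV (A.H 1) (B.H q) (A.cl 1 a) (B.cl q b)) = \<phi> a \<odot>\<^bsub>B.H q\<^esub> B.cl q b"
        using ctensor_map(2)[OF A.H_kmod B.H_kmod scalar_module_kmod B.H_kmod f(1) linear_map_id A.cl_in_H[OF a1] B.cl_in_H[OF bq]]
          smult_lift(2)[OF B.cl_in_H[OF bq]] f(2)[OF a1] by simp
      ultimately show ?thesis using True a(2) b(2) B.cl_smult[OF bq] by simp
    next
      case False
      have "cap \<phi> q (S ?n i (pt i (?n - i) a b)) = \<zero>\<^bsub>C' q\<^esub>"
        unfolding cap_def using False S_apply[of 1 ?n i "pt i (?n - i) a b"]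
          additive_map_zero[OF t_abelian B.abC linear_mapD(1)[OF cap_lift(1)]] by simp
      then show ?thesis using False B.H_zero[of q] by simp
    qed
    finally show "?M (?c i (tensor_pure UNIV (A.H i) (B.H (?n - i)) U V)) =
      (if i = 1 then ?r (tensor_pure UNIV (A.H i) (B.H (?n - i)) U V) else \<zero>\<^bsub>B.H q\<^esub>)" .
  qed
  have cH: "(\<lambda>i. ?c i (y i)) \<in> {..?n} \<rightarrow> carrier (TC.H ?n)"
    using linear_mapD(3)[OF cross_lift(1) yi] by auto
  have r1: "?r (y 1) \<in> carrier (B.H q)"
    using comp[of 1 "y 1"] yi[of 1] linear_mapD(3)[OF Ml funcset_mem[OF cH, of 1]] by simp
  have "B.cl q (cap \<phi> q w) = ?M (homology_cross C d C' d' ?n y)"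
    unfolding cross by (rule Mcl[OF w, symmetric])
  also have "\<dots> = (\<Oplus>\<^bsub>B.H q\<^esub>i\<in>{..?n}. ?M (?c i (y i)))"
    unfolding homology_cross_eq
    by (rule additive_map_finsum[OF HT.abelian_group_axioms HB.abelian_group_axioms linear_mapD(1)[OF Ml] _ cH]) simp
  also have "\<dots> = (\<Oplus>\<^bsub>B.H q\<^esub>i\<in>{..?n}. if 1 = i then ?r (y 1) else \<zero>\<^bsub>B.H q\<^esub>)"
    using comp yi r1 by (intro HB.finsum_cong') auto
  also have "\<dots> = ?r (y 1)"
    using HB.add.finprod_singleton[of 1 "{..?n}" "\<lambda>_. ?r (y 1)"] r1 by simp
  finally show ?thesis by simp
qed

end

end

section \<open>Chains with coefficients in a commutative ring\<close>

abbreviation pscale :: "'k::comm_ring_1 \<Rightarrow> ('x \<Rightarrow>\<^sub>0 'k) \<Rightarrow> 'x \<Rightarrow>\<^sub>0 'k" where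
  "pscale a \<equiv> Poly_Mapping.map ((*) a)"

lemma lookup_pscale [simp]: "Poly_Mapping.lookup (pscale a c) x = a * Poly_Mapping.lookup c x"
  by (simp add: map.rep_eq when_def)

lemma keys_pscale: "Poly_Mapping.keys (pscale a c) \<subseteq> Poly_Mapping.keys c"
  by (auto simp: in_keys_iff)

lemma pscale_simps [simp]:
  "pscale a 0 = 0" "pscale 0 c = 0" "pscale 1 c = c" "pscale a (pscale b c) = pscale (a * b) c"
  "pscale a (Poly_Mapping.single x b) = Poly_Mapping.single x (a * b)"
  by (auto intro!: poly_mapping_eqI simp: lookup_single when_def algebra_simps)

lemma pscale_add: "pscale a (c + c') = pscale a c + pscale a c'" "pscale (a + b) c = pscale a c + pscale b c"
  by (auto intro!: poly_mapping_eqI simp: lookup_add algebra_simps)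

lemma pscale_minus: "pscale (- a) c = - pscale a c" "pscale a (- c) = - pscale a c"
  by (auto intro!: poly_mapping_eqI)

lemma pscale_sum: "pscale a (sum f A) = (\<Sum>x\<in>A. pscale a (f x))"
  by (auto intro!: poly_mapping_eqI simp: lookup_sum sum_distrib_left)

lemma lin_extend_superset:
  assumes "finite A" "Poly_Mapping.keys c \<subseteq> A"
  shows "lin_extend f c = (\<Sum>x\<in>A. pscale (Poly_Mapping.lookup c x) (f x))"
  unfolding lin_extend_def using assms by (intro sum.mono_neutral_left) (auto simp: in_keys_iff)

lemma lin_extend_0 [simp]: "lin_extend f 0 = 0"
  by (simp add: lin_extend_def)

lemma lin_extend_single [simp]: "lin_extend f (Poly_Mapping.single x k) = pscale k (f x)"
  by (subst lin_extend_superset[of "{x}"]) auto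

lemma lin_extend_add: "lin_extend f (c + c') = lin_extend f c + lin_extend f c'"
proof -
  let ?A = "Poly_Mapping.keys c \<union> Poly_Mapping.keys c'"
  have "Poly_Mapping.keys (c + c') \<subseteq> ?A" by (rule keys_add)
  then show ?thesis
    by (simp add: lin_extend_superset[of ?A] lookup_add pscale_add sum.distrib)
qed

lemma lin_extend_pscale: "lin_extend f (pscale a c) = pscale a (lin_extend f c)"
  using keys_pscale[of a c] by (simp add: lin_extend_superset[of "Poly_Mapping.keys c"] pscale_sum)

lemma lin_extend_minus: "lin_extend f (- c) = - lin_extend f c"
  using lin_extend_add[of f "- c" c] by (simp add: eq_neg_iff_add_eq_0)

lemma lin_extend_diff: "lin_extend f (c - c') = lin_extend f c - lin_extend f c'"
  using lin_extend_add[of f c "- c'"] by (simp add: lin_extend_minus)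

lemma lin_extend_sum: "lin_extend f (sum u A) = (\<Sum>x\<in>A. lin_extend f (u x))"
  by (induction A rule: infinite_finite_induct) (auto simp: lin_extend_add)

lemma keys_lin_extend:
  assumes "\<And>x. x \<in> Poly_Mapping.keys c \<Longrightarrow> Poly_Mapping.keys (f x) \<subseteq> S"
  shows "Poly_Mapping.keys (lin_extend f c) \<subseteq> S"
proof -
  have "Poly_Mapping.keys (lin_extend f c) \<subseteq>
      (\<Union>x\<in>Poly_Mapping.keys c. Poly_Mapping.keys (pscale (Poly_Mapping.lookup c x) (f x)))"
    unfolding lin_extend_def by (rule keys_sum)
  also have "\<dots> \<subseteq> S" using assms keys_pscale by fast
  finally show ?thesis .
qed

lemma poly_mapping_decompose:
  fixes c :: "'x \<Rightarrow>\<^sub>0 'k::comm_monoid_add"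
  shows "c = (\<Sum>x\<in>Poly_Mapping.keys c. Poly_Mapping.single x (Poly_Mapping.lookup c x))"
  by (rule poly_mapping_eqI)
    (auto simp: lookup_sum lookup_single when_def in_keys_iff if_distrib sum.If_cases cong: if_cong)

lemma chain_induct [consumes 1, case_names zero single add]:
  fixes c :: "'x \<Rightarrow>\<^sub>0 'k::comm_monoid_add"
  assumes c: "Poly_Mapping.keys c \<subseteq> S" and P0: "P 0"
    and s: "\<And>x k. x \<in> S \<Longrightarrow> P (Poly_Mapping.single x k)"
    and a: "\<And>u v. \<lbrakk>Poly_Mapping.keys u \<subseteq> S; Poly_Mapping.keys v \<subseteq> S; P u; P v\<rbrakk> \<Longrightarrow> P (u + v)"
  shows "P c"
proof -
  let ?f = "\<lambda>x. Poly_Mapping.single x (Poly_Mapping.lookup c x)"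
  have "Poly_Mapping.keys (sum ?f A) \<subseteq> S \<and> P (sum ?f A)" if "finite A" "A \<subseteq> S" for A
    using that
  proof (induction A rule: finite_induct)
    case (insert x A)
    note ins = this
    have x: "x \<in> S" and A: "A \<subseteq> S" using ins(4) by auto
    note IH = ins(3)[OF A]
    have k: "Poly_Mapping.keys (?f x) \<subseteq> S" using x by simp
    have "Poly_Mapping.keys (?f x + sum ?f A) \<subseteq> S"
      using k IH keys_add[of "?f x" "sum ?f A"] by blast
    moreover have "P (?f x + sum ?f A)" by (rule a[OF k conjunct1[OF IH] s[OF x] conjunct2[OF IH]])
    ultimately show ?case using ins(1,2) by simp
  qed (simp add: P0)
  then have "P (sum ?f (Poly_Mapping.keys c))" using c by simp
  then show ?thesis using poly_mapping_decompose[of c] by simp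
qed

lemma lin_extend_eqI:
  assumes "Poly_Mapping.keys c \<subseteq> S" "\<And>x. x \<in> S \<Longrightarrow> f x = g x"
  shows "lin_extend f c = lin_extend g c"
  unfolding lin_extend_def using assms by (intro sum.cong) auto

lemma lin_extend_lin_extend: "lin_extend f (lin_extend g c) = lin_extend (\<lambda>x. lin_extend f (g x)) c"
proof -
  have "Poly_Mapping.keys c \<subseteq> UNIV" by simp
  then show ?thesis
    by (induction c rule: chain_induct) (simp_all add: lin_extend_add lin_extend_pscale)
qed

lemma lin_extend_ident: "lin_extend (\<lambda>x. Poly_Mapping.single x 1) c = c"
proof -
  have "Poly_Mapping.keys c \<subseteq> UNIV" by simp
  then show ?thesis by (induction c rule: chain_induct) (simp_all add: lin_extend_add)
qed

lemma chain_module_simps: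
  "carrier (chain_module X n) = {c. Poly_Mapping.keys c \<subseteq> singular_simplex_set n X}"
  "\<zero>\<^bsub>chain_module X n\<^esub> = 0" "c \<oplus>\<^bsub>chain_module X n\<^esub> c' = c + c'" "r \<odot>\<^bsub>chain_module X n\<^esub> c = pscale r c"
  by (simp_all add: chain_module_def)

lemma keys_add_subset: "Poly_Mapping.keys u \<subseteq> S \<Longrightarrow> Poly_Mapping.keys v \<subseteq> S \<Longrightarrow> Poly_Mapping.keys (u + v) \<subseteq> S"
  using keys_add[of u v] by blast

lemma keys_uminus: "Poly_Mapping.keys (- u) = Poly_Mapping.keys (u :: 'x \<Rightarrow>\<^sub>0 'k::ab_group_add)"
  by (auto simp: in_keys_iff)

lemma chain_module_kmod: "kmod (chain_module X n :: ('k::comm_ring_1, 'a simplex \<Rightarrow>\<^sub>0 'k) module)"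
proof -
  have "abelian_group (chain_module X n :: ('k, 'a simplex \<Rightarrow>\<^sub>0 'k) module)"
  proof (rule abelian_groupI)
    fix x assume "x \<in> carrier (chain_module X n :: ('k, 'a simplex \<Rightarrow>\<^sub>0 'k) module)"
    then show "\<exists>y\<in>carrier (chain_module X n). y \<oplus>\<^bsub>chain_module X n\<^esub> x = \<zero>\<^bsub>chain_module X n\<^esub>"
      by (intro bexI[of _ "- x"]) (simp_all add: chain_module_simps keys_uminus)
  qed (simp_all add: chain_module_simps add.assoc add.commute keys_add_subset)
  then interpret abelian_group "chain_module X n :: ('k, 'a simplex \<Rightarrow>\<^sub>0 'k) module" .
  show ?thesis
    by unfold_locales
      (simp_all add: chain_module_simps pscale_add mult.commute order_trans[OF keys_pscale])
qed

lemma chain_module_neg: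
  assumes "c \<in> carrier (chain_module X n)"
  shows "\<ominus>\<^bsub>chain_module X n\<^esub> c = - c"
proof -
  interpret kmod "chain_module X n" by (rule chain_module_kmod)
  show ?thesis
    using assms by (intro minus_equality) (auto simp: chain_module_simps keys_uminus)
qed

lemma finsum_chain_module:
  assumes "finite A" "\<And>x. x \<in> A \<Longrightarrow> u x \<in> carrier (chain_module X n)"
  shows "finsum (chain_module X n) u A = sum u A"
  using assms
proof (induction A rule: finite_induct)
  case empty
  interpret kmod "chain_module X n" by (rule chain_module_kmod)
  show ?case by (simp add: chain_module_simps)
next
  case (insert x A)
  interpret kmod "chain_module X n" by (rule chain_module_kmod)
  have "u \<in> A \<rightarrow> carrier (chain_module X n)" "u x \<in> carrier (chain_module X n)" using insert by auto
  then show ?case using insert by (simp add: finsum_insert chain_module_simps(3))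
qed

lemma single_chain: "singular_simplex n X \<sigma> \<Longrightarrow> Poly_Mapping.single \<sigma> k \<in> carrier (chain_module X n)"
  by (auto simp: chain_module_simps split: if_splits)

lemma chain_module_induct [consumes 1, case_names zero single add]:
  assumes "c \<in> carrier (chain_module X n)" "P 0"
    and "\<And>\<sigma> k. singular_simplex n X \<sigma> \<Longrightarrow> P (Poly_Mapping.single \<sigma> k)"
    and "\<And>u v. \<lbrakk>u \<in> carrier (chain_module X n); v \<in> carrier (chain_module X n); P u; P v\<rbrakk> \<Longrightarrow> P (u + v)"
  shows "P c"
proof -
  have "Poly_Mapping.keys c \<subseteq> singular_simplex_set n X" using assms(1) by (simp add: chain_module_simps)
  then show ?thesis
    by (induction c rule: chain_induct) (use assms(2,3,4) in \<open>auto simp: chain_module_simps\<close>)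
qed

lemma linear_map_lin_extend:
  assumes "\<And>\<sigma>. singular_simplex n X \<sigma> \<Longrightarrow> Poly_Mapping.keys (f \<sigma>) \<subseteq> singular_simplex_set m Y"
  shows "linear_map (chain_module X n) (chain_module Y m) (lin_extend f)"
proof -
  have "Poly_Mapping.keys (lin_extend f c) \<subseteq> singular_simplex_set m Y"
    if "Poly_Mapping.keys c \<subseteq> singular_simplex_set n X" for c
    using that by (intro keys_lin_extend assms) auto
  then show ?thesis
    by (simp add: linear_map_def additive_map_def chain_module_simps lin_extend_add lin_extend_pscale)
qed

text \<open>Generators carry arbitrary coefficients because the maps are only additive; the target
  can then be a module over other scalars, such as the twisted chains.\<close>

lemma additive_chain_eqI:
  assumes P: "abelian_group P" and f: "additive_map (chain_module X n) P f" and g: "additive_map (chain_module X n) P g"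
    and eq: "\<And>\<sigma> k. singular_simplex n X \<sigma> \<Longrightarrow> f (Poly_Mapping.single \<sigma> k) = g (Poly_Mapping.single \<sigma> k)"
    and c: "c \<in> carrier (chain_module X n)"
  shows "f c = g c"
proof -
  interpret kmod "chain_module X n" by (rule chain_module_kmod)
  note ab = abelian_group_axioms
  show ?thesis
    using c
  proof (induction c rule: chain_module_induct)
    case zero
    show ?case
      using additive_map_zero[OF ab P f] additive_map_zero[OF ab P g] by (simp add: chain_module_simps)
  next
    case (add u v)
    then show ?case
      using additive_mapD(2)[OF f add(1,2)] additive_mapD(2)[OF g add(1,2)] by (simp add: chain_module_simps)
  qed (rule eq)
qed

subsection \<open>The singular chain complex\<close>

lemma map_of_int_frag:
  "Poly_Mapping.map of_int (u + v) = (Poly_Mapping.map of_int u + Poly_Mapping.map of_int v :: 'x \<Rightarrow>\<^sub>0 'k::comm_ring_1)"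
  "Poly_Mapping.map of_int (frag_cmul a u) = (pscale (of_int a) (Poly_Mapping.map of_int u) :: 'x \<Rightarrow>\<^sub>0 'k)"
  "Poly_Mapping.map of_int (frag_of x) = (Poly_Mapping.single x 1 :: 'x \<Rightarrow>\<^sub>0 'k)"
  "Poly_Mapping.map of_int (0 :: 'x \<Rightarrow>\<^sub>0 int) = (0 :: 'x \<Rightarrow>\<^sub>0 'k)"
  by (auto intro!: poly_mapping_eqI simp: map.rep_eq when_def lookup_add lookup_frag_cmul lookup_frag_of lookup_single
      simp flip: of_int_add)

lemma map_of_int_diff:
  "Poly_Mapping.map of_int (u - v) = (Poly_Mapping.map of_int u - Poly_Mapping.map of_int v :: 'x \<Rightarrow>\<^sub>0 'k::comm_ring_1)"
  by (rule poly_mapping_eqI) (simp add: map.rep_eq when_def lookup_minus)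

lemma map_of_int_sum:
  "Poly_Mapping.map of_int (sum u A) = (\<Sum>x\<in>A. Poly_Mapping.map of_int (u x) :: 'x \<Rightarrow>\<^sub>0 'k::comm_ring_1)"
  by (induction A rule: infinite_finite_induct) (auto simp: map_of_int_frag)

text \<open>Change of coefficients from the integers, by which the vanishing of the double boundary
  is inherited from integral singular chains.\<close>

lemma chain_diff_of_int:
  "chain_diff n (Poly_Mapping.map of_int u) = (Poly_Mapping.map of_int (chain_boundary n u) :: 'a simplex \<Rightarrow>\<^sub>0 'k::comm_ring_1)"
proof -
  have "Poly_Mapping.keys u \<subseteq> UNIV" by simp
  then show ?thesis
    by (induction u rule: frag_induction)
      (auto simp: map_of_int_frag map_of_int_diff chain_diff_def lin_extend_diff chain_boundary_diff)
qed

lemma chain_diff_add: "chain_diff n (c + c') = chain_diff n c + chain_diff n c'"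
  by (simp add: chain_diff_def lin_extend_add)

lemma chain_diff_0 [simp]: "chain_diff n 0 = 0"
  by (simp add: chain_diff_def)

lemma chain_diff_zero [simp]: "chain_diff 0 c = 0"
  by (simp add: chain_diff_def chain_boundary_def map_of_int_frag lin_extend_def)

lemma chain_diff_single:
  "chain_diff (Suc n) (Poly_Mapping.single \<sigma> a) =
    (\<Sum>k\<le>Suc n. Poly_Mapping.single (singular_face (Suc n) k \<sigma>) ((-1) ^ k * a) :: 'a simplex \<Rightarrow>\<^sub>0 'k::comm_ring_1)"
  by (simp add: chain_diff_def chain_boundary_def map_of_int_frag map_of_int_sum pscale_sum mult.commute del: sum.atMost_Suc)

lemma face_simplex: "singular_simplex (Suc n) X \<sigma> \<Longrightarrow> k \<le> Suc n \<Longrightarrow> singular_simplex n X (singular_face (Suc n) k \<sigma>)"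
  using singular_simplex_singular_face[of "Suc n" X \<sigma> k] by simp

lemma chain_diff_linear: "linear_map (chain_module X (Suc n)) (chain_module X n) (chain_diff (Suc n))"
  unfolding chain_diff_def
proof (rule linear_map_lin_extend)
  fix \<sigma> assume s: "singular_simplex (Suc n) X \<sigma>"
  have "Poly_Mapping.keys (chain_diff (Suc n) (Poly_Mapping.single \<sigma> 1) :: _ \<Rightarrow>\<^sub>0 'b) \<subseteq>
      (\<Union>k\<in>{..Suc n}. Poly_Mapping.keys (Poly_Mapping.single (singular_face (Suc n) k \<sigma>) ((-1) ^ k * 1 :: 'b)))"
    unfolding chain_diff_single by (rule keys_sum)
  also have "\<dots> \<subseteq> singular_simplex_set n X" using face_simplex[OF s] by auto
  finally show "Poly_Mapping.keys (Poly_Mapping.map of_int (chain_boundary (Suc n) (frag_of \<sigma>)) :: _ \<Rightarrow>\<^sub>0 'b)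
      \<subseteq> singular_simplex_set n X"
    by (simp add: chain_diff_def)
qed

lemma chain_diff_chain_diff:
  fixes c :: "'a simplex \<Rightarrow>\<^sub>0 'k::comm_ring_1"
  assumes "c \<in> carrier (chain_module X (Suc (Suc n)))"
  shows "chain_diff (Suc n) (chain_diff (Suc (Suc n)) c) = 0"
  using assms
proof (induction c rule: chain_module_induct)
  case (single \<sigma> k)
  have "Poly_Mapping.single \<sigma> k = pscale k (Poly_Mapping.map of_int (frag_of \<sigma>))"
    by (simp add: map_of_int_frag)
  then have "chain_diff (Suc n) (chain_diff (Suc (Suc n)) (Poly_Mapping.single \<sigma> k)) =
      pscale k (chain_diff (Suc n) (chain_diff (Suc (Suc n)) (Poly_Mapping.map of_int (frag_of \<sigma>))))"
    by (simp add: chain_diff_def lin_extend_pscale)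
  also have "chain_diff (Suc n) (chain_diff (Suc (Suc n)) (Poly_Mapping.map of_int (frag_of \<sigma>))) = (0 :: _ \<Rightarrow>\<^sub>0 'k)"
    unfolding chain_diff_of_int
    using chain_boundary_boundary[of "Suc (Suc n)" X "frag_of \<sigma>"] single
    by (simp add: singular_chain_of map_of_int_frag)
  finally show ?case by simp
qed (auto simp: chain_diff_add)

lemma sing_kcomplex: "kcomplex (chain_module X :: nat \<Rightarrow> ('k::comm_ring_1, _) module) chain_diff"
  by (intro kcomplex.intro chain_module_kmod chain_diff_linear)
    (simp add: chain_diff_chain_diff chain_module_simps(2))

text \<open>Over a field, a linear right inverse of the differential on its image splits the complex.\<close>

lemma sing_split:
  obtains g where "split_complex (chain_module X :: nat \<Rightarrow> ('k::field, 'a simplex \<Rightarrow>\<^sub>0 'k) module) chain_diff g"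
proof -
  let ?C = "\<lambda>n. chain_module X n :: ('k, 'a simplex \<Rightarrow>\<^sub>0 'k) module"
  let ?s = "pscale :: 'k \<Rightarrow> ('a simplex \<Rightarrow>\<^sub>0 'k) \<Rightarrow> _"
  have vs: "vector_space ?s" by unfold_locales (auto simp: pscale_add mult.commute)
  interpret vector_space_pair ?s ?s by (intro vector_space_pair.intro vs)
  have lin: "Vector_Spaces.linear ?s ?s (chain_diff n :: ('a simplex \<Rightarrow>\<^sub>0 'k) \<Rightarrow> _)" for n
    by (simp add: Vector_Spaces.linear_iff vs chain_diff_def lin_extend_add lin_extend_pscale)
  have sub: "vs1.subspace (carrier (?C n))" for n
    by (simp add: vs1.subspace_def chain_module_simps keys_add_subset order_trans[OF keys_pscale])
  have "\<exists>g. range g \<subseteq> carrier (?C (Suc n)) \<and> Vector_Spaces.linear ?s ?s g \<and>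
      (\<forall>v\<in>chain_diff (Suc n) ` carrier (?C (Suc n)). chain_diff (Suc n) (g v) = v)" for n
    by (rule linear_exists_right_inverse_on[OF lin sub])
  then have "\<exists>g. \<forall>n. range (g n) \<subseteq> carrier (?C (Suc n)) \<and> Vector_Spaces.linear ?s ?s (g n) \<and>
      (\<forall>v\<in>chain_diff (Suc n) ` carrier (?C (Suc n)). chain_diff (Suc n) (g n v) = v)"
    by (intro choice allI)
  then obtain g where g: "\<And>n. range (g n) \<subseteq> carrier (?C (Suc n))" "\<And>n. Vector_Spaces.linear ?s ?s (g n)"
      "\<And>n. \<forall>v\<in>chain_diff (Suc n) ` carrier (?C (Suc n)). chain_diff (Suc n) (g n v) = v"
    by blast
  have "linear_map (?C n) (?C (Suc n)) (g n)" for n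
    using g(1)[of n] g(2)[of n]
    unfolding Vector_Spaces.linear_iff linear_map_def additive_map_def by (auto simp: chain_module_simps)
  then have "split_complex ?C chain_diff g"
    using g(3) by (intro split_complex.intro sing_kcomplex split_complex_axioms.intro) auto
  then show thesis by (rule that)
qed

subsection \<open>Linear extension to a module given by a record\<close>

text \<open>Covers \<open>alexander_whitney\<close> and \<open>up\<close>, which are defined by
  exactly such sums in a record.\<close>

lemma module_extend:
  assumes P: "kmod P" and f: "\<And>\<sigma>. singular_simplex n X \<sigma> \<Longrightarrow> f \<sigma> \<in> carrier P"
  defines "F \<equiv> \<lambda>c. \<Oplus>\<^bsub>P\<^esub>\<sigma>\<in>Poly_Mapping.keys c. Poly_Mapping.lookup c \<sigma> \<odot>\<^bsub>P\<^esub> f \<sigma>"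
  shows "linear_map (chain_module X n) P F"
    and "singular_simplex n X \<sigma> \<Longrightarrow> F (Poly_Mapping.single \<sigma> k) = k \<odot>\<^bsub>P\<^esub> f \<sigma>"
proof -
  interpret P: kmod P by (rule P)
  let ?S = "singular_simplex_set n X"
  have fS: "f \<sigma> \<in> carrier P" if "\<sigma> \<in> ?S" for \<sigma> using f that by simp
  have fc: "k \<odot>\<^bsub>P\<^esub> f \<sigma> \<in> carrier P" if "\<sigma> \<in> ?S" for k \<sigma> using fS[OF that] by (rule P.smult_closed)
  have f0: "0 \<odot>\<^bsub>P\<^esub> f \<sigma> = \<zero>\<^bsub>P\<^esub>" if "\<sigma> \<in> ?S" for \<sigma> using fS[OF that] by (rule P.zero_smult)
  have sup: "F c = (\<Oplus>\<^bsub>P\<^esub>\<sigma>\<in>A. Poly_Mapping.lookup c \<sigma> \<odot>\<^bsub>P\<^esub> f \<sigma>)"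
    if "finite A" "Poly_Mapping.keys c \<subseteq> A" "A \<subseteq> ?S" for c A
    unfolding F_def
    by (rule P.finsum_keys_superset[where F = "\<lambda>x k. k \<odot>\<^bsub>P\<^esub> f x", OF that(1,2)])
      (rule f0 fc, erule subsetD[OF that(3)])+
  show "F (Poly_Mapping.single \<sigma> k) = k \<odot>\<^bsub>P\<^esub> f \<sigma>" if s: "singular_simplex n X \<sigma>" for \<sigma> k
  proof -
    have "F (Poly_Mapping.single \<sigma> k) = (\<Oplus>\<^bsub>P\<^esub>\<tau>\<in>{\<sigma>}. Poly_Mapping.lookup (Poly_Mapping.single \<sigma> k) \<tau> \<odot>\<^bsub>P\<^esub> f \<tau>)"
      by (rule sup) (use s in auto)
    also have "\<dots> = k \<odot>\<^bsub>P\<^esub> f \<sigma>"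
      using fc[of \<sigma>] s by (subst P.finsum_insert) auto
    finally show ?thesis .
  qed
  have cl: "F c \<in> carrier P" if "Poly_Mapping.keys c \<subseteq> ?S" for c
    unfolding F_def using that fc by (intro P.finsum_closed) blast
  have add: "F (c + c') = F c \<oplus>\<^bsub>P\<^esub> F c'" if "Poly_Mapping.keys c \<subseteq> ?S" "Poly_Mapping.keys c' \<subseteq> ?S" for c c'
    unfolding F_def
    by (rule P.finsum_keys_add[where F = "\<lambda>x k. k \<odot>\<^bsub>P\<^esub> f x", OF that])
      (simp_all add: P.add_smult fS fc)
  have scal: "F (pscale r c) = r \<odot>\<^bsub>P\<^esub> F c" if c: "Poly_Mapping.keys c \<subseteq> ?S" for r c
  proof -
    let ?A = "Poly_Mapping.keys c"
    have g: "(\<lambda>\<sigma>. Poly_Mapping.lookup c \<sigma> \<odot>\<^bsub>P\<^esub> f \<sigma>) \<in> ?A \<rightarrow> carrier P" using fc c by blast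
    have "F (pscale r c) = (\<Oplus>\<^bsub>P\<^esub>\<sigma>\<in>?A. Poly_Mapping.lookup (pscale r c) \<sigma> \<odot>\<^bsub>P\<^esub> f \<sigma>)"
      by (rule sup[OF finite_keys keys_pscale c])
    also have "\<dots> = (\<Oplus>\<^bsub>P\<^esub>\<sigma>\<in>?A. r \<odot>\<^bsub>P\<^esub> (Poly_Mapping.lookup c \<sigma> \<odot>\<^bsub>P\<^esub> f \<sigma>))"
    proof (rule P.finsum_cong')
      fix \<sigma> assume "\<sigma> \<in> ?A"
      then have "\<sigma> \<in> ?S" using c by blast
      then show "Poly_Mapping.lookup (pscale r c) \<sigma> \<odot>\<^bsub>P\<^esub> f \<sigma> = r \<odot>\<^bsub>P\<^esub> (Poly_Mapping.lookup c \<sigma> \<odot>\<^bsub>P\<^esub> f \<sigma>)"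
        by (simp add: P.mult_smult fS)
    qed (use g P.smult_closed in blast)+
    also have "\<dots> = r \<odot>\<^bsub>P\<^esub> F c"
      unfolding F_def
      by (rule additive_map_finsum[OF P.abelian_group_axioms P.abelian_group_axioms P.smult_additive finite_keys g, symmetric])
    finally show ?thesis .
  qed
  show "linear_map (chain_module X n) P F"
    using cl add scal by (simp add: linear_map_def additive_map_def chain_module_simps Pi_iff)
qed

lemma chain_sum_closed:
  assumes "\<And>k. k \<in> A \<Longrightarrow> u k \<in> carrier (chain_module X n)"
  shows "sum u A \<in> carrier (chain_module X n)"
  using assms
  by (induction A rule: infinite_finite_induct) (simp_all add: chain_module_simps keys_add_subset)

lemma additive_chain_sum_eq:
  assumes P: "abelian_group P" and f: "additive_map (chain_module X n) P f" and g: "additive_map (chain_module Y m) P g"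
    and A: "finite A" and u: "\<And>k. k \<in> A \<Longrightarrow> u k \<in> carrier (chain_module X n)"
    and v: "\<And>k. k \<in> A \<Longrightarrow> v k \<in> carrier (chain_module Y m)"
    and eq: "\<And>k. k \<in> A \<Longrightarrow> f (u k) = g (v k)"
  shows "f (sum u A) = g (sum v A)"
proof -
  interpret P: abelian_group P by (rule P)
  interpret M: kmod "chain_module X n" by (rule chain_module_kmod)
  interpret N: kmod "chain_module Y m" by (rule chain_module_kmod)
  have u': "u \<in> A \<rightarrow> carrier (chain_module X n)" and v': "v \<in> A \<rightarrow> carrier (chain_module Y m)" using u v by auto
  have "f (sum u A) = f (finsum (chain_module X n) u A)" using finsum_chain_module[OF A u] by simp
  also have "\<dots> = finsum P (\<lambda>k. f (u k)) A"
    by (rule additive_map_finsum[OF M.abelian_group_axioms P f A u'])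
  also have "\<dots> = finsum P (\<lambda>k. g (v k)) A"
    using eq additive_mapD(1)[OF g] v by (intro P.finsum_cong') auto
  also have "\<dots> = g (finsum (chain_module Y m) v A)"
    by (rule additive_map_finsum[OF N.abelian_group_axioms P g A v', symmetric])
  also have "\<dots> = g (sum v A)" using finsum_chain_module[OF A v] by simp
  finally show ?thesis .
qed

subsection \<open>Faces\<close>

lemma standard_simplex_mono: "i \<le> n \<Longrightarrow> x \<in> standard_simplex i \<Longrightarrow> x \<in> standard_simplex n"
  using standard_simplex_mono[of i n] by blast

definition shift_point :: "nat \<Rightarrow> (nat \<Rightarrow> real) \<Rightarrow> nat \<Rightarrow> real" where
  "shift_point i x = (\<lambda>j. if j < i then 0 else x (j - i))"

lemma shift_point_simplex:
  assumes "x \<in> standard_simplex m"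
  shows "shift_point i x \<in> standard_simplex (i + m)"
proof -
  have "(\<Sum>j\<le>i + m. shift_point i x j) = (\<Sum>j\<in>{i..i + m}. x (j - i))"
    by (rule sum.mono_neutral_cong_right) (auto simp: shift_point_def)
  also have "\<dots> = (\<Sum>j\<le>m. x j)"
    by (rule sum.reindex_bij_witness[of _ "\<lambda>j. j + i" "\<lambda>j. j - i"]) auto
  finally show ?thesis using assms by (auto simp: standard_simplex_def shift_point_def)
qed

lemma front_face_apply: "x \<in> standard_simplex i \<Longrightarrow> front_face i \<sigma> x = \<sigma> x"
  by (simp add: front_face_def)

lemma back_face_apply: "x \<in> standard_simplex m \<Longrightarrow> back_face i m \<sigma> x = \<sigma> (shift_point i x)"
  by (simp add: back_face_def shift_point_def)

lemma singular_face_apply: "x \<in> standard_simplex n \<Longrightarrow> singular_face (Suc n) k \<sigma> x = \<sigma> (simplical_face k x)"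
  by (simp add: singular_face_def)

lemma simplical_face_simplex: "k \<le> Suc n \<Longrightarrow> x \<in> standard_simplex n \<Longrightarrow> simplical_face k x \<in> standard_simplex (Suc n)"
  using simplical_face_in_standard_simplex[of "Suc n" k x] by simp

lemma face_eqI:
  assumes "f \<in> extensional (standard_simplex n)" "g \<in> extensional (standard_simplex n)"
    and "\<And>x. x \<in> standard_simplex n \<Longrightarrow> f x = g x"
  shows "f = g"
  by (rule extensionalityI[OF assms])

lemma face_extensional:
  "front_face i \<sigma> \<in> extensional (standard_simplex i)" "back_face i m \<sigma> \<in> extensional (standard_simplex m)"
  "singular_face (Suc n) k \<sigma> \<in> extensional (standard_simplex n)" "simplex_map n f \<sigma> \<in> extensional (standard_simplex n)"
  by (simp_all add: front_face_def back_face_def singular_face_def simplex_map_def)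

lemma standard_simplex_zero: "x \<in> standard_simplex n \<Longrightarrow> n < j \<Longrightarrow> x j = 0"
  by (simp add: standard_simplex_def)

lemma front_face_simplex:
  assumes "singular_simplex n X \<sigma>" "i \<le> n"
  shows "singular_simplex i X (front_face i \<sigma>)"
proof -
  have sub: "standard_simplex i \<subseteq> standard_simplex n" using standard_simplex_mono[OF assms(2)] by blast
  have "continuous_map (subtopology (powertop_real UNIV) (standard_simplex i)) X \<sigma>"
    using assms(1) continuous_map_from_subtopology_mono[OF _ sub] by (auto simp: singular_simplex_def)
  then show ?thesis by (simp add: singular_simplex_def front_face_def)
qed

lemma back_face_simplex:
  assumes "singular_simplex (i + m) X \<sigma>"
  shows "singular_simplex m X (back_face i m \<sigma>)"
proof -
  let ?P = "powertop_real UNIV"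
  have c: "continuous_map (subtopology ?P (standard_simplex (i + m))) X \<sigma>"
    using assms by (simp add: singular_simplex_def)
  have "continuous_map (subtopology ?P (standard_simplex m)) ?P (shift_point i)"
  proof (subst continuous_map_componentwise_UNIV, intro allI)
    fix j
    show "continuous_map (subtopology ?P (standard_simplex m)) euclideanreal (\<lambda>x. shift_point i x j)"
      by (cases "j < i") (auto simp: shift_point_def intro!: continuous_map_from_subtopology continuous_map_product_projection)
  qed
  then have "continuous_map (subtopology ?P (standard_simplex m)) (subtopology ?P (standard_simplex (i + m))) (shift_point i)"
    using shift_point_simplex by (auto simp: continuous_map_in_subtopology)
  from continuous_map_compose[OF this c]
  have "continuous_map (subtopology ?P (standard_simplex m)) X (\<sigma> \<circ> shift_point i)" .
  moreover have "back_face i m \<sigma> = restrict (\<sigma> \<circ> shift_point i) (standard_simplex m)"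
    by (simp add: back_face_def shift_point_def[abs_def])
  ultimately show ?thesis by (simp add: singular_simplex_def)
qed

lemma simplical_face_ident: "x \<in> standard_simplex n \<Longrightarrow> n < k \<Longrightarrow> simplical_face k x = x"
  by (auto simp: simplical_face_def fun_eq_iff standard_simplex_def)

text \<open>If vertex \<open>k\<close> with \<open>k \<le> i\<close> is omitted, the first i + 1
  remaining vertices are 0, ..., i + 1 without \<open>k\<close>; omitting a later vertex does not
  affect the front face. The rules for back faces are the mirror image.\<close>

lemma front_face_face_le:
  assumes "k \<le> i" "i \<le> n"
  shows "front_face i (singular_face (Suc n) k \<sigma>) = singular_face (Suc i) k (front_face (Suc i) \<sigma>)"
proof (rule face_eqI[OF face_extensional(1,3)])
  fix x :: "nat \<Rightarrow> real" assume x: "x \<in> standard_simplex i"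
  have "x \<in> standard_simplex n" "simplical_face k x \<in> standard_simplex (Suc i)"
    using standard_simplex_mono[OF assms(2) x] simplical_face_simplex[OF _ x, of k] assms by auto
  then show "front_face i (singular_face (Suc n) k \<sigma>) x = singular_face (Suc i) k (front_face (Suc i) \<sigma>) x"
    by (simp add: front_face_apply singular_face_apply x)
qed

lemma front_face_face_gt:
  assumes "i < k" "i \<le> n"
  shows "front_face i (singular_face (Suc n) k \<sigma>) = front_face i \<sigma>"
proof (rule face_eqI[OF face_extensional(1,1)])
  fix x :: "nat \<Rightarrow> real" assume x: "x \<in> standard_simplex i"
  show "front_face i (singular_face (Suc n) k \<sigma>) x = front_face i \<sigma> x"
    using standard_simplex_mono[OF assms(2) x] simplical_face_ident[OF x assms(1)]
    by (simp add: front_face_apply singular_face_apply x)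
qed

text \<open>The last face of a front face and face 0 of a back face produce the two surplus terms
  that cancel in \<open>AW_diff_simplex\<close>.\<close>

lemma face_front_face: "singular_face (Suc i) (Suc i) (front_face (Suc i) \<sigma>) = front_face i \<sigma>"
proof (rule face_eqI[OF face_extensional(3,1)])
  fix x :: "nat \<Rightarrow> real" assume x: "x \<in> standard_simplex i"
  show "singular_face (Suc i) (Suc i) (front_face (Suc i) \<sigma>) x = front_face i \<sigma> x"
    using standard_simplex_mono[OF _ x, of "Suc i"] simplical_face_ident[OF x, of "Suc i"]
    by (simp add: front_face_apply singular_face_apply x)
qed

lemma back_face_face_le:
  assumes "k \<le> i"
  shows "back_face i m (singular_face (Suc (i + m)) k \<sigma>) = back_face (Suc i) m \<sigma>"
proof (rule face_eqI[OF face_extensional(2,2)])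
  fix x :: "nat \<Rightarrow> real" assume x: "x \<in> standard_simplex m"
  have "simplical_face k (shift_point i x) = shift_point (Suc i) x"
    using assms by (auto simp: simplical_face_def shift_point_def fun_eq_iff)
  then show "back_face i m (singular_face (Suc (i + m)) k \<sigma>) x = back_face (Suc i) m \<sigma> x"
    by (simp add: back_face_apply singular_face_apply x shift_point_simplex)
qed

lemma back_face_face_gt:
  assumes "k \<le> Suc m"
  shows "back_face i m (singular_face (Suc (i + m)) (i + k) \<sigma>) = singular_face (Suc m) k (back_face i (Suc m) \<sigma>)"
proof (rule face_eqI[OF face_extensional(2,3)])
  fix x :: "nat \<Rightarrow> real" assume x: "x \<in> standard_simplex m"
  have "simplical_face (i + k) (shift_point i x) = shift_point i (simplical_face k x)"
    by (auto simp: simplical_face_def shift_point_def fun_eq_iff)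
  then show "back_face i m (singular_face (Suc (i + m)) (i + k) \<sigma>) x = singular_face (Suc m) k (back_face i (Suc m) \<sigma>) x"
    using simplical_face_simplex[OF assms x]
    by (simp add: back_face_apply singular_face_apply x shift_point_simplex)
qed

lemma face_back_face: "singular_face (Suc m) 0 (back_face i (Suc m) \<sigma>) = back_face (Suc i) m \<sigma>"
  using back_face_face_gt[of 0 m i \<sigma>] back_face_face_le[of i i m \<sigma>] by simp

lemma face_simplex_map:
  assumes "k \<le> Suc n"
  shows "singular_face (Suc n) k (simplex_map (Suc n) f \<sigma>) = simplex_map n f (singular_face (Suc n) k \<sigma>)"
  by (rule face_eqI[OF face_extensional(3,4)])
    (simp add: singular_face_apply simplex_map_def simplical_face_simplex[OF assms])

lemma back_face_1: "back_face 1 n \<sigma> = singular_face (Suc n) 0 \<sigma>"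
proof (rule face_eqI[OF face_extensional(2,3)])
  fix x :: "nat \<Rightarrow> real" assume x: "x \<in> standard_simplex n"
  have "simplical_face 0 x = shift_point 1 x" by (auto simp: simplical_face_def shift_point_def fun_eq_iff)
  then show "back_face 1 n \<sigma> x = singular_face (Suc n) 0 \<sigma> x"
    by (simp add: back_face_apply singular_face_apply x)
qed

subsection \<open>The Alexander-Whitney map is a chain map\<close>

definition aw where
  "aw X Y n \<omega> = (\<lambda>i\<in>{..n}. tensor_pure UNIV (chain_module X i :: ('k::comm_ring_1, _) module) (chain_module Y (n - i))
      (Poly_Mapping.single (front_face i (simplex_map n fst \<omega>)) (1::'k))
      (Poly_Mapping.single (back_face i (n - i) (simplex_map n snd \<omega>)) (1::'k)))"

context
  fixes X :: "'a topology" and Y :: "'b topology" and k :: "'k::comm_ring_1"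
begin

interpretation K: complex_pair "chain_module X :: nat \<Rightarrow> ('k, _) module" chain_diff "chain_module Y :: nat \<Rightarrow> ('k, _) module" chain_diff
  by (intro complex_pair.intro sing_kcomplex)

abbreviation "AWm n \<equiv> (alexander_whitney X Y n :: (('a \<times> 'b) simplex \<Rightarrow>\<^sub>0 'k) \<Rightarrow> _)"

lemma aw_closed:
  assumes w: "singular_simplex n (prod_topology X Y) \<omega>"
  shows "(aw X Y n \<omega> :: _ \<Rightarrow> ((_ \<Rightarrow>\<^sub>0 'k) \<times> _ \<Rightarrow>\<^sub>0 int) set) \<in> carrier (K.T n)"
proof -
  have 1: "singular_simplex n X (simplex_map n fst \<omega>)" and 2: "singular_simplex n Y (simplex_map n snd \<omega>)"
    using singular_simplex_simplex_map[OF w continuous_map_fst] singular_simplex_simplex_map[OF w continuous_map_snd] .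
  have "K.pt i (n - i) (Poly_Mapping.single (front_face i (simplex_map n fst \<omega>)) 1)
      (Poly_Mapping.single (back_face i (n - i) (simplex_map n snd \<omega>)) 1) \<in> carrier (K.t i (n - i))" if "i \<le> n" for i
    using 1 2 that
    by (intro K.pt_closed single_chain front_face_simplex[OF 1 that] back_face_simplex) simp
  then show ?thesis by (simp add: tensor_complex_def direct_sum_simps aw_def)
qed

lemma AW_extend:
  "linear_map (chain_module (prod_topology X Y) n) (K.T n) (AWm n)"
  "singular_simplex n (prod_topology X Y) \<omega> \<Longrightarrow> AWm n (Poly_Mapping.single \<omega> r) = r \<odot>\<^bsub>K.T n\<^esub> aw X Y n \<omega>"
  unfolding alexander_whitney_def[abs_def] Let_def aw_def[symmetric]
  by (rule module_extend[OF K.T_kmod aw_closed]; assumption)+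

lemma AW_component:
  assumes w: "singular_simplex n (prod_topology X Y) \<omega>" and i: "i \<le> n"
  shows "AWm n (Poly_Mapping.single \<omega> r) i = K.pt i (n - i)
      (Poly_Mapping.single (front_face i (simplex_map n fst \<omega>)) r)
      (Poly_Mapping.single (back_face i (n - i) (simplex_map n snd \<omega>)) 1)"
proof -
  have 1: "singular_simplex n X (simplex_map n fst \<omega>)" and 2: "singular_simplex n Y (simplex_map n snd \<omega>)"
    using singular_simplex_simplex_map[OF w continuous_map_fst] singular_simplex_simplex_map[OF w continuous_map_snd] .
  have a: "Poly_Mapping.single (front_face i (simplex_map n fst \<omega>)) (1::'k) \<in> carrier (chain_module X i)"
    by (rule single_chain[OF front_face_simplex[OF 1 i]])
  have b: "Poly_Mapping.single (back_face i (n - i) (simplex_map n snd \<omega>)) (1::'k) \<in> carrier (chain_module Y (n - i))"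
    using 2 i by (intro single_chain back_face_simplex) simp
  show ?thesis
    using linear_mapD(2)[OF ctensor_pure_linear(1)[OF K.A.km K.B.km b] a, of r] i
    by (simp add: AW_extend(2)[OF w] K.T_simps(3)[OF i] aw_def chain_module_simps)
qed

text \<open>In component i, faces \<open>k \<le> i\<close> of the simplex match faces of the front
  part and faces \<open>k > i\<close> match faces of the back part. Left over are the last face of
  the front part and face 0 of the back part; both give front i-face tensor back m-face, with
  opposite signs.\<close>

lemma AW_diff_simplex:
  assumes w: "singular_simplex (Suc n) (prod_topology X Y) \<omega>"
  shows "K.D (Suc n) (AWm (Suc n) (Poly_Mapping.single \<omega> 1)) = AWm n (chain_diff (Suc n) (Poly_Mapping.single \<omega> 1))"
proof (rule K.T_eqI)
  let ?\<sigma> = "simplex_map (Suc n) fst \<omega>" and ?\<tau> = "simplex_map (Suc n) snd \<omega>"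
  let ?s = "\<lambda>x a. Poly_Mapping.single x (a::'k)"
  have 1: "singular_simplex (Suc n) X ?\<sigma>" and 2: "singular_simplex (Suc n) Y ?\<tau>"
    using singular_simplex_simplex_map[OF w continuous_map_fst] singular_simplex_simplex_map[OF w continuous_map_snd] .
  have wc: "?s \<omega> 1 \<in> carrier (chain_module (prod_topology X Y) (Suc n))" by (rule single_chain[OF w])
  show "K.D (Suc n) (AWm (Suc n) (?s \<omega> 1)) \<in> carrier (K.T n)"
    by (rule K.D_closed[OF linear_mapD(3)[OF AW_extend(1) wc]])
  show "AWm n (chain_diff (Suc n) (?s \<omega> 1)) \<in> carrier (K.T n)"
    by (rule linear_mapD(3)[OF AW_extend(1) linear_mapD(3)[OF chain_diff_linear wc]])
  fix i assume i: "i \<le> n"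
  define m where "m = n - i"
  have nm: "n = i + m" "Suc n - Suc i = m" "Suc n - i = Suc m" using i by (auto simp: m_def)
  interpret t: kmod "K.t i m" by (rule K.t_kmod)
  define f1 where "f1 = ?s (front_face (Suc i) ?\<sigma>) 1"
  define f0 where "f0 = ?s (front_face i ?\<sigma>) 1"
  define b0 where "b0 = ?s (back_face i (Suc m) ?\<tau>) 1"
  define b1 where "b1 = ?s (back_face (Suc i) m ?\<tau>) 1"
  let ?A = "\<lambda>k. ?s (singular_face (Suc i) k (front_face (Suc i) ?\<sigma>)) ((-1) ^ k)"
  let ?B = "\<lambda>k. ?s (singular_face (Suc m) (Suc k) (back_face i (Suc m) ?\<tau>)) ((-1) ^ Suc k)"
  let ?U = "\<lambda>k. ?s (singular_face (Suc n) k \<omega>) ((-1) ^ k)"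
  \<comment> \<open>\<open>A\<close> leaves out the last face of \<open>f1\<close>, which is
    \<open>f0\<close>, and \<open>B\<close> leaves out face 0 of \<open>b0\<close>, which is
    \<open>b1\<close>.\<close>
  define A where "A = sum ?A {..i}"
  define B where "B = sum ?B {..m}"
  have ff: "singular_simplex (Suc i) X (front_face (Suc i) ?\<sigma>)" "singular_simplex i X (front_face i ?\<sigma>)"
    using i by (auto intro: front_face_simplex[OF 1])
  have bb: "singular_simplex (Suc m) Y (back_face i (Suc m) ?\<tau>)" "singular_simplex m Y (back_face (Suc i) m ?\<tau>)"
    using 2 nm(1) by (auto intro!: back_face_simplex)
  have f: "f1 \<in> carrier (chain_module X (Suc i))" "f0 \<in> carrier (chain_module X i)"
    unfolding f1_def f0_def by (rule single_chain[OF ff(1)], rule single_chain[OF ff(2)])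
  have b: "b0 \<in> carrier (chain_module Y (Suc m))" "b1 \<in> carrier (chain_module Y m)"
    unfolding b0_def b1_def by (rule single_chain[OF bb(1)], rule single_chain[OF bb(2)])
  have Ak: "?A k \<in> carrier (chain_module X i)" if "k \<in> {..i}" for k
    using that by (intro single_chain face_simplex[OF ff(1)]) simp
  have Bk: "?B k \<in> carrier (chain_module Y m)" if "k \<in> {..m}" for k
    using that by (intro single_chain face_simplex[OF bb(1)]) simp
  have Uk: "?U k \<in> carrier (chain_module (prod_topology X Y) n)" if "k \<le> Suc n" for k
    using that by (intro single_chain face_simplex[OF w]) simp
  have Uk': "?U (i + Suc k) \<in> carrier (chain_module (prod_topology X Y) n)" if "k \<in> {..m}" for k
    by (rule Uk) (use that nm(1) in simp)
  interpret cX: kmod "chain_module X i :: ('k, _) module" by (rule chain_module_kmod)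
  interpret cY: kmod "chain_module Y m :: ('k, _) module" by (rule chain_module_kmod)
  interpret cP: kmod "chain_module (prod_topology X Y) n :: ('k, _) module" by (rule chain_module_kmod)
  have Ac: "A \<in> carrier (chain_module X i)"
    unfolding A_def by (rule chain_sum_closed[OF Ak])
  have Bc: "B \<in> carrier (chain_module Y m)"
    unfolding B_def by (rule chain_sum_closed[OF Bk])
  have df: "chain_diff (Suc i) f1 = A + pscale ((-1) ^ Suc i) f0"
    unfolding f1_def f0_def A_def chain_diff_single mult_1_right sum.atMost_Suc face_front_face by simp
  have db: "chain_diff (Suc m) b0 = b1 + B"
    unfolding b0_def b1_def B_def chain_diff_single mult_1_right sum.atMost_Suc_shift face_back_face by simp
  let ?G = "\<lambda>c. AWm n c i"
  let ?U' = "\<lambda>j. ?U (i + Suc j)"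
  \<comment> \<open>Faces up to i shorten the front part, the others the back part.\<close>
  have split: "sum ?U {..Suc n} = sum ?U {..i} + sum ?U' {..m}"
  proof -
    have "{..Suc n} = {..i} \<union> {Suc i..Suc n}" using i by auto
    then have "sum ?U {..Suc n} = sum ?U {..i} + sum ?U {Suc i..Suc n}"
      by (simp only:) (rule sum.union_disjoint, auto)
    moreover have "sum ?U {Suc i..Suc n} = sum ?U' {..m}"
      by (rule sum.reindex_bij_witness[of _ "\<lambda>j. i + Suc j" "\<lambda>k. k - Suc i"]) (use nm in auto)
    ultimately show ?thesis by simp
  qed
  have Gl: "linear_map (chain_module (prod_topology X Y) n) (K.t i m) ?G"
  proof -
    have "linear_map (K.T n) (K.t i m) (\<lambda>x. x i)"
      using K.T_carrier[of _ n i] K.T_simps[of i n] i by (auto simp: linear_map_def additive_map_def m_def)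
    from linear_map_compose[OF AW_extend(1) this] show ?thesis .
  qed
  have Ga: "additive_map (chain_module (prod_topology X Y) n) (K.t i m) ?G" using Gl by (rule linear_mapD(1))
  have pl: "linear_map (chain_module X i) (K.t i m) (\<lambda>a. K.pt i m a b1)"
    by (rule ctensor_pure_linear(1)[OF K.A.km K.B.km b(2)])
  have pr: "linear_map (chain_module Y m) (K.t i m) (K.pt i m f0)"
    by (rule ctensor_pure_linear(2)[OF K.A.km K.B.km f(2)])
  have GU: "?G (sum ?U {..i}) = K.pt i m A b1"
    unfolding A_def
  proof (rule additive_chain_sum_eq[OF t.abelian_group_axioms Ga linear_mapD(1)[OF pl] finite_atMost _ Ak])
    fix k assume k: "k \<in> {..i}"
    then show "?U k \<in> carrier (chain_module (prod_topology X Y) n)" using Uk i by simp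
    have s: "singular_simplex n (prod_topology X Y) (singular_face (Suc n) k \<omega>)"
      using face_simplex[OF w] k i by simp
    show "?G (?U k) = K.pt i m (?A k) b1"
      unfolding AW_component[OF s i] b1_def m_def[symmetric]
      using k i face_simplex_map[of k n fst \<omega>, symmetric] face_simplex_map[of k n snd \<omega>, symmetric]
        back_face_face_le[of k i m ?\<tau>]
      by (simp add: front_face_face_le nm(1))
  qed
  have GV: "?G (sum ?U' {..m}) = K.pt i m f0 (pscale ((-1) ^ i) B)"
    unfolding B_def pscale_sum
  proof (rule additive_chain_sum_eq[OF t.abelian_group_axioms Ga linear_mapD(1)[OF pr] finite_atMost])
    fix k assume k: "k \<in> {..m}"
    then show "?U' k \<in> carrier (chain_module (prod_topology X Y) n)" by (rule Uk')
    show "pscale ((-1) ^ i) (?B k) \<in> carrier (chain_module Y m)"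
      using cY.smult_closed[OF Bk[OF k], of "(-1) ^ i"] unfolding chain_module_simps(4) .
    have ki: "i + Suc k \<le> Suc n" using k nm(1) by simp
    have s: "singular_simplex n (prod_topology X Y) (singular_face (Suc n) (i + Suc k) \<omega>)"
      using face_simplex[OF w ki] .
    have bf: "back_face i m (singular_face (Suc n) (i + Suc k) ?\<tau>) = singular_face (Suc m) (Suc k) (back_face i (Suc m) ?\<tau>)"
      unfolding nm(1) by (rule back_face_face_gt) (use k in simp)
    have fs: "Poly_Mapping.single (singular_face (Suc m) (Suc k) (back_face i (Suc m) ?\<tau>)) 1 \<in> carrier (chain_module Y m)"
      using k by (intro single_chain face_simplex[OF bb(1)]) simp
    have "?G (?U' k) = K.pt i m (pscale ((-1) ^ (i + Suc k)) f0)
        (?s (singular_face (Suc m) (Suc k) (back_face i (Suc m) ?\<tau>)) 1)"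
      unfolding AW_component[OF s i] f0_def m_def[symmetric] face_simplex_map[OF ki, symmetric] bf
      by (subst front_face_face_gt) (use i in simp_all)
    \<comment> \<open>The coefficient produced by \<open>AW_component\<close> sits on the left
      factor; it is moved across the tensor so that the back faces can be summed.\<close>
    also have "\<dots> = (-1) ^ (i + Suc k) \<odot>\<^bsub>K.t i m\<^esub> K.pt i m f0 (?s (singular_face (Suc m) (Suc k) (back_face i (Suc m) ?\<tau>)) 1)"
      using linear_mapD(2)[OF ctensor_pure_linear(1)[OF K.A.km K.B.km fs] f(2), of "(-1) ^ (i + Suc k)"]
      unfolding chain_module_simps(4) .
    also have "\<dots> = K.pt i m f0 (pscale ((-1) ^ (i + Suc k)) (?s (singular_face (Suc m) (Suc k) (back_face i (Suc m) ?\<tau>)) 1))"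
      using linear_mapD(2)[OF pr fs, of "(-1) ^ (i + Suc k)"] unfolding chain_module_simps(4) by (rule sym)
    also have "pscale ((-1) ^ (i + Suc k)) (?s (singular_face (Suc m) (Suc k) (back_face i (Suc m) ?\<tau>)) 1) =
        pscale ((-1) ^ i) (?B k)" by (simp add: power_add)
    finally show "?G (?U' k) = K.pt i m f0 (pscale ((-1) ^ i) (?B k))" .
  qed
  let ?P = "K.pt i m f0 b1" and ?e = "(-1::'k) ^ i"
  have P: "?P \<in> carrier (K.t i m)" and PA: "K.pt i m A b1 \<in> carrier (K.t i m)" and PB: "K.pt i m f0 B \<in> carrier (K.t i m)"
    using K.pt_closed f(2) b(2) Ac Bc by auto
  have sf0: "pscale r f0 \<in> carrier (chain_module X i)" for r
    using cX.smult_closed[OF f(2), of r] unfolding chain_module_simps(4) .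
  have eB: "?e \<odot>\<^bsub>K.t i m\<^esub> K.pt i m f0 B = K.pt i m f0 (pscale ?e B)"
    using linear_mapD(2)[OF pr Bc, of ?e] unfolding chain_module_simps(4) by (rule sym)
  have "K.D (Suc n) (AWm (Suc n) (?s \<omega> 1)) i =
      K.pt i m (chain_diff (Suc i) f1) b1 \<oplus>\<^bsub>K.t i m\<^esub> ?e \<odot>\<^bsub>K.t i m\<^esub> K.pt i m f0 (chain_diff (Suc m) b0)"
    using i K.L_pure[OF f(1) b(2)] K.R_pure[OF f(2) b(1)]
    by (simp add: K.D_apply[OF i] AW_component[OF w] Suc_diff_le f1_def f0_def b1_def b0_def m_def)
  also have "K.pt i m (chain_diff (Suc i) f1) b1 = K.pt i m A b1 \<oplus>\<^bsub>K.t i m\<^esub> (- ?e) \<odot>\<^bsub>K.t i m\<^esub> ?P"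
    using additive_mapD(2)[OF linear_mapD(1)[OF pl] Ac sf0] linear_mapD(2)[OF pl f(2), of "- ?e"]
    unfolding df chain_module_simps by simp
  also have "K.pt i m f0 (chain_diff (Suc m) b0) = ?P \<oplus>\<^bsub>K.t i m\<^esub> K.pt i m f0 B"
    using additive_mapD(2)[OF linear_mapD(1)[OF pr] b(2) Bc] unfolding db chain_module_simps .
  also have "(K.pt i m A b1 \<oplus>\<^bsub>K.t i m\<^esub> (- ?e) \<odot>\<^bsub>K.t i m\<^esub> ?P) \<oplus>\<^bsub>K.t i m\<^esub> ?e \<odot>\<^bsub>K.t i m\<^esub> (?P \<oplus>\<^bsub>K.t i m\<^esub> K.pt i m f0 B) =
      K.pt i m A b1 \<oplus>\<^bsub>K.t i m\<^esub> (((- ?e) \<odot>\<^bsub>K.t i m\<^esub> ?P \<oplus>\<^bsub>K.t i m\<^esub> ?e \<odot>\<^bsub>K.t i m\<^esub> ?P) \<oplus>\<^bsub>K.t i m\<^esub> ?e \<odot>\<^bsub>K.t i m\<^esub> K.pt i m f0 B)"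
    using P PA PB by (simp add: t.smult_add t.a_assoc)
  \<comment> \<open>The two surplus terms cancel here.\<close>
  also have "(- ?e) \<odot>\<^bsub>K.t i m\<^esub> ?P \<oplus>\<^bsub>K.t i m\<^esub> ?e \<odot>\<^bsub>K.t i m\<^esub> ?P = \<zero>\<^bsub>K.t i m\<^esub>"
    using t.add_smult[OF P, of "- ?e" ?e] t.zero_smult[OF P] by simp
  also have "K.pt i m A b1 \<oplus>\<^bsub>K.t i m\<^esub> (\<zero>\<^bsub>K.t i m\<^esub> \<oplus>\<^bsub>K.t i m\<^esub> ?e \<odot>\<^bsub>K.t i m\<^esub> K.pt i m f0 B) =
      ?G (sum ?U {..i}) \<oplus>\<^bsub>K.t i m\<^esub> ?G (sum ?U' {..m})"
    using PB unfolding GU GV eB[symmetric] by simp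
  also have "\<dots> = ?G (sum ?U {..i} + sum ?U' {..m})"
  proof -
    have "sum ?U {..i} \<in> carrier (chain_module (prod_topology X Y) n)"
      using Uk i by (intro chain_sum_closed) simp
    moreover have "sum ?U' {..m} \<in> carrier (chain_module (prod_topology X Y) n)"
      by (rule chain_sum_closed[OF Uk'])
    ultimately show ?thesis using additive_mapD(2)[OF Ga] unfolding chain_module_simps by simp
  qed
  also have "sum ?U {..i} + sum ?U' {..m} = chain_diff (Suc n) (?s \<omega> 1)"
    unfolding split[symmetric] chain_diff_single by simp
  finally show "K.D (Suc n) (AWm (Suc n) (?s \<omega> 1)) i = AWm n (chain_diff (Suc n) (?s \<omega> 1)) i" .
qed

lemma AW_diff:
  assumes c: "c \<in> carrier (chain_module (prod_topology X Y) (Suc n))"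
  shows "K.D (Suc n) (AWm (Suc n) c) = AWm n (chain_diff (Suc n) c)"
proof (rule additive_chain_eqI[where f = "\<lambda>c. K.D (Suc n) (AWm (Suc n) c)" and g = "\<lambda>c. AWm n (chain_diff (Suc n) c)", OF _ _ _ _ c])
  note l1 = linear_map_compose[OF AW_extend(1) K.D_linear, of n]
  note l2 = linear_map_compose[OF chain_diff_linear AW_extend(1), of n]
  show "additive_map (chain_module (prod_topology X Y) (Suc n)) (K.T n) (\<lambda>c. K.D (Suc n) (AWm (Suc n) c))"
    "additive_map (chain_module (prod_topology X Y) (Suc n)) (K.T n) (\<lambda>c. AWm n (chain_diff (Suc n) c))"
    using linear_mapD(1)[OF l1] linear_mapD(1)[OF l2] .
  show "abelian_group (K.T n)" by (rule K.TC.abC)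
  fix \<omega> and r :: 'k assume w: "singular_simplex (Suc n) (prod_topology X Y) \<omega>"
  have s: "Poly_Mapping.single \<omega> (1::'k) \<in> carrier (chain_module (prod_topology X Y) (Suc n))" by (rule single_chain[OF w])
  have e: "Poly_Mapping.single \<omega> r = r \<odot>\<^bsub>chain_module (prod_topology X Y) (Suc n)\<^esub> Poly_Mapping.single \<omega> 1"
    by (simp add: chain_module_simps)
  show "K.D (Suc n) (AWm (Suc n) (Poly_Mapping.single \<omega> r)) = AWm n (chain_diff (Suc n) (Poly_Mapping.single \<omega> r))"
    unfolding e using linear_mapD(2)[OF l1 s, of r] linear_mapD(2)[OF l2 s, of r] AW_diff_simplex[OF w] by simp
qed

end

subsection \<open>Induced chain maps\<close>

lemma chain_push_single: "chain_push n f (Poly_Mapping.single \<sigma> k) = Poly_Mapping.single (simplex_map n f \<sigma>) k"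
  by (simp add: chain_push_def)

lemma chain_push_add: "chain_push n f (c + c') = chain_push n f c + chain_push n f c'"
  by (simp add: chain_push_def lin_extend_add)

lemma chain_push_linear:
  assumes "continuous_map X Y f"
  shows "linear_map (chain_module X n) (chain_module Y n) (chain_push n f)"
  unfolding chain_push_def
  by (rule linear_map_lin_extend) (use singular_simplex_simplex_map[OF _ assms] in auto)

lemma chain_push_sum: "chain_push n f (sum u A) = (\<Sum>x\<in>A. chain_push n f (u x))"
  by (simp add: chain_push_def lin_extend_sum)

lemma chain_diff_push:
  fixes c :: "'a simplex \<Rightarrow>\<^sub>0 'k::comm_ring_1"
  shows "chain_diff (Suc n) (chain_push (Suc n) f c) = chain_push n f (chain_diff (Suc n) c)"
proof -
  have "Poly_Mapping.keys c \<subseteq> UNIV" by simp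
  then show ?thesis
  proof (induction c rule: chain_induct)
    case (single \<sigma> k)
    show ?case
      unfolding chain_push_single chain_diff_single chain_push_sum
      by (rule sum.cong) (simp_all add: face_simplex_map)
  next
    case (add u v)
    then show ?case by (simp add: chain_push_add chain_diff_add)
  qed (simp add: chain_push_def)
qed

lemma cycle_boundary_map:
  assumes C: "kcomplex C d" and C': "kcomplex C' d'"
    and f: "\<And>n. linear_map (C n) (C' n) (f n)"
    and comm: "\<And>n x. x \<in> carrier (C (Suc n)) \<Longrightarrow> d' (Suc n) (f (Suc n) x) = f n (d (Suc n) x)"
  shows "z \<in> complex_cycles C d n \<Longrightarrow> f n z \<in> complex_cycles C' d' n"
    and "z \<in> complex_boundaries C d n \<Longrightarrow> f n z \<in> complex_boundaries C' d' n"
proof -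
  interpret C: kcomplex C d by fact
  interpret C': kcomplex C' d' by fact
  show "f n z \<in> C'.Z n" if z: "z \<in> C.Z n"
  proof (cases n)
    case 0
    then show ?thesis using linear_mapD(3)[OF f C.cycleD(1)[OF z]] by (simp add: complex_cycles_def)
  next
    case (Suc m)
    have "d n z = \<zero>\<^bsub>C m\<^esub>" "z \<in> carrier (C n)" using z Suc by (auto simp: complex_cycles_def)
    then have "d' n (f n z) = f m \<zero>\<^bsub>C m\<^esub>" using comm[of z m] Suc by simp
    also have "\<dots> = \<zero>\<^bsub>C' m\<^esub>" by (rule additive_map_zero[OF C.abC C'.abC linear_mapD(1)[OF f]])
    finally show ?thesis using linear_mapD(3)[OF f C.cycleD(1)[OF z]] Suc by (simp add: complex_cycles_def)
  qed
  show "f n z \<in> C'.Bd n" if z: "z \<in> C.Bd n"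
  proof -
    obtain y where y: "z = d (Suc n) y" "y \<in> carrier (C (Suc n))" using z by (auto simp: complex_boundaries_def)
    have "f n z = d' (Suc n) (f (Suc n) y)" unfolding y(1) by (rule comm[OF y(2), symmetric])
    then show ?thesis using linear_mapD(3)[OF f y(2)] by (auto simp: complex_boundaries_def)
  qed
qed

subsection \<open>The map rho as a cap product\<close>

definition cochain_eval :: "('x \<Rightarrow> 'k::comm_ring_1) \<Rightarrow> ('x \<Rightarrow>\<^sub>0 'k) \<Rightarrow> 'k" where
  "cochain_eval \<phi> c = (\<Sum>\<sigma>\<in>Poly_Mapping.keys c. Poly_Mapping.lookup c \<sigma> * \<phi> \<sigma>)"

lemma cochain_eval_superset:
  assumes "finite A" "Poly_Mapping.keys c \<subseteq> A"
  shows "cochain_eval \<phi> c = (\<Sum>\<sigma>\<in>A. Poly_Mapping.lookup c \<sigma> * \<phi> \<sigma>)"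
  unfolding cochain_eval_def using assms by (intro sum.mono_neutral_left) (auto simp: in_keys_iff)

lemma cochain_eval_simps:
  "cochain_eval \<phi> (Poly_Mapping.single \<sigma> k) = k * \<phi> \<sigma>" "cochain_eval \<phi> 0 = 0"
  "cochain_eval \<phi> (pscale r c) = r * cochain_eval \<phi> c"
proof -
  show "cochain_eval \<phi> (pscale r c) = r * cochain_eval \<phi> c"
    by (subst cochain_eval_superset[OF finite_keys keys_pscale])
      (simp add: cochain_eval_def sum_distrib_left mult.assoc)
qed (simp_all add: cochain_eval_superset[of "{\<sigma>}"] cochain_eval_def)

lemma cochain_eval_add: "cochain_eval \<phi> (c + c') = cochain_eval \<phi> c + cochain_eval \<phi> c'"
  using keys_add[of c c']
  by (simp add: cochain_eval_superset[of "Poly_Mapping.keys c \<union> Poly_Mapping.keys c'"]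
      lookup_add distrib_right sum.distrib)

lemma cochain_eval_linear: "linear_map (chain_module X n) scalar_module (cochain_eval \<phi>)"
  by (simp add: linear_map_def additive_map_def chain_module_simps scalar_module_simps cochain_eval_simps cochain_eval_add)

text \<open>The cap product with a 1-cochain: \<phi> is evaluated on the front edge, and the back
  q-face of a simplex of dimension q + 1 is its face opposite to vertex 0.\<close>

definition cap_simplex :: "('a simplex \<Rightarrow> 'k) \<Rightarrow> nat \<Rightarrow> ('a simplex \<Rightarrow>\<^sub>0 'k) \<Rightarrow> 'a simplex \<Rightarrow>\<^sub>0 'k::comm_ring_1" where
  "cap_simplex \<phi> q = lin_extend (\<lambda>\<sigma>. Poly_Mapping.single (singular_face (Suc q) 0 \<sigma>) (\<phi> (front_face 1 \<sigma>)))"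

lemma homology_chain_map:
  assumes C: "kcomplex C d" and C': "kcomplex C' d'"
    and f: "\<And>n. linear_map (C n) (C' n) (f n)"
    and comm: "\<And>n x. x \<in> carrier (C (Suc n)) \<Longrightarrow> d' (Suc n) (f (Suc n) x) = f n (d (Suc n) x)"
    and z: "z \<in> complex_cycles C d n"
  shows "homology_map C' d' n (f n) (complex_class C d n z) = complex_class C' d' n (f n z)"
proof (rule homology_map(2)[OF C C' f _ _ z])
  show "f n z \<in> complex_cycles C' d' n" if "z \<in> complex_cycles C d n" for z
    by (rule cycle_boundary_map(1)[where f = f, OF C C' f comm that])
  show "f n z \<in> complex_boundaries C' d' n" if "z \<in> complex_boundaries C d n" for z
    by (rule cycle_boundary_map(2)[where f = f, OF C C' f comm that])
qed

lemma simplex_map_diagonal: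
  assumes "singular_simplex n X \<sigma>"
  shows "simplex_map n fst (simplex_map n (\<lambda>x. (x, x)) \<sigma>) = \<sigma>" "simplex_map n snd (simplex_map n (\<lambda>x. (x, x)) \<sigma>) = \<sigma>"
  using assms by (auto simp: singular_simplex_def simplex_map_def fun_eq_iff extensional_def)

lemma continuous_map_diagonal: "continuous_map X (prod_topology X X) (\<lambda>x. (x, x))"
  by (simp add: continuous_map_pairedI)

text \<open>Both projections of a diagonal simplex give the simplex back, so component 1 of its
  Alexander-Whitney image is front edge tensor back q-face.\<close>

lemma cap_AW_diagonal:
  fixes \<phi> :: "'a simplex \<Rightarrow> 'k::comm_ring_1"
  assumes \<phi>: "\<And>x. x \<in> carrier (chain_module X 2) \<Longrightarrow> cochain_eval \<phi> (chain_diff 2 x) = 0"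
    and c: "c \<in> carrier (chain_module X (Suc q))"
  shows "complex_pair.cap (chain_module X) (cochain_eval \<phi>) q
      (alexander_whitney X X (Suc q) (chain_push (Suc q) (\<lambda>x. (x, x)) c)) = cap_simplex \<phi> q c"
proof -
  interpret K: complex_pair "chain_module X :: nat \<Rightarrow> ('k, _) module" chain_diff "chain_module X :: nat \<Rightarrow> ('k, _) module" chain_diff
    by (intro complex_pair.intro sing_kcomplex)
  let ?D = "\<lambda>x. (x, x) :: 'a \<times> 'a"
  note dc = continuous_map_diagonal[of X]
  note l1 = linear_map_compose[OF linear_map_compose[OF chain_push_linear[OF dc] AW_extend(1)] K.cap_linear[OF cochain_eval_linear \<phi>], of q]
  show ?thesis
  proof (rule additive_chain_eqI[OF K.A.abC linear_mapD(1)[OF l1] _ _ c])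
    show "additive_map (chain_module X (Suc q)) (chain_module X q) (cap_simplex \<phi> q)"
      unfolding cap_simplex_def
      by (rule linear_mapD(1)[OF linear_map_lin_extend]) (use face_simplex[of q X _ 0] in auto)
    fix \<sigma> and k :: 'k assume s: "singular_simplex (Suc q) X \<sigma>"
    let ?w = "simplex_map (Suc q) ?D \<sigma>"
    have w: "singular_simplex (Suc q) (prod_topology X X) ?w" by (rule singular_simplex_simplex_map[OF s dc])
    have a: "Poly_Mapping.single (front_face 1 \<sigma>) k \<in> carrier (chain_module X 1)"
      by (rule single_chain[OF front_face_simplex[OF s]]) simp
    have b: "Poly_Mapping.single (back_face 1 q \<sigma>) (1::'k) \<in> carrier (chain_module X q)"
      by (rule single_chain[OF back_face_simplex]) (use s in simp)
    have l: "1 \<le> Suc q" by simp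
    have A: "alexander_whitney X X (Suc q) (Poly_Mapping.single ?w k) 1 =
        K.pt 1 q (Poly_Mapping.single (front_face 1 \<sigma>) k) (Poly_Mapping.single (back_face 1 q \<sigma>) 1)"
      using AW_component[OF w l, of k] unfolding simplex_map_diagonal[OF s] diff_Suc_1 .
    have "K.cap (cochain_eval \<phi>) q (alexander_whitney X X (Suc q) (chain_push (Suc q) ?D (Poly_Mapping.single \<sigma> k)))
        = tensor_lift (chain_module X q) (\<lambda>a b. cochain_eval \<phi> a \<odot>\<^bsub>chain_module X q\<^esub> b)
            (K.pt 1 q (Poly_Mapping.single (front_face 1 \<sigma>) k) (Poly_Mapping.single (back_face 1 q \<sigma>) 1))"
      unfolding K.cap_def chain_push_single A ..
    also have "\<dots> = cochain_eval \<phi> (Poly_Mapping.single (front_face 1 \<sigma>) k) \<odot>\<^bsub>chain_module X q\<^esub>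
        Poly_Mapping.single (back_face 1 q \<sigma>) 1"
      by (rule K.cap_lift(2)[OF cochain_eval_linear \<phi> a b])
    also have "\<dots> = cap_simplex \<phi> q (Poly_Mapping.single \<sigma> k)"
      by (simp only: cochain_eval_simps(1) chain_module_simps(4) pscale_simps(5) cap_simplex_def
          lin_extend_single back_face_1 mult_1_right)
    finally show "K.cap (cochain_eval \<phi>) q (alexander_whitney X X (Suc q) (chain_push (Suc q) ?D (Poly_Mapping.single \<sigma> k)))
        = cap_simplex \<phi> q (Poly_Mapping.single \<sigma> k)" .
  qed
qed

text \<open>Surjectivity of the cross product ensures that the element picked by
  \<open>inv_into\<close> really is a preimage; \<open>cap_cross\<close> then computes the value
  from it.\<close>

lemma rho_class:
  fixes X :: "'a::topological_space set" and \<nu> :: "(real \<Rightarrow> 'a) set \<Rightarrow> 'p::prime_card mod_ring"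
  assumes \<phi>: "\<And>x. x \<in> carrier (chain_module (top_of_set X) 2) \<Longrightarrow> cochain_eval \<phi> (chain_diff 2 x) = 0"
    and nu: "linear_map (sing_homology (top_of_set X) 1) scalar_module (nu_star X x \<nu>)"
      "\<And>a. a \<in> complex_cycles (chain_module (top_of_set X)) chain_diff 1 \<Longrightarrow>
        nu_star X x \<nu> (complex_class (chain_module (top_of_set X)) chain_diff 1 a) = cochain_eval \<phi> a"
    and z: "z \<in> complex_cycles (chain_module (top_of_set X)) chain_diff (Suc q)"
  shows "rho X x \<nu> (Suc q) (complex_class (chain_module (top_of_set X)) chain_diff (Suc q) z) =
      complex_class (chain_module (top_of_set X)) chain_diff q (cap_simplex \<phi> q z)"
proof -
  let ?X = "top_of_set X" and ?D = "\<lambda>x. (x, x) :: 'a \<times> 'a"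
  let ?C = "chain_module ?X :: nat \<Rightarrow> ('p mod_ring, _) module"
  interpret K: complex_pair ?C chain_diff ?C chain_diff by (intro complex_pair.intro sing_kcomplex)
  obtain g where g: "split_complex ?C chain_diff g"
    by (rule sing_split[where X = "top_of_set X"])
  interpret S: split_pair ?C chain_diff g ?C chain_diff g by (intro split_pair.intro g)
  note dc = continuous_map_diagonal[of ?X]
  let ?w = "alexander_whitney ?X ?X (Suc q) (chain_push (Suc q) ?D z)"
  let ?P = "chain_module (prod_topology ?X ?X) :: nat \<Rightarrow> ('p mod_ring, _) module"
  let ?p = "\<lambda>n. chain_push n ?D :: ('a simplex \<Rightarrow>\<^sub>0 'p mod_ring) \<Rightarrow> _"
  let ?a = "alexander_whitney ?X ?X :: nat \<Rightarrow> (('a \<times> 'a) simplex \<Rightarrow>\<^sub>0 'p mod_ring) \<Rightarrow> _"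
  have pc: "?p (Suc q) z \<in> complex_cycles ?P chain_diff (Suc q)"
    by (rule cycle_boundary_map(1)[where f = ?p, OF sing_kcomplex sing_kcomplex chain_push_linear[OF dc] chain_diff_push z])
  have 1: "homology_map ?P chain_diff (Suc q) (?p (Suc q)) (K.A.cl (Suc q) z) = complex_class ?P chain_diff (Suc q) (?p (Suc q) z)"
    by (rule homology_chain_map[where f = ?p, OF sing_kcomplex sing_kcomplex chain_push_linear[OF dc] chain_diff_push z])
  have w: "?w \<in> K.TC.Z (Suc q)"
    by (rule cycle_boundary_map(1)[where f = ?a, OF sing_kcomplex K.TC.kcomplex_axioms AW_extend(1) AW_diff pc])
  have 2: "homology_map K.T K.D (Suc q) (?a (Suc q)) (complex_class ?P chain_diff (Suc q) (?p (Suc q) z)) = K.TC.cl (Suc q) ?w"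
    by (rule homology_chain_map[where f = ?a, OF sing_kcomplex K.TC.kcomplex_axioms AW_extend(1) AW_diff pc])
  let ?S = "carrier (direct_sum {..Suc q} (\<lambda>i. ctensor (K.A.H i) (K.A.H (Suc q - i))))"
  let ?cross = "homology_cross ?C chain_diff ?C chain_diff (Suc q)"
  obtain y0 where y0: "y0 \<in> ?S" "?cross y0 = K.TC.cl (Suc q) ?w" by (rule S.cross_surj[OF w])
  have im: "K.TC.cl (Suc q) ?w \<in> ?cross ` ?S" unfolding y0(2)[symmetric] by (rule imageI[OF y0(1)])
  define y where "y = inv_into ?S ?cross (K.TC.cl (Suc q) ?w)"
  have y: "y \<in> ?S" "?cross y = K.TC.cl (Suc q) ?w"
    unfolding y_def by (rule inv_into_into[OF im], rule f_inv_into_f[OF im])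
  have n: "nabla ?X (Suc q) (K.A.cl (Suc q) z) = y 1"
    unfolding nabla_def kunneth_iso_def 1 2 y_def ..
  have "rho X x \<nu> (Suc q) (K.A.cl (Suc q) z) = K.A.cl q (K.cap (cochain_eval \<phi>) q ?w)"
    unfolding rho_def Let_def n diff_Suc_1
    by (rule K.cap_cross[OF cochain_eval_linear \<phi> y(1) w y(2) nu])
  also have "K.cap (cochain_eval \<phi>) q ?w = cap_simplex \<phi> q z"
    by (rule cap_AW_diagonal[OF \<phi> K.A.cycleD(1)[OF z]])
  finally show ?thesis .
qed

subsection \<open>Singular simplices of dimension one\<close>

definition vertex :: "nat \<Rightarrow> nat \<Rightarrow> real" where
  "vertex k = (\<lambda>j. if j = k then 1 else 0)"

lemma vertex_simplex: "k \<le> n \<Longrightarrow> vertex k \<in> standard_simplex n"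
  by (auto simp: standard_simplex_def vertex_def sum.delta)

lemma simplical_face_vertex: "simplical_face k (vertex j) = vertex (if j < k then j else Suc j)"
  by (auto simp: simplical_face_def vertex_def fun_eq_iff)

lemma path_simplex_vertex: "path_simplex \<gamma> (vertex 0) = pathstart \<gamma>" "path_simplex \<gamma> (vertex 1) = pathfinish \<gamma>"
  using vertex_simplex[of 0 1] vertex_simplex[of 1 1]
  by (simp_all add: path_simplex_def pathstart_def pathfinish_def) (simp_all add: vertex_def)

lemma standard_simplex_1: "x \<in> standard_simplex 1 \<Longrightarrow> x 0 = 1 - x 1 \<and> x 1 \<in> {0..1}"
  by (auto simp: standard_simplex_def)

lemma singular_simplex_path_compose:
  assumes \<gamma>: "path \<gamma>" "path_image \<gamma> \<subseteq> X"
    and f: "continuous_map (powertop_real UNIV) euclideanreal f" "\<And>x. x \<in> standard_simplex n \<Longrightarrow> f x \<in> {0..1}"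
  shows "singular_simplex n (top_of_set X) (\<lambda>x\<in>standard_simplex n. \<gamma> (f x))"
proof -
  have "continuous_map (subtopology (powertop_real UNIV) (standard_simplex n)) (top_of_set {0..1}) f"
    using f by (auto simp: continuous_map_in_subtopology intro: continuous_map_from_subtopology)
  moreover have "continuous_map (top_of_set {0..1}) (top_of_set X) \<gamma>"
    using \<gamma> by (auto simp: path_def path_image_def)
  ultimately have "continuous_map (subtopology (powertop_real UNIV) (standard_simplex n)) (top_of_set X) (\<gamma> \<circ> f)"
    by (rule continuous_map_compose)
  then show ?thesis
    unfolding singular_simplex_def by (auto intro: continuous_map_eq)
qed

lemma continuous_map_coordinate: "continuous_map (powertop_real UNIV) euclideanreal (\<lambda>x. x (i::nat))"
  by (rule continuous_map_product_projection) simp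

lemma path_simplex_singular:
  assumes "path \<gamma>" "path_image \<gamma> \<subseteq> X"
  shows "singular_simplex 1 (top_of_set X) (path_simplex \<gamma>)"
  unfolding path_simplex_def
  by (rule singular_simplex_path_compose[OF assms continuous_map_coordinate]) (use standard_simplex_1 in auto)

definition simplex_path :: "'a simplex \<Rightarrow> real \<Rightarrow> 'a" where
  "simplex_path \<sigma> t = \<sigma> (\<lambda>j. if j = 0 then 1 - t else if j = 1 then t else 0)"

lemma simplex_path:
  assumes \<sigma>: "singular_simplex 1 (top_of_set X) \<sigma>"
  shows "path (simplex_path \<sigma>)" "path_image (simplex_path \<sigma>) \<subseteq> X" "path_simplex (simplex_path \<sigma>) = \<sigma>"
    "pathstart (simplex_path \<sigma>) = \<sigma> (vertex 0)" "pathfinish (simplex_path \<sigma>) = \<sigma> (vertex 1)"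
proof -
  let ?f = "\<lambda>(t::real) (j::nat). if j = 0 then 1 - t else if j = 1 then t else 0"
  have "continuous_map (top_of_set {0..1}) (powertop_real UNIV) ?f"
  proof (subst continuous_map_componentwise_UNIV, intro allI)
    fix k :: nat
    show "continuous_map (top_of_set {0..1}) euclideanreal (\<lambda>t. ?f t k)"
      by (cases "k = 0"; cases "k = 1") (auto intro!: continuous_intros)
  qed
  moreover have "?f t \<in> standard_simplex 1" if "t \<in> {0..1}" for t
    using that by (auto simp: standard_simplex_def)
  ultimately have "continuous_map (top_of_set {0..1}) (subtopology (powertop_real UNIV) (standard_simplex 1)) ?f"
    by (auto simp: continuous_map_in_subtopology)
  moreover have "continuous_map (subtopology (powertop_real UNIV) (standard_simplex 1)) (top_of_set X) \<sigma>"
    using \<sigma> by (simp add: singular_simplex_def)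
  ultimately have "continuous_map (top_of_set {0..1}) (top_of_set X) (\<sigma> \<circ> ?f)"
    by (rule continuous_map_compose)
  then have c: "continuous_map (top_of_set {0..1}) (top_of_set X) (simplex_path \<sigma>)"
    by (simp add: simplex_path_def[abs_def] o_def)
  then show "path (simplex_path \<sigma>)" "path_image (simplex_path \<sigma>) \<subseteq> X"
    by (auto simp: path_def path_image_def)
  show "path_simplex (simplex_path \<sigma>) = \<sigma>"
  proof (rule extensionalityI[of _ "standard_simplex 1"])
    fix x :: "nat \<Rightarrow> real" assume x: "x \<in> standard_simplex 1"
    have "?f (x 1) = x"
      using standard_simplex_1[OF x] standard_simplex_zero[OF x] by (auto simp: fun_eq_iff)
    then show "path_simplex (simplex_path \<sigma>) x = \<sigma> x"
      using x by (simp add: path_simplex_def simplex_path_def del: One_nat_def)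
  qed (use \<sigma> in \<open>auto simp: path_simplex_def singular_simplex_def\<close>)
  have "?f 0 = vertex 0" "?f 1 = vertex 1" by (auto simp: vertex_def fun_eq_iff)
  then show "pathstart (simplex_path \<sigma>) = \<sigma> (vertex 0)" "pathfinish (simplex_path \<sigma>) = \<sigma> (vertex 1)"
    by (simp_all add: pathstart_def pathfinish_def simplex_path_def)
qed

text \<open>The triangle is collapsed onto an interval by sending the vertices 0, 1, 2 to 0, 1/2, 1,
  that is, by \<open>x 1 / 2 + x 2\<close>, and then mapped by the joined path. Its edges are
  \<alpha>, \<beta> and the join.\<close>

lemma join_boundary:
  assumes \<alpha>: "path \<alpha>" "path_image \<alpha> \<subseteq> X" and \<beta>: "path \<beta>" "path_image \<beta> \<subseteq> X" and fs: "pathfinish \<alpha> = pathstart \<beta>"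
  shows "(Poly_Mapping.single (path_simplex \<alpha>) 1 + Poly_Mapping.single (path_simplex \<beta>) 1 -
      Poly_Mapping.single (path_simplex (\<alpha> +++ \<beta>)) (1::'k::comm_ring_1))
    \<in> complex_boundaries (chain_module (top_of_set X)) chain_diff 1"
proof -
  interpret K: kcomplex "chain_module (top_of_set X) :: nat \<Rightarrow> ('k, _) module" chain_diff by (rule sing_kcomplex)
  let ?f = "\<lambda>x::nat \<Rightarrow> real. x 1 / 2 + x 2"
  let ?\<kappa> = "\<lambda>x\<in>standard_simplex 2. (\<alpha> +++ \<beta>) (?f x)"
  have f01: "?f x \<in> {0..1}" if "x \<in> standard_simplex 2" for x
  proof -
    have "x 0 + x 1 + x 2 = 1" "0 \<le> x 0" "0 \<le> x 1" "0 \<le> x 2"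
      using that by (auto simp: standard_simplex_def numeral_2_eq_2)
    then show ?thesis by auto
  qed
  have fc: "continuous_map (powertop_real UNIV) euclideanreal ?f"
    by (intro continuous_map_add continuous_map_real_mult_right continuous_map_coordinate
        continuous_map_real_divide) auto
  have k: "singular_simplex 2 (top_of_set X) ?\<kappa>"
    by (rule singular_simplex_path_compose[OF _ _ fc f01])
      (use assms path_image_join_subset[of \<alpha> \<beta>] in auto)
  have face: "singular_face (Suc 1) j ?\<kappa> = (\<lambda>x\<in>standard_simplex 1. (\<alpha> +++ \<beta>) (?f (simplical_face j x)))" if "j \<le> 2" for j
    using that simplical_face_simplex[of j 1]
    by (intro extensionalityI[of _ "standard_simplex 1"])
      (auto simp: face_extensional singular_face_apply numeral_2_eq_2)
  have 0: "singular_face (Suc 1) 0 ?\<kappa> = path_simplex \<beta>"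
  proof (rule extensionalityI[of _ "standard_simplex 1"])
    fix x :: "nat \<Rightarrow> real" assume x: "x \<in> standard_simplex 1"
    have e: "?f (simplical_face 0 x) = (1 + x 1) / 2" "0 \<le> x 1"
      using standard_simplex_1[OF x] by (auto simp: simplical_face_def field_simps)
    show "singular_face (Suc 1) 0 ?\<kappa> x = path_simplex \<beta> x"
      unfolding face[OF le0] path_simplex_def restrict_apply'[OF x] e(1)
    proof (cases "x 1 = 0")
      \<comment> \<open>At the junction the join is evaluated through its first path, so agreement
        with \<beta> needs the matching end points.\<close>
      case True
      then show "(\<alpha> +++ \<beta>) ((1 + x 1) / 2) = \<beta> (x 1)"
        using fs by (simp add: joinpaths_def pathfinish_def pathstart_def)
    next
      case False
      then have "\<not> (1 + x 1) / 2 \<le> 1 / 2" using e(2) by simp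
      then have "(\<alpha> +++ \<beta>) ((1 + x 1) / 2) = \<beta> (2 * ((1 + x 1) / 2) - 1)"
        by (simp only: joinpaths_def if_False)
      also have "2 * ((1 + x 1) / 2) - 1 = x 1" by (simp only: field_simps) simp
      finally show "(\<alpha> +++ \<beta>) ((1 + x 1) / 2) = \<beta> (x 1)" .
    qed
  qed (auto simp: face_extensional path_simplex_def)
  have 2: "singular_face (Suc 1) 2 ?\<kappa> = path_simplex \<alpha>"
  proof (rule extensionalityI[of _ "standard_simplex 1"])
    fix x :: "nat \<Rightarrow> real" assume x: "x \<in> standard_simplex 1"
    have e: "?f (simplical_face 2 x) = x 1 / 2" "x 1 \<le> 1"
      using standard_simplex_1[OF x] by (auto simp: simplical_face_def)
    show "singular_face (Suc 1) 2 ?\<kappa> x = path_simplex \<alpha> x"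
      unfolding face[OF order_refl] path_simplex_def restrict_apply'[OF x] e(1)
      using e(2) by (auto simp: joinpaths_def)
  qed (auto simp: face_extensional path_simplex_def)
  have 1: "singular_face (Suc 1) 1 ?\<kappa> = path_simplex (\<alpha> +++ \<beta>)"
  proof (rule extensionalityI[of _ "standard_simplex 1"])
    fix x :: "nat \<Rightarrow> real" assume x: "x \<in> standard_simplex 1"
    have e: "?f (simplical_face 1 x) = x 1" by (auto simp: simplical_face_def)
    show "singular_face (Suc 1) 1 ?\<kappa> x = path_simplex (\<alpha> +++ \<beta>) x"
      using face[of 1] x e by (simp add: path_simplex_def)
  qed (auto simp: face_extensional path_simplex_def)
  have "chain_diff (Suc 1) (Poly_Mapping.single ?\<kappa> 1) = (Poly_Mapping.single (path_simplex \<alpha>) 1 +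
      Poly_Mapping.single (path_simplex \<beta>) 1 - Poly_Mapping.single (path_simplex (\<alpha> +++ \<beta>)) (1::'k))"
    unfolding chain_diff_single
    using 0 1 2 by (simp add: numeral_2_eq_2 single_uminus)
  moreover have "Poly_Mapping.single ?\<kappa> (1::'k) \<in> carrier (chain_module (top_of_set X) (Suc 1))"
    using k by (intro single_chain) (simp add: numeral_2_eq_2)
  ultimately show ?thesis using K.boundaryI[of "Poly_Mapping.single ?\<kappa> 1" 1] by simp
qed

subsection \<open>The Hurewicz homomorphism generates the first homology\<close>

lemma loop_cycle:
  assumes "\<gamma> \<in> based_loops X x"
  shows "Poly_Mapping.single (path_simplex \<gamma>) (k::'k::comm_ring_1) \<in> complex_cycles (chain_module (top_of_set X)) chain_diff 1"
proof -
  have g: "path \<gamma>" "path_image \<gamma> \<subseteq> X" "pathstart \<gamma> = x" "pathfinish \<gamma> = x" using assms by (auto simp: based_loops_def)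
  note s = path_simplex_singular[OF g(1,2)]
  have f: "singular_face (Suc 0) j (path_simplex \<gamma>) = (\<lambda>y\<in>standard_simplex 0. x)" if "j \<le> 1" for j
  proof (rule extensionalityI[of _ "standard_simplex 0"])
    fix y :: "nat \<Rightarrow> real" assume y: "y \<in> standard_simplex 0"
    have "y = vertex 0" using y by (auto simp: standard_simplex_def vertex_def fun_eq_iff)
    then show "singular_face (Suc 0) j (path_simplex \<gamma>) y = (\<lambda>y\<in>standard_simplex 0. x) y"
      using y that path_simplex_vertex[of \<gamma>] g
      by (cases "j = 0") (auto simp: singular_face_apply simplical_face_vertex)
  qed (auto simp: face_extensional)
  have "chain_diff (Suc 0) (Poly_Mapping.single (path_simplex \<gamma>) k) = 0"
    unfolding chain_diff_single using f[of 0] f[of 1] by (simp add: single_uminus)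
  then show ?thesis
    using single_chain[OF s, of k] by (simp add: complex_cycles_def chain_module_simps)
qed

lemma pscale_diff: "pscale a (c - c') = pscale a c - pscale a c'"
  using pscale_add(1)[of a c "- c'"] by (simp add: pscale_minus)

text \<open>With chosen paths \<open>\<beta>\<close> from \<open>x\<close> to all points, every edge
  is homologous to a difference of two based loops plus a difference of values of
  \<open>\<beta>\<close> at its ends. On a cycle the latter sums to zero, so the class is a
  combination of loops.\<close>

lemma loops_generate_homology:
  fixes X :: "'a::topological_space set"
  assumes pc: "path_connected X" and x: "x \<in> X"
    and f: "linear_map (sing_homology (top_of_set X) 1 :: ('k::comm_ring_1, _) module) scalar_module f"
    and g: "linear_map (sing_homology (top_of_set X) 1) scalar_module g"
    and eq: "\<And>\<gamma>. \<gamma> \<in> based_loops X x \<Longrightarrow>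
      f (complex_class (chain_module (top_of_set X)) chain_diff 1 (Poly_Mapping.single (path_simplex \<gamma>) 1)) =
      g (complex_class (chain_module (top_of_set X)) chain_diff 1 (Poly_Mapping.single (path_simplex \<gamma>) 1))"
    and U: "U \<in> carrier (sing_homology (top_of_set X) 1)"
  shows "f U = g U"
proof -
  let ?C = "chain_module (top_of_set X) :: nat \<Rightarrow> ('k, _) module"
  interpret K: kcomplex ?C chain_diff by (rule sing_kcomplex)
  interpret H: kmod "K.H 1" by (rule K.H_kmod)
  let ?s = "\<lambda>\<gamma>. Poly_Mapping.single (path_simplex \<gamma>) (1::'k)"
  obtain \<beta> where \<beta>: "\<And>a. a \<in> X \<Longrightarrow> path (\<beta> a) \<and> path_image (\<beta> a) \<subseteq> X \<and> pathstart (\<beta> a) = x \<and> pathfinish (\<beta> a) = a"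
    using pc x unfolding path_connected_def by metis
  define \<beta>' where "\<beta>' a = reversepath (\<beta> a)" for a
  have \<beta>': "path (\<beta>' a) \<and> path_image (\<beta>' a) \<subseteq> X \<and> pathstart (\<beta>' a) = a \<and> pathfinish (\<beta>' a) = x" if "a \<in> X" for a
    using \<beta>[OF that] by (simp add: \<beta>'_def)
  define l where "l \<sigma> = (\<beta> (\<sigma> (vertex 0)) +++ simplex_path \<sigma>) +++ \<beta>' (\<sigma> (vertex 1))" for \<sigma>
  \<comment> \<open>\<open>\<beta>'\<close> differs as a chain from minus \<open>\<beta>\<close> by
    this loop, up to a boundary; it corrects for closing up the edge with a reversed path.\<close>
  define m where "m \<sigma> = \<beta> (\<sigma> (vertex 1)) +++ \<beta>' (\<sigma> (vertex 1))" for \<sigma> :: "'a simplex"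
  let ?F = "\<lambda>\<sigma>. Poly_Mapping.single \<sigma> 1 - (?s (l \<sigma>) - ?s (m \<sigma>)) - (?s (\<beta> (\<sigma> (vertex 1))) - ?s (\<beta> (\<sigma> (vertex 0))))"
  let ?L = "\<lambda>\<sigma>. ?s (l \<sigma>) - ?s (m \<sigma>)"
  let ?T = "\<lambda>\<tau>. ?s (\<beta> (\<tau> (vertex 0)))"
  have vx: "\<sigma> (vertex k) \<in> X" if "singular_simplex n (top_of_set X) \<sigma>" "k \<le> n" for \<sigma> n k
    using that vertex_simplex[of k n] by (auto simp: singular_simplex_def continuous_map_def Pi_iff)
  have loops: "l \<sigma> \<in> based_loops X x" "m \<sigma> \<in> based_loops X x" if s: "singular_simplex 1 (top_of_set X) \<sigma>" for \<sigma>
  proof -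
    note v = vx[OF s, of 0] vx[OF s, of 1]
    note b = \<beta>[OF v(1)] \<beta>[OF v(2)] \<beta>'[OF v(2)]
    show "l \<sigma> \<in> based_loops X x" "m \<sigma> \<in> based_loops X x"
      using b simplex_path[OF s] unfolding l_def m_def based_loops_def
      by (auto simp: path_image_join)
  qed
  have Bd: "u + v \<in> K.Bd 1" "u - v \<in> K.Bd 1" if "u \<in> K.Bd 1" "v \<in> K.Bd 1" for u v
  proof -
    show "u + v \<in> K.Bd 1" using K.boundary_linear(2)[OF that] by (simp add: chain_module_simps)
    have "- v \<in> K.Bd 1" using K.boundary_linear(4)[OF that(2), of "- 1"] by (simp add: chain_module_simps pscale_minus)
    then show "u - v \<in> K.Bd 1" using K.boundary_linear(2)[OF that(1), of "- v"] by (simp add: chain_module_simps)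
  qed
  have FBd: "?F \<sigma> \<in> K.Bd 1" if s: "singular_simplex 1 (top_of_set X) \<sigma>" for \<sigma>
  proof -
    note v = vx[OF s, of 0] vx[OF s, of 1]
    note b = \<beta>[OF v(1)] \<beta>[OF v(2)] \<beta>'[OF v(2)] and p = simplex_path[OF s]
    have 1: "?s (\<beta> (\<sigma> (vertex 0))) + ?s (simplex_path \<sigma>) - ?s (\<beta> (\<sigma> (vertex 0)) +++ simplex_path \<sigma>) \<in> K.Bd 1"
      by (rule join_boundary) (use b p in auto)
    have 2: "?s (\<beta> (\<sigma> (vertex 0)) +++ simplex_path \<sigma>) + ?s (\<beta>' (\<sigma> (vertex 1))) - ?s (l \<sigma>) \<in> K.Bd 1"
      unfolding l_def by (rule join_boundary) (use b p in \<open>auto simp: path_image_join\<close>)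
    have 3: "?s (\<beta> (\<sigma> (vertex 1))) + ?s (\<beta>' (\<sigma> (vertex 1))) - ?s (m \<sigma>) \<in> K.Bd 1"
      unfolding m_def by (rule join_boundary) (use b p in auto)
    show ?thesis using Bd(2)[OF Bd(1)[OF 1 2] 3] by (simp add: p(3) algebra_simps)
  qed
  have FB: "lin_extend ?F c \<in> K.Bd 1" if "c \<in> carrier (?C 1)" for c
    using that
  proof (induction c rule: chain_module_induct)
    case zero
    show ?case using K.boundary_linear(1)[of 1] by (simp add: chain_module_simps)
  next
    case (single \<sigma> k)
    show ?case using K.boundary_linear(4)[OF FBd[OF single], of k] by (simp add: chain_module_simps)
  next
    case (add u v)
    show ?case using Bd(1)[OF add(3,4)] by (simp add: lin_extend_add)
  qed
  \<comment> \<open>The correction at the end points factors through the boundary of the chain,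
    hence vanishes on cycles.\<close>
  have dT: "lin_extend (\<lambda>\<sigma>. ?s (\<beta> (\<sigma> (vertex 1))) - ?s (\<beta> (\<sigma> (vertex 0)))) c = lin_extend ?T (chain_diff 1 c)" for c
  proof -
    have v: "singular_face (Suc 0) j \<sigma> (vertex 0) = \<sigma> (vertex (if j = 0 then 1 else 0))" for j and \<sigma> :: "'a simplex"
      by (simp add: singular_face_apply vertex_simplex simplical_face_vertex)
    have "Poly_Mapping.keys c \<subseteq> UNIV" by simp
    then show ?thesis
    proof (induction c rule: chain_induct)
      case (single \<sigma> k)
      have "chain_diff (Suc 0) (Poly_Mapping.single \<sigma> k) =
          Poly_Mapping.single (singular_face (Suc 0) 0 \<sigma>) k - Poly_Mapping.single (singular_face (Suc 0) 1 \<sigma>) k"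
        unfolding chain_diff_single by (simp add: single_uminus)
      then show ?case by (simp add: lin_extend_diff v pscale_diff)
    next
      case (add u v)
      then show ?case by (simp add: lin_extend_add chain_diff_add)
    qed simp
  qed
  have LZ: "lin_extend ?L c \<in> K.Z 1 \<and> f (K.cl 1 (lin_extend ?L c)) = g (K.cl 1 (lin_extend ?L c))"
    if "c \<in> carrier (?C 1)" for c
    using that
  proof (induction c rule: chain_module_induct)
    case zero
    have "K.cl 1 0 \<in> carrier (K.H 1)" "0 \<odot>\<^bsub>?C 1\<^esub> 0 = (0 :: _ \<Rightarrow>\<^sub>0 'k)" and z: "(0 :: _ \<Rightarrow>\<^sub>0 'k) \<in> K.Z 1"
      using K.cl_in_H[of 0 1] K.cycle_linear(1)[of 1] by (auto simp: chain_module_simps)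
    then have h0: "h (K.cl 1 0) = 0" if "linear_map (K.H 1) scalar_module h" for h :: "_ \<Rightarrow> 'k"
      using linear_mapD(2)[OF that, of "K.cl 1 0" 0] K.cl_smult[of 0 1 0] z by (simp add: scalar_module_simps)
    show ?case using h0[OF f] h0[OF g] z by (simp del: One_nat_def)
  next
    case (single \<sigma> k)
    note lo = loops[OF single]
    have 1: "?s (l \<sigma>) \<in> K.Z 1" "?s (m \<sigma>) \<in> K.Z 1" using loop_cycle lo by blast+
    have e: "lin_extend ?L (Poly_Mapping.single \<sigma> k) = k \<odot>\<^bsub>?C 1\<^esub> ?s (l \<sigma>) \<oplus>\<^bsub>?C 1\<^esub> (- k) \<odot>\<^bsub>?C 1\<^esub> ?s (m \<sigma>)"
      by (simp add: chain_module_simps pscale_diff single_uminus)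
    have z: "k \<odot>\<^bsub>?C 1\<^esub> ?s (l \<sigma>) \<in> K.Z 1" "(- k) \<odot>\<^bsub>?C 1\<^esub> ?s (m \<sigma>) \<in> K.Z 1"
      using K.cycle_linear(4) 1 by blast+
    have h: "h (K.cl 1 (k \<odot>\<^bsub>?C 1\<^esub> ?s (l \<sigma>) \<oplus>\<^bsub>?C 1\<^esub> (- k) \<odot>\<^bsub>?C 1\<^esub> ?s (m \<sigma>))) = k * h (K.cl 1 (?s (l \<sigma>))) - k * h (K.cl 1 (?s (m \<sigma>)))"
      if h: "linear_map (K.H 1) scalar_module h" for h :: "_ \<Rightarrow> 'k"
      unfolding K.cl_add[OF z] K.cl_smult[OF 1(1)] K.cl_smult[OF 1(2)]
      by (simp add: linear_mapD(4)[OF h] linear_mapD(2)[OF h] K.cl_in_H[OF 1(1)] K.cl_in_H[OF 1(2)] H.smult_closed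
          scalar_module_simps del: One_nat_def)
    show ?case
      unfolding e h[OF f] h[OF g] using eq[OF lo(1)] eq[OF lo(2)] K.cycle_linear(2)[OF z] by simp
  next
    case (add u v)
    have u: "lin_extend ?L u \<in> K.Z 1" and v: "lin_extend ?L v \<in> K.Z 1" using add by auto
    have e: "lin_extend ?L (u + v) = lin_extend ?L u \<oplus>\<^bsub>?C 1\<^esub> lin_extend ?L v"
      by (simp add: lin_extend_add chain_module_simps)
    show ?case
      unfolding e K.cl_add[OF u v] linear_mapD(4)[OF f K.cl_in_H[OF u] K.cl_in_H[OF v]]
        linear_mapD(4)[OF g K.cl_in_H[OF u] K.cl_in_H[OF v]]
      using add K.cycle_linear(2)[OF u v] by simp
  qed
  obtain z where z: "z \<in> K.Z 1" "U = K.cl 1 z" using U by (rule K.H_carrierE)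
  have dz: "chain_diff 1 z = 0" "z \<in> carrier (?C 1)" using z(1) by (auto simp: complex_cycles_def chain_module_simps)
  have Fe: "lin_extend ?F c = lin_extend (\<lambda>x. Poly_Mapping.single x 1) c - lin_extend ?L c -
      lin_extend (\<lambda>\<sigma>. ?s (\<beta> (\<sigma> (vertex 1))) - ?s (\<beta> (\<sigma> (vertex 0)))) c" for c
    unfolding lin_extend_def
    by (simp only: pscale_diff sum_subtractf)
  have "lin_extend ?F z = z - lin_extend ?L z" unfolding Fe lin_extend_ident dT dz(1) by simp
  then have "z - lin_extend ?L z \<in> K.Bd 1" using FB[OF dz(2)] by simp
  moreover have "z \<ominus>\<^bsub>?C 1\<^esub> lin_extend ?L z = z - lin_extend ?L z"
    using LZ[OF dz(2)] K.cycleD(1)[of "lin_extend ?L z" 1] chain_module_neg[of "lin_extend ?L z" "top_of_set X" 1]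
    by (simp add: a_minus_def chain_module_simps)
  ultimately have "U = K.cl 1 (lin_extend ?L z)"
    using K.cl_eq_iff[OF z(1), of "lin_extend ?L z"] LZ[OF dz(2)] z(2) by simp
  then show ?thesis using LZ[OF dz(2)] by simp
qed

subsection \<open>The group algebra of the cyclic group\<close>

abbreviation (input) aug :: "'p::prime_card group_algebra \<Rightarrow> 'p mod_ring" where
  "aug \<equiv> cochain_eval (\<lambda>_. 1)"

abbreviation (input) emb :: "'p::prime_card mod_ring \<Rightarrow> 'p group_algebra" where
  "emb \<equiv> Poly_Mapping.single 0"

text \<open>The element s of the overview; it generates \<open>augmentation_ideal\<close>.\<close>

definition aug_gen :: "'p::prime_card group_algebra" where
  "aug_gen = Poly_Mapping.single 1 1 - 1"

lemma aug_simps: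
  fixes a b :: "'p::prime_card group_algebra" and k x :: "'p mod_ring"
  shows "aug (a + b) = aug a + aug b" "aug (a * b) = aug a * aug b" "aug (emb k) = k" "aug 1 = (1 :: 'p mod_ring)" "aug 0 = (0 :: 'p mod_ring)"
  "aug (of_int i) = (of_int i :: 'p mod_ring)" "aug (Poly_Mapping.single x k) = k" "aug (a - b) = aug a - aug b"
  "aug aug_gen = (0 :: 'p mod_ring)"
proof -
  have s: "aug (Poly_Mapping.single x k) = k" for x k :: "'p mod_ring" by (simp add: cochain_eval_simps)
  show a: "aug (a + b) = aug a + aug b" for a b :: "'p group_algebra" by (rule cochain_eval_add)
  have m: "aug (Poly_Mapping.single x k * b) = k * aug b" for x k :: "'p mod_ring" and b
  proof -
    have "Poly_Mapping.keys b \<subseteq> UNIV" by simp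
    then show ?thesis
      by (induction b rule: chain_induct) (simp_all add: cochain_eval_simps cochain_eval_add mult_single distrib_left)
  qed
  show "aug (a * b) = aug a * aug b"
  proof -
    have "Poly_Mapping.keys a \<subseteq> UNIV" by simp
    then show ?thesis
      by (induction a rule: chain_induct) (simp_all add: cochain_eval_simps cochain_eval_add m distrib_right)
  qed
  show one: "aug 1 = (1 :: 'p mod_ring)" using s[of 0 1] by simp
  show "aug (emb k) = k" by (rule s)
  show "aug (Poly_Mapping.single x k) = k" by (rule s)
  show "aug 0 = (0 :: 'p mod_ring)" by (rule cochain_eval_simps(2))
  show "aug (of_int i) = (of_int i :: 'p mod_ring)" using s[of 0 "of_int i"] by simp
  show d: "aug (a - b) = aug a - aug b" for a b :: "'p group_algebra" using a[of "a - b" b] by simp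
  show "aug aug_gen = (0 :: 'p mod_ring)" unfolding aug_gen_def d one by (simp add: s)
qed

lemma single_power: "Poly_Mapping.single x 1 ^ n = Poly_Mapping.single (of_nat n * x :: 'p::prime_card mod_ring) (1 :: 'p mod_ring)"
  by (induction n) (simp_all add: mult_single distrib_right)

lemma of_nat_group_algebra: "of_nat n = (emb (of_nat n) :: 'p::prime_card group_algebra)"
  by simp

text \<open>Every group element is a power of t, and \<open>t^n - 1\<close> is divisible by
  \<open>t - 1\<close>; the general case follows by linearity.\<close>

lemma aug_gen_dvd:
  fixes a :: "'p::prime_card group_algebra"
  shows "aug_gen dvd a - emb (aug a)"
proof -
  have t: "aug_gen dvd Poly_Mapping.single x 1 - 1" for x :: "'p mod_ring"
  proof -
    obtain n where n: "x = of_nat n" using surj_of_nat_mod_ring by blast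
    have "aug_gen dvd Poly_Mapping.single 1 1 ^ n - (1 :: 'p group_algebra)"
      unfolding aug_gen_def power_diff_1_eq by simp
    then show ?thesis unfolding single_power n by simp
  qed
  have "Poly_Mapping.keys a \<subseteq> UNIV" by simp
  then show ?thesis
  proof (induction a rule: chain_induct)
    case (single x k)
    have "Poly_Mapping.single x k - emb k = emb k * (Poly_Mapping.single x 1 - 1)"
      by (simp add: right_diff_distrib mult_single)
    then show ?case using t[of x] by (simp add: aug_simps)
  next
    case (add u v)
    have "u + v - emb (aug (u + v)) = (u - emb (aug u)) + (v - emb (aug v))"
      by (simp add: aug_simps single_add)
    then show ?case using dvd_add[OF add(3,4)] by (simp only:)
  qed (simp add: aug_simps)
qed

lemma prime_card_odd:
  assumes "CARD('p::prime_card) \<noteq> 2"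
  shows "odd CARD('p)" "prime CARD('p)" "3 \<le> CARD('p)"
proof -
  show p: "prime CARD('p)" by (rule prime_card)
  show "odd CARD('p)" using p assms prime_odd_nat[of "CARD('p)"] prime_ge_2_nat[of "CARD('p)"] by simp
  show "3 \<le> CARD('p)" using prime_ge_2_nat[OF p] assms by simp
qed

lemma of_nat_mod_ring_eq_0_iff: "(of_nat n :: 'p::prime_card mod_ring) = 0 \<longleftrightarrow> CARD('p) dvd n"
  using of_nat_eq_0_iff_char_dvd[of n, where 'a = "'p mod_ring"] by simp

text \<open>The inner binomial coefficients of \<open>(t - 1)^p\<close> are divisible by p, and
  \<open>t^p = 1\<close> cancels \<open>(-1)^p\<close>.\<close>

lemma aug_gen_power_card:
  assumes odd: "CARD('p::prime_card) \<noteq> 2"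
  shows "aug_gen ^ CARD('p) = (0 :: 'p group_algebra)"
proof -
  let ?p = "CARD('p)" and ?t = "Poly_Mapping.single 1 1 :: 'p group_algebra"
  note p = prime_card_odd[OF odd]
  have "aug_gen ^ ?p = (\<Sum>k\<le>?p. of_nat (?p choose k) * ?t ^ k * (- 1) ^ (?p - k))"
    unfolding aug_gen_def diff_conv_add_uminus binomial_ring ..
  also have "\<dots> = (\<Sum>k\<in>{0, ?p}. of_nat (?p choose k) * ?t ^ k * (- 1) ^ (?p - k))"
  proof (rule sum.mono_neutral_right)
    show "\<forall>k\<in>{..?p} - {0, ?p}. of_nat (?p choose k) * ?t ^ k * (- 1) ^ (?p - k) = 0"
    proof
      fix k assume k: "k \<in> {..?p} - {0, ?p}"
      have "?p dvd ?p choose k" using k p(2) by (intro dvd_choose_prime) auto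
      then have "(of_nat (?p choose k) :: 'p mod_ring) = 0" by (simp add: of_nat_mod_ring_eq_0_iff)
      then have "(of_nat (?p choose k) :: 'p group_algebra) = 0" by (simp add: of_nat_group_algebra del: single_of_nat)
      then show "of_nat (?p choose k) * ?t ^ k * (- 1) ^ (?p - k) = 0" by simp
    qed
  qed auto
  also have "\<dots> = (- 1) ^ ?p + ?t ^ ?p" using p(3) by simp
  also have "?t ^ ?p = 1"
    unfolding single_power using of_nat_mod_ring_eq_0_iff[of ?p, where 'p = 'p] by simp
  finally show ?thesis using p(1) by simp
qed

text \<open>Write \<open>a\<close> as its augmentation plus a multiple of s; since
  \<open>s^p = 0\<close>, only the augmentation matters. The coefficient of \<open>s^(p-1)\<close>
  at the unit of the group is \<open>(-1)^(p-1) = 1\<close>, so the augmentation must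
  vanish.\<close>

lemma aug_gen_power_annihilates:
  assumes odd: "CARD('p::prime_card) \<noteq> 2" and a: "aug_gen ^ (CARD('p) - 1) * a = (0 :: 'p group_algebra)"
  shows "aug a = 0"
proof -
  let ?m = "CARD('p) - 1" and ?t = "Poly_Mapping.single 1 1 :: 'p group_algebra" and ?e = "aug a"
  note p = prime_card_odd[OF odd]
  obtain b where "a - emb ?e = aug_gen * b" using aug_gen_dvd by (rule dvdE)
  then have b: "a = emb ?e + aug_gen * b" by (simp add: algebra_simps)
  have "Suc ?m = CARD('p)" using p(3) by simp
  then have z: "aug_gen ^ ?m * (aug_gen * b) = 0"
    using aug_gen_power_card[OF odd] by (simp only: mult.assoc[symmetric] power_Suc2[symmetric] mult_zero_left)
  have "aug_gen ^ ?m * emb ?e + aug_gen ^ ?m * (aug_gen * b) = 0"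
    using a unfolding distrib_left[symmetric] b[symmetric] .
  then have "aug_gen ^ ?m * emb ?e = 0" unfolding z by simp
  moreover have "aug_gen ^ ?m * emb ?e = (\<Sum>k\<le>?m. Poly_Mapping.single (of_nat k) (of_nat (?m choose k) * (- 1) ^ (?m - k) * ?e))"
  proof -
    have e: "(- 1) ^ j = (emb ((- 1) ^ j) :: 'p group_algebra)" for j
      by (induction j) (simp_all add: single_uminus)
    have "aug_gen ^ ?m = (\<Sum>k\<le>?m. of_nat (?m choose k) * ?t ^ k * (- 1) ^ (?m - k))"
      unfolding aug_gen_def diff_conv_add_uminus binomial_ring ..
    also have "\<dots> * emb ?e = (\<Sum>k\<le>?m. Poly_Mapping.single (of_nat k) (of_nat (?m choose k) * (- 1) ^ (?m - k) * ?e))"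
      unfolding sum_distrib_right single_power e of_nat_group_algebra by (simp add: mult_single del: single_of_nat)
    finally show ?thesis .
  qed
  ultimately have "0 = Poly_Mapping.lookup (\<Sum>k\<le>?m. Poly_Mapping.single (of_nat k) (of_nat (?m choose k) * (- 1) ^ (?m - k) * ?e)) (0 :: 'p mod_ring)"
    by simp
  also have "\<dots> = (\<Sum>k\<le>?m. if k = 0 then ?e else 0)"
    unfolding lookup_sum
  proof (rule sum.cong[OF refl])
    fix k assume k: "k \<in> {..?m}"
    \<comment> \<open>The exponents 0, ..., p - 1 are distinct residues, so a single binomial term
      meets the unit of the group.\<close>
    have "(of_nat k :: 'p mod_ring) = 0 \<longleftrightarrow> k = 0"
    proof -
      have "k < CARD('p)" using k p(3) by auto
      then show ?thesis unfolding of_nat_mod_ring_eq_0_iff by (auto dest: dvd_imp_le)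
    qed
    moreover have "even ?m" using p(1) by simp
    ultimately show "Poly_Mapping.lookup (Poly_Mapping.single (of_nat k) (of_nat (?m choose k) * (- 1) ^ (?m - k) * ?e)) (0 :: 'p mod_ring) = (if k = 0 then ?e else 0)"
      by (simp add: lookup_single when_def)
  qed
  also have "\<dots> = ?e" by (simp add: sum.delta)
  finally show ?thesis by simp
qed

text \<open>The expansion of \<open>(1 + s)^x\<close> to second order, by induction on a
  representative of x. Its linear coefficient x is how the values of the cocycle become coefficients
  of a cap product.\<close>

lemma single_expand:
  obtains r :: "'p::prime_card mod_ring \<Rightarrow> 'p group_algebra" where "\<And>x. Poly_Mapping.single x 1 - 1 = aug_gen * emb x + aug_gen * (aug_gen * r x)"
proof -
  have n: "\<exists>r. Poly_Mapping.single (of_nat n :: 'p mod_ring) 1 - 1 = aug_gen * emb (of_nat n) + aug_gen * (aug_gen * r)" for n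
  proof (induction n)
    case 0
    show ?case by (intro exI[of _ 0]) simp
  next
    case (Suc n)
    then obtain r where r0: "Poly_Mapping.single (of_nat n :: 'p mod_ring) 1 - 1 = aug_gen * emb (of_nat n) + aug_gen * (aug_gen * r)"
      by (elim exE) (rule that)
    have r: "Poly_Mapping.single (of_nat n :: 'p mod_ring) 1 = 1 + aug_gen * emb (of_nat n) + aug_gen * (aug_gen * r)"
      using r0 unfolding diff_eq_eq by (simp only: ac_simps)
    have t: "Poly_Mapping.single (1 :: 'p mod_ring) 1 = 1 + aug_gen" by (simp add: aug_gen_def)
    have "Poly_Mapping.single (of_nat (Suc n) :: 'p mod_ring) 1 =
        (Poly_Mapping.single (1 :: 'p mod_ring) 1 * Poly_Mapping.single (of_nat n :: 'p mod_ring) 1 :: 'p group_algebra)"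
      by (simp add: mult_single)
    also have "\<dots> = (1 + aug_gen) * (1 + aug_gen * emb (of_nat n) + aug_gen * (aug_gen * r))"
      unfolding r t ..
    finally have "Poly_Mapping.single (of_nat (Suc n) :: 'p mod_ring) 1 - 1 =
        aug_gen * (emb (of_nat n) + 1) + aug_gen * (aug_gen * (emb (of_nat n) + r + aug_gen * r))"
      by (simp add: algebra_simps del: single_of_nat of_nat_Suc)
    moreover have "emb (of_nat n) + 1 = (emb (of_nat (Suc n)) :: 'p group_algebra)"
      unfolding of_nat_group_algebra[symmetric] by simp
    ultimately show ?case by (intro exI) simp
  qed
  have "\<exists>r. Poly_Mapping.single x 1 - 1 = aug_gen * emb x + aug_gen * (aug_gen * r)" for x :: "'p mod_ring"
    using n surj_of_nat_mod_ring[of x] by (elim exE conjE) (simp only:)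
  then have "\<exists>r. \<forall>x :: 'p mod_ring. Poly_Mapping.single x 1 - 1 = aug_gen * emb x + aug_gen * (aug_gen * r x)"
    by (intro choice allI)
  then show thesis using that by (elim exE) blast
qed

lemma group_algebra_simps:
  "carrier group_algebra = UNIV" "a \<otimes>\<^bsub>group_algebra\<^esub> b = a * b" "a \<oplus>\<^bsub>group_algebra\<^esub> b = a + b" "\<zero>\<^bsub>group_algebra\<^esub> = 0"
  by (simp_all add: group_algebra_def)

lemma ideal_square_dvd:
  assumes "a \<in> ideal_prod group_algebra augmentation_ideal augmentation_ideal"
  obtains b where "a = b * aug_gen ^ 2"
proof -
  have "aug_gen ^ 2 dvd a"
    using assms
  proof (induction a rule: ideal_prod.induct)
    case (prod i j)
    then obtain k l where "i = k * aug_gen" "j = l * aug_gen"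
      by (auto simp: augmentation_ideal_def cgenideal_def group_algebra_simps aug_gen_def)
    then have "i \<otimes>\<^bsub>group_algebra\<^esub> j = aug_gen ^ 2 * (k * l)" by (simp add: group_algebra_simps power2_eq_square ac_simps)
    then show ?case by simp
  next
    case (sum a b)
    then show ?case by (simp add: group_algebra_simps)
  qed
  then show thesis using that by (metis dvdE mult.commute)
qed

text \<open>The final claim is an equality of sets, so zero itself must be exhibited as a product of
  an ideal element and a class.\<close>

lemma zero_in_ideal_square: "0 \<in> ideal_prod group_algebra augmentation_ideal augmentation_ideal"
proof -
  have "0 \<in> augmentation_ideal" by (auto simp: augmentation_ideal_def cgenideal_def group_algebra_simps intro!: exI[of _ 0])
  from ideal_prod.prod[OF this this, of group_algebra] show ?thesis by (simp add: group_algebra_simps)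
qed

subsection \<open>The cocycle on the base of a covering\<close>

locale nu_cover = universal_cover X E \<pi> e
  for X :: "'a::topological_space set" and E :: "'b::topological_space set" and \<pi> e +
  fixes \<nu> :: "(real \<Rightarrow> 'a) set \<Rightarrow> 'p::prime_card mod_ring"
  assumes nu_hom: "\<nu> \<in> hom G additive_cyclic_group"
begin

lemma nu_mult: "g \<in> carrier G \<Longrightarrow> h \<in> carrier G \<Longrightarrow> \<nu> (g \<otimes>\<^bsub>G\<^esub> h) = \<nu> g + \<nu> h"
  using nu_hom by (auto simp: hom_def additive_cyclic_group_def)

definition fibre_point :: "'a \<Rightarrow> 'b" where
  "fibre_point a = (SOME y. y \<in> E \<and> \<pi> y = a)"

text \<open>The position of \<open>y\<close> in its fibre, measured from a chosen point of that
  fibre and read through \<nu>.\<close>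

definition phase :: "'b \<Rightarrow> 'p mod_ring" where
  "phase y = \<nu> (SOME g. g \<in> carrier G \<and> deck g (fibre_point (\<pi> y)) = y)"

lemma fibre_point: "y \<in> E \<Longrightarrow> fibre_point (\<pi> y) \<in> E \<and> \<pi> (fibre_point (\<pi> y)) = \<pi> y"
  unfolding fibre_point_def by (rule someI[of _ y]) simp

lemma phase_eq: "g \<in> carrier G \<Longrightarrow> y \<in> E \<Longrightarrow> deck g (fibre_point (\<pi> y)) = y \<Longrightarrow> phase y = \<nu> g"
proof -
  assume g: "g \<in> carrier G" "y \<in> E" "deck g (fibre_point (\<pi> y)) = y"
  let ?h = "SOME g. g \<in> carrier G \<and> deck g (fibre_point (\<pi> y)) = y"
  have h: "?h \<in> carrier G \<and> deck ?h (fibre_point (\<pi> y)) = y" by (rule someI[of _ g]) (simp add: g)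
  have "?h = g" by (rule deck_free[of _ _ "fibre_point (\<pi> y)"]) (use g h fibre_point in auto)
  then show ?thesis by (simp add: phase_def)
qed

text \<open>A deck transformation stays in the fibre, so both points are measured from the same
  reference point and the group elements multiply.\<close>

lemma phase_deck:
  assumes g: "g \<in> carrier G" and y: "y \<in> E"
  shows "phase (deck g y) = \<nu> g + phase y"
proof -
  note f = fibre_point[OF y]
  obtain h where h: "h \<in> carrier G" "deck h (fibre_point (\<pi> y)) = y"
    using deck_transitive[of "fibre_point (\<pi> y)" y] f y by metis
  have "deck (g \<otimes>\<^bsub>G\<^esub> h) (fibre_point (\<pi> (deck g y))) = deck g y"
    using deck_mult(2)[OF g h(1)] f h(2) deck(4)[OF g y] by simp
  then have "phase (deck g y) = \<nu> (g \<otimes>\<^bsub>G\<^esub> h)"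
    by (intro phase_eq deck_mult(1)[OF g h(1)] deck(3)[OF g y])
  then show ?thesis using phase_eq[OF h(1) y h(2)] nu_mult[OF g h(1)] by simp
qed

definition the_lift :: "nat \<Rightarrow> 'a simplex \<Rightarrow> 'b simplex" where
  "the_lift n \<sigma> = (SOME \<tau>. singular_simplex n (top_of_set E) \<tau> \<and> simplex_map n \<pi> \<tau> = \<sigma>)"

lemma the_lift:
  assumes "singular_simplex n (top_of_set X) \<sigma>"
  shows "singular_simplex n (top_of_set E) (the_lift n \<sigma>)" "simplex_map n \<pi> (the_lift n \<sigma>) = \<sigma>"
proof -
  have "\<exists>\<tau>. singular_simplex n (top_of_set E) \<tau> \<and> simplex_map n \<pi> \<tau> = \<sigma>" using simplex_lift[OF assms] by metis
  then have "singular_simplex n (top_of_set E) (the_lift n \<sigma>) \<and> simplex_map n \<pi> (the_lift n \<sigma>) = \<sigma>"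
    unfolding the_lift_def by (rule someI_ex)
  then show "singular_simplex n (top_of_set E) (the_lift n \<sigma>)" "simplex_map n \<pi> (the_lift n \<sigma>) = \<sigma>" by auto
qed

lemma simplex_vertex: "singular_simplex n (top_of_set Y) \<sigma> \<Longrightarrow> k \<le> n \<Longrightarrow> \<sigma> (vertex k) \<in> Y"
  using vertex_simplex[of k n] by (auto simp: singular_simplex_def continuous_map_def Pi_iff)

lemma phase_deck_simplex:
  assumes "g \<in> carrier G" "singular_simplex n (top_of_set E) \<sigma>" "k \<le> n"
  shows "phase (simplex_map n (deck g) \<sigma> (vertex k)) = \<nu> g + phase (\<sigma> (vertex k))"
  using phase_deck[OF assms(1) simplex_vertex[OF assms(2,3)]] vertex_simplex[OF assms(3)]
  by (simp add: simplex_map_def)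

text \<open>On the covering this is the coboundary of \<open>phase\<close>. A deck transformation
  shifts both phases by the same amount, so the choice of the lift does not influence the
  difference.\<close>

definition cocycle :: "'a simplex \<Rightarrow> 'p mod_ring" where
  "cocycle \<sigma> = phase (the_lift 1 \<sigma> (vertex 1)) - phase (the_lift 1 \<sigma> (vertex 0))"

lemma projection_simplex: "singular_simplex n (top_of_set E) \<tau> \<Longrightarrow> singular_simplex n (top_of_set X) (simplex_map n \<pi> \<tau>)"
  by (rule singular_simplex_simplex_map) (use cont img in auto)

lemma cocycle_projection:
  assumes \<tau>: "singular_simplex 1 (top_of_set E) \<tau>"
  shows "cocycle (simplex_map 1 \<pi> \<tau>) = phase (\<tau> (vertex 1)) - phase (\<tau> (vertex 0))"
proof -
  note l = the_lift[OF projection_simplex[OF \<tau>]]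
  obtain g where g: "g \<in> carrier G" "simplex_map 1 (deck g) (the_lift 1 (simplex_map 1 \<pi> \<tau>)) = \<tau>"
    by (rule simplex_deck_transitive[OF l(1) \<tau> l(2)])
  show ?thesis
    using phase_deck_simplex[OF g(1) l(1), of 0] phase_deck_simplex[OF g(1) l(1), of 1]
    unfolding g(2) by (simp add: cocycle_def)
qed

lemma face_vertex: "k \<le> n \<Longrightarrow> singular_face (Suc n) j \<sigma> (vertex k) = \<sigma> (vertex (if k < j then k else Suc k))"
  by (simp add: singular_face_apply vertex_simplex simplical_face_vertex)

text \<open>A lift of the triangle restricts to lifts of its three edges, on which the values are
  differences of phases at the vertices and cancel in the alternating sum.\<close>

lemma cocycle_boundary:
  assumes "c \<in> carrier (chain_module (top_of_set X) 2)"
  shows "cochain_eval cocycle (chain_diff 2 c) = 0"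
  using assms
proof (induction c rule: chain_module_induct)
  case (single \<sigma> k)
  note l = the_lift[OF single]
  have c: "cocycle (singular_face (Suc 1) j \<sigma>) = phase (singular_face (Suc 1) j (the_lift 2 \<sigma>) (vertex 1)) -
      phase (singular_face (Suc 1) j (the_lift 2 \<sigma>) (vertex 0))" if "j \<le> 2" for j
  proof -
    have "singular_face (Suc 1) j \<sigma> = simplex_map 1 \<pi> (singular_face (Suc 1) j (the_lift 2 \<sigma>))"
      using face_simplex_map[of j 1 \<pi> "the_lift 2 \<sigma>"] l(2) that by (simp add: numeral_2_eq_2)
    moreover have "singular_simplex 1 (top_of_set E) (singular_face (Suc 1) j (the_lift 2 \<sigma>))"
      using face_simplex[of 1 "top_of_set E" "the_lift 2 \<sigma>" j] l(1) that by (simp add: numeral_2_eq_2)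
    ultimately show ?thesis using cocycle_projection by simp
  qed
  have "chain_diff (Suc 1) (Poly_Mapping.single \<sigma> k) = (\<Sum>j\<le>Suc 1. Poly_Mapping.single (singular_face (Suc 1) j \<sigma>) ((-1) ^ j * k))"
    by (rule chain_diff_single)
  then have "cochain_eval cocycle (chain_diff (Suc 1) (Poly_Mapping.single \<sigma> k)) =
      k * cocycle (singular_face (Suc 1) 0 \<sigma>) - k * cocycle (singular_face (Suc 1) 1 \<sigma>) + k * cocycle (singular_face (Suc 1) 2 \<sigma>)"
    by (simp add: cochain_eval_simps cochain_eval_add numeral_2_eq_2)
  also have "\<dots> = k * (cocycle (singular_face (Suc 1) 0 \<sigma>) - cocycle (singular_face (Suc 1) 1 \<sigma>) + cocycle (singular_face (Suc 1) 2 \<sigma>))"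
    by (simp add: algebra_simps)
  also have "cocycle (singular_face (Suc 1) 0 \<sigma>) - cocycle (singular_face (Suc 1) 1 \<sigma>) + cocycle (singular_face (Suc 1) 2 \<sigma>) = 0"
  proof -
    note v = face_vertex[of 0 1 _ "the_lift 2 \<sigma>"] face_vertex[of 1 1 _ "the_lift 2 \<sigma>"]
    have c0: "cocycle (singular_face (Suc 1) 0 \<sigma>) = phase (the_lift 2 \<sigma> (vertex 2)) - phase (the_lift 2 \<sigma> (vertex 1))"
      using c[of 0] v by (simp add: numeral_2_eq_2)
    have c1: "cocycle (singular_face (Suc 1) 1 \<sigma>) = phase (the_lift 2 \<sigma> (vertex 2)) - phase (the_lift 2 \<sigma> (vertex 0))"
      using c[of 1] v by (simp add: numeral_2_eq_2)
    have c2: "cocycle (singular_face (Suc 1) 2 \<sigma>) = phase (the_lift 2 \<sigma> (vertex 1)) - phase (the_lift 2 \<sigma> (vertex 0))"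
      using c[of 2] v by (simp add: numeral_2_eq_2)
    show ?thesis unfolding c0 c1 c2 by simp
  qed
  also have "k * 0 = 0" by simp
  finally show ?case by (simp add: numeral_2_eq_2)
qed (simp_all add: cochain_eval_simps cochain_eval_add chain_diff_add)

text \<open>The lift of the loop from \<open>e\<close> ends at the image of \<open>e\<close> under
  the class of the loop, whose phase exceeds that of \<open>e\<close> by the value of \<nu>.\<close>

lemma cocycle_loop:
  assumes \<gamma>: "\<gamma> \<in> based_loops X (\<pi> e)"
  shows "cocycle (path_simplex \<gamma>) = \<nu> (loop_class X \<gamma>)"
proof -
  have g: "path \<gamma>" "path_image \<gamma> \<subseteq> X" "\<pi> e = pathstart \<gamma>" "pathfinish \<gamma> = \<pi> e" using \<gamma> by (auto simp: based_loops_def)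
  obtain \<delta> where d: "path \<delta>" "path_image \<delta> \<subseteq> E" "pathstart \<delta> = e" "\<And>t. t \<in> {0..1} \<Longrightarrow> \<pi> (\<delta> t) = \<gamma> t"
    by (rule covering_lift_path[OF cov g(1,2) e g(3)]) blast
  have fin: "pathfinish \<delta> \<in> E" using d(2) pathfinish_in_path_image[of \<delta>] by blast
  have pf: "\<pi> e = \<pi> (pathfinish \<delta>)" using d(4)[of 1] g(4) by (simp add: pathfinish_def)
  obtain f where f: "deck_transformation E \<pi> f" "f e = pathfinish \<delta>"
    by (rule deck_transformation_exists[OF e fin pf])
  have lc: "loop_class X \<gamma> = loop_class X (\<pi> \<circ> \<delta>)"
    by (rule loop_class_cong[OF g(1,2)]) (simp add: d(4))
  note a = deck_actionI[OF f(1) d(1,2,3) f(2)[symmetric], folded lc]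
  have "simplex_map 1 \<pi> (path_simplex \<delta>) = path_simplex \<gamma>"
    using d(4) standard_simplex_1 by (auto simp: simplex_map_def path_simplex_def fun_eq_iff simp del: One_nat_def)
  then have "cocycle (path_simplex \<gamma>) = phase (pathfinish \<delta>) - phase e"
    using cocycle_projection[OF path_simplex_singular[OF d(1,2)]] path_simplex_vertex[of \<delta>] d(3) by simp
  also have "pathfinish \<delta> = deck (loop_class X \<gamma>) e" using a(2) f(2) by simp
  finally show ?thesis using phase_deck[OF a(1) e] by simp
qed

text \<open>Evaluation of the cocycle descends to homology and has the prescribed values on loops;
  since loops generate, it is the only such map, which resolves the definite description.\<close>

lemma nu_star_cocycle:
  shows "linear_map (sing_homology (top_of_set X) 1) scalar_module (nu_star X (\<pi> e) \<nu>)"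
    and "a \<in> complex_cycles (chain_module (top_of_set X)) chain_diff 1 \<Longrightarrow>
      nu_star X (\<pi> e) \<nu> (complex_class (chain_module (top_of_set X)) chain_diff 1 a) = cochain_eval cocycle a"
proof -
  let ?C = "chain_module (top_of_set X) :: nat \<Rightarrow> ('p mod_ring, _) module"
  interpret K: kcomplex ?C chain_diff by (rule sing_kcomplex)
  \<comment> \<open>Restricted to the carrier, because \<open>module_maps\<close> consists of
    extensional functions and uniqueness is uniqueness among these.\<close>
  define F where "F = (\<lambda>U\<in>carrier (K.H 1). cochain_eval cocycle (SOME a. a \<in> K.Z 1 \<and> U = K.cl 1 a))"
  have FZ: "F (K.cl 1 a) = cochain_eval cocycle a" if a: "a \<in> K.Z 1" for a
  proof -
    let ?b = "SOME b. b \<in> K.Z 1 \<and> K.cl 1 a = K.cl 1 b"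
    have b: "?b \<in> K.Z 1 \<and> K.cl 1 a = K.cl 1 ?b" by (rule someI[of _ a]) (use a in blast)
    then have "a \<ominus>\<^bsub>?C 1\<^esub> ?b \<in> K.Bd 1" using K.cl_eq_iff[OF a, of ?b] by blast
    moreover have "a \<ominus>\<^bsub>?C 1\<^esub> ?b = a + pscale (- 1) ?b"
      using chain_module_neg[OF K.cycleD(1)] b by (simp add: a_minus_def chain_module_simps pscale_minus)
    ultimately obtain y where y: "y \<in> carrier (?C (Suc 1))" "a + pscale (- 1) ?b = chain_diff (Suc 1) y"
      by (auto simp: complex_boundaries_def)
    have "cochain_eval cocycle (a + pscale (- 1) ?b) = 0"
      unfolding y(2) using cocycle_boundary[of y] y(1) by (simp add: numeral_2_eq_2)
    then have "cochain_eval cocycle a = cochain_eval cocycle ?b"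
      unfolding cochain_eval_add cochain_eval_simps by simp
    then show ?thesis unfolding F_def restrict_apply'[OF K.cl_in_H[OF a]] by simp
  qed
  have Fl: "linear_map (K.H 1) scalar_module F"
  proof -
    have "F (U \<oplus>\<^bsub>K.H 1\<^esub> V) = F U + F V" if UV: "U \<in> carrier (K.H 1)" "V \<in> carrier (K.H 1)" for U V
    proof -
      obtain a b where a: "a \<in> K.Z 1" "U = K.cl 1 a" and b: "b \<in> K.Z 1" "V = K.cl 1 b"
        using K.H_carrierE[OF UV(1)] K.H_carrierE[OF UV(2)] by metis
      show ?thesis
        unfolding a(2) b(2) K.cl_add[OF a(1) b(1), symmetric] FZ[OF a(1)] FZ[OF b(1)] FZ[OF K.cycle_linear(2)[OF a(1) b(1)]]
        by (simp add: chain_module_simps cochain_eval_add)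
    qed
    moreover have "F (r \<odot>\<^bsub>K.H 1\<^esub> U) = r * F U" if U: "U \<in> carrier (K.H 1)" for r U
    proof -
      obtain a where a: "a \<in> K.Z 1" "U = K.cl 1 a" using K.H_carrierE[OF U] by metis
      show ?thesis
        unfolding a(2) K.cl_smult[OF a(1), symmetric] FZ[OF a(1)] FZ[OF K.cycle_linear(4)[OF a(1)]]
        by (simp add: chain_module_simps cochain_eval_simps)
    qed
    ultimately show ?thesis by (simp add: linear_map_def additive_map_def scalar_module_simps)
  qed
  have e: "\<pi> e \<in> X" using img e by blast
  let ?P = "\<lambda>f. f \<in> module_maps (K.H 1) scalar_module \<and>
      (\<forall>\<gamma>\<in>based_loops X (\<pi> e). f (K.cl 1 (Poly_Mapping.single (path_simplex \<gamma>) 1)) = \<nu> (loop_class X \<gamma>))"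
  have nu: "nu_star X (\<pi> e) \<nu> = F"
    unfolding nu_star_def
  proof (rule the_equality)
    have "F \<in> extensional (carrier (K.H 1))" by (simp add: F_def)
    then have "F \<in> module_maps (K.H 1) scalar_module"
      using Fl by (auto simp: module_maps_def linear_map_def additive_map_def PiE_def scalar_module_simps)
    moreover have "F (K.cl 1 (Poly_Mapping.single (path_simplex \<gamma>) 1)) = \<nu> (loop_class X \<gamma>)"
      if "\<gamma> \<in> based_loops X (\<pi> e)" for \<gamma>
      unfolding FZ[OF loop_cycle[OF that]] by (simp add: cochain_eval_simps cocycle_loop[OF that])
    ultimately show "?P F" by blast
    fix f assume f: "?P f"
    then have fl: "linear_map (K.H 1) scalar_module f" and fe: "f \<in> extensional (carrier (K.H 1))"
      by (auto simp: module_maps_def linear_map_def additive_map_def PiE_def)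
    show "f = F"
    proof (rule extensionalityI[OF fe])
      show "F \<in> extensional (carrier (K.H 1))" by fact
      fix U assume U: "U \<in> carrier (K.H 1)"
      show "f U = F U"
        by (rule loops_generate_homology[OF pcX e fl Fl _ U])
          (use f FZ[OF loop_cycle] cocycle_loop in \<open>simp add: cochain_eval_simps\<close>)
    qed
  qed
  show "linear_map (K.H 1) scalar_module (nu_star X (\<pi> e) \<nu>)" unfolding nu by (rule Fl)
  show "a \<in> K.Z 1 \<Longrightarrow> nu_star X (\<pi> e) \<nu> (K.cl 1 a) = cochain_eval cocycle a" unfolding nu by (rule FZ)
qed

lemma rho_cocycle:
  assumes "z \<in> complex_cycles (chain_module (top_of_set X)) chain_diff (Suc q)"
  shows "rho X (\<pi> e) \<nu> (Suc q) (complex_class (chain_module (top_of_set X)) chain_diff (Suc q) z) =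
    complex_class (chain_module (top_of_set X)) chain_diff q (cap_simplex cocycle q z)"
  by (rule rho_class[OF cocycle_boundary nu_star_cocycle assms])

end

subsection \<open>Reduction of chains over the group algebra\<close>

lemma lookup_map_zero: "f 0 = 0 \<Longrightarrow> Poly_Mapping.lookup (Poly_Mapping.map f c) x = f (Poly_Mapping.lookup c x)"
  by (simp add: map.rep_eq when_def)

lemma keys_map_zero:
  assumes f: "f 0 = 0"
  shows "Poly_Mapping.keys (Poly_Mapping.map f c) \<subseteq> Poly_Mapping.keys c"
proof
  fix x assume "x \<in> Poly_Mapping.keys (Poly_Mapping.map f c)"
  then have "f (Poly_Mapping.lookup c x) \<noteq> 0" by (simp add: in_keys_iff lookup_map_zero f)
  then have "Poly_Mapping.lookup c x \<noteq> 0" using f by (cases "Poly_Mapping.lookup c x = 0") auto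
  then show "x \<in> Poly_Mapping.keys c" by (simp add: in_keys_iff)
qed

text \<open>Change of coefficients, applied both to the augmentation and to its section
  \<open>emb\<close>.\<close>

lemma map_coeff_lin_extend:
  fixes f :: "'k::comm_ring_1 \<Rightarrow> 'l::comm_ring_1" and c :: "'x \<Rightarrow>\<^sub>0 'k"
  assumes f: "f 0 = 0" "\<And>a b. f (a + b) = f a + f b" "\<And>a b. f (a * b) = f a * f b"
  shows "Poly_Mapping.map f (lin_extend g c) = lin_extend (\<lambda>x. Poly_Mapping.map f (g x)) (Poly_Mapping.map f c)"
proof -
  have a: "Poly_Mapping.map f (u + v) = Poly_Mapping.map f u + Poly_Mapping.map f v" for u v :: "'z \<Rightarrow>\<^sub>0 'k"
    by (rule poly_mapping_eqI) (simp add: lookup_map_zero lookup_add f)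
  have a': "Poly_Mapping.map f (u + v) = Poly_Mapping.map f u + Poly_Mapping.map f v" for u v :: "'x \<Rightarrow>\<^sub>0 'k"
    by (rule poly_mapping_eqI) (simp add: lookup_map_zero lookup_add f)
  have p: "Poly_Mapping.map f (pscale k u) = pscale (f k) (Poly_Mapping.map f u)" for k and u :: "'z \<Rightarrow>\<^sub>0 'k"
    by (rule poly_mapping_eqI) (simp add: lookup_map_zero f)
  have s: "Poly_Mapping.map f (Poly_Mapping.single x k) = Poly_Mapping.single x (f k)" for x :: 'x and k
    by (rule poly_mapping_eqI) (simp add: lookup_map_zero lookup_single when_def f)
  have z: "Poly_Mapping.map f (0 :: 'y \<Rightarrow>\<^sub>0 'k) = 0"
    by (rule poly_mapping_eqI) (simp add: lookup_map_zero f)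
  have "Poly_Mapping.keys c \<subseteq> UNIV" by simp
  then show ?thesis
  proof (induction c rule: chain_induct)
    case zero
    show ?case by (rule poly_mapping_eqI) (simp add: lookup_map_zero[of f, OF f(1)] lin_extend_def f(1))
  next
    case (single x k)
    show ?case
      unfolding s lin_extend_single
      by (rule poly_mapping_eqI) (simp add: lookup_map_zero f)
  next
    case (add u v)
    have "Poly_Mapping.map f (lin_extend g u + lin_extend g v) = Poly_Mapping.map f (lin_extend g u) + Poly_Mapping.map f (lin_extend g v)"
      by (rule poly_mapping_eqI) (simp add: lookup_map_zero lookup_add f)
    then show ?case unfolding lin_extend_add a' using add by simp
  qed
qed

lemma lin_extend_fun_add: "lin_extend (\<lambda>x. f x + g x) c = lin_extend f c + lin_extend g c"
  by (simp add: lin_extend_def pscale_add sum.distrib)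

lemma lin_extend_fun_pscale: "lin_extend (\<lambda>x. pscale a (f x)) c = pscale a (lin_extend f c)"
  unfolding lin_extend_def pscale_sum by (rule sum.cong) (simp_all add: mult.commute)

context
  fixes \<phi> :: "'a simplex \<Rightarrow> 'p::prime_card mod_ring" and X :: "'a topology"
begin

abbreviation (input) chains :: "nat \<Rightarrow> ('a simplex \<Rightarrow>\<^sub>0 'k::comm_ring_1) set" where
  "chains n \<equiv> carrier (chain_module X n)"

abbreviation (input) red :: "('a simplex \<Rightarrow>\<^sub>0 'p group_algebra) \<Rightarrow> 'a simplex \<Rightarrow>\<^sub>0 'p mod_ring" where
  "red \<equiv> Poly_Mapping.map aug"

abbreviation (input) ext :: "('a simplex \<Rightarrow>\<^sub>0 'p mod_ring) \<Rightarrow> 'a simplex \<Rightarrow>\<^sub>0 'p group_algebra" where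
  "ext \<equiv> Poly_Mapping.map emb"

text \<open>The twisted differential in terms of chosen lifts: only face 0 has a new initial vertex,
  so only its coefficient acquires the factor \<open>t^k\<close> with k the cocycle on the front
  edge. The summand subtracting 1 removes the untwisted copy of that face already in
  \<open>chain_diff\<close>.\<close>

definition twist_diff :: "nat \<Rightarrow> ('a simplex \<Rightarrow>\<^sub>0 'p group_algebra) \<Rightarrow> 'a simplex \<Rightarrow>\<^sub>0 'p group_algebra" where
  "twist_diff n c = chain_diff n c +
     lin_extend (\<lambda>\<sigma>. Poly_Mapping.single (singular_face n 0 \<sigma>) (Poly_Mapping.single (\<phi> (front_face 1 \<sigma>)) 1 - 1)) c"

lemma twist_diff_linear:
  "twist_diff n (c + c') = twist_diff n c + twist_diff n c'" "twist_diff n (pscale a c) = pscale a (twist_diff n c)"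
  by (simp_all add: twist_diff_def chain_diff_def lin_extend_add lin_extend_pscale pscale_add)

lemma emb_hom: "emb 0 = (0 :: 'p group_algebra)" "emb (a + b) = (emb a + emb b :: 'p group_algebra)"
  "emb (a * b) = (emb a * emb b :: 'p group_algebra)"
  by (simp_all add: single_add mult_single)

lemma red_simps:
  "red (c + c') = red c + red c'" "red (pscale a c) = pscale (aug a) (red c)" "red (ext z) = z"
  "ext (z + z') = ext z + ext z'" "ext 0 = 0" "red (c - c') = red c - red c'"
  by (rule poly_mapping_eqI; simp add: lookup_map_zero aug_simps lookup_add lookup_minus single_add)+

lemma map_single_zero: "f 0 = 0 \<Longrightarrow> Poly_Mapping.map f (Poly_Mapping.single x k) = Poly_Mapping.single x (f k)"
  by (rule poly_mapping_eqI) (simp add: lookup_map_zero lookup_single when_def)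

lemma map_map_of_int: "f 0 = 0 \<Longrightarrow> (\<And>i. f (of_int i) = of_int i) \<Longrightarrow>
    Poly_Mapping.map f (Poly_Mapping.map of_int u) = Poly_Mapping.map of_int u"
  by (rule poly_mapping_eqI) (simp add: lookup_map_zero)

lemma red_chain_diff: "red (chain_diff n c) = chain_diff n (red c)" "ext (chain_diff n z) = chain_diff n (ext z)"
  unfolding chain_diff_def
  by (subst map_coeff_lin_extend; simp add: aug_simps emb_hom map_map_of_int)+

lemma red_cap: "red (cap_simplex (\<lambda>\<sigma>. emb (\<phi> \<sigma>)) n c) = cap_simplex \<phi> n (red c)"
  "ext (cap_simplex \<phi> n z) = cap_simplex (\<lambda>\<sigma>. emb (\<phi> \<sigma>)) n (ext z)"
  unfolding cap_simplex_def
  by (subst map_coeff_lin_extend; simp add: aug_simps emb_hom map_single_zero)+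

lemma cap_add: "cap_simplex \<psi> n (c + c') = cap_simplex \<psi> n c + cap_simplex \<psi> n c'"
  by (simp add: cap_simplex_def lin_extend_add)

lemma cap_pscale: "cap_simplex \<psi> n (pscale a c) = pscale a (cap_simplex \<psi> n c)"
  by (simp add: cap_simplex_def lin_extend_pscale)

lemma closed:
  fixes c c' :: "'a simplex \<Rightarrow>\<^sub>0 'k::comm_ring_1"
  shows "c \<in> chains n \<Longrightarrow> c' \<in> chains n \<Longrightarrow> c + c' \<in> chains n" "c \<in> chains n \<Longrightarrow> pscale a c \<in> chains n"
    "c \<in> chains n \<Longrightarrow> c' \<in> chains n \<Longrightarrow> c - c' \<in> chains n"
    "f 0 = 0 \<Longrightarrow> c \<in> chains n \<Longrightarrow> Poly_Mapping.map f c \<in> chains n"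
    "c \<in> chains (Suc n) \<Longrightarrow> cap_simplex \<psi> n c \<in> chains n" "c \<in> chains (Suc n) \<Longrightarrow> chain_diff (Suc n) c \<in> chains n"
    "(\<And>\<sigma>. singular_simplex (Suc n) X \<sigma> \<Longrightarrow> g \<sigma> \<in> chains n) \<Longrightarrow> c \<in> chains (Suc n) \<Longrightarrow> lin_extend g c \<in> chains n"
proof -
  show a: "c \<in> chains n \<Longrightarrow> c' \<in> chains n \<Longrightarrow> c + c' \<in> chains n" for c c' :: "'a simplex \<Rightarrow>\<^sub>0 'k"
    by (simp add: chain_module_simps keys_add_subset)
  show "c \<in> chains n \<Longrightarrow> pscale a c \<in> chains n"
    using keys_pscale[of a c] by (auto simp: chain_module_simps)
  show "c \<in> chains n \<Longrightarrow> c' \<in> chains n \<Longrightarrow> c - c' \<in> chains n"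
    using a[of c "- c'"] by (simp add: chain_module_simps keys_uminus)
  show "f 0 = 0 \<Longrightarrow> c \<in> chains n \<Longrightarrow> Poly_Mapping.map f c \<in> chains n"
    using keys_map_zero[of f c] by (auto simp: chain_module_simps)
  show l: "(\<And>\<sigma>. singular_simplex (Suc n) X \<sigma> \<Longrightarrow> g \<sigma> \<in> chains n) \<Longrightarrow> c \<in> chains (Suc n) \<Longrightarrow> lin_extend g c \<in> chains n" for g
    by (rule linear_mapD(3)[OF linear_map_lin_extend]) (auto simp: chain_module_simps)
  show "c \<in> chains (Suc n) \<Longrightarrow> cap_simplex \<psi> n c \<in> chains n"
    unfolding cap_simplex_def by (rule l) (rule single_chain[OF face_simplex], auto)
  show "c \<in> chains (Suc n) \<Longrightarrow> chain_diff (Suc n) c \<in> chains n"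
    by (rule linear_mapD(3)[OF chain_diff_linear])
qed

lemma twist_diff_closed: "c \<in> chains (Suc n) \<Longrightarrow> twist_diff (Suc n) c \<in> chains n"
  unfolding twist_diff_def
  by (intro closed(1) closed(6) closed(7) single_chain face_simplex) auto

text \<open>The expansion of \<open>t^k - 1\<close> applied to the coefficient of face 0. The
  first-order term is s times the cap product; \<open>R\<close> collects all that is divisible by
  \<open>s^2\<close>.\<close>

lemma twist_diff_expand:
  obtains R where "\<And>n c. twist_diff (Suc n) c =
      chain_diff (Suc n) c + pscale aug_gen (cap_simplex (\<lambda>\<sigma>. emb (\<phi> \<sigma>)) n c) + pscale aug_gen (pscale aug_gen (R n c))"
    and "\<And>n c. c \<in> chains (Suc n) \<Longrightarrow> R n c \<in> chains n"
proof -
  obtain r :: "'p mod_ring \<Rightarrow> 'p group_algebra" where r: "\<And>x. Poly_Mapping.single x 1 - 1 = aug_gen * emb x + aug_gen * (aug_gen * r x)"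
    by (rule single_expand) blast
  define R where "R n = lin_extend (\<lambda>\<sigma>. Poly_Mapping.single (singular_face (Suc n) 0 \<sigma>) (r (\<phi> (front_face 1 \<sigma>))))" for n
  show thesis
  proof (rule that[of R])
    fix n c
    show "twist_diff (Suc n) c = chain_diff (Suc n) c + pscale aug_gen (cap_simplex (\<lambda>\<sigma>. emb (\<phi> \<sigma>)) n c) + pscale aug_gen (pscale aug_gen (R n c))"
      unfolding twist_diff_def R_def cap_simplex_def r single_add
        lin_extend_fun_add pscale_simps(5)[symmetric] lin_extend_fun_pscale by (simp only: add.assoc)
    show "c \<in> chains (Suc n) \<Longrightarrow> R n c \<in> chains n"
      unfolding R_def by (intro closed(7) single_chain face_simplex) auto
  qed
qed

lemma divide_aug_gen:
  assumes c: "c \<in> chains n" and r: "red c = 0"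
  obtains c' where "c' \<in> chains n" "c = pscale aug_gen c'"
proof -
  have d: "aug_gen dvd Poly_Mapping.lookup c x" for x
  proof -
    have "aug (Poly_Mapping.lookup c x) = 0"
      using arg_cong[OF r, of "\<lambda>u. Poly_Mapping.lookup u x"] by (simp add: lookup_map_zero aug_simps)
    then show ?thesis using aug_gen_dvd[of "Poly_Mapping.lookup c x"] by simp
  qed
  \<comment> \<open>Zero must go to zero for \<open>Poly_Mapping.map\<close> to act on every
    coefficient.\<close>
  define g where "g a = (if a = 0 then 0 else SOME b. a = aug_gen * b)" for a :: "'p group_algebra"
  have g0: "g 0 = 0" by (simp add: g_def)
  have g: "a = aug_gen * g a" if "aug_gen dvd a" for a
    using that unfolding g_def dvd_def by (auto intro: someI_ex)
  show thesis
  proof (rule that[of "Poly_Mapping.map g c"])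
    show "Poly_Mapping.map g c \<in> chains n" by (rule closed(4)[where f = g, OF g0 c])
    show "c = pscale aug_gen (Poly_Mapping.map g c)"
      by (rule poly_mapping_eqI) (simp add: lookup_map_zero[where f = g, OF g0] g[OF d, symmetric])
  qed
qed

lemma red_eq_0:
  assumes odd: "CARD('p) \<noteq> 2" and c: "pscale (aug_gen ^ (CARD('p) - 1)) c = 0"
  shows "red c = 0"
proof (rule poly_mapping_eqI)
  fix x
  have "aug_gen ^ (CARD('p) - 1) * Poly_Mapping.lookup c x = 0"
    using arg_cong[OF c, of "\<lambda>u. Poly_Mapping.lookup u x"] by simp
  then show "Poly_Mapping.lookup (red c) x = Poly_Mapping.lookup 0 x"
    using aug_gen_power_annihilates[OF odd] by (simp add: lookup_map_zero aug_simps)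
qed

text \<open>The assumption is acyclicity stated for chains: a cycle whose cap product is a boundary,
  witnessed by \<open>z1\<close>, is itself the cap product of a cycle up to a boundary. In degree 0
  every chain qualifies.\<close>

context
  fixes q :: nat
  assumes odd: "CARD('p) \<noteq> 2"
    and acyclic: "\<And>z z1 :: 'a simplex \<Rightarrow>\<^sub>0 'p mod_ring. \<lbrakk>z \<in> chains q; z1 \<in> chains q;
        \<And>m. q = Suc m \<Longrightarrow> chain_diff q z = 0 \<and> cap_simplex \<phi> m z + chain_diff q z1 = 0\<rbrakk> \<Longrightarrow>
      \<exists>w w1. w \<in> chains (Suc q) \<and> w1 \<in> chains (Suc q) \<and> chain_diff (Suc q) w = 0 \<and>
        z = cap_simplex \<phi> q w + chain_diff (Suc q) w1"
begin

abbreviation (input) "\<rho>' \<equiv> cap_simplex (\<lambda>\<sigma>. emb (\<phi> \<sigma>))"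

text \<open>Write x as \<open>z + s y\<close> with z its reduction. The weak cycle condition still
  gives that z is a cycle with cap product \<open>- d y\<close> modulo s, so acyclicity provides
  \<open>w0\<close> and \<open>w1\<close>. Then \<open>D (w0 + s w1)\<close> equals
  \<open>s z\<close> up to a multiple of \<open>s^2\<close>, and \<open>s y\<close> adds only
  another such multiple to \<open>s x\<close>.\<close>

lemma reduction_step:
  assumes x: "x \<in> chains q" and dx: "\<And>m. q = Suc m \<Longrightarrow> pscale (aug_gen ^ (CARD('p) - 2)) (twist_diff q x) = 0"
  obtains w x' where "w \<in> chains (Suc q)" "x' \<in> chains q"
    "pscale aug_gen x = twist_diff (Suc q) w + pscale aug_gen (pscale aug_gen x')"
proof -
  let ?s = "pscale (aug_gen :: 'p group_algebra) :: ('a simplex \<Rightarrow>\<^sub>0 'p group_algebra) \<Rightarrow> _"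
  obtain R where R: "\<And>n c. twist_diff (Suc n) c = chain_diff (Suc n) c + ?s (\<rho>' n c) + ?s (?s (R n c))"
      "\<And>n c. c \<in> chains (Suc n) \<Longrightarrow> R n c \<in> chains n"
    by (rule twist_diff_expand) blast
  have red_s: "red (?s c) = 0" for c unfolding red_simps(2) aug_simps by simp
  have aug0: "aug 0 = (0 :: 'p mod_ring)" by (rule aug_simps(5))
  define z where "z = red x"
  have z: "z \<in> chains q" unfolding z_def by (rule closed(4)[where f = aug, OF aug0 x])
  have ez: "ext z \<in> chains q" by (rule closed(4)[where f = emb, OF emb_hom(1) z])
  have "red (x - ext z) = 0" unfolding red_simps(6,3) z_def by simp
  then obtain y where y: "y \<in> chains q" "x - ext z = ?s y" by (rule divide_aug_gen[OF closed(3)[OF x ez]])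
  have xe: "x = ext z + ?s y" using y(2) by (simp add: algebra_simps)
  have "chain_diff q z = 0 \<and> cap_simplex \<phi> m z + chain_diff q (red y) = 0" if q: "q = Suc m" for m
  proof -
    have p3: "CARD('p) - 1 = Suc (CARD('p) - 2)" using prime_card_odd(3)[OF odd] by simp
    have "pscale (aug_gen ^ (CARD('p) - 1)) (twist_diff q x) = ?s (pscale (aug_gen ^ (CARD('p) - 2)) (twist_diff q x))"
      unfolding p3 by simp
    also have "\<dots> = 0" unfolding dx[OF q] by simp
    finally have "red (twist_diff q x) = 0" by (rule red_eq_0[OF odd])
    then have dz: "chain_diff q z = 0"
      unfolding q R(1) red_simps(1) red_s red_chain_diff(1) z_def by simp
    \<comment> \<open>Once z is known to be a cycle, \<open>D x\<close> is divisible by s and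
      \<open>u\<close> is the quotient. Since \<open>s^(p-1) u = s^(p-2) D x = 0\<close>, it reduces
      to zero as well.\<close>
    define u where "u = \<rho>' m (ext z) + ?s (R m (ext z)) + twist_diff q y"
    have "chain_diff q (ext z) = 0" unfolding red_chain_diff(2)[symmetric] dz red_simps(5) ..
    then have "twist_diff q (ext z) = ?s (\<rho>' m (ext z)) + ?s (?s (R m (ext z)))" unfolding q R(1) by simp
    then have tx: "twist_diff q x = ?s u"
      unfolding xe twist_diff_linear u_def pscale_add(1) by simp
    have "pscale (aug_gen ^ (CARD('p) - 1)) u = pscale (aug_gen ^ (CARD('p) - 2)) (twist_diff q x)"
      unfolding tx p3 by (simp add: mult.commute)
    then have "red u = 0" using red_eq_0[OF odd] dx[OF q] by simp
    then have "cap_simplex \<phi> m z + chain_diff q (red y) = 0"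
      unfolding u_def q R(1) red_simps(1) red_s red_chain_diff(1) red_cap(1) red_simps(3) by simp
    then show ?thesis using dz by simp
  qed
  then obtain w0 w1 where w: "w0 \<in> chains (Suc q)" "w1 \<in> chains (Suc q)" "chain_diff (Suc q) w0 = 0"
      "z = cap_simplex \<phi> q w0 + chain_diff (Suc q) w1"
    using acyclic[OF z closed(4)[where f = aug, OF aug0 y(1)]] by blast
  have e: "ext w0 \<in> chains (Suc q)" "ext w1 \<in> chains (Suc q)" by (rule closed(4)[where f = emb, OF emb_hom(1) w(1)], rule closed(4)[where f = emb, OF emb_hom(1) w(2)])
  \<comment> \<open>The second-order part of \<open>D (w0 + s w1)\<close> with \<open>s^2\<close>
    taken out: the remainder for \<open>w0\<close>, the cap product of \<open>w1\<close>, and the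
    remainder for \<open>w1\<close>.\<close>
  define v where "v = R q (ext w0) + \<rho>' q (ext w1) + ?s (R q (ext w1))"
  have v: "v \<in> chains q" unfolding v_def by (intro closed(1,2) closed(5) R(2) e)
  have d0: "chain_diff (Suc q) (ext w0) = 0" unfolding red_chain_diff(2)[symmetric] w(3) red_simps(5) ..
  have "twist_diff (Suc q) (ext w0 + ?s (ext w1)) = ?s (\<rho>' q (ext w0) + chain_diff (Suc q) (ext w1)) + ?s (?s v)"
    unfolding twist_diff_linear R(1) d0 v_def pscale_add(1) by (simp add: ac_simps)
  also have "\<rho>' q (ext w0) + chain_diff (Suc q) (ext w1) = ext z"
    unfolding red_cap(2)[symmetric] red_chain_diff(2)[symmetric] red_simps(4)[symmetric] w(4)[symmetric] ..
  finally have D: "twist_diff (Suc q) (ext w0 + ?s (ext w1)) = ?s (ext z) + ?s (?s v)" .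
  have m: "pscale a (- c) = - pscale a c" for a and c :: "'a simplex \<Rightarrow>\<^sub>0 'p group_algebra" by (rule pscale_minus(2))
  have "?s x = (?s (ext z) + ?s (?s v)) + ?s (?s (y - v))"
    unfolding xe pscale_add(1) diff_conv_add_uminus m by (simp add: algebra_simps)
  then have "?s x = twist_diff (Suc q) (ext w0 + ?s (ext w1)) + ?s (?s (y - v))" unfolding D .
  then show thesis by (rule that[OF closed(1)[OF e(1) closed(2)[OF e(2)]] closed(3)[OF y(1) v]])
qed

text \<open>The induction maintains \<open>s z = D w + s^(k+1) z'\<close>. Applying D shows
  \<open>s^(k+1) D z' = 0\<close>, the hypothesis of \<open>reduction_step\<close> as long as
  \<open>k + 1 \<le> p - 2\<close>. At k = p - 2 the remainder is \<open>s^(p-1) z'\<close>, and one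
  more factor s removes it.\<close>

lemma square_annihilates:
  assumes z: "z \<in> chains q" and dz: "\<And>m. q = Suc m \<Longrightarrow> twist_diff q z = 0"
    and dd: "\<And>m w. q = Suc m \<Longrightarrow> w \<in> chains (Suc q) \<Longrightarrow> twist_diff q (twist_diff (Suc q) w) = 0"
  obtains w where "w \<in> chains (Suc q)" "pscale (aug_gen ^ 2) z = twist_diff (Suc q) w"
proof -
  let ?p = "CARD('p)"
  have "\<exists>w z'. w \<in> chains (Suc q) \<and> z' \<in> chains q \<and> pscale aug_gen z = twist_diff (Suc q) w + pscale (aug_gen ^ Suc k) z'"
    if "k \<le> ?p - 2" for k
    using that
  proof (induction k)
    case 0
    have "twist_diff (Suc q) 0 = 0" using twist_diff_linear(2)[of "Suc q" 0 0] by simp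
    then show ?case using z by (intro exI[of _ 0] exI[of _ z]) (simp add: chain_module_simps)
  next
    case (Suc k)
    then obtain w z' where w: "w \<in> chains (Suc q)" "z' \<in> chains q"
        "pscale aug_gen z = twist_diff (Suc q) w + pscale (aug_gen ^ Suc k) z'" by auto
    have dx: "pscale (aug_gen ^ (?p - 2)) (twist_diff q z') = 0" if q: "q = Suc m" for m
    proof -
      have "twist_diff q (pscale aug_gen z) = pscale (aug_gen ^ Suc k) (twist_diff q z')"
        unfolding w(3) twist_diff_linear dd[OF q w(1)] by simp
      then have h: "pscale (aug_gen ^ Suc k) (twist_diff q z') = 0"
        unfolding twist_diff_linear dz[OF q] by simp
      \<comment> \<open>The bound on the step enters here: the known power of s killing
        \<open>D z'\<close> is padded up to the exponent p - 2.\<close>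
      have "?p - 2 = (?p - 2 - Suc k) + Suc k" using Suc.prems by simp
      then have "aug_gen ^ (?p - 2) = (aug_gen ^ (?p - 2 - Suc k) * aug_gen ^ Suc k :: 'p group_algebra)"
        by (simp only: power_add[symmetric])
      then have "pscale (aug_gen ^ (?p - 2)) (twist_diff q z') = pscale (aug_gen ^ (?p - 2 - Suc k)) (pscale (aug_gen ^ Suc k) (twist_diff q z'))"
        by (simp only: pscale_simps(4))
      then show ?thesis unfolding h by simp
    qed
    obtain v y where v: "v \<in> chains (Suc q)" "y \<in> chains q"
        "pscale aug_gen z' = twist_diff (Suc q) v + pscale aug_gen (pscale aug_gen y)"
      by (rule reduction_step[OF w(2)]) ((rule dx; assumption) | (rule that; assumption))+
    have "pscale (aug_gen ^ Suc k) z' = pscale (aug_gen ^ k) (pscale aug_gen z')" by (simp add: mult.commute)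
    also have "\<dots> = twist_diff (Suc q) (pscale (aug_gen ^ k) v) + pscale (aug_gen ^ Suc (Suc k)) y"
      unfolding v(3) pscale_add(1) twist_diff_linear by (simp add: ac_simps)
    finally have "pscale aug_gen z = twist_diff (Suc q) (w + pscale (aug_gen ^ k) v) + pscale (aug_gen ^ Suc (Suc k)) y"
      unfolding w(3) twist_diff_linear by (simp only: add.assoc)
    then show ?case using closed(1)[OF w(1) closed(2)[OF v(1)]] v(2) by blast
  qed
  from this[of "?p - 2"] obtain w z' where w: "w \<in> chains (Suc q)"
      "pscale aug_gen z = twist_diff (Suc q) w + pscale (aug_gen ^ Suc (?p - 2)) z'" by blast
  have "aug_gen * aug_gen ^ Suc (?p - 2) = (aug_gen ^ ?p :: 'p group_algebra)"
  proof -
    have "Suc (Suc (?p - 2)) = ?p" using prime_card_odd(3)[OF odd] by simp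
    then show ?thesis by (simp only: power_Suc[symmetric])
  qed
  then have p0: "aug_gen * aug_gen ^ Suc (?p - 2) = (0 :: 'p group_algebra)" using aug_gen_power_card[OF odd] by simp
  have "pscale (aug_gen ^ 2) z = pscale aug_gen (pscale aug_gen z)" by (simp add: power2_eq_square)
  also have "\<dots> = twist_diff (Suc q) (pscale aug_gen w) + pscale (aug_gen * aug_gen ^ Suc (?p - 2)) z'"
    unfolding w(2) pscale_add(1) twist_diff_linear pscale_simps(4) ..
  finally have "pscale (aug_gen ^ 2) z = twist_diff (Suc q) (pscale aug_gen w)" unfolding p0 by simp
  then show thesis by (rule that[OF closed(2)[OF w(1)]])
qed

end

end

subsection \<open>Twisted chains\<close>

lemma sum_keys_add:
  assumes F: "\<And>x. F x 0 = 0" "\<And>x a b. F x (a + b) = F x a + F x b"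
  shows "(\<Sum>x\<in>Poly_Mapping.keys (u + v). F x (Poly_Mapping.lookup (u + v) x)) =
    (\<Sum>x\<in>Poly_Mapping.keys u. F x (Poly_Mapping.lookup u x)) + (\<Sum>x\<in>Poly_Mapping.keys v. F x (Poly_Mapping.lookup v x))"
proof -
  let ?A = "Poly_Mapping.keys u \<union> Poly_Mapping.keys v"
  have s: "(\<Sum>x\<in>Poly_Mapping.keys w. F x (Poly_Mapping.lookup w x)) = (\<Sum>x\<in>?A. F x (Poly_Mapping.lookup w x))"
    if "Poly_Mapping.keys w \<subseteq> ?A" for w
    using that by (intro sum.mono_neutral_left) (auto simp: in_keys_iff F(1))
  have "(\<Sum>x\<in>?A. F x (Poly_Mapping.lookup (u + v) x)) = (\<Sum>x\<in>?A. F x (Poly_Mapping.lookup u x)) + (\<Sum>x\<in>?A. F x (Poly_Mapping.lookup v x))"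
    by (simp add: lookup_add F(2) sum.distrib)
  then show ?thesis using s[of "u + v"] s[of u] s[of v] keys_add[of u v] by simp
qed

lemma sign_single: "(- 1) ^ j * Poly_Mapping.single x k = (Poly_Mapping.single x ((- 1) ^ j * k) :: 'p::prime_card group_algebra)"
  by (induction j) (simp_all add: single_uminus)

context nu_cover
begin

abbreviation "ring_elems \<equiv> group_ring_carrier G :: (_ \<Rightarrow>\<^sub>0 'p mod_ring) set"

abbreviation "coef_mod \<equiv> coeff_module \<nu>"

abbreviation "lifted \<equiv> cover_chain_module E \<pi> e :: nat \<Rightarrow> (_ \<Rightarrow>\<^sub>0 'p mod_ring, _ \<Rightarrow>\<^sub>0 'p mod_ring) module"

abbreviation "twisted \<equiv> twisted_chain_module X E \<pi> e \<nu>"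

abbreviation "twisted_d \<equiv> twisted_chain_diff X E \<pi> e \<nu>"

abbreviation "base_chains n \<equiv> chain_module (top_of_set X) n :: ('p group_algebra, _) module"

lemma coeff_simps:
  "carrier coef_mod = UNIV" "h \<oplus>\<^bsub>coef_mod\<^esub> h' = h + h'" "\<zero>\<^bsub>coef_mod\<^esub> = 0"
  "r \<odot>\<^bsub>coef_mod\<^esub> h = h * lin_extend (\<lambda>g. Poly_Mapping.single (\<nu> g) 1) r"
  by (simp_all add: coeff_module_def)

lemma lifted_simps:
  "carrier (lifted n) = {c. Poly_Mapping.keys c \<subseteq> singular_simplex_set n (top_of_set E)}"
  "carrier (lifted n) = carrier (chain_module (top_of_set E) n :: ('p mod_ring, _) module)"
  "c \<oplus>\<^bsub>lifted n\<^esub> c' = c + c'" "\<zero>\<^bsub>lifted n\<^esub> = 0"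
  "r \<odot>\<^bsub>lifted n\<^esub> c = lin_extend (\<lambda>g. chain_push n (deck g) c) r"
  by (simp_all add: cover_chain_module_def chain_module_simps)

lemma deck_push_closed:
  assumes "g \<in> carrier G" "c \<in> carrier (lifted n)"
  shows "chain_push n (deck g) c \<in> carrier (lifted n)"
proof -
  have "continuous_map (top_of_set E) (top_of_set E) (deck g)" using deck(2,3)[OF assms(1)] by auto
  from linear_mapD(3)[OF chain_push_linear[OF this] assms(2)[unfolded lifted_simps(2)]]
  show ?thesis unfolding lifted_simps(2) .
qed

lemma twisted_pair: "tensor_pair ring_elems coef_mod (lifted n)"
proof (rule tensor_pair.intro)
  show "abelian_group coef_mod"
  proof (rule abelian_groupI)
    fix x
    show "\<exists>y\<in>carrier coef_mod. y \<oplus>\<^bsub>coef_mod\<^esub> x = \<zero>\<^bsub>coef_mod\<^esub>"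
      by (intro bexI[of _ "- x"]) (simp_all add: coeff_simps)
  qed (simp_all add: coeff_simps ac_simps)
  show "abelian_group (lifted n)"
  proof (rule abelian_groupI)
    fix x assume "x \<in> carrier (lifted n)"
    then show "\<exists>y\<in>carrier (lifted n). y \<oplus>\<^bsub>lifted n\<^esub> x = \<zero>\<^bsub>lifted n\<^esub>"
      by (intro bexI[of _ "- x"]) (simp_all add: lifted_simps(1,3,4) keys_uminus)
  qed (simp_all add: lifted_simps(1,3,4) add.assoc add.commute keys_add_subset)
  show "r \<odot>\<^bsub>coef_mod\<^esub> m \<in> carrier coef_mod" for r m by (simp add: coeff_simps)
  fix r n' assume r: "r \<in> ring_elems" and c: "n' \<in> carrier (lifted n)"
  have "Poly_Mapping.keys (lin_extend (\<lambda>g. chain_push n (deck g) n') r) \<subseteq> singular_simplex_set n (top_of_set E)"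
    using r deck_push_closed[OF _ c] by (intro keys_lin_extend) (auto simp: group_ring_carrier_def lifted_simps(1))
  then show "r \<odot>\<^bsub>lifted n\<^esub> n' \<in> carrier (lifted n)" unfolding lifted_simps(1,5) by simp
qed

abbreviation "tpure n \<equiv> tensor_pure ring_elems coef_mod (lifted n)"

lemma twisted_kmod: "kmod (twisted n)"
  and twisted_smult: "c \<in> carrier (lifted n) \<Longrightarrow> s \<odot>\<^bsub>twisted n\<^esub> tpure n h c = tpure n (s * h) c"
proof -
  interpret tensor_pair ring_elems coef_mod "lifted n" by (rule twisted_pair)
  have a: "additive_map coef_mod coef_mod ((*) s)" for s
    by (simp add: additive_map_def coeff_simps distrib_left)
  show "kmod (twisted n)"
    unfolding twisted_chain_module_def
    by (rule tensor_module_kmod(1)[OF a]) (simp_all add: coeff_simps algebra_simps)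
  show "s \<odot>\<^bsub>twisted n\<^esub> tpure n h c = tpure n (s * h) c" if "c \<in> carrier (lifted n)"
    unfolding twisted_chain_module_def
    by (rule tensor_module_kmod(2)[OF a]) (simp_all add: coeff_simps algebra_simps that)
qed

lemma twisted_eqI:
  assumes "abelian_group P" "additive_map (twisted n) P f" "additive_map (twisted n) P g"
    and "\<And>h c. c \<in> carrier (lifted n) \<Longrightarrow> f (tpure n h c) = g (tpure n h c)"
    and "x \<in> carrier (twisted n)"
  shows "f x = g x"
  by (rule tensor_pair.additive_map_tensor_eq[OF twisted_pair assms(2,3)[unfolded twisted_chain_module_def] assms(1) _
        assms(5)[unfolded twisted_chain_module_def]]) (rule assms(4))

lemma pure_closed: "c \<in> carrier (lifted n) \<Longrightarrow> tpure n h c \<in> carrier (twisted n)"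
  unfolding twisted_chain_module_def by (rule tensor_pair.pure_closed[OF twisted_pair]) (simp_all add: coeff_simps)

lemma chain_diff_act: "chain_diff (Suc n) (r \<odot>\<^bsub>lifted (Suc n)\<^esub> c) = r \<odot>\<^bsub>lifted n\<^esub> chain_diff (Suc n) c"
  unfolding lifted_simps(5) chain_diff_push[symmetric]
  by (simp add: chain_diff_def lin_extend_lin_extend)

lemma chain_diff_lifted: "c \<in> carrier (lifted (Suc n)) \<Longrightarrow> chain_diff (Suc n) c \<in> carrier (lifted n)"
  unfolding lifted_simps(2) by (rule linear_mapD(3)[OF chain_diff_linear])

lemma twisted_d_additive: "additive_map (twisted (Suc n)) (twisted n) (twisted_d (Suc n))"
  and twisted_d_pure: "c \<in> carrier (lifted (Suc n)) \<Longrightarrow> twisted_d (Suc n) (tpure (Suc n) h c) = tpure n h (chain_diff (Suc n) c)"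
proof -
  have i: "additive_map coef_mod coef_mod id" by (simp add: additive_map_def coeff_simps)
  have d: "additive_map (lifted (Suc n)) (lifted n) (chain_diff (Suc n))"
    using chain_diff_lifted by (simp add: additive_map_def lifted_simps(3) chain_diff_add Pi_iff)
  have bal: "tpure n (id (r \<odot>\<^bsub>coef_mod\<^esub> m)) (chain_diff (Suc n) c) = tpure n (id m) (chain_diff (Suc n) (r \<odot>\<^bsub>lifted (Suc n)\<^esub> c))"
    if "r \<in> ring_elems" "m \<in> carrier coef_mod" "c \<in> carrier (lifted (Suc n))" for r m c
    unfolding chain_diff_act id_apply by (rule tensor_pair.pure_balanced[OF twisted_pair that(1,2) chain_diff_lifted[OF that(3)]])
  show "additive_map (twisted (Suc n)) (twisted n) (twisted_d (Suc n))"
    unfolding twisted_chain_module_def twisted_chain_diff_def diff_Suc_1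
    by (rule tensor_map(1)[OF twisted_pair twisted_pair i d bal])
  show "twisted_d (Suc n) (tpure (Suc n) h c) = tpure n h (chain_diff (Suc n) c)" if c: "c \<in> carrier (lifted (Suc n))"
  proof -
    have "tensor_map ring_elems coef_mod (lifted n) id (chain_diff (Suc n)) (tpure (Suc n) h c) = tpure n (id h) (chain_diff (Suc n) c)"
      by (rule tensor_map(2)[OF twisted_pair twisted_pair i d bal _ c]) (simp_all add: coeff_simps)
    then show ?thesis unfolding twisted_chain_diff_def diff_Suc_1 id_apply .
  qed
qed

lemma twisted_ab: "abelian_group (twisted n)"
  using twisted_kmod by (simp add: kmod_def amod_def)

lemma twisted_d_linear: "linear_map (twisted (Suc n)) (twisted n) (twisted_d (Suc n))"
proof -
  interpret T: kmod "twisted n" by (rule twisted_kmod)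
  interpret T': kmod "twisted (Suc n)" by (rule twisted_kmod)
  have "twisted_d (Suc n) (s \<odot>\<^bsub>twisted (Suc n)\<^esub> x) = s \<odot>\<^bsub>twisted n\<^esub> twisted_d (Suc n) x" if "x \<in> carrier (twisted (Suc n))" for s x
    by (rule twisted_eqI[where f = "\<lambda>x. twisted_d (Suc n) (s \<odot>\<^bsub>twisted (Suc n)\<^esub> x)" and g = "\<lambda>x. s \<odot>\<^bsub>twisted n\<^esub> twisted_d (Suc n) x",
          OF twisted_ab additive_map_compose[OF T'.smult_additive twisted_d_additive] additive_map_compose[OF twisted_d_additive T.smult_additive] _ that])
      (simp add: twisted_smult twisted_d_pure chain_diff_lifted)
  then show ?thesis using twisted_d_additive by (simp add: linear_map_def)
qed

lemma twisted_kcomplex: "kcomplex twisted twisted_d"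
proof (intro kcomplex.intro twisted_kmod twisted_d_linear)
  fix x n assume x: "x \<in> carrier (twisted (Suc (Suc n)))"
  have p: "tpure n h 0 = \<zero>\<^bsub>twisted n\<^esub>" for h
  proof -
    have "additive_map (lifted n) (twisted n) (tpure n h)"
      unfolding twisted_chain_module_def by (rule tensor_pair.pure_additive_right[OF twisted_pair]) (simp add: coeff_simps)
    from additive_map_zero[OF tensor_pair.abN[OF twisted_pair] twisted_ab this] show ?thesis by (simp add: lifted_simps(4))
  qed
  have dd: "twisted_d (Suc n) (twisted_d (Suc (Suc n)) (tpure (Suc (Suc n)) h c)) = \<zero>\<^bsub>twisted n\<^esub>"
    if c: "c \<in> carrier (lifted (Suc (Suc n)))" for h c
    unfolding twisted_d_pure[OF c] twisted_d_pure[OF chain_diff_lifted[OF c]]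
      chain_diff_chain_diff[OF c[unfolded lifted_simps(2)]] by (rule p)
  show "twisted_d (Suc n) (twisted_d (Suc (Suc n)) x) = \<zero>\<^bsub>twisted n\<^esub>"
    by (rule twisted_eqI[where f = "\<lambda>x. twisted_d (Suc n) (twisted_d (Suc (Suc n)) x)" and g = "\<lambda>x. \<zero>\<^bsub>twisted n\<^esub>",
          OF twisted_ab additive_map_compose[OF twisted_d_additive twisted_d_additive] additive_map_const_zero[OF twisted_ab] _ x])
      (rule dd, assumption)
qed

subsection \<open>Comparison with chains of the base\<close>

text \<open>The coefficient remembers which lift was projected, as a power of t given by the phase
  of the initial vertex.\<close>

definition descend :: "nat \<Rightarrow> ('b simplex \<Rightarrow>\<^sub>0 'p mod_ring) \<Rightarrow> 'a simplex \<Rightarrow>\<^sub>0 'p group_algebra" where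
  "descend n c = (\<Sum>\<sigma>\<in>Poly_Mapping.keys c.
     Poly_Mapping.single (simplex_map n \<pi> \<sigma>) (Poly_Mapping.single (phase (\<sigma> (vertex 0))) (Poly_Mapping.lookup c \<sigma>)))"

lemma descend_single: "descend n (Poly_Mapping.single \<sigma> k) = Poly_Mapping.single (simplex_map n \<pi> \<sigma>) (Poly_Mapping.single (phase (\<sigma> (vertex 0))) k)"
  by (cases "k = 0") (simp_all add: descend_def)

lemma descend_add: "descend n (c + c') = descend n c + descend n c'"
  unfolding descend_def
  by (rule sum_keys_add[where F = "\<lambda>\<sigma> k. Poly_Mapping.single (simplex_map n \<pi> \<sigma>) (Poly_Mapping.single (phase (\<sigma> (vertex 0))) k)"])
    (simp_all add: single_add)

lemma descend_zero: "descend n 0 = 0"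
  by (simp add: descend_def)

lemma descend_sum: "descend n (sum u A) = (\<Sum>x\<in>A. descend n (u x))"
  by (induction A rule: infinite_finite_induct) (simp_all add: descend_add descend_zero)

lemma descend_closed: "c \<in> carrier (lifted n) \<Longrightarrow> descend n c \<in> carrier (base_chains n)"
  unfolding descend_def lifted_simps(2)
  by (intro chain_sum_closed single_chain projection_simplex) (auto simp: chain_module_simps)

text \<open>A deck transformation leaves the projected simplex unchanged and shifts the phase by
  \<nu>, which multiplies the coefficient by a power of t. This is the balance condition needed to
  define \<open>down\<close>.\<close>

lemma descend_act:
  assumes r: "r \<in> ring_elems" and c: "c \<in> carrier (lifted n)"
  shows "descend n (r \<odot>\<^bsub>lifted n\<^esub> c) = pscale (lin_extend (\<lambda>g. Poly_Mapping.single (\<nu> g) 1) r) (descend n c)"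
proof -
  have s: "descend n (pscale a (chain_push n (deck g) c)) = pscale (Poly_Mapping.single (\<nu> g) a) (descend n c)"
    if g: "g \<in> carrier G" for g a
    using c[unfolded lifted_simps(2)]
  proof (induction c rule: chain_module_induct)
    case (single \<sigma> k)
    show ?case
      using deck_simplex(2)[OF g single] phase_deck_simplex[OF g single, of 0]
      by (simp add: chain_push_single descend_single mult_single)
  next
    case (add u v)
    then show ?case by (simp add: chain_push_add pscale_add descend_add)
  qed (simp add: chain_push_def descend_zero)
  have "Poly_Mapping.keys r \<subseteq> carrier G" using r by (simp add: group_ring_carrier_def)
  then have "descend n (lin_extend (\<lambda>g. chain_push n (deck g) c) r) = pscale (lin_extend (\<lambda>g. Poly_Mapping.single (\<nu> g) 1) r) (descend n c)"
  proof (induction r rule: chain_induct)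
    case zero
    show ?case by (simp only: lin_extend_0 descend_zero pscale_simps(2))
  next
    case (single g k)
    show ?case unfolding lin_extend_single s[OF single] by simp
  next
    case (add u v)
    then show ?case unfolding lin_extend_add descend_add pscale_add(2) by (simp only:)
  qed
  then show ?thesis unfolding lifted_simps(5) .
qed

definition down :: "nat \<Rightarrow> ('p group_algebra \<times> ('b simplex \<Rightarrow>\<^sub>0 'p mod_ring) \<Rightarrow>\<^sub>0 int) set \<Rightarrow> 'a simplex \<Rightarrow>\<^sub>0 'p group_algebra" where
  "down n = tensor_lift (base_chains n) (\<lambda>h c. pscale h (descend n c))"

lemma base_ab: "abelian_group (base_chains n)"
  using chain_module_kmod[of "top_of_set X" n, where 'k = "'p group_algebra"] by (simp add: kmod_def amod_def)

lemma down_additive: "additive_map (twisted n) (base_chains n) (down n)"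
  and down_pure: "c \<in> carrier (lifted n) \<Longrightarrow> down n (tpure n h c) = pscale h (descend n c)"
proof -
  interpret tensor_pair ring_elems coef_mod "lifted n" by (rule twisted_pair)
  interpret C: kmod "base_chains n" by (rule chain_module_kmod)
  have cl: "pscale h (descend n c) \<in> carrier (base_chains n)" if "c \<in> carrier (lifted n)" for h c
    using C.smult_closed[OF descend_closed[OF that], of h] by (simp add: chain_module_simps(4))
  have bal: "pscale (r \<odot>\<^bsub>coef_mod\<^esub> h) (descend n c) = pscale h (descend n (r \<odot>\<^bsub>lifted n\<^esub> c))"
    if "r \<in> ring_elems" "c \<in> carrier (lifted n)" for r h c
    unfolding descend_act[OF that] by (simp add: coeff_simps)
  note lift = tensor_lift[of "base_chains n" "\<lambda>h c. pscale h (descend n c)", OF base_ab cl _ _ bal]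
  show "additive_map (twisted n) (base_chains n) (down n)"
    unfolding down_def twisted_chain_module_def
    by (rule lift(1)) (simp_all add: coeff_simps lifted_simps(3) chain_module_simps(3) pscale_add descend_add)
  show "down n (tpure n h c) = pscale h (descend n c)" if c: "c \<in> carrier (lifted n)"
    unfolding down_def
    by (rule lift(2)) (simp_all add: coeff_simps lifted_simps(3) chain_module_simps(3) pscale_add descend_add c)
qed

lemma down_smult: "x \<in> carrier (twisted n) \<Longrightarrow> down n (s \<odot>\<^bsub>twisted n\<^esub> x) = pscale s (down n x)"
proof -
  assume x: "x \<in> carrier (twisted n)"
  interpret T: kmod "twisted n" by (rule twisted_kmod)
  interpret C: kmod "base_chains n" by (rule chain_module_kmod)
  have "down n (s \<odot>\<^bsub>twisted n\<^esub> x) = s \<odot>\<^bsub>base_chains n\<^esub> down n x"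
    by (rule twisted_eqI[where f = "\<lambda>x. down n (s \<odot>\<^bsub>twisted n\<^esub> x)" and g = "\<lambda>x. s \<odot>\<^bsub>base_chains n\<^esub> down n x",
          OF base_ab additive_map_compose[OF T.smult_additive down_additive] additive_map_compose[OF down_additive C.smult_additive] _ x])
      (simp add: twisted_smult down_pure chain_module_simps(4))
  then show ?thesis by (simp add: chain_module_simps(4))
qed

abbreviation "tdiff \<equiv> twist_diff cocycle"

text \<open>Faces other than face 0 keep the initial vertex and hence the coefficient. Face 0 starts
  at vertex 1, whose phase differs from that of vertex 0 by the cocycle on the front edge, exactly
  the correction in \<open>twist_diff\<close>.\<close>

lemma descend_diff:
  assumes c: "c \<in> carrier (lifted (Suc n))"
  shows "descend n (chain_diff (Suc n) c) = tdiff (Suc n) (descend (Suc n) c)"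
  using c[unfolded lifted_simps(2)]
proof (induction c rule: chain_module_induct)
  case zero
  show ?case using twist_diff_linear(2)[of cocycle "Suc n" 0 0] by (simp add: descend_zero)
next
  case (add u v)
  then show ?case by (simp add: chain_diff_add descend_add twist_diff_linear)
next
  case (single \<sigma> k)
  let ?\<tau> = "simplex_map (Suc n) \<pi> \<sigma>" and ?f = "\<lambda>j. singular_face (Suc n) j (simplex_map (Suc n) \<pi> \<sigma>)"
  let ?a = "Poly_Mapping.single (phase (\<sigma> (vertex 0))) k" and ?b = "Poly_Mapping.single (phase (\<sigma> (vertex 1))) k"
  let ?S = "\<Sum>j\<le>n. Poly_Mapping.single (?f (Suc j)) ((- 1) ^ Suc j * ?a)"
  have ff: "front_face 1 ?\<tau> = simplex_map 1 \<pi> (front_face 1 \<sigma>)"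
    by (rule face_eqI[OF face_extensional(1,4)])
      (simp add: front_face_apply simplex_map_def standard_simplex_mono[of 1 "Suc n"] del: One_nat_def)
  have fs: "singular_simplex 1 (top_of_set E) (front_face 1 \<sigma>)" by (rule front_face_simplex[OF single]) simp
  have co: "cocycle (front_face 1 ?\<tau>) = phase (\<sigma> (vertex 1)) - phase (\<sigma> (vertex 0))"
    unfolding ff cocycle_projection[OF fs] by (simp add: front_face_apply vertex_simplex)
  have "descend n (chain_diff (Suc n) (Poly_Mapping.single \<sigma> k)) =
      (\<Sum>j\<le>Suc n. Poly_Mapping.single (?f j) (Poly_Mapping.single (phase (singular_face (Suc n) j \<sigma> (vertex 0))) ((- 1) ^ j * k)))"
    unfolding chain_diff_single descend_sum descend_single by (rule sum.cong) (simp_all add: face_simplex_map)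
  also have "\<dots> = Poly_Mapping.single (?f 0) ?b + ?S"
    unfolding sum.atMost_Suc_shift sign_single
    by (simp add: face_vertex[of 0 n] del: sum.atMost_Suc)
  finally have L: "descend n (chain_diff (Suc n) (Poly_Mapping.single \<sigma> k)) = Poly_Mapping.single (?f 0) ?b + ?S" .
  have "tdiff (Suc n) (descend (Suc n) (Poly_Mapping.single \<sigma> k)) =
      (\<Sum>j\<le>Suc n. Poly_Mapping.single (?f j) ((- 1) ^ j * ?a)) +
      Poly_Mapping.single (?f 0) (?a * (Poly_Mapping.single (phase (\<sigma> (vertex 1)) - phase (\<sigma> (vertex 0))) 1 - 1))"
    unfolding descend_single twist_diff_def chain_diff_single lin_extend_single pscale_simps(5) co ..
  also have "?a * (Poly_Mapping.single (phase (\<sigma> (vertex 1)) - phase (\<sigma> (vertex 0))) 1 - 1) = ?b - ?a"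
    by (simp add: right_diff_distrib mult_single)
  also have "(\<Sum>j\<le>Suc n. Poly_Mapping.single (?f j) ((- 1) ^ j * ?a)) + Poly_Mapping.single (?f 0) (?b - ?a) =
      Poly_Mapping.single (?f 0) ?a + Poly_Mapping.single (?f 0) (?b - ?a) + ?S"
    unfolding sum.atMost_Suc_shift by (simp add: ac_simps del: sum.atMost_Suc)
  also have "Poly_Mapping.single (?f 0) ?a + Poly_Mapping.single (?f 0) (?b - ?a) = Poly_Mapping.single (?f 0) ?b"
    unfolding single_add[symmetric] by simp
  finally show ?case unfolding L by (rule sym)
qed

lemma down_diff:
  assumes x: "x \<in> carrier (twisted (Suc n))"
  shows "down n (twisted_d (Suc n) x) = tdiff (Suc n) (down (Suc n) x)"
proof (rule twisted_eqI[where f = "\<lambda>x. down n (twisted_d (Suc n) x)" and g = "\<lambda>x. tdiff (Suc n) (down (Suc n) x)",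
      OF base_ab additive_map_compose[OF twisted_d_additive down_additive] _ _ x])
  have "additive_map (base_chains (Suc n)) (base_chains n) (tdiff (Suc n))"
    using twist_diff_closed[of _ "top_of_set X" n cocycle] by (simp add: additive_map_def chain_module_simps(3) twist_diff_linear Pi_iff)
  from additive_map_compose[OF down_additive this]
  show "additive_map (twisted (Suc n)) (base_chains n) (\<lambda>x. tdiff (Suc n) (down (Suc n) x))" .
qed (simp add: twisted_d_pure down_pure chain_diff_lifted descend_diff twist_diff_linear)

text \<open>The inverse of \<open>down\<close>: each simplex goes to its chosen lift, and the
  negative phase cancels the coefficient that \<open>descend\<close> would attach to that
  lift.\<close>

definition up :: "nat \<Rightarrow> ('a simplex \<Rightarrow>\<^sub>0 'p group_algebra) \<Rightarrow> ('p group_algebra \<times> ('b simplex \<Rightarrow>\<^sub>0 'p mod_ring) \<Rightarrow>\<^sub>0 int) set" where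
  "up n c = (\<Oplus>\<^bsub>twisted n\<^esub>\<tau>\<in>Poly_Mapping.keys c. Poly_Mapping.lookup c \<tau> \<odot>\<^bsub>twisted n\<^esub>
     tpure n (Poly_Mapping.single (- phase (the_lift n \<tau> (vertex 0))) 1) (Poly_Mapping.single (the_lift n \<tau>) 1))"

lemma lift_chain: "singular_simplex n (top_of_set E) \<sigma> \<Longrightarrow> Poly_Mapping.single \<sigma> k \<in> carrier (lifted n)"
  unfolding lifted_simps(2) by (rule single_chain)

lemma up_linear: "linear_map (base_chains n) (twisted n) (up n)"
  and up_single: "singular_simplex n (top_of_set X) \<tau> \<Longrightarrow> up n (Poly_Mapping.single \<tau> a) =
      tpure n (a * Poly_Mapping.single (- phase (the_lift n \<tau> (vertex 0))) 1) (Poly_Mapping.single (the_lift n \<tau>) 1)"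
proof -
  let ?f = "\<lambda>\<tau>. tpure n (Poly_Mapping.single (- phase (the_lift n \<tau> (vertex 0))) 1) (Poly_Mapping.single (the_lift n \<tau>) 1)"
  have cl: "?f \<tau> \<in> carrier (twisted n)" if "singular_simplex n (top_of_set X) \<tau>" for \<tau>
    by (rule pure_closed[OF lift_chain[OF the_lift(1)[OF that]]])
  note me = module_extend[where f = ?f, OF twisted_kmod cl]
  show "linear_map (base_chains n) (twisted n) (up n)"
    unfolding up_def[abs_def] by (rule me(1))
  show "up n (Poly_Mapping.single \<tau> a) = tpure n (a * Poly_Mapping.single (- phase (the_lift n \<tau> (vertex 0))) 1) (Poly_Mapping.single (the_lift n \<tau>) 1)"
    if t: "singular_simplex n (top_of_set X) \<tau>"
  proof -
    have "up n (Poly_Mapping.single \<tau> a) = a \<odot>\<^bsub>twisted n\<^esub> ?f \<tau>"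
      unfolding up_def by (rule me(2)[OF _ t])
    then show ?thesis unfolding twisted_smult[OF lift_chain[OF the_lift(1)[OF t]]] .
  qed
qed

text \<open>An arbitrary lift is the translate of the chosen one by some group element g. Balance
  moves g across the tensor product, where it accounts for the difference of the two phases.\<close>

lemma up_down:
  assumes x: "x \<in> carrier (twisted n)"
  shows "up n (down n x) = x"
proof (rule twisted_eqI[where f = "\<lambda>x. up n (down n x)" and g = "\<lambda>x. x",
      OF twisted_ab additive_map_compose[OF down_additive linear_mapD(1)[OF up_linear]] _ _ x])
  show "additive_map (twisted n) (twisted n) (\<lambda>x. x)" by (simp add: additive_map_def)
  fix h c assume c: "c \<in> carrier (lifted n)"
  interpret C: kmod "base_chains n" by (rule chain_module_kmod)
  have d: "additive_map (chain_module (top_of_set E) n) (base_chains n) (\<lambda>c. pscale h (descend n c))"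
    using C.smult_closed[OF descend_closed, of _ h]
    by (simp add: additive_map_def chain_module_simps(3,4) descend_add pscale_add lifted_simps(2) Pi_iff)
  have p: "additive_map (chain_module (top_of_set E) n) (twisted n) (tpure n h)"
  proof -
    have "additive_map (lifted n) (twisted n) (tpure n h)"
      unfolding twisted_chain_module_def by (rule tensor_pair.pure_additive_right[OF twisted_pair]) (simp add: coeff_simps)
    then show ?thesis by (simp add: additive_map_def lifted_simps(2,3) chain_module_simps(3))
  qed
  have "up n (pscale h (descend n c)) = tpure n h c"
  proof (rule additive_chain_eqI[OF twisted_ab additive_map_compose[OF d linear_mapD(1)[OF up_linear]] p _ c[unfolded lifted_simps(2)]])
    fix \<sigma> k assume s: "singular_simplex n (top_of_set E) \<sigma>"
    note ps = projection_simplex[OF s]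
    let ?\<kappa> = "the_lift n (simplex_map n \<pi> \<sigma>)"
    note l = the_lift[OF ps]
    obtain g where g: "g \<in> carrier G" "simplex_map n (deck g) ?\<kappa> = \<sigma>" by (rule simplex_deck_transitive[OF l(1) s l(2)])
    have ph: "phase (\<sigma> (vertex 0)) = \<nu> g + phase (?\<kappa> (vertex 0))"
      using phase_deck_simplex[OF g(1) l(1), of 0] unfolding g(2) by simp
    have gr: "Poly_Mapping.single g k \<in> ring_elems" using g(1) by (auto simp: group_ring_carrier_def)
    have "up n (pscale h (descend n (Poly_Mapping.single \<sigma> k))) =
        tpure n ((h * Poly_Mapping.single (phase (\<sigma> (vertex 0))) k) * Poly_Mapping.single (- phase (?\<kappa> (vertex 0))) 1) (Poly_Mapping.single ?\<kappa> 1)"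
      unfolding descend_single pscale_simps(5) up_single[OF ps] ..
    also have "(h * Poly_Mapping.single (phase (\<sigma> (vertex 0))) k) * Poly_Mapping.single (- phase (?\<kappa> (vertex 0))) 1 =
        Poly_Mapping.single g k \<odot>\<^bsub>coef_mod\<^esub> h"
      by (simp add: coeff_simps mult.assoc mult_single ph)
    also have "tpure n (Poly_Mapping.single g k \<odot>\<^bsub>coef_mod\<^esub> h) (Poly_Mapping.single ?\<kappa> 1) =
        tpure n h (Poly_Mapping.single g k \<odot>\<^bsub>lifted n\<^esub> Poly_Mapping.single ?\<kappa> 1)"
      by (rule tensor_pair.pure_balanced[OF twisted_pair gr _ lift_chain[OF l(1)]]) (simp add: coeff_simps)
    also have "Poly_Mapping.single g k \<odot>\<^bsub>lifted n\<^esub> Poly_Mapping.single ?\<kappa> 1 = Poly_Mapping.single \<sigma> k"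
      unfolding lifted_simps(5) lin_extend_single chain_push_single g(2) by simp
    finally show "up n (pscale h (descend n (Poly_Mapping.single \<sigma> k))) = tpure n h (Poly_Mapping.single \<sigma> k)" .
  qed
  then show "up n (down n (tpure n h c)) = tpure n h c" unfolding down_pure[OF c] .
qed

lemma down_up:
  assumes c: "c \<in> carrier (base_chains n)"
  shows "down n (up n c) = c"
proof (rule additive_chain_eqI[OF base_ab additive_map_compose[OF linear_mapD(1)[OF up_linear] down_additive] _ _ c])
  show "additive_map (base_chains n) (base_chains n) (\<lambda>x. x)" by (simp add: additive_map_def)
  fix \<tau> and a :: "'p group_algebra" assume t: "singular_simplex n (top_of_set X) \<tau>"
  note l = the_lift[OF t]
  show "down n (up n (Poly_Mapping.single \<tau> a)) = Poly_Mapping.single \<tau> a"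
    unfolding up_single[OF t] down_pure[OF lift_chain[OF l(1)]] descend_single l(2)
    by (simp add: mult.assoc mult_single)
qed

text \<open>The hypothesis concerns homology classes and the reduction argument concerns chains on
  the base; \<open>rho_cocycle\<close> mediates between the former, \<open>down\<close> and
  \<open>up\<close> between base chains and twisted chains.\<close>

lemma square_annihilates_twisted:
  assumes odd: "CARD('p) \<noteq> 2"
    and ex: "complex_cycles (sing_homology (top_of_set X)) (rho X (\<pi> e) \<nu>) q =
      complex_boundaries (sing_homology (top_of_set X)) (rho X (\<pi> e) \<nu>) q"
    and u: "u \<in> complex_cycles twisted twisted_d q"
  shows "(aug_gen ^ 2) \<odot>\<^bsub>twisted q\<^esub> u \<in> complex_boundaries twisted twisted_d q"
proof -
  let ?C = "chain_module (top_of_set X) :: nat \<Rightarrow> ('p mod_ring, _) module"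
  interpret K: kcomplex ?C chain_diff by (rule sing_kcomplex)
  interpret TK: kcomplex twisted twisted_d by (rule twisted_kcomplex)
  have acyclic: "\<exists>w w1. w \<in> carrier (?C (Suc q)) \<and> w1 \<in> carrier (?C (Suc q)) \<and> chain_diff (Suc q) w = 0 \<and>
      z = cap_simplex cocycle q w + chain_diff (Suc q) w1"
    if z: "z \<in> carrier (?C q)" "z1 \<in> carrier (?C q)"
      and h: "\<And>m. q = Suc m \<Longrightarrow> chain_diff q z = 0 \<and> cap_simplex cocycle m z + chain_diff q z1 = 0" for z z1
  proof -
    have zZ: "z \<in> K.Z q"
    proof (rule K.cycleI[OF z(1)])
      fix m assume "q = Suc m"
      then show "chain_diff (Suc m) z = \<zero>\<^bsub>?C m\<^esub>" using h by (simp add: chain_module_simps)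
    qed
    have "K.cl q z \<in> complex_cycles (sing_homology (top_of_set X)) (rho X (\<pi> e) \<nu>) q"
    proof (cases q)
      case 0
      then show ?thesis using K.cl_in_H[OF zZ] by (simp add: complex_cycles_def)
    next
      case (Suc m)
      have "cap_simplex cocycle m z = - chain_diff q z1" using h[OF Suc] by (simp add: eq_neg_iff_add_eq_0)
      also have "\<dots> = chain_diff (Suc m) (- z1)" by (simp add: chain_diff_def lin_extend_minus Suc)
      finally have "cap_simplex cocycle m z \<in> K.Bd m"
        using K.boundaryI[of "- z1" m] z(2) Suc by (simp add: chain_module_simps keys_uminus)
      then have "K.cl m (cap_simplex cocycle m z) = \<zero>\<^bsub>K.H m\<^esub>" using K.cl_zero_iff[OF K.boundary_cycle] by blast
      moreover have "rho X (\<pi> e) \<nu> (Suc m) (K.cl (Suc m) z) = K.cl m (cap_simplex cocycle m z)"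
        using rho_cocycle[of z m] zZ Suc by simp
      ultimately show ?thesis using K.cl_in_H[OF zZ] Suc by (simp add: complex_cycles_def)
    qed
    then obtain W where W: "W \<in> carrier (K.H (Suc q))" "K.cl q z = rho X (\<pi> e) \<nu> (Suc q) W"
      unfolding ex complex_boundaries_def by (elim imageE) (rule that; assumption)
    obtain w where w: "w \<in> K.Z (Suc q)" "W = K.cl (Suc q) w" using W(1) by (rule K.H_carrierE)
    have "K.cl q z = K.cl q (cap_simplex cocycle q w)" unfolding W(2) w(2) by (rule rho_cocycle[OF w(1)])
    \<comment> \<open>Regarding \<open>z\<close> as a member of its class turns the equality of
      classes into an equation between chains.\<close>
    moreover have "z \<in> K.cl q z"
      using K.boundary_linear(1)[of q] unfolding complex_class_def a_r_coset_def'
      by (auto simp: chain_module_simps intro!: bexI[of _ 0])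
    ultimately have "z \<in> K.cl q (cap_simplex cocycle q w)" by simp
    then obtain b where b: "b \<in> K.Bd q" "z = b + cap_simplex cocycle q w"
      unfolding complex_class_def a_r_coset_def' by (auto simp: chain_module_simps(3))
    obtain w1 where w1: "w1 \<in> carrier (?C (Suc q))" "b = chain_diff (Suc q) w1"
      using b(1) unfolding complex_boundaries_def by (elim imageE) (rule that; assumption)
    have "chain_diff (Suc q) w = 0" "w \<in> carrier (?C (Suc q))" using w(1) by (auto simp: complex_cycles_def chain_module_simps)
    then show ?thesis using w1(1) b(2)[unfolded w1(2)] by (intro exI conjI) (simp_all add: add.commute)
  qed
  have uc: "u \<in> carrier (twisted q)" by (rule TK.cycleD(1)[OF u])
  have dz: "down n \<zero>\<^bsub>twisted n\<^esub> = 0" for n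
    using additive_map_zero[OF twisted_ab base_ab down_additive] by (simp add: chain_module_simps(2))
  have du: "down q u \<in> carrier (base_chains q)" by (rule additive_mapD(1)[OF down_additive uc])
  have t0: "tdiff q (down q u) = 0" if q: "q = Suc m" for m
    using down_diff[of u m] uc TK.cycleD(2)[of u m] u dz unfolding q by simp
  \<comment> \<open>That the twisted differential on the base squares to zero is transported from
    the twisted complex, instead of being computed with cocycle identities.\<close>
  have tt: "tdiff q (tdiff (Suc q) w) = 0" if q: "q = Suc m" and w: "w \<in> carrier (base_chains (Suc q))" for m w
  proof -
    have U: "up (Suc q) w \<in> carrier (twisted (Suc q))" by (rule linear_mapD(3)[OF up_linear w])
    have "tdiff (Suc q) w = down q (twisted_d (Suc q) (up (Suc q) w))"
      using down_diff[OF U] down_up[OF w] by simp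
    moreover have "twisted_d (Suc q) (up (Suc q) w) \<in> carrier (twisted (Suc m))"
      using linear_mapD(3)[OF twisted_d_linear U] q by simp
    ultimately have "tdiff q (tdiff (Suc q) w) = down m (twisted_d (Suc m) (twisted_d (Suc (Suc m)) (up (Suc q) w)))"
      using down_diff[of "twisted_d (Suc q) (up (Suc q) w)" m] q by simp
    also have "\<dots> = 0" using TK.dd[of "up (Suc q) w" m] U q dz by simp
    finally show ?thesis .
  qed
  obtain w where w: "w \<in> carrier (base_chains (Suc q))" "pscale (aug_gen ^ 2) (down q u) = tdiff (Suc q) w"
    by (rule square_annihilates[where \<phi> = cocycle and X = "top_of_set X" and q = q and z = "down q u", OF odd])
      ((rule acyclic; assumption) | rule du | (rule t0; assumption) | (rule tt; assumption) | (rule that; assumption))+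
  have U: "up (Suc q) w \<in> carrier (twisted (Suc q))" by (rule linear_mapD(3)[OF up_linear w(1)])
  have "down q ((aug_gen ^ 2) \<odot>\<^bsub>twisted q\<^esub> u) = down q (twisted_d (Suc q) (up (Suc q) w))"
    unfolding down_smult[OF uc] w(2) down_diff[OF U] down_up[OF w(1)] ..
  then have "up q (down q ((aug_gen ^ 2) \<odot>\<^bsub>twisted q\<^esub> u)) = up q (down q (twisted_d (Suc q) (up (Suc q) w)))" by simp
  moreover have "(aug_gen ^ 2) \<odot>\<^bsub>twisted q\<^esub> u \<in> carrier (twisted q)" by (rule amod.smult_closed[OF TK.amC uc])
  ultimately have "(aug_gen ^ 2) \<odot>\<^bsub>twisted q\<^esub> u = twisted_d (Suc q) (up (Suc q) w)"
    using up_down linear_mapD(3)[OF twisted_d_linear U] by simp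
  then show ?thesis using TK.boundaryI[OF U] by simp
qed

lemma ideal_square_annihilates:
  assumes odd: "CARD('p) \<noteq> 2"
    and ex: "complex_cycles (sing_homology (top_of_set X)) (rho X (\<pi> e) \<nu>) q =
      complex_boundaries (sing_homology (top_of_set X)) (rho X (\<pi> e) \<nu>) q"
  shows "{a \<odot>\<^bsub>twisted_homology X E \<pi> e \<nu> q\<^esub> h | a h.
            a \<in> ideal_prod group_algebra augmentation_ideal augmentation_ideal \<and>
            h \<in> carrier (twisted_homology X E \<pi> e \<nu> q)} = {\<zero>\<^bsub>twisted_homology X E \<pi> e \<nu> q\<^esub>}"
proof -
  interpret TK: kcomplex twisted twisted_d by (rule twisted_kcomplex)
  interpret T: kmod "twisted q" by (rule twisted_kmod)
  interpret H: kmod "TK.H q" by (rule TK.H_kmod)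
  have "a \<odot>\<^bsub>TK.H q\<^esub> h = \<zero>\<^bsub>TK.H q\<^esub>"
    if a: "a \<in> ideal_prod group_algebra augmentation_ideal augmentation_ideal" and h: "h \<in> carrier (TK.H q)" for a h
  proof -
    obtain b where b: "a = b * aug_gen ^ 2" using a by (rule ideal_square_dvd)
    obtain u where u: "u \<in> TK.Z q" "h = TK.cl q u" using h by (rule TK.H_carrierE)
    have "a \<odot>\<^bsub>twisted q\<^esub> u = b \<odot>\<^bsub>twisted q\<^esub> ((aug_gen ^ 2) \<odot>\<^bsub>twisted q\<^esub> u)"
      unfolding b by (rule T.mult_smult[OF TK.cycleD(1)[OF u(1)]])
    then have "a \<odot>\<^bsub>twisted q\<^esub> u \<in> TK.Bd q"
      using TK.boundary_linear(4)[OF square_annihilates_twisted[OF odd ex u(1)]] by simp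
    then have "TK.cl q (a \<odot>\<^bsub>twisted q\<^esub> u) = \<zero>\<^bsub>TK.H q\<^esub>" using TK.cl_zero_iff[OF TK.boundary_cycle] by blast
    then show ?thesis unfolding u(2) TK.cl_smult[OF u(1)] .
  qed
  \<comment> \<open>The reverse inclusion: zero is the product of the zero element of the ideal and
    the zero class.\<close>
  moreover have "\<zero>\<^bsub>TK.H q\<^esub> = 0 \<odot>\<^bsub>TK.H q\<^esub> \<zero>\<^bsub>TK.H q\<^esub>" by simp
  ultimately show ?thesis
    unfolding twisted_homology_def using zero_in_ideal_square H.zero_closed by blast
qed

end

theorem proposition7p5:
  fixes X :: "'a::topological_space set" and x :: 'a
    and E :: "'b::topological_space set" and \<pi> :: "'b \<Rightarrow> 'a" and e :: 'b
    and \<nu> :: "(real \<Rightarrow> 'a) set \<Rightarrow> 'p::prime_card mod_ring" and q :: nat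
  assumes "CARD('p) \<noteq> 2"
    and "cw_complex X" and "connected X"
    and "universal_covering E \<pi> X" and "e \<in> E" and "\<pi> e = x"
    and "\<nu> \<in> epi (fundamental_group X x) additive_cyclic_group"
    and "complex_cycles (sing_homology (top_of_set X)) (rho X x \<nu>) q =
         complex_boundaries (sing_homology (top_of_set X)) (rho X x \<nu>) q"
  shows "{a \<odot>\<^bsub>twisted_homology X E \<pi> e \<nu> q\<^esub> h | a h.
            a \<in> ideal_prod group_algebra augmentation_ideal augmentation_ideal \<and>
            h \<in> carrier (twisted_homology X E \<pi> e \<nu> q)} =
         {\<zero>\<^bsub>twisted_homology X E \<pi> e \<nu> q\<^esub>}"
proof -
  have "locally_path_connected_space (top_of_set X)"
    using assms(2) by (rule cw_complex_locally_path_connected)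
  then interpret nu_cover X E \<pi> e \<nu>
    using assms(4,5,6,7) by unfold_locales (auto simp: epi_def)
  show ?thesis
    by (rule ideal_square_annihilates[OF assms(1) assms(8)[folded assms(6)]])
qed

end
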